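(* Let $\mathbb{k}$ be an infinite field, and let $I_1\subseteq(x_1,\ldots,x_n)^2\subseteq\mathbb{k}[x_1,\ldots,x_n]$ and $I_2\subseteq(y_1,\ldots,y_m)^2\subseteq\mathbb{k}[y_1,\ldots,y_m]$ be homogeneous ideals with $I_1\neq0$. Set $R_1=\mathbb{k}[x_1,\ldots,x_n]/I_1$, $R_2=\mathbb{k}[y_1,\ldots,y_m]/I_2$, and $R=R_1\otimes_{\mathbb{k}}R_2$. Then $R$ is Golod if and only if $R_1$ is Golod and $I_2=0$.
   Context: All polynomial rings are standard graded. $R$ is regarded as the quotient of $\mathbb{k}[x_1,\ldots,x_n,y_1,\ldots,y_m]$ by the ideal generated by $I_1$ and $I_2$. Golod: Let $T$ be a standard graded polynomial ring in $N$ variables over $\mathbb{k}$ and $A=T/J$ with $J$ a homogeneous ideal contained in the square of the homogeneous maximal ideal. Serre's coefficientwise inequality of power series is $\sum_{i\ge0}\dim_{\mathbb{k}}\mathrm{Tor}^A_i(\mathbb{k},\mathbb{k})z^i\preceq \dfrac{(1+z)^N}{1-\sum_{i\ge1}\dim_{\mathbb{k}}\mathrm{Tor}^T_i(A,\mathbb{k})z^{i+1}}$; the ring $A$ is called Golod if equality holds (equivalently, all Massey operations on the homology of the Koszul complex of $A$ on the variables are trivial). *)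

theory Defs
  imports
    "HOL-Algebra.QuotRing"
    "HOL-Algebra.Ideal_Product"
    "HOL-Algebra.Module"
    "HOL-Algebra.Algebraic_Closure_Type"
    "HOL-Library.Poly_Mapping"
    "HOL-Library.Function_Algebras"
    "HOL-Computational_Algebra.Formal_Power_Series"
begin

section \<open>Polynomial rings and homogeneous ideals\<close>

text \<open>
  A monomial is a finitely supported exponent vector \<open>nat \<Rightarrow>\<^sub>0 nat\<close>.  All polynomial rings are
  subrings of one ambient ring whose variables are indexed by \<^typ>\<open>nat\<close>: \<open>mpoly_ring V\<close> is
  the polynomial ring in the variables with index in \<open>V\<close>.
\<close>

type_synonym 'k mpoly = "(nat \<Rightarrow>\<^sub>0 nat) \<Rightarrow>\<^sub>0 'k"

definition mpoly_ring :: "nat set \<Rightarrow> 'k::field mpoly ring" where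
  "mpoly_ring V =
    \<lparr>carrier = {p. \<forall>m \<in> Poly_Mapping.keys p. Poly_Mapping.keys m \<subseteq> V},
     monoid.mult = times, one = 1, zero = 0, add = plus\<rparr>"

definition mvar :: "nat \<Rightarrow> 'k::field mpoly" where
  "mvar i = Poly_Mapping.single (Poly_Mapping.single i 1) 1"

definition max_ideal :: "nat set \<Rightarrow> 'k::field mpoly set" where
  "max_ideal V = genideal (mpoly_ring V) (mvar ` V)"

definition mdeg :: "(nat \<Rightarrow>\<^sub>0 nat) \<Rightarrow> nat" where
  "mdeg m = (\<Sum>i \<in> Poly_Mapping.keys m. Poly_Mapping.lookup m i)"

definition homogeneous :: "'k::field mpoly \<Rightarrow> bool" where
  "homogeneous p \<longleftrightarrow> (\<exists>d. \<forall>m \<in> Poly_Mapping.keys p. mdeg m = d)"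

definition homogeneous_ideal :: "nat set \<Rightarrow> 'k::field mpoly set \<Rightarrow> bool" where
  "homogeneous_ideal V J \<longleftrightarrow>
     (\<exists>S \<subseteq> carrier (mpoly_ring V). (\<forall>p \<in> S. homogeneous p) \<and> J = genideal (mpoly_ring V) S)"

lemma mpoly_ring_cring: "cring (mpoly_ring V :: 'k::field mpoly ring)"
proof -
  define C where "C = {p :: 'k mpoly. \<forall>m \<in> Poly_Mapping.keys p. Poly_Mapping.keys m \<subseteq> V}"
  have plus: "p + q \<in> C" if "p \<in> C" "q \<in> C" for p q
    using that Poly_Mapping.keys_add[of p q] unfolding C_def by blast
  have times: "p * q \<in> C" if "p \<in> C" "q \<in> C" for p q
    unfolding C_def
  proof (intro CollectI ballI)
    fix m assume "m \<in> Poly_Mapping.keys (p * q)"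
    then obtain a b where "m = a + b" "a \<in> Poly_Mapping.keys p" "b \<in> Poly_Mapping.keys q"
      using Poly_Mapping.keys_mult[of p q] by blast
    then show "Poly_Mapping.keys m \<subseteq> V"
      using that Poly_Mapping.keys_add[of a b] unfolding C_def by blast
  qed
  have uminus: "- p \<in> C" if "p \<in> C" for p
    using that by (simp add: C_def)
  have zero: "0 \<in> C" and one: "1 \<in> C" by (simp_all add: C_def)
  have R: "mpoly_ring V = \<lparr>carrier = C, monoid.mult = times, one = 1, zero = 0, add = plus\<rparr>"
    by (simp add: mpoly_ring_def C_def)
  show ?thesis
    unfolding R
  proof (rule cringI)
    show "abelian_group \<lparr>carrier = C, monoid.mult = times, one = 1, zero = 0, add = plus\<rparr>"
      by (rule abelian_groupI)
         (auto simp: plus zero add.assoc add.commute intro!: bexI[OF _ uminus])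
    show "Group.comm_monoid \<lparr>carrier = C, monoid.mult = times, one = 1, zero = 0, add = plus\<rparr>"
      by (rule comm_monoidI) (simp_all add: times one mult.assoc mult.commute)
  qed (simp add: distrib_right)
qed

section \<open>Modules and free resolutions\<close>

text \<open>The ring \<open>S\<close> as an \<open>R\<close>-module along a ring homomorphism \<open>\<phi> : R \<rightarrow> S\<close>.\<close>

definition module_along :: "('a \<Rightarrow> 'b) \<Rightarrow> 'b ring \<Rightarrow> ('a, 'b) module" where
  "module_along \<phi> S =
    \<lparr>carrier = carrier S, monoid.mult = monoid.mult S, one = one S, zero = zero S, add = add S,
     module.smult = (\<lambda>r s. \<phi> r \<otimes>\<^bsub>S\<^esub> s)\<rparr>"

lemma module_along_module:
  assumes "cring R" "ring S" "\<phi> \<in> ring_hom R S"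
  shows "module R (module_along \<phi> S)"
proof -
  interpret S: ring S by fact
  interpret \<phi>: ring_hom_ring R S \<phi>
    using assms by (intro ring_hom_ringI2) (auto simp: cring_def)
  have "abelian_group (module_along \<phi> S)"
  proof (rule abelian_groupI)
    fix x assume "x \<in> carrier (module_along \<phi> S)"
    then show "\<exists>y \<in> carrier (module_along \<phi> S).
        y \<oplus>\<^bsub>module_along \<phi> S\<^esub> x = \<zero>\<^bsub>module_along \<phi> S\<^esub>"
      by (intro bexI[of _ "\<ominus>\<^bsub>S\<^esub> x"]) (simp_all add: module_along_def S.l_neg)
  qed (simp_all add: module_along_def S.a_ac)
  with assms(1) show ?thesis
    by (rule moduleI) (simp_all add: module_along_def S.l_distr S.r_distr S.m_assoc)
qed

text \<open>\<open>M\<^sup>n\<close>, with vectors extended by zero beyond the first \<open>n\<close> entries.\<close>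

definition power_module :: "('a, 'b) module \<Rightarrow> nat \<Rightarrow> (nat \<Rightarrow> 'b) set" where
  "power_module M n = {v. (\<forall>i<n. v i \<in> carrier M) \<and> (\<forall>i\<ge>n. v i = \<zero>\<^bsub>M\<^esub>)}"

text \<open>The map \<open>M\<^sup>q \<rightarrow> M\<^sup>p\<close> given by a \<open>p \<times> q\<close> matrix over the base ring.\<close>

definition mat_apply ::
  "('a, 'b) module \<Rightarrow> nat \<Rightarrow> nat \<Rightarrow> (nat \<Rightarrow> nat \<Rightarrow> 'a) \<Rightarrow> (nat \<Rightarrow> 'b) \<Rightarrow> nat \<Rightarrow> 'b" where
  "mat_apply M p q D v =
    (\<lambda>i. if i < p then (\<Oplus>\<^bsub>M\<^esub>j\<in>{..<q}. D i j \<odot>\<^bsub>M\<^esub> v j) else \<zero>\<^bsub>M\<^esub>)"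

text \<open>
  A resolution \<open>\<dots> \<rightarrow> R\<^bsup>b 2\<^esup> \<rightarrow> R\<^bsup>b 1\<^esup> \<rightarrow> R\<^bsup>b 0\<^esup> \<rightarrow> M \<rightarrow> 0\<close> by free modules of finite rank:
  \<open>D i\<close> is the \<open>b i \<times> b (i + 1)\<close> matrix of the differential out of homological degree \<open>i + 1\<close>,
  and \<open>e j\<close> is the image in \<open>M\<close> of the \<open>j\<close>-th basis vector.
\<close>

definition free_resolution ::
  "'a ring \<Rightarrow> ('a, 'b) module \<Rightarrow> (nat \<Rightarrow> nat) \<Rightarrow> (nat \<Rightarrow> nat \<Rightarrow> nat \<Rightarrow> 'a) \<Rightarrow> (nat \<Rightarrow> 'b) \<Rightarrow> bool"
where
  "free_resolution R M b D e \<longleftrightarrow>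
    (let F = (\<lambda>i. power_module (module_along id R) (b i));
         d = (\<lambda>i. mat_apply (module_along id R) (b i) (b (Suc i)) (D i));
         \<epsilon> = (\<lambda>v. \<Oplus>\<^bsub>M\<^esub>j\<in>{..<b 0}. v j \<odot>\<^bsub>M\<^esub> e j)
     in (\<forall>i. \<forall>r < b i. \<forall>c < b (Suc i). D i r c \<in> carrier R) \<and>
        (\<forall>j < b 0. e j \<in> carrier M) \<and>
        \<epsilon> ` F 0 = carrier M \<and>
        {v \<in> F 0. \<epsilon> v = \<zero>\<^bsub>M\<^esub>} = d 0 ` F 1 \<and>
        (\<forall>i. {v \<in> F (Suc i). d i v = (\<lambda>_. \<zero>\<^bsub>R\<^esub>)} = d (Suc i) ` F (Suc (Suc i))))"

section \<open>Dimension of Tor\<close>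

text \<open>
  For a resolution as above, \<open>F\<^sub>i \<otimes>\<^sub>R N = N\<^bsup>b i\<^esup>\<close> with the differentials given by the same
  matrices, so \<open>Tor\<^sub>i(M, N)\<close> is the quotient of the following cycles and boundaries.
\<close>

definition tor_cycles ::
  "('a, 'b) module \<Rightarrow> (nat \<Rightarrow> nat) \<Rightarrow> (nat \<Rightarrow> nat \<Rightarrow> nat \<Rightarrow> 'a) \<Rightarrow> nat \<Rightarrow> (nat \<Rightarrow> 'b) set" where
  "tor_cycles N b D i =
    (case i of 0 \<Rightarrow> power_module N (b 0)
     | Suc j \<Rightarrow> {v \<in> power_module N (b (Suc j)).
                  mat_apply N (b j) (b (Suc j)) (D j) v = (\<lambda>_. \<zero>\<^bsub>N\<^esub>)})"

definition tor_boundaries ::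
  "('a, 'b) module \<Rightarrow> (nat \<Rightarrow> nat) \<Rightarrow> (nat \<Rightarrow> nat \<Rightarrow> nat \<Rightarrow> 'a) \<Rightarrow> nat \<Rightarrow> (nat \<Rightarrow> 'b) set" where
  "tor_boundaries N b D i =
    mat_apply N (b i) (b (Suc i)) (D i) ` power_module N (b (Suc i))"

interpretation coord: vector_space "\<lambda>(c::'k::field) (v::nat \<Rightarrow> 'k) i. c * v i"
  by unfold_locales (auto simp: fun_eq_iff algebra_simps)

text \<open>
  The dimension of \<open>Tor\<^sub>i(M, N)\<close> over the field \<open>'k\<close>, for \<open>N\<close> a module structure on \<open>'k\<close> itself,
  computed from a chosen resolution of \<open>M\<close>.  Such a resolution exists for every finitely generated
  \<open>M\<close> over a Noetherian ring, and the dimension does not depend on the choice.  Cycles and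
  boundaries are subspaces of a finite-dimensional space, the boundaries lying in the cycles, so
  the difference below is the dimension of the quotient.
\<close>

definition tor_dim :: "'a ring \<Rightarrow> ('a, 'b) module \<Rightarrow> ('a, 'k::field) module \<Rightarrow> nat \<Rightarrow> nat" where
  "tor_dim R M N i =
    (let (b, D, e) = (SOME (b, D, e). free_resolution R M b D e)
     in coord.dim (tor_cycles N b D i) - coord.dim (tor_boundaries N b D i))"

section \<open>Golod rings\<close>

definition const_coeff :: "'k::field mpoly \<Rightarrow> 'k" where
  "const_coeff p = Poly_Mapping.lookup p 0"

text \<open>
  The residue field as a module over \<open>T = mpoly_ring V\<close> and over a quotient \<open>T/J\<close>.  An element of
  \<open>T/J\<close> is a coset, on which the constant coefficient is constant as soon as \<open>J\<close> lies in the
  homogeneous maximal ideal.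
\<close>

definition residue_field :: "('k::field mpoly, 'k) module" where
  "residue_field = module_along const_coeff ring_of_type_algebra"

definition residue_field_quot :: "('k::field mpoly set, 'k) module" where
  "residue_field_quot = module_along (\<lambda>a. the_elem (const_coeff ` a)) ring_of_type_algebra"

definition quot_module :: "nat set \<Rightarrow> 'k::field mpoly set \<Rightarrow> ('k mpoly, 'k mpoly set) module" where
  "quot_module V J = module_along (\<lambda>p. J +>\<^bsub>mpoly_ring V\<^esub> p) (mpoly_ring V Quot J)"

text \<open>\<open>dim\<^sub>k Tor\<^sup>A\<^sub>i(k, k)\<close> and \<open>dim\<^sub>k Tor\<^sup>T\<^sub>i(A, k)\<close> for \<open>A = T/J\<close>.\<close>

definition residue_betti :: "nat set \<Rightarrow> 'k::field mpoly set \<Rightarrow> nat \<Rightarrow> nat" where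
  "residue_betti V J i =
    tor_dim (mpoly_ring V Quot J) residue_field_quot (residue_field_quot :: (_, 'k) module) i"

definition betti_dim :: "nat set \<Rightarrow> 'k::field mpoly set \<Rightarrow> nat \<Rightarrow> nat" where
  "betti_dim V J i = tor_dim (mpoly_ring V) (quot_module V J) (residue_field :: (_, 'k) module) i"

text \<open>
  Meaningful for a finite set \<open>V\<close> and a homogeneous ideal \<open>J\<close> of \<open>mpoly_ring V\<close> contained in the
  square of the homogeneous maximal ideal; the series are taken over the rationals.  The exponent
  \<open>i + 1\<close> of the denominator sum is the index \<open>j\<close> below.
\<close>

definition golod :: "nat set \<Rightarrow> 'k::field mpoly set \<Rightarrow> bool" where
  "golod V J \<longleftrightarrow>
    (Abs_fps (\<lambda>i. of_nat (residue_betti V J i)) :: rat fps) =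
    (1 + fps_X) ^ card V /
    (1 - Abs_fps (\<lambda>j. if j \<ge> 2 then of_nat (betti_dim V J (j - 1)) else 0))"

end

theory Submission
  imports Defs
begin

text \<open>
  For \<open>A = T/J\<close> let \<open>P\<^sub>A(z) = \<Sum>\<^sub>i dim Tor\<^sup>A\<^sub>i(k, k) z\<^sup>i\<close> and \<open>B\<^sub>A(z) = \<Sum>\<^sub>i dim Tor\<^sup>T\<^sub>i(A, k) z\<^sup>i\<close>.  Both series are
  multiplicative under tensor products over \<open>k\<close>: the tensor product of a resolution over \<open>R1\<close> and
  one over \<open>R2\<close> is a resolution over \<open>R\<close>, and its homology with coefficients in \<open>k\<close> is given by the
  Kuenneth formula (\<open>residue_betti_tensor\<close>, \<open>betti_dim_tensor\<close>).

  If \<open>I2 = 0\<close>, then \<open>P\<close> of the second factor is \<open>(1 + z)\<^sup>m\<close> and \<open>B\<close> is \<open>1\<close>, so the passage from \<open>R1\<close> to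
  \<open>R\<close> multiplies both sides of the Golod identity by \<open>(1 + z)\<^sup>m\<close> (\<open>golod_extend_variables\<close>).

  If neither ideal is zero, the Golod identity of \<open>R\<close> fails in degree three.  Let \<open>s\<^sub>i\<close> and \<open>t\<^sub>i\<close> be the
  coefficients of \<open>B\<close> for \<open>R1\<close> and \<open>R2\<close>.  The second Betti number of \<open>R\<close> over its polynomial ring is
  \<open>s\<^sub>2 + s\<^sub>1 t\<^sub>1 + t\<^sub>2\<close>, so the Golod identity asks for the coefficient
  \<open>(n+m choose 3) + (n + m) (s\<^sub>1 + t\<^sub>1) + s\<^sub>2 + s\<^sub>1 t\<^sub>1 + t\<^sub>2\<close> of \<open>z\<^sup>3\<close> in \<open>P\<close>.  But that series is the product of
  those of \<open>R1\<close> and \<open>R2\<close>, whose coefficients up to \<open>z\<^sup>3\<close> are bounded by Serre's inequality; multiplying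
  the bounds out gives the same number without the term \<open>s\<^sub>1 t\<^sub>1\<close>.  Since a nonzero ideal has a generator,
  \<open>s\<^sub>1\<close> and \<open>t\<^sub>1\<close> are positive (\<open>betti_dim_1_pos\<close>), which is a contradiction (\<open>tensor_not_golod\<close>).

  Up to \<open>z\<^sup>3\<close> Serre's inequality (\<open>serre_bound\<close>) follows from an explicit beginning of a resolution of \<open>k\<close>
  over \<open>A\<close>: take the Koszul complex of \<open>A\<close> and adjoin free modules that kill its homology in degrees one
  and two.  One more free module is needed for the relations in the new part; it has \<open>n\<close> generators per
  basis element of the first homology, because the maximal ideal annihilates Koszul homology.  The
  dimensions of Koszul homology are the coefficients of \<open>B\<close> by the symmetry of Tor (\<open>balance_tor\<close>),
  which also shows that Tor does not depend on the resolution.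

  All rings that occur are treated as quotients of one ambient polynomial ring \<open>S\<close>: the polynomial ring
  in the variables \<open>V\<close> is \<open>S\<close> modulo the variables outside \<open>V\<close>.  A free complex over \<open>S/J\<close> is given by finite
  index sets and matrices over \<open>S\<close>, its elements are vectors over \<open>S\<close>, and an equation over \<open>S/J\<close> becomes
  membership of a difference in \<open>J\<close>.  The passage between these complexes and modules over rings with a
  carrier is made once, for modules presented as quotients of \<open>S\<close> (\<open>presented_module\<close>).
\<close>


section \<open>Double complexes with exact rows\<close>

text \<open>
  Components of a double complex are quotients of one abelian group: \<open>N p q\<close> is the set of elements that
  count as zero in bidegree \<open>(p, q)\<close>, and \<open>d1\<close>, \<open>d2\<close> lower the first and the second degree.  Working with
  representatives avoids a type of quotients for each bidegree.
\<close>

locale double_complex =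
  fixes N :: "nat \<Rightarrow> nat \<Rightarrow> 'x::ab_group_add set"
    and d1 d2 :: "nat \<Rightarrow> nat \<Rightarrow> 'x \<Rightarrow> 'x"
  assumes N_zero: "0 \<in> N p q"
    and N_diff: "x \<in> N p q \<Longrightarrow> y \<in> N p q \<Longrightarrow> x - y \<in> N p q"
    and d1_diff: "d1 p q (x - y) = d1 p q x - d1 p q y"
    and d2_diff: "d2 p q (x - y) = d2 p q x - d2 p q y"
    and d1_N: "x \<in> N (Suc p) q \<Longrightarrow> d1 p q x \<in> N p q"
    and d2_N: "x \<in> N p (Suc q) \<Longrightarrow> d2 p q x \<in> N p q"
    and d1_d1: "d1 p q (d1 (Suc p) q x) \<in> N p q"
    and d2_d2: "d2 p q (d2 p (Suc q) x) \<in> N p q"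
    and anticomm: "d1 p q (d2 (Suc p) q x) + d2 p q (d1 p (Suc q) x) \<in> N p q"
begin

text \<open>
  An element of the total complex in degree \<open>n\<close> is a family \<open>U\<close> whose entry \<open>U p\<close> lies in bidegree
  \<open>(p, n - p)\<close>.
\<close>

definition tot_cycle :: "nat \<Rightarrow> (nat \<Rightarrow> 'x) \<Rightarrow> bool" where
  "tot_cycle n U \<longleftrightarrow> (\<forall>p q. Suc (p + q) = n \<longrightarrow> d1 p q (U (Suc p)) + d2 p q (U p) \<in> N p q)"

definition tot_boundary :: "nat \<Rightarrow> (nat \<Rightarrow> 'x) \<Rightarrow> bool" where
  "tot_boundary n U \<longleftrightarrow>
    (\<exists>Y. \<forall>p q. p + q = n \<longrightarrow> U p - (d1 p q (Y (Suc p)) + d2 p q (Y p)) \<in> N p q)"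

lemma N_minus: "x \<in> N p q \<Longrightarrow> - x \<in> N p q"
  using N_diff[OF N_zero, of x] by simp

lemma N_add: "x \<in> N p q \<Longrightarrow> y \<in> N p q \<Longrightarrow> x + y \<in> N p q"
  using N_diff[OF _ N_minus, of x p q y] by simp

lemma d1_zero: "d1 p q 0 = 0"
  using d1_diff[of p q 0 0] by simp

lemma d2_zero: "d2 p q 0 = 0"
  using d2_diff[of p q 0 0] by simp

lemma d1_minus: "d1 p q (- x) = - d1 p q x"
  using d1_diff[of p q 0 x] by (simp add: d1_zero)

lemma d2_minus: "d2 p q (- x) = - d2 p q x"
  using d2_diff[of p q 0 x] by (simp add: d2_zero)

lemma d1_add: "d1 p q (x + y) = d1 p q x + d1 p q y"
  using d1_diff[of p q x "- y"] by (simp add: d1_minus)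

lemma d2_add: "d2 p q (x + y) = d2 p q x + d2 p q y"
  using d2_diff[of p q x "- y"] by (simp add: d2_minus)

lemma tot_cycle_of_boundary:
  assumes "tot_boundary n U"
  shows "tot_cycle n U"
  unfolding tot_cycle_def
proof (intro allI impI)
  fix p q assume n: "Suc (p + q) = n"
  obtain Y where Y: "\<And>p q. p + q = n \<Longrightarrow> U p - (d1 p q (Y (Suc p)) + d2 p q (Y p)) \<in> N p q"
    using assms by (auto simp: tot_boundary_def)
  have 1: "d1 p q (U (Suc p)) - (d1 p q (d1 (Suc p) q (Y (Suc (Suc p)))) + d1 p q (d2 (Suc p) q (Y (Suc p)))) \<in> N p q"
    using d1_N[OF Y[of "Suc p" q]] n by (simp add: d1_add d1_diff)
  have 2: "d2 p q (U p) - (d2 p q (d1 p (Suc q) (Y (Suc p))) + d2 p q (d2 p (Suc q) (Y p))) \<in> N p q"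
    using d2_N[OF Y[of p "Suc q"]] n by (simp add: d2_add d2_diff)
  from N_add[OF N_add[OF 1 2] N_add[OF N_add[OF d1_d1[of p q "Y (Suc (Suc p))"] d2_d2[of p q "Y p"]] anticomm[of p q "Y (Suc p)"]]]
  show "d1 p q (U (Suc p)) + d2 p q (U p) \<in> N p q"
    by (rule back_subst[of "\<lambda>x. x \<in> N p q"]) (simp add: algebra_simps)
qed

lemma tot_cycle_diff:
  assumes "tot_cycle n U" "tot_cycle n V"
  shows "tot_cycle n (\<lambda>p. U p - V p)"
  unfolding tot_cycle_def
proof (intro allI impI)
  fix p q assume "Suc (p + q) = n"
  then have "(d1 p q (U (Suc p)) + d2 p q (U p)) - (d1 p q (V (Suc p)) + d2 p q (V p)) \<in> N p q"
    using assms by (intro N_diff) (auto simp: tot_cycle_def)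
  then show "d1 p q (U (Suc p) - V (Suc p)) + d2 p q (U p - V p) \<in> N p q"
    by (simp add: d1_diff d2_diff algebra_simps)
qed

lemma tot_boundary_add:
  assumes "tot_boundary n U" "tot_boundary n V"
  shows "tot_boundary n (\<lambda>p. U p + V p)"
proof -
  obtain Y Y' where "\<And>p q. p + q = n \<Longrightarrow> U p - (d1 p q (Y (Suc p)) + d2 p q (Y p)) \<in> N p q"
    "\<And>p q. p + q = n \<Longrightarrow> V p - (d1 p q (Y' (Suc p)) + d2 p q (Y' p)) \<in> N p q"
    using assms unfolding tot_boundary_def by blast
  from N_add[OF this] show ?thesis
    unfolding tot_boundary_def
    by (intro exI[of _ "\<lambda>p. Y p + Y' p"]) (simp add: d1_add d2_add algebra_simps)
qed

lemma tot_boundary_sum: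
  assumes "finite A" "\<And>a. a \<in> A \<Longrightarrow> tot_boundary n (U a)"
  shows "tot_boundary n (\<lambda>p. \<Sum>a\<in>A. U a p)"
  using assms
proof (induction A rule: finite_induct)
  case empty
  show ?case unfolding tot_boundary_def
    by (rule exI[of _ "\<lambda>_. 0"]) (simp add: d1_zero d2_zero N_zero)
next
  case (insert a A)
  then show ?case using tot_boundary_add[of n "U a" "\<lambda>p. \<Sum>a\<in>A. U a p"] by simp
qed

lemma transpose_double_complex:
  "double_complex (\<lambda>p q. N q p) (\<lambda>p q. d2 q p) (\<lambda>p q. d1 q p)"
  by unfold_locales
    (use N_zero N_diff d1_diff d2_diff d1_N d2_N d1_d1 d2_d2 anticomm in \<open>auto simp: add.commute\<close>)

end

text \<open>
  The rows \<open>C\<^sub>p\<^sub>,\<^sub>\<bullet> \<rightarrow> E\<^sub>p \<rightarrow> 0\<close> are exact.  As in \<^locale>\<open>double_complex\<close>, every module is a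
  quotient of an ambient group: \<open>N p q\<close> and \<open>M p\<close> consist of the elements that count as zero.
\<close>

locale exact_rows = double_complex N d1 d2
  for N :: "nat \<Rightarrow> nat \<Rightarrow> 'x::ab_group_add set" and d1 d2 +
  fixes M :: "nat \<Rightarrow> 'y::ab_group_add set" and \<epsilon> :: "nat \<Rightarrow> 'x \<Rightarrow> 'y" and dE :: "nat \<Rightarrow> 'y \<Rightarrow> 'y"
  assumes M_zero: "0 \<in> M p"
    and M_diff: "x' \<in> M p \<Longrightarrow> y' \<in> M p \<Longrightarrow> x' - y' \<in> M p"
    and \<epsilon>_diff: "\<epsilon> p (x - y) = \<epsilon> p x - \<epsilon> p y"
    and dE_diff: "dE p (x' - y') = dE p x' - dE p y'"
    and dE_M: "x' \<in> M (Suc p) \<Longrightarrow> dE p x' \<in> M p"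
    and \<epsilon>_surj: "\<exists>x. \<epsilon> p x - y' \<in> M p"
    and \<epsilon>_kernel: "\<epsilon> p x \<in> M p \<longleftrightarrow> (\<exists>y. x - d2 p 0 y \<in> N p 0)"
    and \<epsilon>_d1: "\<epsilon> p (d1 p 0 x) - dE p (\<epsilon> (Suc p) x) \<in> M p"
    and row_exact: "d2 p q x \<in> N p q \<Longrightarrow> \<exists>y. x - d2 p (Suc q) y \<in> N p (Suc q)"
begin

definition edge_cycle :: "nat \<Rightarrow> 'y \<Rightarrow> bool" where
  "edge_cycle n y \<longleftrightarrow> (\<forall>p. Suc p = n \<longrightarrow> dE p y \<in> M p)"

definition edge_boundary :: "nat \<Rightarrow> 'y \<Rightarrow> bool" where
  "edge_boundary n y \<longleftrightarrow> (\<exists>z. y - dE n z \<in> M n)"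

lemma M_minus: "x \<in> M p \<Longrightarrow> - x \<in> M p"
  using M_diff[OF M_zero, of x] by simp

lemma M_add: "x \<in> M p \<Longrightarrow> y \<in> M p \<Longrightarrow> x + y \<in> M p"
  using M_diff[OF _ M_minus, of x p y] by simp

lemma \<epsilon>_zero: "\<epsilon> p 0 = 0"
  using \<epsilon>_diff[of p 0 0] by simp

lemma \<epsilon>_minus: "\<epsilon> p (- x) = - \<epsilon> p x"
  using \<epsilon>_diff[of p 0 x] by (simp add: \<epsilon>_zero)

lemma \<epsilon>_add: "\<epsilon> p (x + y) = \<epsilon> p x + \<epsilon> p y"
  using \<epsilon>_diff[of p x "- y"] by (simp add: \<epsilon>_minus)

lemma \<epsilon>_N: "x \<in> N p 0 \<Longrightarrow> \<epsilon> p x \<in> M p"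
  using \<epsilon>_kernel[of p x] d2_zero[of p 0] by (metis diff_zero)

lemma \<epsilon>_d2: "\<epsilon> p (d2 p 0 x) \<in> M p"
  using \<epsilon>_kernel[of p "d2 p 0 x"] N_zero[of p 0] by (metis diff_self)

text \<open>
  The augmentation \<open>\<epsilon>\<close> extends to a chain map from the total complex onto the edge complex \<open>E\<close>: it
  forgets all components except the one in the column of second degree \<open>0\<close>.
\<close>

lemma edge_cycle_of_tot_cycle:
  assumes "tot_cycle n U"
  shows "edge_cycle n (\<epsilon> n (U n))"
  unfolding edge_cycle_def
proof (intro allI impI)
  fix p assume p: "Suc p = n"
  have "d1 p 0 (U (Suc p)) + d2 p 0 (U p) \<in> N p 0"
    using assms p by (auto simp: tot_cycle_def)
  from \<epsilon>_N[OF this] have "\<epsilon> p (d1 p 0 (U (Suc p))) + \<epsilon> p (d2 p 0 (U p)) \<in> M p"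
    by (simp add: \<epsilon>_add)
  from M_diff[OF this \<epsilon>_d2[of p "U p"]] have "\<epsilon> p (d1 p 0 (U (Suc p))) \<in> M p" by simp
  from M_diff[OF this \<epsilon>_d1[of p "U (Suc p)"]] show "dE p (\<epsilon> n (U n)) \<in> M p" using p by simp
qed

lemma edge_boundary_of_tot_boundary:
  assumes "tot_boundary n U"
  shows "edge_boundary n (\<epsilon> n (U n))"
proof -
  obtain Y where "\<forall>p q. p + q = n \<longrightarrow> U p - (d1 p q (Y (Suc p)) + d2 p q (Y p)) \<in> N p q"
    using assms by (auto simp: tot_boundary_def)
  then have "U n - (d1 n 0 (Y (Suc n)) + d2 n 0 (Y n)) \<in> N n 0" by simp
  from \<epsilon>_N[OF this] have "\<epsilon> n (U n) - (\<epsilon> n (d1 n 0 (Y (Suc n))) + \<epsilon> n (d2 n 0 (Y n))) \<in> M n"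
    by (simp add: \<epsilon>_add \<epsilon>_diff)
  from M_add[OF M_add[OF this \<epsilon>_d2[of n "Y n"]] \<epsilon>_d1[of n "Y (Suc n)"]]
  have "\<epsilon> n (U n) - dE n (\<epsilon> (Suc n) (Y (Suc n))) \<in> M n" by (simp add: algebra_simps)
  then show ?thesis by (auto simp: edge_boundary_def)
qed

text \<open>
  Staircase construction: start with a lift in \<open>C\<^sub>n\<^sub>,\<^sub>0\<close> and use exactness of one row after the
  other to find the components in \<open>C\<^sub>n\<^sub>-\<^sub>1\<^sub>,\<^sub>1, \<dots>, C\<^sub>0\<^sub>,\<^sub>n\<close>.
\<close>

lemma tot_cycle_lift:
  assumes "edge_cycle n y"
  shows "\<exists>U. tot_cycle n U \<and> \<epsilon> n (U n) - y \<in> M n"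
proof -
  obtain x where x: "\<epsilon> n x - y \<in> M n" using \<epsilon>_surj by blast
  have "\<exists>U. U n = x \<and>
      (\<forall>p q. Suc (p + q) = n \<longrightarrow> q < k \<longrightarrow> d1 p q (U (Suc p)) + d2 p q (U p) \<in> N p q)" if "k \<le> n" for k
    using that
  proof (induction k)
    case 0
    show ?case by auto
  next
    case (Suc k)
    then obtain U where U: "U n = x"
      "\<And>p q. Suc (p + q) = n \<Longrightarrow> q < k \<Longrightarrow> d1 p q (U (Suc p)) + d2 p q (U p) \<in> N p q" by auto
    define p where "p = n - Suc k"
    have pn: "Suc (p + k) = n" using Suc.prems by (simp add: p_def)
    have "\<exists>u. d1 p k (U (Suc p)) - d2 p k u \<in> N p k"
    proof (cases k)
      case 0
      then have n: "n = Suc p" using pn by simp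
      have "dE p (\<epsilon> n x - y) \<in> M p" using x n dE_M by blast
      moreover have "dE p y \<in> M p" using assms n by (simp add: edge_cycle_def)
      ultimately have "dE p (\<epsilon> n x) \<in> M p" using M_add by (fastforce simp: dE_diff)
      from M_add[OF \<epsilon>_d1[of p x] this[unfolded n]] have "\<epsilon> p (d1 p 0 x) \<in> M p" by simp
      then show ?thesis using \<epsilon>_kernel U(1) 0 n by blast
    next
      case (Suc l)
      have "d1 (Suc p) l (U (Suc (Suc p))) + d2 (Suc p) l (U (Suc p)) \<in> N (Suc p) l"
        using pn Suc by (intro U(2)) auto
      from d1_N[OF this] N_diff[OF _ d1_d1[of p l "U (Suc (Suc p))"]]
      have "d1 p l (d2 (Suc p) l (U (Suc p))) \<in> N p l" by (fastforce simp: d1_add)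
      from N_diff[OF anticomm[of p l "U (Suc p)"] this]
      have "d2 p l (d1 p k (U (Suc p))) \<in> N p l" using Suc by simp
      from row_exact[OF this] show ?thesis using Suc by simp
    qed
    then obtain u where u: "d1 p k (U (Suc p)) - d2 p k u \<in> N p k" by blast
    define U' where "U' = U(p := - u)"
    have "d1 p' q (U' (Suc p')) + d2 p' q (U' p') \<in> N p' q" if "Suc (p' + q) = n" "q < Suc k" for p' q
    proof (cases "q = k")
      case True
      then have "p' = p" using that pn by simp
      then show ?thesis using u True by (simp add: U'_def d2_minus)
    next
      case False
      then have "p' > p" using that pn by simp
      then show ?thesis using U(2)[OF that(1)] False that by (simp add: U'_def)
    qed
    moreover have "U' n = x" using U(1) pn by (auto simp: U'_def)
    ultimately show ?case by blast
  qed
  from this[of n] obtain U where "U n = x"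
    "\<forall>p q. Suc (p + q) = n \<longrightarrow> q < n \<longrightarrow> d1 p q (U (Suc p)) + d2 p q (U p) \<in> N p q" by blast
  then show ?thesis using x by (intro exI[of _ U]) (auto simp: tot_cycle_def)
qed

text \<open>
  Together with \<open>tot_cycle_lift\<close> this says that the edge map is an isomorphism on homology.  The proof is
  the same staircase, one degree higher.
\<close>

lemma tot_boundary_lift:
  assumes cyc: "tot_cycle n U" and "edge_boundary n (\<epsilon> n (U n))"
  shows "tot_boundary n U"
proof -
  obtain z where z: "\<epsilon> n (U n) - dE n z \<in> M n" using assms by (auto simp: edge_boundary_def)
  obtain x where x: "\<epsilon> (Suc n) x - z \<in> M (Suc n)" using \<epsilon>_surj by blast
  have "\<exists>Y. Y (Suc n) = x \<and>
      (\<forall>p q. p + q = n \<longrightarrow> q < k \<longrightarrow> U p - (d1 p q (Y (Suc p)) + d2 p q (Y p)) \<in> N p q)"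
    if "k \<le> Suc n" for k
    using that
  proof (induction k)
    case 0
    show ?case by auto
  next
    case (Suc k)
    then obtain Y where Y: "Y (Suc n) = x"
      "\<And>p q. p + q = n \<Longrightarrow> q < k \<Longrightarrow> U p - (d1 p q (Y (Suc p)) + d2 p q (Y p)) \<in> N p q" by auto
    define p where "p = n - k"
    have pn: "p + k = n" using Suc.prems by (simp add: p_def)
    have "\<exists>u. (U p - d1 p k (Y (Suc p))) - d2 p k u \<in> N p k"
    proof (cases k)
      case 0
      then have n: "p = n" using pn by simp
      have "dE n (\<epsilon> (Suc n) x - z) \<in> M n" using x dE_M by blast
      from M_diff[OF z this] have "\<epsilon> n (U n) - dE n (\<epsilon> (Suc n) x) \<in> M n" by (simp add: dE_diff)
      from M_diff[OF this \<epsilon>_d1[of n x]] have "\<epsilon> n (U n - d1 n 0 x) \<in> M n" by (simp add: \<epsilon>_diff)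
      then show ?thesis using \<epsilon>_kernel Y(1) 0 n by blast
    next
      case (Suc l)
      have "U (Suc p) - (d1 (Suc p) l (Y (Suc (Suc p))) + d2 (Suc p) l (Y (Suc p))) \<in> N (Suc p) l"
        using pn Suc by (intro Y(2)) auto
      from N_add[OF d1_N[OF this] d1_d1[of p l "Y (Suc (Suc p))"]]
      have 1: "d1 p l (U (Suc p)) - d1 p l (d2 (Suc p) l (Y (Suc p))) \<in> N p l"
        by (simp add: d1_add d1_diff)
      have "d1 p l (U (Suc p)) + d2 p l (U p) \<in> N p l"
        using cyc pn Suc by (auto simp: tot_cycle_def)
      from N_diff[OF this N_add[OF 1 anticomm[of p l "Y (Suc p)"]]]
      have "d2 p l (U p - d1 p k (Y (Suc p))) \<in> N p l" using Suc by (simp add: d2_diff)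
      from row_exact[OF this] show ?thesis using Suc by simp
    qed
    then obtain u where u: "(U p - d1 p k (Y (Suc p))) - d2 p k u \<in> N p k" by blast
    define Y' where "Y' = Y(p := u)"
    have "U p' - (d1 p' q (Y' (Suc p')) + d2 p' q (Y' p')) \<in> N p' q" if "p' + q = n" "q < Suc k" for p' q
    proof (cases "q = k")
      case True
      then have "p' = p" using that pn by simp
      then show ?thesis using u True by (simp add: Y'_def diff_diff_eq)
    next
      case False
      then have "p' > p" using that pn by simp
      then show ?thesis using Y(2)[OF that(1)] False that by (simp add: Y'_def)
    qed
    moreover have "Y' (Suc n) = x" using Y(1) pn by (auto simp: Y'_def)
    ultimately show ?case by blast
  qed
  from this[of "Suc n"] obtain Y where
    "\<forall>p q. p + q = n \<longrightarrow> q < Suc n \<longrightarrow> U p - (d1 p q (Y (Suc p)) + d2 p q (Y p)) \<in> N p q" by blast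
  then show ?thesis by (auto simp: tot_boundary_def intro!: exI[of _ Y])
qed

end


section \<open>Free complexes modulo an ideal\<close>

text \<open>The ring as a module over itself, so that ideals are the subspaces.\<close>

interpretation self: Modules.module "(*) :: 'a::comm_ring_1 \<Rightarrow> 'a \<Rightarrow> 'a"
  by unfold_locales (auto simp: algebra_simps)

declare self.scale_scale [simp del]

definition mat_vec :: "'j set \<Rightarrow> ('i \<Rightarrow> 'j \<Rightarrow> 'a::comm_ring_1) \<Rightarrow> ('j \<Rightarrow> 'a) \<Rightarrow> 'i \<Rightarrow> 'a" where
  "mat_vec B D v = (\<lambda>i. \<Sum>j\<in>B. D i j * v j)"

text \<open>
  The free complex over \<open>S/A\<close> with basis \<open>B n\<close> in degree \<open>n\<close> and differential \<open>D n\<close> from degree \<open>Suc n\<close> to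
  degree \<open>n\<close>.  The ideal \<open>A\<close> is a parameter because the same matrices are used over several quotients:
  a resolution over \<open>S/J\<close> is tensored with \<open>S/A\<close> by replacing \<open>J\<close> by \<open>A\<close>.  In degree \<open>0\<close> everything is a cycle.
\<close>

definition cycle_mod ::
  "'a::comm_ring_1 set \<Rightarrow> (nat \<Rightarrow> 'i set) \<Rightarrow> (nat \<Rightarrow> 'i \<Rightarrow> 'i \<Rightarrow> 'a) \<Rightarrow> nat \<Rightarrow> ('i \<Rightarrow> 'a) \<Rightarrow> bool" where
  "cycle_mod A B D n v \<longleftrightarrow> (\<forall>p. Suc p = n \<longrightarrow> (\<forall>i\<in>B p. mat_vec (B (Suc p)) (D p) v i \<in> A))"

definition boundary_mod ::
  "'a::comm_ring_1 set \<Rightarrow> (nat \<Rightarrow> 'i set) \<Rightarrow> (nat \<Rightarrow> 'i \<Rightarrow> 'i \<Rightarrow> 'a) \<Rightarrow> nat \<Rightarrow> ('i \<Rightarrow> 'a) \<Rightarrow> bool" where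
  "boundary_mod A B D n v \<longleftrightarrow> (\<exists>w. \<forall>i\<in>B n. v i - mat_vec (B (Suc n)) (D n) w i \<in> A)"

definition complex_mod ::
  "'a::comm_ring_1 set \<Rightarrow> (nat \<Rightarrow> 'i set) \<Rightarrow> (nat \<Rightarrow> 'i \<Rightarrow> 'i \<Rightarrow> 'a) \<Rightarrow> bool" where
  "complex_mod J B D \<longleftrightarrow> (\<forall>p. finite (B p)) \<and>
    (\<forall>p w. \<forall>i\<in>B p. mat_vec (B (Suc p)) (D p) (mat_vec (B (Suc (Suc p))) (D (Suc p)) w) i \<in> J)"

text \<open>
  The complex is a resolution over \<open>S/J\<close> of the cyclic module \<open>S/A\<close>, augmented by the basis images \<open>e\<close>.
\<close>

definition resolution_mod ::
  "'a::comm_ring_1 set \<Rightarrow> 'a set \<Rightarrow> (nat \<Rightarrow> 'i set) \<Rightarrow> (nat \<Rightarrow> 'i \<Rightarrow> 'i \<Rightarrow> 'a) \<Rightarrow> ('i \<Rightarrow> 'a) \<Rightarrow> bool" where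
  "resolution_mod J A B D e \<longleftrightarrow> (\<forall>p. finite (B p)) \<and>
    (\<exists>v. (\<Sum>i\<in>B 0. e i * v i) - 1 \<in> A) \<and>
    (\<forall>v. (\<Sum>i\<in>B 0. e i * v i) \<in> A \<longleftrightarrow> boundary_mod J B D 0 v) \<and>
    (\<forall>n v. cycle_mod J B D (Suc n) v \<longleftrightarrow> boundary_mod J B D (Suc n) v)"

text \<open>
  The cycles \<open>v a\<close>, for \<open>a\<close> in \<open>K\<close>, represent a basis of cycles \<open>Z\<close> modulo boundaries \<open>W\<close> over the field \<open>'k\<close>,
  which acts through \<open>\<iota>\<close>.  The coefficient field is separate from the ring, so that the notion applies
  both over the polynomial ring and over the field.
\<close>

definition homology_basis ::
  "('k::zero \<Rightarrow> 'a::comm_ring_1) \<Rightarrow> (('i \<Rightarrow> 'a) \<Rightarrow> bool) \<Rightarrow> (('i \<Rightarrow> 'a) \<Rightarrow> bool) \<Rightarrow> 'l set \<Rightarrow> ('l \<Rightarrow> 'i \<Rightarrow> 'a) \<Rightarrow> bool"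
where
  "homology_basis \<iota> Z W K v \<longleftrightarrow> finite K \<and> (\<forall>a\<in>K. Z (v a)) \<and>
    (\<forall>z. Z z \<longrightarrow> (\<exists>c. W (\<lambda>i. z i - (\<Sum>a\<in>K. \<iota> (c a) * v a i)))) \<and>
    (\<forall>c. W (\<lambda>i. \<Sum>a\<in>K. \<iota> (c a) * v a i) \<longrightarrow> (\<forall>a\<in>K. c a = 0))"

lemma mat_vec_diff: "mat_vec B D (\<lambda>j. v j - w j) i = mat_vec B D v i - mat_vec B D w i"
  by (simp add: mat_vec_def algebra_simps sum_subtractf)

lemma mat_vec_add: "mat_vec B D (\<lambda>j. v j + w j) i = mat_vec B D v i + mat_vec B D w i"
  by (simp add: mat_vec_def algebra_simps sum.distrib)

lemma mat_vec_sum: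
  "mat_vec B D (\<lambda>j. \<Sum>a\<in>K. s a * v a j) i = (\<Sum>a\<in>K. s a * mat_vec B D (v a) i)"
  unfolding mat_vec_def
  by (simp add: sum_distrib_left sum.swap[of _ K] algebra_simps)

lemma mat_vec_mult: "mat_vec B D (\<lambda>j. s * v j) i = s * mat_vec B D v i"
  unfolding mat_vec_def by (simp add: sum_distrib_left algebra_simps)

lemma mat_vec_mem:
  assumes "self.subspace J" "\<And>j. j \<in> B \<Longrightarrow> v j \<in> J"
  shows "mat_vec B D v i \<in> J"
  unfolding mat_vec_def by (intro self.subspace_sum self.subspace_scale assms)

lemma mat_vec_cong: "(\<And>j. j \<in> B \<Longrightarrow> v j = w j) \<Longrightarrow> mat_vec B D v i = mat_vec B D w i"
  by (simp add: mat_vec_def)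

lemma mat_vec_mem_cong:
  assumes "self.subspace J" "\<And>j. j \<in> B \<Longrightarrow> v j - w j \<in> J"
  shows "mat_vec B D v i \<in> J \<longleftrightarrow> mat_vec B D w i \<in> J"
proof -
  have "mat_vec B D v i - mat_vec B D w i \<in> J"
    using mat_vec_mem[OF assms, where D = D and i = i] by (simp add: mat_vec_diff)
  then show ?thesis
    using self.subspace_diff[OF assms(1)] self.subspace_add[OF assms(1)] by (metis add_diff_cancel_left' diff_add_cancel diff_diff_eq2)
qed

text \<open>
  The image of a vector under a differential is a boundary, hence a cycle by exactness.
\<close>

lemma complex_of_resolution:
  assumes "self.subspace J" "resolution_mod J A B D e"
  shows "complex_mod J B D"
proof -
  have "cycle_mod J B D (Suc p) (mat_vec (B (Suc (Suc p))) (D (Suc p)) w)" for p w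
    using assms self.subspace_0[OF assms(1)]
    by (auto simp: resolution_mod_def boundary_mod_def intro!: exI[of _ w])
  then show ?thesis
    using assms by (auto simp: complex_mod_def resolution_mod_def cycle_mod_def)
qed

lemma resolution_ideal_le:
  assumes "self.subspace J" "self.subspace A" "resolution_mod J A B D e"
  shows "J \<subseteq> A"
proof
  fix x assume x: "x \<in> J"
  obtain v where v: "(\<Sum>i\<in>B 0. e i * v i) - 1 \<in> A" using assms by (auto simp: resolution_mod_def)
  have "boundary_mod J B D 0 (\<lambda>i. x * v i)"
    unfolding boundary_mod_def
    by (rule exI[of _ "\<lambda>_. 0"])
      (use self.subspace_scale[OF assms(1) x] in \<open>simp add: mat_vec_def mult.commute[of x]\<close>)
  then have "(\<Sum>i\<in>B 0. e i * (x * v i)) \<in> A" using assms by (auto simp: resolution_mod_def)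
  then have "x * (\<Sum>i\<in>B 0. e i * v i) \<in> A" by (simp add: sum_distrib_left algebra_simps)
  from self.subspace_diff[OF assms(2) this self.subspace_scale[OF assms(2) v, of x]]
  show "x \<in> A" by (simp add: algebra_simps)
qed

subsection \<open>The double complex of a tensor product\<close>

definition grid_zero :: "'a set \<Rightarrow> (nat \<Rightarrow> 'i set) \<Rightarrow> (nat \<Rightarrow> 'j set) \<Rightarrow> nat \<Rightarrow> nat \<Rightarrow> ('i \<Rightarrow> 'j \<Rightarrow> 'a) set" where
  "grid_zero J B C p q = {x. \<forall>i\<in>B p. \<forall>j\<in>C q. x i j \<in> J}"

definition grid_d1 ::
  "(nat \<Rightarrow> 'i set) \<Rightarrow> (nat \<Rightarrow> 'i \<Rightarrow> 'i \<Rightarrow> 'a::comm_ring_1) \<Rightarrow> nat \<Rightarrow> nat \<Rightarrow> ('i \<Rightarrow> 'j \<Rightarrow> 'a) \<Rightarrow> 'i \<Rightarrow> 'j \<Rightarrow> 'a" where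
  "grid_d1 B D p q x = (\<lambda>i j. mat_vec (B (Suc p)) (D p) (\<lambda>i'. x i' j) i)"

definition grid_d2 ::
  "(nat \<Rightarrow> 'j set) \<Rightarrow> (nat \<Rightarrow> 'j \<Rightarrow> 'j \<Rightarrow> 'a::comm_ring_1) \<Rightarrow> nat \<Rightarrow> nat \<Rightarrow> ('i \<Rightarrow> 'j \<Rightarrow> 'a) \<Rightarrow> 'i \<Rightarrow> 'j \<Rightarrow> 'a" where
  "grid_d2 C E p q x = (\<lambda>i j. (-1) ^ p * mat_vec (C (Suc q)) (E q) (x i) j)"

text \<open>
  The sign in \<open>grid_d2\<close> makes the squares anticommute; membership in an ideal ignores it.
\<close>

lemma sign_mem_iff:
  assumes "self.subspace J"
  shows "(-1) ^ p * x \<in> J \<longleftrightarrow> x \<in> J"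
  using self.subspace_neg[OF assms, of x] self.subspace_neg[OF assms, of "- x"]
  by (cases "even p") auto

lemma mat_vec_swap:
  "mat_vec B D (\<lambda>i'. mat_vec C E (x i') j) i = mat_vec C E (\<lambda>j'. mat_vec B D (\<lambda>i'. x i' j') i) j"
  unfolding mat_vec_def
  by (simp add: sum_distrib_left sum.swap[of _ C B] algebra_simps)

lemma grid_double_complex:
  fixes J :: "'a::comm_ring_1 set" and B :: "nat \<Rightarrow> 'i set" and C :: "nat \<Rightarrow> 'j set"
  assumes J: "self.subspace J" and B: "complex_mod J B D" and C: "complex_mod J C E"
  shows "double_complex (grid_zero J B C) (grid_d1 B D) (grid_d2 C E)"
proof
  fix p q and x y :: "'i \<Rightarrow> 'j \<Rightarrow> 'a"
  show "0 \<in> grid_zero J B C p q" using self.subspace_0[OF J] by (simp add: grid_zero_def)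
  show "x \<in> grid_zero J B C p q \<Longrightarrow> y \<in> grid_zero J B C p q \<Longrightarrow> x - y \<in> grid_zero J B C p q" 
    using self.subspace_diff[OF J] by (simp add: grid_zero_def)
  show "grid_d1 B D p q (x - y) = grid_d1 B D p q x - grid_d1 B D p q y"
    by (simp add: grid_d1_def mat_vec_diff fun_eq_iff)
  show "grid_d2 C E p q (x - y) = grid_d2 C E p q x - grid_d2 C E p q y"
    by (simp add: grid_d2_def fun_eq_iff mat_vec_diff algebra_simps fun_diff_def)
  show "x \<in> grid_zero J B C (Suc p) q \<Longrightarrow> grid_d1 B D p q x \<in> grid_zero J B C p q"
    by (auto simp: grid_zero_def grid_d1_def intro: mat_vec_mem[OF J])
  show "x \<in> grid_zero J B C p (Suc q) \<Longrightarrow> grid_d2 C E p q x \<in> grid_zero J B C p q"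
    by (auto simp: grid_zero_def grid_d2_def sign_mem_iff[OF J] intro: mat_vec_mem[OF J])
  show "grid_d1 B D p q (grid_d1 B D (Suc p) q x) \<in> grid_zero J B C p q"
    using B by (simp add: grid_zero_def grid_d1_def complex_mod_def)
  show "grid_d2 C E p q (grid_d2 C E p (Suc q) x) \<in> grid_zero J B C p q"
    using C by (simp add: grid_zero_def grid_d2_def complex_mod_def sign_mem_iff[OF J] mat_vec_mult)
  have "grid_d1 B D p q (grid_d2 C E (Suc p) q x) i j + grid_d2 C E p q (grid_d1 B D p (Suc q) x) i j = 0" for i j
    unfolding grid_d1_def grid_d2_def mat_vec_mult mat_vec_swap[of "B (Suc p)"] by simp
  then show "grid_d1 B D p q (grid_d2 C E (Suc p) q x) + grid_d2 C E p q (grid_d1 B D p (Suc q) x)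
      \<in> grid_zero J B C p q"
    using self.subspace_0[OF J] by (simp add: grid_zero_def)
qed

lemma sum_mult_diff: "(\<Sum>j\<in>B. e j * (v j - w j)) = (\<Sum>j\<in>B. e j * v j) - (\<Sum>j\<in>B. e j * (w j :: 'a::comm_ring_1))"
  by (simp add: algebra_simps sum_subtractf)

text \<open>
  A row of the double complex is a direct sum of copies of the resolution \<open>C\<close> of \<open>S/b\<close>, so it is exact with
  augmentation onto a direct sum of copies of \<open>S/b\<close>; the edge complex is \<open>B\<close> over \<open>S/b\<close>.
\<close>

lemma grid_exact_rows:
  fixes J b :: "'a::comm_ring_1 set" and B :: "nat \<Rightarrow> 'i set" and C :: "nat \<Rightarrow> 'j set"
  assumes J: "self.subspace J" and b: "self.subspace b"
    and B: "complex_mod J B D" and C: "resolution_mod J b C E e'"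
  shows "exact_rows (grid_zero J B C) (grid_d1 B D) (grid_d2 C E)
    (\<lambda>p. {y. \<forall>i\<in>B p. y i \<in> b}) (\<lambda>p x i. \<Sum>j\<in>C 0. e' j * x i j) (\<lambda>p. mat_vec (B (Suc p)) (D p))"
proof (rule exact_rows.intro[OF grid_double_complex[OF J B complex_of_resolution[OF J C]]], unfold_locales)
  fix p q and x y :: "'i \<Rightarrow> 'j \<Rightarrow> 'a" and x' y' :: "'i \<Rightarrow> 'a"
  let ?M = "\<lambda>p. {y. \<forall>i\<in>B p. y i \<in> b}"
  let ?eps = "\<lambda>x i. \<Sum>j\<in>C 0. e' j * x i j"
  show "0 \<in> ?M p" using self.subspace_0[OF b] by simp
  show "x' \<in> ?M p \<Longrightarrow> y' \<in> ?M p \<Longrightarrow> x' - y' \<in> ?M p" using self.subspace_diff[OF b] by simp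
  show "?eps (x - y) = ?eps x - ?eps y" by (simp add: fun_eq_iff sum_mult_diff)
  show "mat_vec (B (Suc p)) (D p) (x' - y') = mat_vec (B (Suc p)) (D p) x' - mat_vec (B (Suc p)) (D p) y'"
    by (simp add: fun_eq_iff mat_vec_diff fun_diff_def)
  show "x' \<in> ?M (Suc p) \<Longrightarrow> mat_vec (B (Suc p)) (D p) x' \<in> ?M p"
    by (auto intro: mat_vec_mem[OF b])
  obtain u where u: "(\<Sum>j\<in>C 0. e' j * u j) - 1 \<in> b" using C by (auto simp: resolution_mod_def)
  have "?eps (\<lambda>i j. y' i * u j) i - y' i \<in> b" for i
    using self.subspace_scale[OF b u, of "y' i"] by (simp add: sum_distrib_left algebra_simps)
  then show "\<exists>x. ?eps x - y' \<in> ?M p" by (intro exI[of _ "\<lambda>i j. y' i * u j"]) simp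
  have "?eps x \<in> ?M p \<longleftrightarrow> (\<forall>i\<in>B p. boundary_mod J C E 0 (x i))"
    using C by (auto simp: resolution_mod_def)
  also have "\<dots> \<longleftrightarrow> (\<exists>y. \<forall>i\<in>B p. \<forall>j\<in>C 0. x i j - mat_vec (C (Suc 0)) (E 0) (y i) j \<in> J)"
    unfolding boundary_mod_def by (rule bchoice_iff)
  also have "\<dots> \<longleftrightarrow> (\<exists>y. \<forall>i\<in>B p. \<forall>j\<in>C 0. x i j - (-1) ^ p * mat_vec (C (Suc 0)) (E 0) (y i) j \<in> J)"
  proof
    assume "\<exists>y. \<forall>i\<in>B p. \<forall>j\<in>C 0. x i j - mat_vec (C (Suc 0)) (E 0) (y i) j \<in> J"
    then obtain y where "\<forall>i\<in>B p. \<forall>j\<in>C 0. x i j - mat_vec (C (Suc 0)) (E 0) (y i) j \<in> J" by blast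
    then show "\<exists>y. \<forall>i\<in>B p. \<forall>j\<in>C 0. x i j - (-1) ^ p * mat_vec (C (Suc 0)) (E 0) (y i) j \<in> J"
      by (intro exI[of _ "\<lambda>i j. (-1) ^ p * y i j"]) (simp add: mat_vec_mult flip: mult.assoc power_add)
  next
    assume "\<exists>y. \<forall>i\<in>B p. \<forall>j\<in>C 0. x i j - (-1) ^ p * mat_vec (C (Suc 0)) (E 0) (y i) j \<in> J"
    then obtain y where "\<forall>i\<in>B p. \<forall>j\<in>C 0. x i j - (-1) ^ p * mat_vec (C (Suc 0)) (E 0) (y i) j \<in> J" by blast
    then show "\<exists>y. \<forall>i\<in>B p. \<forall>j\<in>C 0. x i j - mat_vec (C (Suc 0)) (E 0) (y i) j \<in> J"
      by (intro exI[of _ "\<lambda>i j. (-1) ^ p * y i j"]) (simp add: mat_vec_mult)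
  qed
  finally show "?eps x \<in> ?M p \<longleftrightarrow> (\<exists>y. x - grid_d2 C E p 0 y \<in> grid_zero J B C p 0)"
    by (simp add: grid_zero_def grid_d2_def)
  have "?eps (grid_d1 B D p 0 x) i = mat_vec (B (Suc p)) (D p) (?eps x) i" for i
    unfolding grid_d1_def mat_vec_sum ..
  then show "?eps (grid_d1 B D p 0 x) - mat_vec (B (Suc p)) (D p) (?eps x) \<in> ?M p"
    using self.subspace_0[OF b] by simp
  assume "grid_d2 C E p q x \<in> grid_zero J B C p q"
  then have "\<forall>i\<in>B p. cycle_mod J C E (Suc q) (x i)"
    by (simp add: grid_zero_def grid_d2_def sign_mem_iff[OF J] cycle_mod_def)
  then have "\<forall>i\<in>B p. boundary_mod J C E (Suc q) (x i)"
    using C by (simp add: resolution_mod_def)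
  then obtain y where "\<forall>i\<in>B p. \<forall>j\<in>C (Suc q). x i j - mat_vec (C (Suc (Suc q))) (E (Suc q)) (y i) j \<in> J"
    unfolding boundary_mod_def by metis
  then show "\<exists>y. x - grid_d2 C E p (Suc q) y \<in> grid_zero J B C p (Suc q)"
    by (intro exI[of _ "\<lambda>i j. (-1) ^ p * y i j"])
      (simp add: grid_zero_def grid_d2_def mat_vec_mult flip: mult.assoc power_add)
qed

lemma grid_exact_columns:
  fixes J a :: "'a::comm_ring_1 set" and B :: "nat \<Rightarrow> 'i set" and C :: "nat \<Rightarrow> 'j set"
  assumes J: "self.subspace J" and a: "self.subspace a"
    and B: "resolution_mod J a B D e" and C: "complex_mod J C E"
  shows "exact_rows (\<lambda>q p. grid_zero J B C p q) (\<lambda>q p. grid_d2 C E p q) (\<lambda>q p. grid_d1 B D p q)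
    (\<lambda>q. {y. \<forall>j\<in>C q. y j \<in> a}) (\<lambda>q x j. \<Sum>i\<in>B 0. e i * x i j) (\<lambda>q. mat_vec (C (Suc q)) (E q))"
proof (rule exact_rows.intro[OF double_complex.transpose_double_complex
      [OF grid_double_complex[OF J complex_of_resolution[OF J B] C]]], unfold_locales)
  fix q p and x y :: "'i \<Rightarrow> 'j \<Rightarrow> 'a" and x' y' :: "'j \<Rightarrow> 'a"
  let ?M = "\<lambda>q. {y. \<forall>j\<in>C q. y j \<in> a}"
  let ?eps = "\<lambda>x j. \<Sum>i\<in>B 0. e i * x i j"
  show "0 \<in> ?M q" using self.subspace_0[OF a] by simp
  show "x' \<in> ?M q \<Longrightarrow> y' \<in> ?M q \<Longrightarrow> x' - y' \<in> ?M q" using self.subspace_diff[OF a] by simp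
  show "?eps (x - y) = ?eps x - ?eps y" by (simp add: fun_eq_iff sum_mult_diff)
  show "mat_vec (C (Suc q)) (E q) (x' - y') = mat_vec (C (Suc q)) (E q) x' - mat_vec (C (Suc q)) (E q) y'"
    by (simp add: fun_eq_iff mat_vec_diff fun_diff_def)
  show "x' \<in> ?M (Suc q) \<Longrightarrow> mat_vec (C (Suc q)) (E q) x' \<in> ?M q"
    by (auto intro: mat_vec_mem[OF a])
  obtain u where u: "(\<Sum>j\<in>B 0. e j * u j) - 1 \<in> a" using B by (auto simp: resolution_mod_def)
  have "?eps (\<lambda>i j. y' j * u i) j - y' j \<in> a" for j
    using self.subspace_scale[OF a u, of "y' j"] by (simp add: sum_distrib_left algebra_simps)
  then show "\<exists>x. ?eps x - y' \<in> ?M q" by (intro exI[of _ "\<lambda>i j. y' j * u i"]) simp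
  have "?eps x \<in> ?M q \<longleftrightarrow> (\<forall>j\<in>C q. boundary_mod J B D 0 (\<lambda>i. x i j))"
    using B by (auto simp: resolution_mod_def)
  also have "\<dots> \<longleftrightarrow> (\<exists>y. \<forall>j\<in>C q. \<forall>i\<in>B 0. x i j - mat_vec (B (Suc 0)) (D 0) (y j) i \<in> J)"
    unfolding boundary_mod_def by (rule bchoice_iff)
  also have "\<dots> \<longleftrightarrow> (\<exists>y. \<forall>j\<in>C q. \<forall>i\<in>B 0. x i j - mat_vec (B (Suc 0)) (D 0) (\<lambda>i. y i j) i \<in> J)"
    (is "?l \<longleftrightarrow> ?r")
  proof
    assume ?l then obtain y where "\<forall>j\<in>C q. \<forall>i\<in>B 0. x i j - mat_vec (B (Suc 0)) (D 0) (y j) i \<in> J" by blast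
    then show ?r by (intro exI[of _ "\<lambda>i j. y j i"]) simp
  next
    assume ?r then obtain y where "\<forall>j\<in>C q. \<forall>i\<in>B 0. x i j - mat_vec (B (Suc 0)) (D 0) (\<lambda>i. y i j) i \<in> J" by blast
    then show ?l by (intro exI[of _ "\<lambda>j i. y i j"]) simp
  qed
  finally show "?eps x \<in> ?M q \<longleftrightarrow> (\<exists>y. x - grid_d1 B D 0 q y \<in> grid_zero J B C 0 q)"
    by (simp add: grid_zero_def grid_d1_def) blast
  have "?eps (grid_d2 C E 0 q x) j = mat_vec (C (Suc q)) (E q) (?eps x) j" for j
    unfolding grid_d2_def mat_vec_sum by simp
  then show "?eps (grid_d2 C E 0 q x) - mat_vec (C (Suc q)) (E q) (?eps x) \<in> ?M q"
    using self.subspace_0[OF a] by simp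
  assume "grid_d1 B D p q x \<in> grid_zero J B C p q"
  then have "\<forall>j\<in>C q. cycle_mod J B D (Suc p) (\<lambda>i. x i j)"
    by (simp add: grid_zero_def grid_d1_def cycle_mod_def)
  then have "\<forall>j\<in>C q. boundary_mod J B D (Suc p) (\<lambda>i. x i j)"
    using B by (simp add: resolution_mod_def)
  then obtain y where "\<forall>j\<in>C q. \<forall>i\<in>B (Suc p). x i j - mat_vec (B (Suc (Suc p))) (D (Suc p)) (y j) i \<in> J"
    unfolding boundary_mod_def by metis
  then show "\<exists>y. x - grid_d1 B D (Suc p) q y \<in> grid_zero J B C (Suc p) q"
    by (intro exI[of _ "\<lambda>i j. y j i"]) (simp add: grid_zero_def grid_d1_def)
qed


lemma boundary_mod_cong:
  assumes "self.subspace A" "boundary_mod A B D n v" "\<And>i. i \<in> B n \<Longrightarrow> v i - v' i \<in> A"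
  shows "boundary_mod A B D n v'"
proof -
  obtain w where w: "\<And>i. i \<in> B n \<Longrightarrow> v i - mat_vec (B (Suc n)) (D n) w i \<in> A"
    using assms(2) by (auto simp: boundary_mod_def)
  have "v' i - mat_vec (B (Suc n)) (D n) w i \<in> A" if "i \<in> B n" for i
    using self.subspace_diff[OF assms(1) w assms(3), OF that that] by simp
  then show ?thesis by (auto simp: boundary_mod_def)
qed

lemma boundary_mod_uminus:
  assumes "self.subspace A" "boundary_mod A B D n v"
  shows "boundary_mod A B D n (\<lambda>i. - v i)"
proof -
  obtain w where w: "\<And>i. i \<in> B n \<Longrightarrow> v i - mat_vec (B (Suc n)) (D n) w i \<in> A"
    using assms(2) by (auto simp: boundary_mod_def)
  have "- v i - mat_vec (B (Suc n)) (D n) (\<lambda>j. (-1) * w j) i \<in> A" if "i \<in> B n" for i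
    unfolding mat_vec_mult using self.subspace_neg[OF assms(1) w[OF that]] by simp
  then show ?thesis by (auto simp: boundary_mod_def)
qed

lemma grid_cycle_comb:
  fixes J :: "'a::comm_ring_1 set" and B :: "nat \<Rightarrow> 'i set" and C :: "nat \<Rightarrow> 'j set"
  assumes J: "self.subspace J" and B: "complex_mod J B D" and C: "complex_mod J C E"
    and U: "double_complex.tot_cycle (grid_zero J B C) (grid_d1 B D) (grid_d2 C E) n U"
    and V: "\<And>a. a \<in> K \<Longrightarrow> double_complex.tot_cycle (grid_zero J B C) (grid_d1 B D) (grid_d2 C E) n (V a)"
  shows "double_complex.tot_cycle (grid_zero J B C) (grid_d1 B D) (grid_d2 C E) n
    (\<lambda>p i j. U p i j - (\<Sum>a\<in>K. s a * V a p i j))"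
proof -
  interpret double_complex "grid_zero J B C" "grid_d1 B D" "grid_d2 C E"
    by (rule grid_double_complex[OF J B C])
  have 1: "grid_d1 B D p q (\<lambda>i j. U p' i j - (\<Sum>a\<in>K. s a * V a p' i j)) i j =
      grid_d1 B D p q (U p') i j - (\<Sum>a\<in>K. s a * grid_d1 B D p q (V a p') i j)" for p q p' i j
    by (simp add: grid_d1_def mat_vec_diff mat_vec_sum)
  have 2: "grid_d2 C E p q (\<lambda>i j. U p' i j - (\<Sum>a\<in>K. s a * V a p' i j)) i j =
      grid_d2 C E p q (U p') i j - (\<Sum>a\<in>K. s a * grid_d2 C E p q (V a p') i j)" for p q p' i j
    by (simp add: grid_d2_def mat_vec_diff mat_vec_sum algebra_simps sum_distrib_left)
  show ?thesis
    unfolding tot_cycle_def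
  proof (intro allI impI)
    fix p q assume n: "Suc (p + q) = n"
    have "(grid_d1 B D p q (U (Suc p)) i j + grid_d2 C E p q (U p) i j) -
        (\<Sum>a\<in>K. s a * (grid_d1 B D p q (V a (Suc p)) i j + grid_d2 C E p q (V a p) i j)) \<in> J"
      if "i \<in> B p" "j \<in> C q" for i j
      using U V n that
      by (intro self.subspace_diff[OF J] self.subspace_sum[OF J] self.subspace_scale[OF J])
        (auto simp: tot_cycle_def grid_zero_def)
    then show "grid_d1 B D p q (\<lambda>i j. U (Suc p) i j - (\<Sum>a\<in>K. s a * V a (Suc p) i j)) +
        grid_d2 C E p q (\<lambda>i j. U p i j - (\<Sum>a\<in>K. s a * V a p i j)) \<in> grid_zero J B C p q"
      by (simp add: grid_zero_def 1 2 algebra_simps sum.distrib)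
  qed
qed

text \<open>
  Balancing of Tor: the homology of \<open>F \<otimes> S/b\<close> and that of \<open>G \<otimes> S/a\<close>, for resolutions \<open>F\<close> of \<open>S/a\<close>
  and \<open>G\<close> of \<open>S/b\<close>, are both the homology of the total complex of \<open>F \<otimes> G\<close>, which has exact rows
  and exact columns.  Applied twice, this also shows that the homology of \<open>F \<otimes> S/b\<close> does not depend
  on the resolution \<open>F\<close>.
\<close>

theorem balance_tor:
  fixes J :: "'a::comm_ring_1 set" and B :: "nat \<Rightarrow> 'i set" and C :: "nat \<Rightarrow> 'j set"
  assumes J: "self.subspace J" and a: "self.subspace a" and b: "self.subspace b"
    and B: "resolution_mod J a B D e" and C: "resolution_mod J b C E e'"
    and basis: "homology_basis \<iota> (cycle_mod b B D n) (boundary_mod b B D n) K v"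
  shows "\<exists>v'. homology_basis \<iota> (cycle_mod a C E n) (boundary_mod a C E n) K v'"
proof -
  note BC = complex_of_resolution[OF J B] complex_of_resolution[OF J C]
  interpret R: exact_rows "grid_zero J B C" "grid_d1 B D" "grid_d2 C E"
    "\<lambda>p. {y. \<forall>i\<in>B p. y i \<in> b}" "\<lambda>p x i. \<Sum>j\<in>C 0. e' j * x i j" "\<lambda>p. mat_vec (B (Suc p)) (D p)"
    by (rule grid_exact_rows[OF J b BC(1) C])
  interpret T: exact_rows "\<lambda>q p. grid_zero J B C p q" "\<lambda>q p. grid_d2 C E p q" "\<lambda>q p. grid_d1 B D p q"
    "\<lambda>q. {y. \<forall>j\<in>C q. y j \<in> a}" "\<lambda>q x j. \<Sum>i\<in>B 0. e i * x i j" "\<lambda>q. mat_vec (C (Suc q)) (E q)"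
    by (rule grid_exact_columns[OF J a B BC(2)])
  have Rc: "R.edge_cycle n y \<longleftrightarrow> cycle_mod b B D n y"
    and Rb: "R.edge_boundary n y \<longleftrightarrow> boundary_mod b B D n y" for y
    by (auto simp: R.edge_cycle_def R.edge_boundary_def cycle_mod_def boundary_mod_def)
  have Tc: "T.edge_cycle n y \<longleftrightarrow> cycle_mod a C E n y"
    and Tb: "T.edge_boundary n y \<longleftrightarrow> boundary_mod a C E n y" for y
    by (auto simp: T.edge_cycle_def T.edge_boundary_def cycle_mod_def boundary_mod_def)
  \<comment> \<open>The transposed double complex numbers the components by the other degree, hence \<open>n - p\<close>.\<close>
  have flip_cycle: "R.tot_cycle n (\<lambda>p. U (n - p)) \<longleftrightarrow> T.tot_cycle n U" for U
    unfolding R.tot_cycle_def T.tot_cycle_def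
  proof (intro iffI allI impI)
    fix q p assume H: "\<forall>p q. Suc (p + q) = n \<longrightarrow>
          grid_d1 B D p q (U (n - Suc p)) + grid_d2 C E p q (U (n - p)) \<in> grid_zero J B C p q"
      and n: "Suc (q + p) = n"
    have "n - Suc p = q" "n - p = Suc q" using n by auto
    with H n show "grid_d2 C E p q (U (Suc q)) + grid_d1 B D p q (U q) \<in> grid_zero J B C p q"
      by (metis add.commute)
  next
    fix p q assume H: "\<forall>p q. Suc (p + q) = n \<longrightarrow>
          grid_d2 C E q p (U (Suc p)) + grid_d1 B D q p (U p) \<in> grid_zero J B C q p"
      and n: "Suc (p + q) = n"
    have "n - Suc p = q" "n - p = Suc q" using n by auto
    with H n show "grid_d1 B D p q (U (n - Suc p)) + grid_d2 C E p q (U (n - p)) \<in> grid_zero J B C p q"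
      by (metis add.commute)
  qed
  have flip_boundary: "T.tot_boundary n U" if R: "R.tot_boundary n (\<lambda>p. U (n - p))" for U
  proof -
    obtain Y where Y: "\<And>p q. p + q = n \<Longrightarrow>
        U (n - p) - (grid_d1 B D p q (Y (Suc p)) + grid_d2 C E p q (Y p)) \<in> grid_zero J B C p q"
      using R unfolding R.tot_boundary_def by blast
    show ?thesis
      unfolding T.tot_boundary_def
    proof (intro exI[of _ "\<lambda>q. Y (Suc n - q)"] allI impI)
      fix q p assume n: "q + p = n"
      have "n - p = q" "Suc n - q = Suc p" "Suc n - Suc q = p" using n by auto
      with Y[of p q] n show "U q - (grid_d2 C E p q (Y (Suc n - Suc q)) + grid_d1 B D p q (Y (Suc n - q)))
          \<in> grid_zero J B C p q"
        by (simp add: add.commute)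
    qed
  qed
  have flip_boundary': "R.tot_boundary n U" if T: "T.tot_boundary n (\<lambda>q. U (n - q))" for U
  proof -
    obtain Y where Y: "\<And>q p. q + p = n \<Longrightarrow>
        U (n - q) - (grid_d2 C E p q (Y (Suc q)) + grid_d1 B D p q (Y q)) \<in> grid_zero J B C p q"
      using T unfolding T.tot_boundary_def by blast
    show ?thesis
      unfolding R.tot_boundary_def
    proof (intro exI[of _ "\<lambda>p. Y (Suc n - p)"] allI impI)
      fix p q assume n: "p + q = n"
      have "n - q = p" "Suc n - p = Suc q" "Suc n - Suc p = q" using n by auto
      with Y[of q p] n show "U p - (grid_d1 B D p q (Y (Suc n - Suc p)) + grid_d2 C E p q (Y (Suc n - p)))
          \<in> grid_zero J B C p q"
        by (simp add: add.commute)
    qed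
  qed
  have flip_cycle': "T.tot_cycle n (\<lambda>q. U (n - q))" if U: "R.tot_cycle n U" for U
  proof -
    have "R.tot_cycle n (\<lambda>p. U (n - (n - p)))"
      unfolding R.tot_cycle_def
    proof (intro allI impI)
      fix p q assume n: "Suc (p + q) = n"
      have "n - (n - Suc p) = Suc p" "n - (n - p) = p" using n by auto
      then show "grid_d1 B D p q (U (n - (n - Suc p))) + grid_d2 C E p q (U (n - (n - p))) \<in> grid_zero J B C p q"
        using U n by (simp add: R.tot_cycle_def)
    qed
    then show ?thesis using flip_cycle[of "\<lambda>q. U (n - q)"] by blast
  qed
  let ?r = "\<lambda>U i. \<Sum>j\<in>C 0. e' j * U n i j" and ?t = "\<lambda>U j. \<Sum>i\<in>B 0. e i * U (0::nat) i j"
  let ?comb = "\<lambda>U V c p i j. U p i j - (\<Sum>k\<in>K. \<iota> (c k) * V k p i j)"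
  have fin: "finite K" using basis by (simp add: homology_basis_def)
  have r_comb: "?r (?comb U V c) i = ?r U i - (\<Sum>k\<in>K. \<iota> (c k) * ?r (V k) i)" for U V c i
    by (simp add: algebra_simps sum_subtractf sum_distrib_left sum.swap[of _ K "C 0"])
  have t_comb: "?t (?comb U V c) j = ?t U j - (\<Sum>k\<in>K. \<iota> (c k) * ?t (V k) j)" for U V c j
    by (simp add: algebra_simps sum_subtractf sum_distrib_left sum.swap[of _ K "B 0"])
  \<comment> \<open>On cycles of the total complex, being a boundary can be tested at either edge.\<close>
  have edge: "boundary_mod b B D n (?r U) \<longleftrightarrow> boundary_mod a C E n (?t U)" if U: "R.tot_cycle n U" for U
  proof -
    have U': "T.tot_cycle n (\<lambda>q. U (n - q))"
      by (rule flip_cycle'[OF U])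
    have "boundary_mod b B D n (?r U) \<longleftrightarrow> R.tot_boundary n U"
      using R.tot_boundary_lift[OF U] R.edge_boundary_of_tot_boundary Rb by blast
    also have "\<dots> \<longleftrightarrow> T.tot_boundary n (\<lambda>q. U (n - q))"
    proof
      assume "R.tot_boundary n U"
      then have "R.tot_boundary n (\<lambda>p. U (n - (n - p)))"
        unfolding R.tot_boundary_def by (metis diff_diff_cancel le_add1)
      then show "T.tot_boundary n (\<lambda>q. U (n - q))" by (rule flip_boundary)
    qed (rule flip_boundary')
    also have "\<dots> \<longleftrightarrow> boundary_mod a C E n (?t U)"
      using T.tot_boundary_lift[OF U'] T.edge_boundary_of_tot_boundary[of n "\<lambda>q. U (n - q)"]
      by (auto simp: Tb)
    finally show ?thesis .
  qed
  \<comment> \<open>Lift the basis to the total complex along one edge; the new basis is its image at the other.\<close>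
  have "\<forall>k\<in>K. \<exists>V. R.tot_cycle n V \<and> (\<forall>i\<in>B n. ?r V i - v k i \<in> b)"
  proof
    fix k assume "k \<in> K"
    then have "R.edge_cycle n (v k)" using basis by (simp add: homology_basis_def Rc)
    from R.tot_cycle_lift[OF this] show "\<exists>V. R.tot_cycle n V \<and> (\<forall>i\<in>B n. ?r V i - v k i \<in> b)"
      by simp
  qed
  then obtain V where V: "\<And>k. k \<in> K \<Longrightarrow> R.tot_cycle n (V k)"
    and Vv: "\<And>k i. k \<in> K \<Longrightarrow> i \<in> B n \<Longrightarrow> ?r (V k) i - v k i \<in> b"
    by metis
  have comb: "R.tot_cycle n (?comb U V c)" if "R.tot_cycle n U" for U c
    by (rule grid_cycle_comb[OF J BC that V])
  show ?thesis
    unfolding homology_basis_def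
  proof (intro exI[of _ "\<lambda>k. ?t (V k)"] conjI ballI allI impI fin)
    fix k assume k: "k \<in> K"
    have "T.tot_cycle n (\<lambda>q. V k (n - q))"
      by (rule flip_cycle'[OF V[OF k]])
    from T.edge_cycle_of_tot_cycle[OF this] show "cycle_mod a C E n (?t (V k))" by (simp add: Tc)
  next
    fix z assume "cycle_mod a C E n z"
    then obtain U where U: "T.tot_cycle n U" "\<And>j. j \<in> C n \<Longrightarrow> (\<Sum>i\<in>B 0. e i * U n i j) - z j \<in> a"
      using T.tot_cycle_lift[of n z] by (auto simp: Tc)
    define U' where "U' = (\<lambda>p. U (n - p))"
    have U': "R.tot_cycle n U'" using U(1) by (simp add: U'_def flip_cycle)
    from R.edge_cycle_of_tot_cycle[OF this] have "cycle_mod b B D n (?r U')" by (simp add: Rc)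
    then obtain c where c: "boundary_mod b B D n (\<lambda>i. ?r U' i - (\<Sum>k\<in>K. \<iota> (c k) * v k i))"
      using basis unfolding homology_basis_def by blast
    have "boundary_mod b B D n (?r (?comb U' V c))"
    proof (rule boundary_mod_cong[OF b c])
      fix i assume "i \<in> B n"
      then have "(\<Sum>k\<in>K. \<iota> (c k) * (?r (V k) i - v k i)) \<in> b"
        by (intro self.subspace_sum[OF b] self.subspace_scale[OF b] Vv) auto
      then show "?r U' i - (\<Sum>k\<in>K. \<iota> (c k) * v k i) - ?r (?comb U' V c) i \<in> b"
        unfolding r_comb by (simp add: right_diff_distrib sum_subtractf)
    qed
    then have "boundary_mod a C E n (?t (?comb U' V c))" using edge[OF comb[OF U']] by blast
    then have "boundary_mod a C E n (\<lambda>j. z j - (\<Sum>k\<in>K. \<iota> (c k) * ?t (V k) j))"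
    proof (rule boundary_mod_cong[OF a])
      fix j assume "j \<in> C n"
      then show "?t (?comb U' V c) j - (z j - (\<Sum>k\<in>K. \<iota> (c k) * ?t (V k) j)) \<in> a"
        unfolding t_comb using U(2) by (simp add: U'_def)
    qed
    then show "\<exists>c. boundary_mod a C E n (\<lambda>j. z j - (\<Sum>k\<in>K. \<iota> (c k) * ?t (V k) j))" by blast
  next
    fix c k assume t: "boundary_mod a C E n (\<lambda>j. \<Sum>k\<in>K. \<iota> (c k) * ?t (V k) j)" and k: "k \<in> K"
    let ?U = "?comb (\<lambda>_ _ _. 0) V c"
    have 0: "R.tot_cycle n (\<lambda>_ _ _. 0)"
      unfolding R.tot_cycle_def using R.N_zero by (simp add: grid_d1_def grid_d2_def mat_vec_def zero_fun_def[symmetric])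
    have "boundary_mod a C E n (?t ?U)"
      using boundary_mod_uminus[OF a t] by (subst t_comb) simp
    then have "boundary_mod b B D n (?r ?U)" using edge[OF comb[OF 0]] by blast
    then have "boundary_mod b B D n (\<lambda>i. - (\<Sum>k\<in>K. \<iota> (c k) * v k i))"
    proof (rule boundary_mod_cong[OF b])
      fix i assume "i \<in> B n"
      then have "(\<Sum>k\<in>K. \<iota> (c k) * (?r (V k) i - v k i)) \<in> b"
        by (intro self.subspace_sum[OF b] self.subspace_scale[OF b] Vv) auto
      from self.subspace_neg[OF b this]
      show "?r ?U i - - (\<Sum>k\<in>K. \<iota> (c k) * v k i) \<in> b"
        using r_comb[of "\<lambda>_ _ _. 0" i c V] by (simp only:) (simp add: right_diff_distrib sum_subtractf)
    qed
    from boundary_mod_uminus[OF b this] have "boundary_mod b B D n (\<lambda>i. \<Sum>k\<in>K. \<iota> (c k) * v k i)" by simp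
    then show "c k = 0" using basis k unfolding homology_basis_def by blast
  qed
qed

text \<open>
  Basis and matrix of the total complex; an index \<open>(p, i, j)\<close> records the first degree \<open>p\<close>.
\<close>

definition tot_index :: "(nat \<Rightarrow> 'i set) \<Rightarrow> (nat \<Rightarrow> 'j set) \<Rightarrow> nat \<Rightarrow> (nat \<times> 'i \<times> 'j) set" where
  "tot_index B C n = (SIGMA p:{..n}. B p \<times> C (n - p))"

definition tot_mat ::
  "(nat \<Rightarrow> 'i \<Rightarrow> 'i \<Rightarrow> 'a::comm_ring_1) \<Rightarrow> (nat \<Rightarrow> 'j \<Rightarrow> 'j \<Rightarrow> 'a) \<Rightarrow>
    nat \<Rightarrow> nat \<times> 'i \<times> 'j \<Rightarrow> nat \<times> 'i \<times> 'j \<Rightarrow> 'a" where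
  "tot_mat D E n = (\<lambda>(p, i, j) (p', i', j').
    (if p' = Suc p \<and> j' = j then D p i i' else 0) +
    (if p' = p \<and> i' = i then (-1) ^ p * E (n - p) j j' else 0))"

lemma all_antidiagonal: "(\<forall>p\<le>n. P p (n - p)) \<longleftrightarrow> (\<forall>p q. p + q = n \<longrightarrow> P p q)" for n :: nat
  by (metis add_diff_cancel_left' le_add1 le_add_diff_inverse)

lemma finite_tot_index:
  "(\<And>p. finite (B p)) \<Longrightarrow> (\<And>q. finite (C q)) \<Longrightarrow> finite (tot_index B C n)"
  by (auto simp: tot_index_def)

lemma card_tot_index:
  assumes "\<And>p. finite (B p)" "\<And>q. finite (C q)"
  shows "card (tot_index B C n) = (\<Sum>p\<le>n. card (B p) * card (C (n - p)))"
  unfolding tot_index_def by (subst card_SigmaI) (auto simp: assms card_cartesian_product)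

lemma sum_tot_index:
  assumes "\<And>p. finite (B p)" "\<And>q. finite (C q)"
  shows "(\<Sum>x\<in>tot_index B C n. f x) = (\<Sum>p\<le>n. \<Sum>i\<in>B p. \<Sum>j\<in>C (n - p). f (p, i, j))"
  unfolding tot_index_def
  by (simp add: sum.Sigma sum.cartesian_product assms split_def)

lemma mat_vec_tot:
  fixes B :: "nat \<Rightarrow> 'i set" and C :: "nat \<Rightarrow> 'j set"
  assumes fin: "\<And>p. finite (B p)" "\<And>q. finite (C q)" and p: "p \<le> n" "i \<in> B p" "j \<in> C (n - p)"
  shows "mat_vec (tot_index B C (Suc n)) (tot_mat D E n) v (p, i, j) =
    grid_d1 B D p (n - p) (\<lambda>i j. v (Suc p, i, j)) i j + grid_d2 C E p (n - p) (\<lambda>i j. v (p, i, j)) i j"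
proof -
  let ?f = "\<lambda>p' i' j'. if p' = Suc p \<and> j' = j then D p i i' * v (p', i', j') else 0"
  let ?g = "\<lambda>p' i' j'. if p' = p \<and> i' = i then (-1) ^ p * E (n - p) j j' * v (p', i', j') else 0"
  have "mat_vec (tot_index B C (Suc n)) (tot_mat D E n) v (p, i, j) =
      (\<Sum>p'\<le>Suc n. \<Sum>i'\<in>B p'. \<Sum>j'\<in>C (Suc n - p'). ?f p' i' j' + ?g p' i' j')"
    unfolding mat_vec_def sum_tot_index[of B C, OF fin]
    by (intro sum.cong refl) (auto simp: tot_mat_def algebra_simps)
  also have "\<dots> = (\<Sum>p'\<le>Suc n. \<Sum>i'\<in>B p'. \<Sum>j'\<in>C (Suc n - p'). ?f p' i' j') +
      (\<Sum>p'\<le>Suc n. \<Sum>i'\<in>B p'. \<Sum>j'\<in>C (Suc n - p'). ?g p' i' j')"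
    by (simp only: sum.distrib)
  also have "(\<Sum>p'\<le>Suc n. \<Sum>i'\<in>B p'. \<Sum>j'\<in>C (Suc n - p'). ?f p' i' j') =
      (\<Sum>p'\<le>Suc n. if p' = Suc p then \<Sum>i'\<in>B p'. D p i i' * v (p', i', j) else 0)"
    using p by (intro sum.cong refl) (auto simp: sum.delta fin Suc_diff_le)
  also have "\<dots> = grid_d1 B D p (n - p) (\<lambda>i j. v (Suc p, i, j)) i j"
    using p by (simp add: sum.delta grid_d1_def mat_vec_def)
  also have "(\<Sum>p'\<le>Suc n. \<Sum>i'\<in>B p'. \<Sum>j'\<in>C (Suc n - p'). ?g p' i' j') =
      (\<Sum>p'\<le>Suc n. if p' = p then \<Sum>j'\<in>C (Suc n - p). (-1) ^ p * E (n - p) j j' * v (p, i, j') else 0)"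
  proof (intro sum.cong refl)
    fix p'
    show "(\<Sum>i'\<in>B p'. \<Sum>j'\<in>C (Suc n - p'). ?g p' i' j') =
        (if p' = p then \<Sum>j'\<in>C (Suc n - p). (-1) ^ p * E (n - p) j j' * v (p, i, j') else 0)"
    proof (cases "p' = p")
      case True
      then have "(\<Sum>i'\<in>B p'. \<Sum>j'\<in>C (Suc n - p'). ?g p' i' j') =
          (\<Sum>i'\<in>B p. if i' = i then \<Sum>j'\<in>C (Suc n - p). (-1) ^ p * E (n - p) j j' * v (p, i, j') else 0)"
        by (intro sum.cong) auto
      then show ?thesis using True p by (simp add: sum.delta fin)
    qed simp
  qed
  also have "\<dots> = grid_d2 C E p (n - p) (\<lambda>i j. v (p, i, j)) i j"
    using p by (simp add: sum.delta grid_d2_def mat_vec_def Suc_diff_le sum_distrib_left mult.assoc)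
  finally show ?thesis .
qed

lemma cycle_tot:
  fixes B :: "nat \<Rightarrow> 'i set" and C :: "nat \<Rightarrow> 'j set"
  assumes J: "self.subspace J" and B: "complex_mod J B D" and C: "complex_mod J C E"
  shows "cycle_mod J (tot_index B C) (tot_mat D E) n v \<longleftrightarrow>
    double_complex.tot_cycle (grid_zero J B C) (grid_d1 B D) (grid_d2 C E) n (\<lambda>p i j. v (p, i, j))"
proof -
  interpret double_complex "grid_zero J B C" "grid_d1 B D" "grid_d2 C E"
    by (rule grid_double_complex[OF J B C])
  have fin: "finite (B p)" "finite (C p)" for p using B C by (auto simp: complex_mod_def)
  show ?thesis
  proof (cases n)
    case (Suc m)
    have "cycle_mod J (tot_index B C) (tot_mat D E) n v \<longleftrightarrow>
        (\<forall>p\<le>m. \<forall>i\<in>B p. \<forall>j\<in>C (m - p).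
          mat_vec (tot_index B C (Suc m)) (tot_mat D E m) v (p, i, j) \<in> J)"
      by (auto simp: cycle_mod_def Suc tot_index_def)
    also have "\<dots> \<longleftrightarrow> (\<forall>p\<le>m. \<forall>i\<in>B p. \<forall>j\<in>C (m - p). grid_d1 B D p (m - p) (\<lambda>i j. v (Suc p, i, j)) i j +
        grid_d2 C E p (m - p) (\<lambda>i j. v (p, i, j)) i j \<in> J)"
      by (simp add: mat_vec_tot[of B C, OF fin] cong: ball_cong_simp imp_cong)
    also have "\<dots> \<longleftrightarrow> tot_cycle n (\<lambda>p i j. v (p, i, j))"
      using all_antidiagonal[of m "\<lambda>p q. \<forall>i\<in>B p. \<forall>j\<in>C q. grid_d1 B D p q (\<lambda>i j. v (Suc p, i, j)) i j +
        grid_d2 C E p q (\<lambda>i j. v (p, i, j)) i j \<in> J"]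
      by (simp add: tot_cycle_def grid_zero_def Suc)
    finally show ?thesis .
  qed (auto simp: cycle_mod_def tot_cycle_def)
qed

lemma boundary_tot:
  fixes B :: "nat \<Rightarrow> 'i set" and C :: "nat \<Rightarrow> 'j set"
  assumes J: "self.subspace J" and B: "complex_mod J B D" and C: "complex_mod J C E"
  shows "boundary_mod J (tot_index B C) (tot_mat D E) n v \<longleftrightarrow>
    double_complex.tot_boundary (grid_zero J B C) (grid_d1 B D) (grid_d2 C E) n (\<lambda>p i j. v (p, i, j))"
proof -
  interpret double_complex "grid_zero J B C" "grid_d1 B D" "grid_d2 C E"
    by (rule grid_double_complex[OF J B C])
  have fin: "finite (B p)" "finite (C p)" for p using B C by (auto simp: complex_mod_def)
  have "(\<forall>x\<in>tot_index B C n. v x - mat_vec (tot_index B C (Suc n)) (tot_mat D E n) w x \<in> J) \<longleftrightarrow>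
      (\<forall>p q. p + q = n \<longrightarrow> (\<lambda>i j. v (p, i, j)) -
        (grid_d1 B D p q (\<lambda>i j. w (Suc p, i, j)) + grid_d2 C E p q (\<lambda>i j. w (p, i, j))) \<in> grid_zero J B C p q)"
    (is "?l w \<longleftrightarrow> ?r w") for w
  proof -
    have "?l w \<longleftrightarrow> (\<forall>p\<le>n. \<forall>i\<in>B p. \<forall>j\<in>C (n - p).
          v (p, i, j) - mat_vec (tot_index B C (Suc n)) (tot_mat D E n) w (p, i, j) \<in> J)"
      by (auto simp: tot_index_def)
    also have "\<dots> \<longleftrightarrow> (\<forall>p\<le>n. \<forall>i\<in>B p. \<forall>j\<in>C (n - p). v (p, i, j) -
        (grid_d1 B D p (n - p) (\<lambda>i j. w (Suc p, i, j)) i j +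
        grid_d2 C E p (n - p) (\<lambda>i j. w (p, i, j)) i j) \<in> J)"
      by (simp add: mat_vec_tot[of B C, OF fin] cong: ball_cong_simp imp_cong)
    also have "\<dots> \<longleftrightarrow> ?r w"
      using all_antidiagonal[of n "\<lambda>p q. \<forall>i\<in>B p. \<forall>j\<in>C q. v (p, i, j) -
        (grid_d1 B D p q (\<lambda>i j. w (Suc p, i, j)) i j + grid_d2 C E p q (\<lambda>i j. w (p, i, j)) i j) \<in> J"]
      by (simp add: grid_zero_def)
    finally show ?thesis .
  qed
  note * = this
  show ?thesis
    unfolding boundary_mod_def tot_boundary_def *
  proof
    assume "\<exists>Y. \<forall>p q. p + q = n \<longrightarrow> (\<lambda>i j. v (p, i, j)) -
        (grid_d1 B D p q (Y (Suc p)) + grid_d2 C E p q (Y p)) \<in> grid_zero J B C p q"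
    then obtain Y where "\<forall>p q. p + q = n \<longrightarrow> (\<lambda>i j. v (p, i, j)) -
        (grid_d1 B D p q (Y (Suc p)) + grid_d2 C E p q (Y p)) \<in> grid_zero J B C p q" by blast
    then show "\<exists>w. ?r w" by (intro exI[of _ "\<lambda>(p, i, j). Y p i j"]) (simp add: grid_zero_def)
  next
    assume "\<exists>w. ?r w"
    then obtain w where "?r w" by blast
    then show "\<exists>Y. \<forall>p q. p + q = n \<longrightarrow> (\<lambda>i j. v (p, i, j)) -
        (grid_d1 B D p q (Y (Suc p)) + grid_d2 C E p q (Y p)) \<in> grid_zero J B C p q"
      by (intro exI[of _ "\<lambda>p i j. w (p, i, j)"])
  qed
qed

text \<open>
  The double complex has exact rows, so its homology is that of the edge complex, which is \<open>B\<close> over \<open>S/b\<close>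
  and therefore a resolution of \<open>S/c\<close>.
\<close>

theorem resolution_tot:
  fixes J b c :: "'a::comm_ring_1 set" and B :: "nat \<Rightarrow> 'i set" and C :: "nat \<Rightarrow> 'j set"
  assumes J: "self.subspace J" and b: "self.subspace b" and c: "self.subspace c"
    and Bc: "complex_mod J B D" and B: "resolution_mod b c B D e" and C: "resolution_mod J b C E e'"
  shows "resolution_mod J c (tot_index B C) (tot_mat D E) (\<lambda>(p, i, j). e i * e' j)"
  unfolding resolution_mod_def
proof (intro conjI allI)
  note Cc = complex_of_resolution[OF J C]
  interpret R: exact_rows "grid_zero J B C" "grid_d1 B D" "grid_d2 C E"
    "\<lambda>p. {y. \<forall>i\<in>B p. y i \<in> b}" "\<lambda>p x i. \<Sum>j\<in>C 0. e' j * x i j" "\<lambda>p. mat_vec (B (Suc p)) (D p)"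
    by (rule grid_exact_rows[OF J b Bc C])
  have Rc: "R.edge_cycle n y \<longleftrightarrow> cycle_mod b B D n y"
    and Rb: "R.edge_boundary n y \<longleftrightarrow> boundary_mod b B D n y" for n y
    by (auto simp: R.edge_cycle_def R.edge_boundary_def cycle_mod_def boundary_mod_def)
  have fin: "finite (B p)" "finite (C p)" for p using Bc Cc by (auto simp: complex_mod_def)
  show "finite (tot_index B C p)" for p by (rule finite_tot_index[OF fin])
  have sum0: "(\<Sum>x\<in>tot_index B C 0. (case x of (p, i, j) \<Rightarrow> e i * e' j) * v x) =
      (\<Sum>i\<in>B 0. e i * (\<Sum>j\<in>C 0. e' j * v (0, i, j)))" for v
    unfolding sum_tot_index[of B C, OF fin] by (simp add: sum_distrib_left mult.assoc)
  show "\<exists>v. (\<Sum>x\<in>tot_index B C 0. (case x of (p, i, j) \<Rightarrow> e i * e' j) * v x) - 1 \<in> c"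
  proof -
    obtain u where u: "(\<Sum>i\<in>B 0. e i * u i) - 1 \<in> c" using B by (auto simp: resolution_mod_def)
    obtain w where "(\<Sum>j\<in>C 0. e' j * w j) - 1 \<in> b" using C by (auto simp: resolution_mod_def)
    then have w: "(\<Sum>j\<in>C 0. e' j * w j) - 1 \<in> c" using resolution_ideal_le[OF b c B] by blast
    have "(\<Sum>i\<in>B 0. e i * (\<Sum>j\<in>C 0. e' j * (u i * w j))) =
        (\<Sum>i\<in>B 0. e i * u i) * (\<Sum>j\<in>C 0. e' j * w j)"
      by (simp add: sum_distrib_left sum_distrib_right mult.assoc mult.left_commute sum.swap[of _ "C 0"])
    moreover have "x * y - 1 \<in> c" if "x - 1 \<in> c" "y - 1 \<in> c" for x y
      using self.subspace_add[OF c self.subspace_scale[OF c that(2), of x] that(1)]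
      by (simp add: algebra_simps)
    ultimately show ?thesis
      using u w unfolding sum0 by (intro exI[of _ "\<lambda>(p, i, j). u i * w j"]) simp
  qed
  fix v :: "nat \<times> 'i \<times> 'j \<Rightarrow> 'a"
  let ?y = "\<lambda>p i. \<Sum>j\<in>C 0. e' j * v (p, i, j)"
  have "boundary_mod b B D n (?y n) \<longleftrightarrow> boundary_mod J (tot_index B C) (tot_mat D E) n v"
    if "cycle_mod J (tot_index B C) (tot_mat D E) n v" for n
    using that R.edge_boundary_of_tot_boundary[of n "\<lambda>p i j. v (p, i, j)"]
      R.tot_boundary_lift[of n "\<lambda>p i j. v (p, i, j)"]
    unfolding Rb cycle_tot[OF J Bc Cc] boundary_tot[OF J Bc Cc] by blast
  note edge = this
  show "(\<Sum>x\<in>tot_index B C 0. (case x of (p, i, j) \<Rightarrow> e i * e' j) * v x) \<in> c \<longleftrightarrow>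
      boundary_mod J (tot_index B C) (tot_mat D E) 0 v"
    unfolding sum0 using B edge[of 0] by (simp add: resolution_mod_def cycle_mod_def)
  fix n
  show "cycle_mod J (tot_index B C) (tot_mat D E) (Suc n) v \<longleftrightarrow>
      boundary_mod J (tot_index B C) (tot_mat D E) (Suc n) v"
  proof
    assume cyc: "cycle_mod J (tot_index B C) (tot_mat D E) (Suc n) v"
    then have "R.edge_cycle (Suc n) (?y (Suc n))"
      using R.edge_cycle_of_tot_cycle[of "Suc n" "\<lambda>p i j. v (p, i, j)"] by (simp add: cycle_tot[OF J Bc Cc])
    then have "boundary_mod b B D (Suc n) (?y (Suc n))"
      using B unfolding Rc by (simp add: resolution_mod_def)
    then show "boundary_mod J (tot_index B C) (tot_mat D E) (Suc n) v" using edge[OF cyc] by blast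
  next
    assume "boundary_mod J (tot_index B C) (tot_mat D E) (Suc n) v"
    then show "cycle_mod J (tot_index B C) (tot_mat D E) (Suc n) v"
      unfolding cycle_tot[OF J Bc Cc] boundary_tot[OF J Bc Cc] by (rule R.tot_cycle_of_boundary)
  qed
qed


section \<open>Complexes of vector spaces\<close>

interpretation fn: vector_space "\<lambda>(c::'k::field) (v::'i \<Rightarrow> 'k) i. c * v i"
  by unfold_locales (auto simp: fun_eq_iff algebra_simps)

declare fn.scale_scale [simp del]

lemma fn_sum_apply: "(\<Sum>a\<in>K. f a) i = (\<Sum>a\<in>K. f a i)"
  by (induction K rule: infinite_finite_induct) auto

abbreviation unit_vec :: "'i \<Rightarrow> 'i \<Rightarrow> 'k::field" where
  "unit_vec k \<equiv> (\<lambda>i. if i = k then 1 else 0)"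

lemma sum_mult_unit_vec:
  assumes "finite A"
  shows "(\<Sum>k\<in>A. x k * unit_vec k i) = (if i \<in> A then x i else 0)"
proof -
  have "(\<Sum>k\<in>A. x k * unit_vec k i) = (\<Sum>k\<in>A. if i = k then x k else 0)"
    by (intro sum.cong) auto
  then show ?thesis using assms by simp
qed

text \<open>
  A matrix \<open>S\<close> with \<open>D S D = D\<close>; it exists because a linear map between vector spaces has a right inverse
  on its range.
\<close>

lemma generalized_inverse:
  fixes D :: "'i \<Rightarrow> 'j \<Rightarrow> 'k::field"
  assumes A: "finite A" and B: "finite B"
  shows "\<exists>S. \<forall>v. \<forall>i\<in>A. mat_vec B D (mat_vec A S (mat_vec B D v)) i = mat_vec B D v i"
proof -
  define f where "f v = (\<lambda>i. if i \<in> A then mat_vec B D v i else 0)" for v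
  let ?s1 = "\<lambda>(c::'k) (v::'j \<Rightarrow> 'k) i. c * v i" and ?s2 = "\<lambda>(c::'k) (v::'i \<Rightarrow> 'k) i. c * v i"
  have f: "Vector_Spaces.linear ?s1 ?s2 f"
    by unfold_locales
      (auto simp: f_def fun_eq_iff mat_vec_def algebra_simps sum.distrib sum_distrib_left)
  obtain g where g: "Vector_Spaces.linear ?s2 ?s1 g" and fg: "\<And>v. f (g (f v)) = f v"
    using vector_space_pair.linear_exists_right_inverse_on[OF vector_space_pair.intro
        [OF fn.vector_space_axioms fn.vector_space_axioms] f fn.subspace_UNIV] by auto
  interpret g: Vector_Spaces.linear ?s2 ?s1 g by fact
  have "mat_vec B D (mat_vec A (\<lambda>j i. g (unit_vec i) j) (mat_vec B D v)) i = mat_vec B D v i"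
    if i: "i \<in> A" for v i
  proof -
    define y where "y = f v"
    have "y = (\<Sum>i\<in>A. (\<lambda>i'. y i * unit_vec i i'))"
      by (rule ext, unfold fn_sum_apply sum_mult_unit_vec[OF A]) (simp add: y_def f_def)
    moreover have "g (\<Sum>i\<in>A. (\<lambda>i'. y i * unit_vec i i')) = (\<Sum>i\<in>A. (\<lambda>j. y i * g (unit_vec i) j))"
      by (simp only: g.sum g.scale)
    ultimately have "g (f v) = (\<Sum>i\<in>A. (\<lambda>j. f v i * g (unit_vec i) j))"
      by (simp only: y_def)
    then have "g (f v) j = (\<Sum>i\<in>A. f v i * g (unit_vec i) j)" for j
      by (simp only: fn_sum_apply)
    then have "g (f v) j = mat_vec A (\<lambda>j i. g (unit_vec i) j) (mat_vec B D v) j" for j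
      unfolding mat_vec_def[of A] by (simp only:) (intro sum.cong refl, simp add: f_def mult.commute)
    then have *: "g (f v) = mat_vec A (\<lambda>j i. g (unit_vec i) j) (mat_vec B D v)" by (rule ext)
    have f_eq: "f w i = mat_vec B D w i" for w using i by (simp add: f_def)
    have "mat_vec B D (g (f v)) i = mat_vec B D v i" unfolding f_eq[symmetric] fg ..
    then show ?thesis by (simp only: *)
  qed
  then show ?thesis by (intro exI[of _ "\<lambda>j i. g (unit_vec i) j"]) blast
qed

text \<open>
  With generalised inverses \<open>s\<close> of the differentials, \<open>1 - d s - s d\<close> is a chain map that projects
  onto representatives of the homology.
\<close>

locale split_complex =
  fixes B :: "nat \<Rightarrow> 'i set" and D S :: "nat \<Rightarrow> 'i \<Rightarrow> 'i \<Rightarrow> 'k::field"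
  assumes cx: "complex_mod {0} B D"
    and inv: "i \<in> B n \<Longrightarrow> mat_vec (B (Suc n)) (D n) (mat_vec (B n) (S n) (mat_vec (B (Suc n)) (D n) v)) i =
      mat_vec (B (Suc n)) (D n) v i"
begin

abbreviation "d n \<equiv> mat_vec (B (Suc n)) (D n)"
abbreviation "s n \<equiv> mat_vec (B n) (S n)"

definition proj :: "nat \<Rightarrow> ('i \<Rightarrow> 'k) \<Rightarrow> 'i \<Rightarrow> 'k" where
  "proj n x i = x i - d n (s n x) i - (case n of 0 \<Rightarrow> 0 | Suc m \<Rightarrow> s m (d m x) i)"

lemma fin: "finite (B n)" using cx by (simp add: complex_mod_def)

lemma dd: "i \<in> B n \<Longrightarrow> d n (d (Suc n) v) i = 0" using cx by (simp add: complex_mod_def)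

lemma mat_vec_zero: "(\<And>j. j \<in> A \<Longrightarrow> v j = 0) \<Longrightarrow> mat_vec A M v i = 0"
  by (simp add: mat_vec_def)

lemma proj_cycle: "cycle_mod {0} B D n (proj n x)"
  unfolding cycle_mod_def
proof (intro allI impI ballI)
  fix m i assume n: "Suc m = n" and i: "i \<in> B m"
  have "d m (proj n x) i = d m (\<lambda>i. x i - d n (s n x) i - s m (d m x) i) i"
    using n by (intro mat_vec_cong) (auto simp: proj_def)
  then show "d m (proj n x) i \<in> {0}" using dd[OF i] inv[OF i] n by (auto simp: mat_vec_diff)
qed

lemma proj_d: "i \<in> B n \<Longrightarrow> proj n (d n y) i = 0"
  by (cases n) (auto simp: proj_def inv intro!: mat_vec_zero dd)

lemma proj_of_cycle: "cycle_mod {0} B D n x \<Longrightarrow> proj n x i = x i - d n (s n x) i"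
proof (cases n)
  case (Suc m)
  assume "cycle_mod {0} B D n x"
  then have "s m (d m x) i = 0" using Suc by (subst mat_vec_zero) (auto simp: cycle_mod_def)
  then show ?thesis using Suc by (simp add: proj_def)
qed (simp add: proj_def)

lemma mat_vec_sum_fun:
  "mat_vec A M (\<lambda>j. \<Sum>a\<in>K. c a * x a j) = (\<lambda>i. \<Sum>a\<in>K. c a * mat_vec A M (x a) i)"
  by (rule ext) (rule mat_vec_sum)

lemma proj_sum: "proj n (\<lambda>i. \<Sum>a\<in>K. c a * x a i) i = (\<Sum>a\<in>K. c a * proj n (x a) i)"
  by (cases n) (simp_all add: proj_def mat_vec_sum_fun algebra_simps sum_subtractf sum.distrib)

lemma proj_cong: "(\<And>i. i \<in> B n \<Longrightarrow> x i = y i) \<Longrightarrow> i \<in> B n \<Longrightarrow> proj n x i = proj n y i"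
  using mat_vec_cong[of "B n" x y]
  by (cases n) (auto simp: proj_def fun_eq_iff intro!: mat_vec_cong arg_cong2[of _ _ _ _ "(-)"])

lemma sum_unit: "i \<in> B n \<Longrightarrow> (\<Sum>k\<in>B n. x k * unit_vec k i) = x i"
  by (simp add: sum_mult_unit_vec[OF fin])

lemma proj_expand:
  assumes i: "i \<in> B n"
  shows "proj n x i = (\<Sum>k\<in>B n. x k * proj n (unit_vec k) i)"
  unfolding proj_sum[symmetric] by (rule proj_cong[OF _ i]) (simp only: sum_unit)

text \<open>
  Coordinates on homology as functionals on chains: \<open>\<phi> a\<close> sends a chain to the \<open>a\<close>-th coordinate of the
  class of its projection.  It vanishes on boundaries and is dual to the basis \<open>v\<close>.
\<close>

lemma basis_functionals:
  assumes "homology_basis id (cycle_mod {0} B D n) (boundary_mod {0} B D n) K v"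
  obtains \<phi> f where
    "\<And>k i. k \<in> B n \<Longrightarrow> i \<in> B n \<Longrightarrow> proj n (unit_vec k) i = (\<Sum>a\<in>K. \<phi> a k * v a i) + d n (f k) i"
    "\<And>a y. a \<in> K \<Longrightarrow> (\<Sum>k\<in>B n. \<phi> a k * d n y k) = 0"
    "\<And>a a'. a \<in> K \<Longrightarrow> a' \<in> K \<Longrightarrow> (\<Sum>k\<in>B n. \<phi> a k * v a' k) = (if a = a' then 1 else 0)"
proof -
  have "\<forall>k. \<exists>cw. \<forall>i\<in>B n. proj n (unit_vec k) i - (\<Sum>a\<in>K. fst cw a * v a i) - d n (snd cw) i = 0"
    using assms proj_cycle[of n] unfolding homology_basis_def boundary_mod_def
    by (simp add: split_paired_Ex)
  from choice[OF this] obtain cw where cw: "\<And>k i. i \<in> B n \<Longrightarrow>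
      proj n (unit_vec k) i - (\<Sum>a\<in>K. fst (cw k) a * v a i) - d n (snd (cw k)) i = 0"
    by blast
  define c f where "c k = fst (cw k)" and "f k = snd (cw k)" for k
  have cf: "proj n (unit_vec k) i - (\<Sum>a\<in>K. c k a * v a i) - d n (f k) i = 0" if "i \<in> B n" for k i
    using cw[OF that, of k] by (simp only: c_def f_def)
  have 1: "proj n (unit_vec k) i = (\<Sum>a\<in>K. c k a * v a i) + d n (f k) i" if "i \<in> B n" for k i
    using cf[OF that, of k] by (simp add: algebra_simps)
  have pr: "proj n x i = (\<Sum>a\<in>K. (\<Sum>k\<in>B n. c k a * x k) * v a i) + d n (\<lambda>j. \<Sum>k\<in>B n. x k * f k j) i"
    if i: "i \<in> B n" for x i
  proof -
    have "proj n x i = (\<Sum>k\<in>B n. x k * (\<Sum>a\<in>K. c k a * v a i)) + (\<Sum>k\<in>B n. x k * d n (f k) i)"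
      unfolding proj_expand[OF i, of x] by (simp add: 1[OF i] distrib_left sum.distrib)
    also have "(\<Sum>k\<in>B n. x k * (\<Sum>a\<in>K. c k a * v a i)) = (\<Sum>a\<in>K. (\<Sum>k\<in>B n. c k a * x k) * v a i)"
      by (simp add: sum_distrib_left sum_distrib_right sum.swap[of _ K "B n"] mult_ac)
    finally show ?thesis by (simp add: mat_vec_sum)
  qed
  have indep: "(\<forall>a\<in>K. c a = 0)" if "boundary_mod {0} B D n (\<lambda>i. \<Sum>a\<in>K. c a * v a i)" for c
    using assms that unfolding homology_basis_def by simp
  have 2: "(\<Sum>k\<in>B n. c k a * d n y k) = 0" if "a \<in> K" for a y
  proof -
    have "boundary_mod {0} B D n (\<lambda>i. \<Sum>a\<in>K. (\<Sum>k\<in>B n. c k a * d n y k) * v a i)"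
      unfolding boundary_mod_def
    proof (intro exI ballI)
      fix i assume "i \<in> B n"
      from pr[OF this, of "d n y"] proj_d[OF this, of y]
      show "(\<Sum>a\<in>K. (\<Sum>k\<in>B n. c k a * d n y k) * v a i) -
          d n (\<lambda>j. (-1) * (\<Sum>k\<in>B n. d n y k * f k j)) i \<in> {0}"
        unfolding mat_vec_mult by simp
    qed
    from indep[OF this] that show ?thesis by blast
  qed
  have 3: "(\<Sum>k\<in>B n. c k a * v a' k) = (if a = a' then 1 else 0)" if a: "a \<in> K" "a' \<in> K" for a a'
  proof -
    have K: "finite K" and cyc: "cycle_mod {0} B D n (v a')" using assms a by (auto simp: homology_basis_def)
    have "boundary_mod {0} B D n (\<lambda>i. \<Sum>a\<in>K. ((\<Sum>k\<in>B n. c k a * v a' k) - (if a = a' then 1 else 0)) * v a i)"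
      unfolding boundary_mod_def
    proof (intro exI ballI)
      fix i assume i: "i \<in> B n"
      have "(\<Sum>a\<in>K. ((\<Sum>k\<in>B n. c k a * v a' k) - (if a = a' then 1 else 0)) * v a i) =
          (\<Sum>a\<in>K. (\<Sum>k\<in>B n. c k a * v a' k) * v a i) - v a' i"
        using sum_mult_unit_vec[OF K, of "\<lambda>a. v a i" a'] a
        by (simp add: right_diff_distrib sum_subtractf mult.commute[of _ "v _ i"] eq_commute[of a'])
      with pr[OF i, of "v a'"] proj_of_cycle[OF cyc, of i]
      show "(\<Sum>a\<in>K. ((\<Sum>k\<in>B n. c k a * v a' k) - (if a = a' then 1 else 0)) * v a i) -
          d n (\<lambda>j. - 1 * (s n (v a') j + (\<Sum>k\<in>B n. v a' k * f k j))) i \<in> {0}"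
        unfolding mat_vec_mult mat_vec_add by (simp add: algebra_simps)
    qed
    from indep[OF this] a(1) have "(\<Sum>k\<in>B n. c k a * v a' k) - (if a = a' then 1 else 0) = 0" by blast
    then show ?thesis by simp
  qed
  from 1 2 3 show ?thesis by (intro that[of "\<lambda>a k. c k a" f])
qed

end

lemma split_complex_exists:
  fixes B :: "nat \<Rightarrow> 'i set" and D :: "nat \<Rightarrow> 'i \<Rightarrow> 'i \<Rightarrow> 'k::field"
  assumes "complex_mod {0} B D"
  obtains S where "split_complex B D S"
proof -
  have "\<forall>n. \<exists>S. \<forall>v. \<forall>i\<in>B n. mat_vec (B (Suc n)) (D n) (mat_vec (B n) S (mat_vec (B (Suc n)) (D n) v)) i =
      mat_vec (B (Suc n)) (D n) v i"
    using assms by (auto simp: complex_mod_def intro!: generalized_inverse)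
  then obtain S where "\<forall>n. \<forall>v. \<forall>i\<in>B n. mat_vec (B (Suc n)) (D n) (mat_vec (B n) (S n) (mat_vec (B (Suc n)) (D n) v)) i =
      mat_vec (B (Suc n)) (D n) v i" by metis
  with assms show ?thesis by (intro that[of S]) (simp add: split_complex_def)
qed


text \<open>
  Kuenneth formula over a field.  Both projections onto homology are homotopic to the identity, also
  when they are applied to one tensor factor, so a total cycle is homologous to its image under their
  product; this is a combination of products of basis cycles.
\<close>

locale split_pair = F: split_complex B D S + G: split_complex C E S'
  for B :: "nat \<Rightarrow> 'i set" and D S :: "nat \<Rightarrow> 'i \<Rightarrow> 'i \<Rightarrow> 'k::field"
    and C :: "nat \<Rightarrow> 'j set" and E S' :: "nat \<Rightarrow> 'j \<Rightarrow> 'j \<Rightarrow> 'k"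
begin

sublocale T: double_complex "grid_zero {0} B C" "grid_d1 B D" "grid_d2 C E"
  by (rule grid_double_complex[OF self.subspace_single_0 F.cx G.cx])

lemma tot_boundaryI:
  assumes "\<And>p q i j. p + q = n \<Longrightarrow> i \<in> B p \<Longrightarrow> j \<in> C q \<Longrightarrow>
    U p i j = grid_d1 B D p q (Y (Suc p)) i j + grid_d2 C E p q (Y p) i j"
  shows "T.tot_boundary n U"
  unfolding T.tot_boundary_def using assms by (intro exI[of _ Y]) (simp add: grid_zero_def)

lemma tot_boundaryD:
  assumes "T.tot_boundary n U"
  obtains Y where "\<And>p q i j. p + q = n \<Longrightarrow> i \<in> B p \<Longrightarrow> j \<in> C q \<Longrightarrow>
    U p i j = grid_d1 B D p q (Y (Suc p)) i j + grid_d2 C E p q (Y p) i j"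
  using assms unfolding T.tot_boundary_def grid_zero_def by (auto simp: algebra_simps)

lemma tot_boundary_cong:
  assumes "T.tot_boundary n U"
    and "\<And>p q i j. p + q = n \<Longrightarrow> i \<in> B p \<Longrightarrow> j \<in> C q \<Longrightarrow> V p i j = U p i j"
  shows "T.tot_boundary n V"
  using assms(1) by (rule tot_boundaryD) (use assms(2) in \<open>auto intro: tot_boundaryI\<close>)

lemma tot_cycleD:
  assumes "T.tot_cycle n U" "Suc (p + q) = n" "i \<in> B p" "j \<in> C q"
  shows "grid_d1 B D p q (U (Suc p)) i j + grid_d2 C E p q (U p) i j = 0"
  using assms unfolding T.tot_cycle_def grid_zero_def by auto

text \<open>
  The homotopy is \<open>s\<close> on one factor; the sign matches that of \<open>grid_d2\<close>.  For a cycle \<open>U\<close> the mixed terms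
  become \<open>s d\<close> on the same factor, by the cycle condition.
\<close>

lemma proj2_homotopic:
  assumes "T.tot_cycle n U"
  shows "T.tot_boundary n (\<lambda>p i j. U p i j - G.proj (n - p) (U p i) j)"
proof (rule tot_boundaryI)
  fix p q i j assume n: "p + q = n" and i: "i \<in> B p" and j: "j \<in> C q"
  let ?Y = "\<lambda>p i j. if p \<le> n then (-1) ^ p * G.s (n - p) (U p i) j else 0"
  have np: "n - p = q" "p \<le> n" using n by auto
  have 2: "grid_d2 C E p q (?Y p) i j = G.d q (G.s q (U p i)) j"
    using np by (simp add: grid_d2_def mat_vec_mult flip: mult.assoc power_add)
  have 1: "grid_d1 B D p q (?Y (Suc p)) i j = (case q of 0 \<Rightarrow> 0 | Suc m \<Rightarrow> G.s m (G.d m (U p i)) j)"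
  proof (cases q)
    case 0
    then show ?thesis using n by (simp add: grid_d1_def mat_vec_def)
  next
    case (Suc m)
    then have m: "n - Suc p = m" "Suc p \<le> n" using n by auto
    have "grid_d1 B D p q (?Y (Suc p)) i j = (-1) ^ Suc p * G.s m (\<lambda>j'. F.d p (\<lambda>i'. U (Suc p) i' j') i) j"
      using m by (simp add: grid_d1_def mat_vec_mult mat_vec_swap[of "B (Suc p)"] del: power_Suc)
    also have "G.s m (\<lambda>j'. F.d p (\<lambda>i'. U (Suc p) i' j') i) j = G.s m (\<lambda>j'. (-1) ^ Suc p * G.d m (U p i) j') j"
    proof (rule mat_vec_cong)
      fix j' assume "j' \<in> C m"
      from tot_cycleD[OF assms _ i this] Suc n
      show "F.d p (\<lambda>i'. U (Suc p) i' j') i = (-1) ^ Suc p * G.d m (U p i) j'"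
        by (simp add: grid_d1_def grid_d2_def eq_neg_iff_add_eq_0)
    qed
    finally show ?thesis unfolding mat_vec_mult using Suc by (simp flip: mult.assoc power_add)
  qed
  show "U p i j - G.proj (n - p) (U p i) j =
      grid_d1 B D p q (?Y (Suc p)) i j + grid_d2 C E p q (?Y p) i j"
    by (simp only: 1 2) (simp add: np G.proj_def)
qed

lemma proj1_homotopic:
  assumes "T.tot_cycle n U"
  shows "T.tot_boundary n (\<lambda>p i j. U p i j - F.proj p (\<lambda>i. U p i j) i)"
proof (rule tot_boundaryI)
  fix p q i j assume n: "p + q = n" and i: "i \<in> B p" and j: "j \<in> C q"
  let ?Y = "\<lambda>p i j. case p of 0 \<Rightarrow> 0 | Suc m \<Rightarrow> F.s m (\<lambda>i'. U m i' j) i"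
  have 1: "grid_d1 B D p q (?Y (Suc p)) i j = F.d p (F.s p (\<lambda>i. U p i j)) i"
    by (simp add: grid_d1_def)
  have 2: "grid_d2 C E p q (?Y p) i j = (case p of 0 \<Rightarrow> 0 | Suc m \<Rightarrow> F.s m (F.d m (\<lambda>i. U p i j)) i)"
  proof (cases p)
    case 0
    then show ?thesis by (simp add: grid_d2_def mat_vec_def)
  next
    case (Suc m)
    have "grid_d2 C E p q (?Y p) i j = F.s m (\<lambda>i'. (-1) ^ p * G.d q (U m i') j) i"
      using Suc by (simp add: grid_d2_def mat_vec_mult mat_vec_swap[of "C (Suc q)"] del: power_Suc)
    also have "\<dots> = F.s m (F.d m (\<lambda>i. U p i j)) i"
    proof (rule mat_vec_cong)
      fix i' assume "i' \<in> B m"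
      from tot_cycleD[OF assms _ this j] Suc n
      show "(-1) ^ p * G.d q (U m i') j = F.d m (\<lambda>i. U p i j) i'"
        by (simp add: grid_d1_def grid_d2_def algebra_simps neg_eq_iff_add_eq_0)
    qed
    finally show ?thesis using Suc by simp
  qed
  show "U p i j - F.proj p (\<lambda>i. U p i j) i =
      grid_d1 B D p q (?Y (Suc p)) i j + grid_d2 C E p q (?Y p) i j"
    unfolding 1 2 by (simp add: F.proj_def)
qed

lemma cycle_times_boundary:
  assumes x: "cycle_mod {0} B D p0 x" and n: "p0 + q0 = n"
  shows "T.tot_boundary n (\<lambda>p i j. if p = p0 then x i * G.d q0 y j else 0)"
proof (rule tot_boundaryI)
  fix p q i j assume pq: "p + q = n" and i: "i \<in> B p" and j: "j \<in> C q"
  let ?Y = "\<lambda>p i j. if p = p0 then ((-1) ^ p0 * x i) * y j else 0"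
  have 1: "grid_d1 B D p q (?Y (Suc p)) i j = 0"
  proof (cases "Suc p = p0")
    case True
    then have "grid_d1 B D p q (?Y (Suc p)) i j = F.d p (\<lambda>i'. ((-1) ^ p0 * y j) * x i') i"
      by (simp add: grid_d1_def mult_ac)
    also have "\<dots> = 0"
      using x True i unfolding mat_vec_mult by (auto simp: cycle_mod_def)
    finally show ?thesis .
  qed (simp add: grid_d1_def mat_vec_def)
  have 2: "grid_d2 C E p q (?Y p) i j = (if p = p0 then x i * G.d q0 y j else 0)"
  proof (cases "p = p0")
    case True
    then have "q = q0" using n pq by simp
    with True show ?thesis
      unfolding grid_d2_def by (simp add: mat_vec_mult flip: mult.assoc power_add)
  qed (simp add: grid_d2_def mat_vec_def)
  show "(if p = p0 then x i * G.d q0 y j else 0) =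
      grid_d1 B D p q (?Y (Suc p)) i j + grid_d2 C E p q (?Y p) i j"
    unfolding 1 2 by simp
qed

lemma boundary_times_cycle:
  assumes y: "cycle_mod {0} C E q0 y" and n: "p0 + q0 = n"
  shows "T.tot_boundary n (\<lambda>p i j. if p = p0 then F.d p0 x i * y j else 0)"
proof (rule tot_boundaryI)
  fix p q i j assume pq: "p + q = n" and i: "i \<in> B p" and j: "j \<in> C q"
  let ?Y = "\<lambda>p i j. if p = Suc p0 then x i * y j else 0"
  have 1: "grid_d1 B D p q (?Y (Suc p)) i j = (if p = p0 then F.d p0 x i * y j else 0)"
    by (simp add: grid_d1_def mult.commute[of _ "y j"] mat_vec_mult, simp add: mat_vec_def)
  have 2: "grid_d2 C E p q (?Y p) i j = 0"
  proof (cases "p = Suc p0")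
    case True
    then have "Suc q = q0" using n pq by simp
    with True y j show ?thesis
      unfolding grid_d2_def by (auto simp add: mat_vec_mult cycle_mod_def)
  qed (simp add: grid_d2_def mat_vec_def)
  show "(if p = p0 then F.d p0 x i * y j else 0) =
      grid_d1 B D p q (?Y (Suc p)) i j + grid_d2 C E p q (?Y p) i j"
    unfolding 1 2 by simp
qed

text \<open>
  Products of basis cycles span because the double projection \<open>W\<close> of a cycle can be expanded in basis
  cycles up to boundaries of the two kinds above; they are independent because the products of the
  coordinate functionals vanish on boundaries and are dual to them.
\<close>

lemma product_basis:
  assumes v: "\<And>p. homology_basis id (cycle_mod {0} B D p) (boundary_mod {0} B D p) (K p) (v p)"
    and w: "\<And>q. homology_basis id (cycle_mod {0} C E q) (boundary_mod {0} C E q) (L q) (w q)"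
  shows "homology_basis id (cycle_mod {0} (tot_index B C) (tot_mat D E) n)
    (boundary_mod {0} (tot_index B C) (tot_mat D E) n) (tot_index K L n)
    (\<lambda>(p, a, b) (p', i, j). if p' = p then v p a i * w (n - p) b j else 0)"
proof -
  let ?u = "\<lambda>(p, a, b) (p', i, j). if p' = p then v p a i * w (n - p) b j else 0"
  have fK: "finite (K p)" and fL: "finite (L p)" for p using v w by (auto simp: homology_basis_def)
  have u_sum: "(\<Sum>y\<in>tot_index K L n. c y * ?u y (p, i, j)) =
      (\<Sum>a\<in>K p. \<Sum>b\<in>L (n - p). c (p, a, b) * (v p a i * w (n - p) b j))" if p: "p \<le> n" for c p i j
  proof -
    have "(\<Sum>y\<in>tot_index K L n. c y * ?u y (p, i, j)) =
        (\<Sum>p'\<le>n. if p' = p then \<Sum>a\<in>K p. \<Sum>b\<in>L (n - p). c (p, a, b) * (v p a i * w (n - p) b j) else 0)"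
      unfolding sum_tot_index[of K L, OF fK fL] by (intro sum.cong refl) auto
    then show ?thesis using p by simp
  qed
  obtain \<phi> f where \<phi>: "\<And>p k i. k \<in> B p \<Longrightarrow> i \<in> B p \<Longrightarrow>
        F.proj p (unit_vec k) i = (\<Sum>a\<in>K p. \<phi> p a k * v p a i) + F.d p (f p k) i"
      "\<And>p a y. a \<in> K p \<Longrightarrow> (\<Sum>k\<in>B p. \<phi> p a k * F.d p y k) = 0"
      "\<And>p a a'. a \<in> K p \<Longrightarrow> a' \<in> K p \<Longrightarrow> (\<Sum>k\<in>B p. \<phi> p a k * v p a' k) = (if a = a' then 1 else 0)"
  proof -
    have "\<forall>p. \<exists>\<phi>f. (\<forall>k\<in>B p. \<forall>i\<in>B p.
          F.proj p (unit_vec k) i = (\<Sum>a\<in>K p. fst \<phi>f a k * v p a i) + F.d p (snd \<phi>f k) i) \<and>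
        (\<forall>a\<in>K p. \<forall>y. (\<Sum>k\<in>B p. fst \<phi>f a k * F.d p y k) = 0) \<and>
        (\<forall>a\<in>K p. \<forall>a'\<in>K p. (\<Sum>k\<in>B p. fst \<phi>f a k * v p a' k) = (if a = a' then 1 else 0))"
      (is "\<forall>p. \<exists>\<phi>f. ?P p \<phi>f")
    proof
      fix p
      from v[of p] obtain \<phi> f where
        "\<And>k i. k \<in> B p \<Longrightarrow> i \<in> B p \<Longrightarrow> F.proj p (unit_vec k) i = (\<Sum>a\<in>K p. \<phi> a k * v p a i) + F.d p (f k) i"
        "\<And>a y. a \<in> K p \<Longrightarrow> (\<Sum>k\<in>B p. \<phi> a k * F.d p y k) = 0"
        "\<And>a a'. a \<in> K p \<Longrightarrow> a' \<in> K p \<Longrightarrow> (\<Sum>k\<in>B p. \<phi> a k * v p a' k) = (if a = a' then 1 else 0)"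
        by (rule F.basis_functionals) blast
      then show "\<exists>\<phi>f. ?P p \<phi>f" by (intro exI[of _ "(\<phi>, f)"]) simp
    qed
    from choice[OF this] obtain \<phi>f where "\<And>p. ?P p (\<phi>f p)" by blast
    then show ?thesis by (intro that[of "\<lambda>p. fst (\<phi>f p)" "\<lambda>p. snd (\<phi>f p)"]) blast+
  qed
  obtain \<psi> g where \<psi>: "\<And>q k j. k \<in> C q \<Longrightarrow> j \<in> C q \<Longrightarrow>
        G.proj q (unit_vec k) j = (\<Sum>b\<in>L q. \<psi> q b k * w q b j) + G.d q (g q k) j"
      "\<And>q b y. b \<in> L q \<Longrightarrow> (\<Sum>k\<in>C q. \<psi> q b k * G.d q y k) = 0"
      "\<And>q b b'. b \<in> L q \<Longrightarrow> b' \<in> L q \<Longrightarrow> (\<Sum>k\<in>C q. \<psi> q b k * w q b' k) = (if b = b' then 1 else 0)"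
  proof -
    have "\<forall>q. \<exists>\<psi>g. (\<forall>k\<in>C q. \<forall>j\<in>C q.
          G.proj q (unit_vec k) j = (\<Sum>b\<in>L q. fst \<psi>g b k * w q b j) + G.d q (snd \<psi>g k) j) \<and>
        (\<forall>b\<in>L q. \<forall>y. (\<Sum>k\<in>C q. fst \<psi>g b k * G.d q y k) = 0) \<and>
        (\<forall>b\<in>L q. \<forall>b'\<in>L q. (\<Sum>k\<in>C q. fst \<psi>g b k * w q b' k) = (if b = b' then 1 else 0))"
      (is "\<forall>q. \<exists>\<psi>g. ?P q \<psi>g")
    proof
      fix q
      from w[of q] obtain \<psi> g where
        "\<And>k j. k \<in> C q \<Longrightarrow> j \<in> C q \<Longrightarrow> G.proj q (unit_vec k) j = (\<Sum>b\<in>L q. \<psi> b k * w q b j) + G.d q (g k) j"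
        "\<And>b y. b \<in> L q \<Longrightarrow> (\<Sum>k\<in>C q. \<psi> b k * G.d q y k) = 0"
        "\<And>b b'. b \<in> L q \<Longrightarrow> b' \<in> L q \<Longrightarrow> (\<Sum>k\<in>C q. \<psi> b k * w q b' k) = (if b = b' then 1 else 0)"
        by (rule G.basis_functionals) blast
      then show "\<exists>\<psi>g. ?P q \<psi>g" by (intro exI[of _ "(\<psi>, g)"]) simp
    qed
    from choice[OF this] obtain \<psi>g where "\<And>q. ?P q (\<psi>g q)" by blast
    then show ?thesis by (intro that[of "\<lambda>q. fst (\<psi>g q)" "\<lambda>q. snd (\<psi>g q)"]) blast+
  qed
  have cyc_v: "cycle_mod {0} B D p (v p a)" if "a \<in> K p" for p a
    using v[of p] that by (simp add: homology_basis_def)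
  have cyc_w: "cycle_mod {0} C E q (w q b)" if "b \<in> L q" for q b
    using w[of q] that by (simp add: homology_basis_def)
  have cyc: "T.tot_cycle n (\<lambda>p i j. ?u y (p, i, j))" if y: "y \<in> tot_index K L n" for y
  proof -
    obtain p a b where y: "y = (p, a, b)" "p \<le> n" "a \<in> K p" "b \<in> L (n - p)"
      using y by (auto simp: tot_index_def)
    show ?thesis
      unfolding T.tot_cycle_def
    proof (intro allI impI)
      fix p' q' assume n: "Suc (p' + q') = n"
      have 1: "grid_d1 B D p' q' (\<lambda>i j. ?u y (Suc p', i, j)) i j = 0" if "i \<in> B p'" for i j
      proof (cases "Suc p' = p")
        case True
        have "F.d p' (v p a) i = 0" using cyc_v[OF y(3)] True that by (auto simp: cycle_mod_def)
        then show ?thesis using True y by (simp add: grid_d1_def mult.commute[of "v _ _ _"] mat_vec_mult)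
      qed (simp add: grid_d1_def mat_vec_def y)
      have 2: "grid_d2 C E p' q' (\<lambda>i j. ?u y (p', i, j)) i j = 0" if "j \<in> C q'" for i j
      proof (cases "p' = p")
        case True
        then have "Suc q' = n - p" using n by simp
        then have "G.d q' (w (n - p) b) j = 0" using cyc_w[OF y(4)] that by (auto simp: cycle_mod_def)
        then show ?thesis using True y by (simp add: grid_d2_def mat_vec_mult)
      qed (simp add: grid_d2_def mat_vec_def y)
      show "grid_d1 B D p' q' (\<lambda>i j. ?u y (Suc p', i, j)) + grid_d2 C E p' q' (\<lambda>i j. ?u y (p', i, j)) \<in> grid_zero {0} B C p' q'"
        by (simp add: grid_zero_def 1 2)
    qed
  qed
  have span: "\<exists>c. T.tot_boundary n (\<lambda>p i j. z (p, i, j) - (\<Sum>y\<in>tot_index K L n. c y * ?u y (p, i, j)))"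
    if z: "T.tot_cycle n (\<lambda>p i j. z (p, i, j))" for z
  proof -
    define U where "U = (\<lambda>p i j. z (p, i, j))"
    define V where "V = (\<lambda>p i j. G.proj (n - p) (U p i) j)"
    define W where "W = (\<lambda>p i j. F.proj p (\<lambda>i. V p i j) i)"
    \<comment> \<open>Apply the projection first in the second factor and then in the first.\<close>
    have U: "T.tot_cycle n U" using z by (simp add: U_def)
    have UV: "T.tot_boundary n (\<lambda>p i j. U p i j - V p i j)"
      unfolding V_def by (rule proj2_homotopic[OF U])
    have "T.tot_cycle n (\<lambda>p. U p - (\<lambda>i j. U p i j - V p i j))"
      by (rule T.tot_cycle_diff[OF U T.tot_cycle_of_boundary[OF UV]])
    then have "T.tot_cycle n V" by (simp add: fun_diff_def)
    then have VW: "T.tot_boundary n (\<lambda>p i j. V p i j - W p i j)"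
      unfolding W_def by (rule proj1_homotopic)
    let ?A = "\<lambda>p k i. \<Sum>a\<in>K p. \<phi> p a k * v p a i"
    \<comment> \<open>Remainder of the expansion: cycle times boundary, and boundary times cycle.\<close>
    let ?R = "\<lambda>p0 p i j. \<Sum>k\<in>B p0. \<Sum>l\<in>C (n - p0).
      (if p = p0 then (U p0 k l * ?A p0 k i) * G.d (n - p0) (g (n - p0) l) j else 0) +
      (if p = p0 then F.d p0 (\<lambda>i. U p0 k l * f p0 k i) i * G.proj (n - p0) (unit_vec l) j else 0)"
    have R: "T.tot_boundary n (\<lambda>p i j. \<Sum>p0\<le>n. ?R p0 p i j)"
    proof -
      have "T.tot_boundary n (\<lambda>p. \<Sum>p0\<in>{..n}. \<Sum>k\<in>B p0. \<Sum>l\<in>C (n - p0).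
          (\<lambda>i j. if p = p0 then (U p0 k l * ?A p0 k i) * G.d (n - p0) (g (n - p0) l) j else 0) +
          (\<lambda>i j. if p = p0 then F.d p0 (\<lambda>i. U p0 k l * f p0 k i) i * G.proj (n - p0) (unit_vec l) j else 0))"
      proof (intro T.tot_boundary_sum T.tot_boundary_add finite_atMost F.fin G.fin)
        fix p0 k l assume "p0 \<in> {..n}"
        then have n: "p0 + (n - p0) = n" by simp
        have "cycle_mod {0} B D p0 (\<lambda>i. U p0 k l * ?A p0 k i)"
          using cyc_v by (auto simp: cycle_mod_def mat_vec_mult mat_vec_sum intro!: sum.neutral)
        from cycle_times_boundary[OF this n]
        show "T.tot_boundary n (\<lambda>p i j. if p = p0 then (U p0 k l * ?A p0 k i) * G.d (n - p0) (g (n - p0) l) j else 0)" .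
        show "T.tot_boundary n (\<lambda>p i j. if p = p0 then F.d p0 (\<lambda>i. U p0 k l * f p0 k i) i * G.proj (n - p0) (unit_vec l) j else 0)"
          by (rule boundary_times_cycle[OF G.proj_cycle n])
      qed
      then show ?thesis
        by (rule tot_boundary_cong) (simp add: fn_sum_apply)
    qed
    \<comment> \<open>The coordinates of \<open>U\<close> are the products of the coordinate functionals applied to it.\<close>
    define c where "c = (\<lambda>(p, a, b). \<Sum>k\<in>B p. \<Sum>l\<in>C (n - p). U p k l * \<phi> p a k * \<psi> (n - p) b l)"
    have "T.tot_boundary n (\<lambda>p i j. z (p, i, j) - (\<Sum>y\<in>tot_index K L n. c y * ?u y (p, i, j)))"
    proof (rule tot_boundary_cong[OF T.tot_boundary_add[OF T.tot_boundary_add[OF UV VW] R]])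
      fix p q i j assume n: "p + q = n" and i: "i \<in> B p" and j: "j \<in> C q"
      have np: "n - p = q" "p \<le> n" using n by auto
      have "W p i j = (\<Sum>k\<in>B p. (\<Sum>l\<in>C q. U p k l * G.proj q (unit_vec l) j) * F.proj p (unit_vec k) i)"
        unfolding W_def V_def np F.proj_expand[OF i, of "\<lambda>i. G.proj q (U p i) j"]
        by (simp only: G.proj_expand[OF j, symmetric])
      also have "\<dots> = (\<Sum>k\<in>B p. \<Sum>l\<in>C q. U p k l * ((?A p k i + F.d p (f p k) i) * G.proj q (unit_vec l) j))"
        unfolding sum_distrib_right by (intro sum.cong refl) (simp add: \<phi>(1)[OF _ i] mult_ac)
      also have "\<dots> = (\<Sum>k\<in>B p. \<Sum>l\<in>C q. U p k l * ?A p k i * (\<Sum>b\<in>L q. \<psi> q b l * w q b j) +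
          ((U p k l * ?A p k i) * G.d q (g q l) j +
            F.d p (\<lambda>i. U p k l * f p k i) i * G.proj q (unit_vec l) j))"
      proof (intro sum.cong refl)
        fix k l assume "k \<in> B p" "l \<in> C q"
        then show "U p k l * ((?A p k i + F.d p (f p k) i) * G.proj q (unit_vec l) j) =
            U p k l * ?A p k i * (\<Sum>b\<in>L q. \<psi> q b l * w q b j) +
            ((U p k l * ?A p k i) * G.d q (g q l) j +
              F.d p (\<lambda>i. U p k l * f p k i) i * G.proj q (unit_vec l) j)"
          unfolding mat_vec_mult by (simp only: \<psi>(1)[OF _ j] distrib_left distrib_right mult.assoc add_ac)
      qed
      also have "\<dots> = (\<Sum>k\<in>B p. \<Sum>l\<in>C q. U p k l * ?A p k i * (\<Sum>b\<in>L q. \<psi> q b l * w q b j)) + ?R p p i j"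
        by (simp add: sum.distrib np)
      also have "(\<Sum>k\<in>B p. \<Sum>l\<in>C q. U p k l * ?A p k i * (\<Sum>b\<in>L q. \<psi> q b l * w q b j)) =
          (\<Sum>k\<in>B p. \<Sum>l\<in>C q. \<Sum>a\<in>K p. \<Sum>b\<in>L q. U p k l * \<phi> p a k * \<psi> q b l * (v p a i * w q b j))"
        by (intro sum.cong refl) (simp add: sum_distrib_left sum_distrib_right mult_ac)
      also have "\<dots> = (\<Sum>k\<in>B p. \<Sum>a\<in>K p. \<Sum>b\<in>L q. \<Sum>l\<in>C q. U p k l * \<phi> p a k * \<psi> q b l * (v p a i * w q b j))"
        by (simp only: sum.swap[of _ "K p" "C q"] sum.swap[of _ "L q" "C q"])
      also have "\<dots> = (\<Sum>a\<in>K p. \<Sum>b\<in>L q. \<Sum>k\<in>B p. \<Sum>l\<in>C q. U p k l * \<phi> p a k * \<psi> q b l * (v p a i * w q b j))"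
        by (simp only: sum.swap[of _ "K p" "B p"] sum.swap[of _ "L q" "B p"])
      also have "\<dots> = (\<Sum>y\<in>tot_index K L n. c y * ?u y (p, i, j))"
        unfolding u_sum[OF np(2)] by (simp add: c_def np sum_distrib_right)
      finally have W: "W p i j = (\<Sum>y\<in>tot_index K L n. c y * ?u y (p, i, j)) + ?R p p i j" .
      have "(\<Sum>p0\<le>n. ?R p0 p i j) = (\<Sum>p0\<le>n. if p0 = p then ?R p p i j else 0)"
        by (intro sum.cong refl) auto
      also have "\<dots> = ?R p p i j" using np by simp
      finally have R': "(\<Sum>p0\<le>n. ?R p0 p i j) = ?R p p i j" .
      show "z (p, i, j) - (\<Sum>y\<in>tot_index K L n. c y * ?u y (p, i, j)) =
          ((\<lambda>i j. U p i j - V p i j) + (\<lambda>i j. V p i j - W p i j) + (\<lambda>i j. \<Sum>p0\<le>n. ?R p0 p i j)) i j"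
        unfolding plus_fun_apply R' W by (simp only: U_def) simp
    qed
    then show ?thesis by blast
  qed
  have indep: "c y = 0" if bd: "T.tot_boundary n (\<lambda>p i j. \<Sum>y\<in>tot_index K L n. c y * ?u y (p, i, j))"
    and y: "y \<in> tot_index K L n" for c y
  proof -
    obtain p a b where y: "y = (p, a, b)" "p \<le> n" "a \<in> K p" "b \<in> L (n - p)"
      using y by (auto simp: tot_index_def)
    define q where "q = n - p"
    have n: "p + q = n" and np: "n - p = q" using y by (auto simp: q_def)
    obtain Y where Y: "\<And>i j. i \<in> B p \<Longrightarrow> j \<in> C q \<Longrightarrow> (\<Sum>y\<in>tot_index K L n. c y * ?u y (p, i, j)) =
        grid_d1 B D p q (Y (Suc p)) i j + grid_d2 C E p q (Y p) i j"
      using bd n by (elim tot_boundaryD) blast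
    let ?I = "\<lambda>h. \<Sum>i\<in>B p. \<Sum>j\<in>C q. \<phi> p a i * \<psi> q b j * h i j"
    have "?I (\<lambda>i j. \<Sum>y\<in>tot_index K L n. c y * ?u y (p, i, j)) =
        ?I (\<lambda>i j. grid_d1 B D p q (Y (Suc p)) i j) + ?I (\<lambda>i j. grid_d2 C E p q (Y p) i j)"
      unfolding sum.distrib[symmetric] by (intro sum.cong refl) (simp only: Y distrib_left)
    also have "?I (\<lambda>i j. grid_d1 B D p q (Y (Suc p)) i j) =
        (\<Sum>j\<in>C q. \<psi> q b j * (\<Sum>i\<in>B p. \<phi> p a i * F.d p (\<lambda>i'. Y (Suc p) i' j) i))"
      unfolding sum_distrib_left by (subst sum.swap) (simp add: grid_d1_def mult_ac)
    also have "\<dots> = 0" using \<phi>(2) y by simp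
    also have "?I (\<lambda>i j. grid_d2 C E p q (Y p) i j) =
        (\<Sum>i\<in>B p. \<phi> p a i * (-1) ^ p * (\<Sum>j\<in>C q. \<psi> q b j * G.d q (Y p i) j))"
      unfolding sum_distrib_left by (simp add: grid_d2_def mult_ac)
    also have "\<dots> = 0" using \<psi>(2) y np by simp
    finally have 0: "?I (\<lambda>i j. \<Sum>y\<in>tot_index K L n. c y * ?u y (p, i, j)) = 0" by simp
    have "?I (\<lambda>i j. \<Sum>y\<in>tot_index K L n. c y * ?u y (p, i, j)) =
        (\<Sum>i\<in>B p. \<Sum>j\<in>C q. \<Sum>a'\<in>K p. \<Sum>b'\<in>L q. c (p, a', b') * ((\<phi> p a i * v p a' i) * (\<psi> q b j * w q b' j)))"
      unfolding u_sum[OF y(2)] np by (simp add: sum_distrib_left mult_ac)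
    also have "\<dots> = (\<Sum>i\<in>B p. \<Sum>a'\<in>K p. \<Sum>b'\<in>L q. \<Sum>j\<in>C q. c (p, a', b') * ((\<phi> p a i * v p a' i) * (\<psi> q b j * w q b' j)))"
      by (simp only: sum.swap[of _ "K p" "C q"] sum.swap[of _ "L q" "C q"])
    also have "\<dots> = (\<Sum>a'\<in>K p. \<Sum>b'\<in>L q. \<Sum>i\<in>B p. \<Sum>j\<in>C q. c (p, a', b') * ((\<phi> p a i * v p a' i) * (\<psi> q b j * w q b' j)))"
      by (simp only: sum.swap[of _ "K p" "B p"] sum.swap[of _ "L q" "B p"])
    also have "\<dots> = (\<Sum>a'\<in>K p. \<Sum>b'\<in>L q. c (p, a', b') * ((\<Sum>i\<in>B p. \<phi> p a i * v p a' i) * (\<Sum>j\<in>C q. \<psi> q b j * w q b' j)))"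
      by (simp only: sum_product) (simp only: sum_distrib_left)
    also have "\<dots> = (\<Sum>a'\<in>K p. \<Sum>b'\<in>L q. if a' = a then if b' = b then c (p, a, b) else 0 else 0)"
      using y np by (intro sum.cong refl) (auto simp: \<phi>(3) \<psi>(3))
    also have "\<dots> = (\<Sum>a'\<in>K p. if a' = a then \<Sum>b'\<in>L q. if b' = b then c (p, a, b) else 0 else 0)"
      by (intro sum.cong refl) auto
    also have "\<dots> = c (p, a, b)" using y np by (simp add: fK fL)
    finally show ?thesis using 0 y by simp
  qed
  note tot = cycle_tot[OF self.subspace_single_0 F.cx G.cx] boundary_tot[OF self.subspace_single_0 F.cx G.cx]
  show ?thesis
    unfolding homology_basis_def tot id_apply
    using finite_tot_index[of K L, OF fK fL] cyc span indep by blast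
qed

end


context vector_space
begin

text \<open>
  The vectors \<open>v a\<close> form a basis of \<open>Z\<close> modulo \<open>W\<close>: added to a basis of \<open>W\<close> one at a time, each of them
  raises the dimension by one.
\<close>

lemma dim_quotient:
  assumes W: "subspace W" and fin: "finite T" and WT: "W \<subseteq> span T" and K: "finite K"
    and Z: "subspace Z" and WZ: "W \<subseteq> Z" and vZ: "\<And>a. a \<in> K \<Longrightarrow> v a \<in> Z"
    and span: "\<And>z. z \<in> Z \<Longrightarrow> \<exists>c. z - (\<Sum>a\<in>K. c a *s v a) \<in> W"
    and indep: "\<And>c. (\<Sum>a\<in>K. c a *s v a) \<in> W \<Longrightarrow> \<forall>a\<in>K. c a = 0"
  shows "dim Z = dim W + card K"
proof -
  obtain Bw where Bw: "Bw \<subseteq> W" "independent Bw" "W \<subseteq> span Bw" "card Bw = dim W"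
    using basis_exists[of W] by blast
  have finBw: "finite Bw"
    using independent_span_bound[OF fin Bw(2)] Bw(1) WT by blast
  have spanW: "span Bw = W" using Bw W by (metis span_subspace)
  have "\<exists>A. finite A \<and> independent A \<and> card A = dim W + card L \<and>
      span A = {w + (\<Sum>a\<in>L. c a *s v a) | w c. w \<in> W}" if "L \<subseteq> K" for L
  proof -
    have "finite L" using that K finite_subset by blast
    then show ?thesis using that
    proof (induction L rule: finite_induct)
      case empty
      show ?case using Bw finBw spanW by (intro exI[of _ Bw]) auto
    next
      case (insert x L)
      then obtain A where A: "finite A" "independent A" "card A = dim W + card L"
        "span A = {w + (\<Sum>a\<in>L. c a *s v a) | w c. w \<in> W}" by auto
      have vx: "v x \<notin> span A"
      proof
        assume "v x \<in> span A"
        then obtain w c where wc: "v x = w + (\<Sum>a\<in>L. c a *s v a)" "w \<in> W" using A(4) by auto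
        define c' where "c' a = (if a = x then 1 else if a \<in> L then - c a else 0)" for a
        have "(\<Sum>a\<in>K. c' a *s v a) = (\<Sum>a\<in>insert x L. c' a *s v a)"
          by (rule sum.mono_neutral_right) (use K insert.prems in \<open>auto simp: c'_def\<close>)
        also have "\<dots> = v x + (\<Sum>a\<in>L. - c a *s v a)"
          using insert.hyps by (auto simp: c'_def intro!: sum.cong)
        also have "\<dots> = w" by (simp add: wc(1) sum_negf)
        finally have "\<forall>a\<in>K. c' a = 0" using indep wc(2) by metis
        moreover have "x \<in> K" "c' x = 1" using insert.prems by (auto simp: c'_def)
        ultimately show False by auto
      qed
      then have nA: "v x \<notin> A" using span_base by blast
      have "span (insert (v x) A) = {w + (\<Sum>a\<in>insert x L. c a *s v a) | w c. w \<in> W}"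
      proof (intro equalityI subsetI)
        fix y assume "y \<in> span (insert (v x) A)"
        then obtain k where "y - k *s v x \<in> span A" by (auto simp: span_insert)
        then obtain w c where wc: "y - k *s v x = w + (\<Sum>a\<in>L. c a *s v a)" "w \<in> W" using A(4) by auto
        have "(\<Sum>a\<in>insert x L. (c(x := k)) a *s v a) = k *s v x + (\<Sum>a\<in>L. c a *s v a)"
          using insert.hyps by (auto intro!: sum.cong)
        then have "y = w + (\<Sum>a\<in>insert x L. (c(x := k)) a *s v a)" using wc(1) by (simp add: algebra_simps)
        then show "y \<in> {w + (\<Sum>a\<in>insert x L. c a *s v a) | w c. w \<in> W}" using wc(2) by blast
      next
        fix y assume "y \<in> {w + (\<Sum>a\<in>insert x L. c a *s v a) | w c. w \<in> W}"
        then obtain w c where wc: "y = w + (\<Sum>a\<in>insert x L. c a *s v a)" "w \<in> W" by blast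
        then have "y - c x *s v x = w + (\<Sum>a\<in>L. c a *s v a)" using insert.hyps by simp
        then have "y - c x *s v x \<in> span A" using A(4) wc(2) by blast
        then show "y \<in> span (insert (v x) A)" by (auto simp: span_insert)
      qed
      then show ?case
        using A insert.hyps nA independent_insertI[OF vx A(2)] by (intro exI[of _ "insert (v x) A"]) simp
    qed
  qed
  from this[of K] obtain A where A: "independent A" "card A = dim W + card K"
    "span A = {w + (\<Sum>a\<in>K. c a *s v a) | w c. w \<in> W}" by blast
  have "span A = Z"
  proof (intro equalityI subsetI)
    fix z assume "z \<in> Z"
    then obtain c where "z - (\<Sum>a\<in>K. c a *s v a) \<in> W" using span by blast
    then have "z = (z - (\<Sum>a\<in>K. c a *s v a)) + (\<Sum>a\<in>K. c a *s v a) \<and> z - (\<Sum>a\<in>K. c a *s v a) \<in> W" by simp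
    then show "z \<in> span A" unfolding A(3) by blast
  next
    fix z assume "z \<in> span A"
    then show "z \<in> Z" using A(3) WZ vZ by (auto intro!: subspace_add[OF Z] subspace_sum[OF Z] subspace_scale[OF Z])
  qed
  then show ?thesis using A dim_eq_card[of A Z] by (metis span_span)
qed

end

lemma cycle_mod_cong:
  assumes "cycle_mod J B D n x" "\<And>i. i \<in> B n \<Longrightarrow> x i = y i"
  shows "cycle_mod J B D n y"
  unfolding cycle_mod_def
proof (intro allI impI ballI)
  fix p i assume p: "Suc p = n" and i: "i \<in> B p"
  have "mat_vec (B (Suc p)) (D p) y i = mat_vec (B (Suc p)) (D p) x i"
    by (rule mat_vec_cong) (use assms(2) p in auto)
  then show "mat_vec (B (Suc p)) (D p) y i \<in> J" using assms(1) p i by (simp add: cycle_mod_def)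
qed

lemma boundary_mod_of_eq:
  assumes "boundary_mod J B D n x" "\<And>i. i \<in> B n \<Longrightarrow> x i = y i"
  shows "boundary_mod J B D n y"
  using assms by (auto simp: boundary_mod_def)

lemma cycle_mod_comb:
  assumes J: "self.subspace J" and "cycle_mod J B D n z" "\<And>a. a \<in> K \<Longrightarrow> cycle_mod J B D n (v a)"
  shows "cycle_mod J B D n (\<lambda>i. s0 * z i + (\<Sum>a\<in>K. s a * v a i))"
  using assms(2,3) unfolding cycle_mod_def mat_vec_add mat_vec_mult mat_vec_sum
  by (auto intro!: self.subspace_add[OF J] self.subspace_sum[OF J] self.subspace_scale[OF J])

lemma boundary_mod_comb:
  assumes J: "self.subspace J" and z: "boundary_mod J B D n z" and v: "\<And>a. a \<in> K \<Longrightarrow> boundary_mod J B D n (v a)"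
  shows "boundary_mod J B D n (\<lambda>i. s0 * z i + (\<Sum>a\<in>K. s a * v a i))"
proof -
  obtain w0 where w0: "\<And>i. i \<in> B n \<Longrightarrow> z i - mat_vec (B (Suc n)) (D n) w0 i \<in> J"
    using z by (auto simp: boundary_mod_def)
  obtain w where w: "\<And>a i. a \<in> K \<Longrightarrow> i \<in> B n \<Longrightarrow> v a i - mat_vec (B (Suc n)) (D n) (w a) i \<in> J"
    using v unfolding boundary_mod_def by metis
  have "s0 * (z i - mat_vec (B (Suc n)) (D n) w0 i) + (\<Sum>a\<in>K. s a * (v a i - mat_vec (B (Suc n)) (D n) (w a) i)) \<in> J"
    if "i \<in> B n" for i
    using w0 w that by (intro self.subspace_add[OF J] self.subspace_sum[OF J] self.subspace_scale[OF J]) auto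
  then show ?thesis
    unfolding boundary_mod_def
    by (intro exI[of _ "\<lambda>j. s0 * w0 j + (\<Sum>a\<in>K. s a * w a j)"])
      (simp add: mat_vec_add mat_vec_mult mat_vec_sum right_diff_distrib sum_subtractf algebra_simps)
qed

lemma supported_in_span_unit_vec:
  assumes "finite A" "\<And>i. i \<notin> A \<Longrightarrow> x i = (0 :: 'k::field)"
  shows "x \<in> fn.span (unit_vec ` A)"
proof -
  have "x = (\<Sum>k\<in>A. (\<lambda>i. x k * unit_vec k i))"
    using assms(2) by (intro ext, unfold fn_sum_apply sum_mult_unit_vec[OF assms(1)]) simp
  moreover have "(\<Sum>k\<in>A. (\<lambda>i. x k * unit_vec k i)) \<in> fn.span (unit_vec ` A)"
    by (intro fn.span_sum fn.span_scale fn.span_base) auto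
  ultimately show ?thesis by simp
qed

text \<open>
  Boundaries that are zero outside \<open>B n\<close> have a finite basis; the vectors that extend it to a basis of
  the cycles represent a basis of the homology.
\<close>

lemma homology_basis_exists:
  fixes B :: "nat \<Rightarrow> 'i set" and D :: "nat \<Rightarrow> 'i \<Rightarrow> 'i \<Rightarrow> 'k::field"
  assumes cx: "complex_mod {0} B D"
  shows "\<exists>(K :: ('i \<Rightarrow> 'k) set) v. homology_basis id (cycle_mod {0} B D n) (boundary_mod {0} B D n) K v"
proof -
  have fin: "finite (B n)" using cx by (simp add: complex_mod_def)
  let ?Z = "{x. cycle_mod {0} B D n x \<and> (\<forall>i. i \<notin> B n \<longrightarrow> x i = 0)}"
  let ?W = "{x. boundary_mod {0} B D n x \<and> (\<forall>i. i \<notin> B n \<longrightarrow> x i = 0)}"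
  have WZ: "?W \<subseteq> ?Z"
  proof safe
    fix x assume "boundary_mod {0} B D n x"
    then obtain w where w: "\<And>i. i \<in> B n \<Longrightarrow> mat_vec (B (Suc n)) (D n) w i = x i"
      by (auto simp: boundary_mod_def)
    have "cycle_mod {0} B D n (mat_vec (B (Suc n)) (D n) w)"
      using cx by (auto simp: cycle_mod_def complex_mod_def)
    then show "cycle_mod {0} B D n x" by (rule cycle_mod_cong) (rule w)
  qed
  have b0: "boundary_mod {0} B D n (\<lambda>_. 0)"
    unfolding boundary_mod_def by (rule exI[of _ "\<lambda>_. 0"]) (simp add: mat_vec_def)
  then have c0: "cycle_mod {0} B D n (\<lambda>_. 0)" using WZ by auto
  have Z: "fn.subspace ?Z"
    unfolding fn.subspace_def
  proof (intro conjI ballI allI)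
    fix x y assume x: "x \<in> ?Z" and y: "y \<in> ?Z"
    from cycle_mod_comb[OF self.subspace_single_0, of B D n x "{()}" "\<lambda>_. y" 1 "\<lambda>_. 1"] x y
    show "x + y \<in> ?Z" by (simp add: plus_fun_def)
  next
    fix c x assume x: "x \<in> ?Z"
    from cycle_mod_comb[OF self.subspace_single_0, of B D n x "{}" _ c] x
    show "(\<lambda>i. c * x i) \<in> ?Z" by simp
  qed (use c0 in \<open>simp add: zero_fun_def\<close>)
  have W: "fn.subspace ?W"
    unfolding fn.subspace_def
  proof (intro conjI ballI allI)
    fix x y assume x: "x \<in> ?W" and y: "y \<in> ?W"
    from boundary_mod_comb[OF self.subspace_single_0, of B D n x "{()}" "\<lambda>_. y" 1 "\<lambda>_. 1"] x y
    show "x + y \<in> ?W" by (simp add: plus_fun_def)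
  next
    fix c x assume x: "x \<in> ?W"
    from boundary_mod_comb[OF self.subspace_single_0, of B D n x "{}" _ c] x
    show "(\<lambda>i. c * x i) \<in> ?W" by simp
  qed (use b0 in \<open>simp add: zero_fun_def\<close>)
  obtain Bw where Bw: "Bw \<subseteq> ?W" "fn.independent Bw" "?W \<subseteq> fn.span Bw"
    using fn.maximal_independent_subset[of ?W] by blast
  have BwZ: "Bw \<subseteq> ?Z" using Bw(1) WZ by (rule subset_trans)
  obtain Bz where Bz: "Bw \<subseteq> Bz" "Bz \<subseteq> ?Z" "fn.independent Bz" "?Z \<subseteq> fn.span Bz"
    by (rule fn.maximal_independent_subset_extend[OF BwZ Bw(2)])
  have "?Z \<subseteq> fn.span (unit_vec ` B n)"
    using supported_in_span_unit_vec[OF fin] by auto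
  then have finz: "finite Bz"
    using fn.independent_span_bound[OF finite_imageI[OF fin] Bz(3)] Bz(2) by blast
  define K where "K = Bz - Bw"
  have "homology_basis id (cycle_mod {0} B D n) (boundary_mod {0} B D n) K (\<lambda>a. a)"
    unfolding homology_basis_def
  proof (intro conjI ballI allI impI)
    show "finite K" using finz by (simp add: K_def)
    show "cycle_mod {0} B D n a" if "a \<in> K" for a using that Bz(2) by (auto simp: K_def)
  next
    fix z assume z: "cycle_mod {0} B D n z"
    define z' where "z' = (\<lambda>i. if i \<in> B n then z i else 0)"
    have "z' \<in> ?Z" using cycle_mod_cong[OF z, of z'] by (simp add: z'_def)
    then have "z' \<in> fn.span Bz" using Bz(4) by blast
    then obtain r where r: "z' = (\<Sum>b\<in>Bz. (\<lambda>i. r b * b i))"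
      using finz by (auto simp: fn.span_finite)
    also have "\<dots> = (\<Sum>b\<in>K. (\<lambda>i. r b * b i)) + (\<Sum>b\<in>Bw. (\<lambda>i. r b * b i))"
      unfolding K_def by (rule sum.subset_diff[OF Bz(1) finz])
    finally have z'i: "z' i = (\<Sum>b\<in>K. r b * b i) + (\<Sum>b\<in>Bw. r b * b i)" for i
      by (simp add: fn_sum_apply)
    have "boundary_mod {0} B D n (\<lambda>i. 0 * 0 + (\<Sum>b\<in>Bw. r b * b i))"
      by (rule boundary_mod_comb[OF self.subspace_single_0 b0]) (use Bw(1) in auto)
    then have "boundary_mod {0} B D n (\<lambda>i. z i - (\<Sum>a\<in>K. id (r a) * a i))"
    proof (rule boundary_mod_of_eq)
      fix i assume "i \<in> B n"
      then show "0 * 0 + (\<Sum>b\<in>Bw. r b * b i) = z i - (\<Sum>a\<in>K. id (r a) * a i)"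
        using z'i[of i] by (simp add: z'_def)
    qed
    then show "\<exists>c. boundary_mod {0} B D n (\<lambda>i. z i - (\<Sum>a\<in>K. id (c a) * a i))" by blast
  next
    fix c a assume bd: "boundary_mod {0} B D n (\<lambda>i. \<Sum>a\<in>K. id (c a) * a i)" and a: "a \<in> K"
    have "(\<Sum>a\<in>K. (\<lambda>i. c a * a i)) \<in> ?W"
      using bd Bz(2) by (auto simp: fn_sum_apply[abs_def] fun_eq_iff K_def intro!: sum.neutral)
    then have "(\<Sum>a\<in>K. (\<lambda>i. c a * a i)) \<in> fn.span Bw" using Bw(3) by blast
    then obtain r where r: "(\<Sum>a\<in>K. (\<lambda>i. c a * a i)) = (\<Sum>b\<in>Bw. (\<lambda>i. r b * b i))"
      using finite_subset[OF Bz(1) finz] by (auto simp: fn.span_finite)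
    define c' where "c' b = (if b \<in> Bw then - r b else c b)" for b
    have "(\<Sum>b\<in>Bz. (\<lambda>i. c' b * b i)) = (\<Sum>b\<in>K. (\<lambda>i. c' b * b i)) + (\<Sum>b\<in>Bw. (\<lambda>i. c' b * b i))"
      unfolding K_def by (rule sum.subset_diff[OF Bz(1) finz])
    also have "(\<Sum>b\<in>K. (\<lambda>i. c' b * b i)) = (\<Sum>b\<in>K. (\<lambda>i. c b * b i))"
      by (intro sum.cong) (auto simp: K_def c'_def)
    also have "(\<Sum>b\<in>Bw. (\<lambda>i. c' b * b i)) = - (\<Sum>b\<in>Bw. (\<lambda>i. r b * b i))"
      unfolding sum_negf[symmetric] by (intro sum.cong) (auto simp: c'_def fun_eq_iff)
    finally have "(\<Sum>b\<in>Bz. (\<lambda>i. c' b * b i)) = 0" using r by (simp add: zero_fun_def)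
    then have "c' a = 0"
      using fn.independentD[OF Bz(3) finz subset_refl] a by (auto simp: K_def)
    then show "c a = 0" using a by (simp add: c'_def K_def)
  qed
  then show ?thesis by blast
qed

text \<open>
  Restricted to \<open>B n\<close>, basis cycles are linearly independent vectors of length \<open>card (B n)\<close>.
\<close>

lemma card_homology_basis_le:
  fixes B :: "nat \<Rightarrow> 'i set" and D :: "nat \<Rightarrow> 'i \<Rightarrow> 'i \<Rightarrow> 'k::field"
  assumes fin: "finite (B n)"
    and "homology_basis id (cycle_mod {0} B D n) (boundary_mod {0} B D n) K v"
  shows "card K \<le> card (B n)"
proof -
  have K: "finite K" and ind: "\<And>c. boundary_mod {0} B D n (\<lambda>i. \<Sum>a\<in>K. c a * v a i) \<Longrightarrow> \<forall>a\<in>K. c a = 0"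
    using assms(2) by (auto simp: homology_basis_def)
  define r where "r a = (\<lambda>i. if i \<in> B n then v a i else 0)" for a
  have ind': "\<forall>a\<in>K. c a = 0" if "(\<Sum>a\<in>K. (\<lambda>i. c a * r a i)) = 0" for c
  proof (rule ind)
    have "(\<Sum>a\<in>K. c a * v a i) = 0" if "i \<in> B n" for i
      using fun_cong[OF \<open>(\<Sum>a\<in>K. (\<lambda>i. c a * r a i)) = 0\<close>, of i] that by (simp add: fn_sum_apply r_def)
    then show "boundary_mod {0} B D n (\<lambda>i. \<Sum>a\<in>K. c a * v a i)"
      unfolding boundary_mod_def by (intro exI[of _ "\<lambda>_. 0"]) (simp add: mat_vec_def)
  qed
  have "fn.dim (fn.span (r ` K)) = fn.dim {0 :: 'i \<Rightarrow> 'k} + card K"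
  proof (rule fn.dim_quotient[where v = r and T = "{}"])
    fix z assume "z \<in> fn.span (r ` K)"
    then show "\<exists>c. z - (\<Sum>a\<in>K. (\<lambda>i. c a * r a i)) \<in> {0}"
    proof (induction rule: fn.span_induct_alt)
      case base
      show ?case by (rule exI[of _ "\<lambda>_. 0"]) (auto simp: zero_fun_def[symmetric])
    next
      case (step k x y)
      then obtain a where a: "x = r a" "a \<in> K" by blast
      from step obtain c where "y - (\<Sum>a\<in>K. (\<lambda>i. c a * r a i)) \<in> {0}" by blast
      then have c: "y = (\<Sum>a\<in>K. (\<lambda>i. c a * r a i))" by simp
      have "(\<Sum>b\<in>K. (k * unit_vec a b) * r b i) = k * r a i" for i
        using sum_mult_unit_vec[OF K, of "\<lambda>b. k * r b i" a] a(2)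
        by (simp add: mult_ac eq_commute[of a])
      then show ?case using a c
        by (intro exI[of _ "\<lambda>b. k * unit_vec a b + c b"])
          (simp add: fun_eq_iff fn_sum_apply distrib_right sum.distrib)
    qed
  next
    fix c assume "(\<Sum>a\<in>K. (\<lambda>i. c a * r a i)) \<in> {0 :: 'i \<Rightarrow> 'k}"
    then show "\<forall>a\<in>K. c a = 0" using ind' by simp
  qed (use K in \<open>auto intro: fn.span_base fn.span_zero\<close>)
  moreover have "fn.dim {0 :: 'i \<Rightarrow> 'k} = 0"
    by (rule fn.dim_unique[of "{}"]) (auto simp: fn.span_empty fn.independent_empty)
  moreover have "fn.dim (fn.span (r ` K)) \<le> card (unit_vec ` B n :: ('i \<Rightarrow> 'k) set)"
  proof (rule fn.dim_le_card)
    have "r ` K \<subseteq> fn.span (unit_vec ` B n)"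
      by (auto simp: r_def intro!: supported_in_span_unit_vec[OF fin])
    then show "fn.span (r ` K) \<subseteq> fn.span (unit_vec ` B n)" by (rule fn.span_minimal) simp
  qed (use fin in simp)
  ultimately show ?thesis using card_image_le[OF fin, of "unit_vec :: 'i \<Rightarrow> 'i \<Rightarrow> 'k"] by linarith
qed


section \<open>Polynomials in a set of variables\<close>

abbreviation Const :: "'k::field \<Rightarrow> 'k mpoly" where
  "Const \<equiv> Poly_Mapping.single 0"

abbreviation monomial :: "(nat \<Rightarrow>\<^sub>0 nat) \<Rightarrow> 'k::field mpoly" where
  "monomial m \<equiv> Poly_Mapping.single m 1"

lemma Const_mult_single: "Const c * Poly_Mapping.single m a = Poly_Mapping.single m (c * a)"
  by (simp add: mult_single)

lemma Const_add: "Const (a + b) = Const a + Const b"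
  by (simp add: single_add)

lemma Const_mult: "Const (a * b) = Const a * Const b"
  by (simp add: mult_single)

interpretation poly: vector_space "\<lambda>(c::'k::field) (p::'k mpoly). Const c * p"
  by unfold_locales (simp_all add: distrib_left distrib_right Const_add mult_single flip: mult.assoc)

declare poly.scale_scale [simp del]

lemma mpoly_decomposition:
  fixes p :: "'k::field mpoly"
  shows "p = (\<Sum>m\<in>Poly_Mapping.keys p. Const (Poly_Mapping.lookup p m) * monomial m)"
proof (rule poly_mapping_eqI)
  fix m
  have "Poly_Mapping.lookup (\<Sum>m\<in>Poly_Mapping.keys p. Const (Poly_Mapping.lookup p m) * monomial m) m =
      (\<Sum>m'\<in>Poly_Mapping.keys p. if m' = m then Poly_Mapping.lookup p m else 0)"
    unfolding lookup_sum by (intro sum.cong refl) (simp add: Const_mult_single lookup_single when_def)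
  then show "Poly_Mapping.lookup p m =
      Poly_Mapping.lookup (\<Sum>m\<in>Poly_Mapping.keys p. Const (Poly_Mapping.lookup p m) * monomial m) m"
    by (simp add: in_keys_iff)
qed

definition linear_ext :: "((nat \<Rightarrow>\<^sub>0 nat) \<Rightarrow> 'k::field mpoly) \<Rightarrow> 'k mpoly \<Rightarrow> 'k mpoly" where
  "linear_ext g p = (\<Sum>m\<in>Poly_Mapping.keys p. Const (Poly_Mapping.lookup p m) * g m)"

lemma linear_ext_add: "linear_ext g (p + q) = linear_ext g p + linear_ext g q"
  unfolding linear_ext_def
  by (rule setsum_keys_plus_distrib) (simp_all add: Const_add distrib_right)

lemma linear_ext_zero [simp]: "linear_ext g 0 = 0"
  by (simp add: linear_ext_def)

lemma linear_ext_minus: "linear_ext g (- p) = - linear_ext g p"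
  using linear_ext_add[of g p "- p"] by (simp add: eq_neg_iff_add_eq_0 add.commute)

lemma linear_ext_diff: "linear_ext g (p - q) = linear_ext g p - linear_ext g q"
  using linear_ext_add[of g p "- q"] by (simp add: linear_ext_minus)

lemma linear_ext_sum: "linear_ext g (\<Sum>a\<in>A. p a) = (\<Sum>a\<in>A. linear_ext g (p a))"
  by (induction A rule: infinite_finite_induct) (auto simp: linear_ext_add)

lemma linear_ext_single: "linear_ext g (Poly_Mapping.single m c) = Const c * g m"
  by (cases "c = 0") (simp_all add: linear_ext_def)

lemma mpoly_induct:
  assumes "\<And>p q. P p \<Longrightarrow> P q \<Longrightarrow> P (p + q)" "\<And>m c. P (Poly_Mapping.single m c)"
  shows "P (p :: 'k::field mpoly)"
proof -
  have "P (\<Sum>m\<in>A. Const (Poly_Mapping.lookup p m) * monomial m)" if "finite A" for A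
    using that
  proof (induction A rule: finite_induct)
    case empty
    show ?case using assms(2)[of 0 0] by simp
  next
    case (insert m A)
    then show ?case by (simp add: assms Const_mult_single)
  qed
  then show ?thesis by (subst mpoly_decomposition) simp
qed


text \<open>\<open>restrict_vars V\<close> sets the variables outside \<open>V\<close> to zero.\<close>

definition restrict_vars :: "nat set \<Rightarrow> 'k::field mpoly \<Rightarrow> 'k mpoly" where
  "restrict_vars V = linear_ext (\<lambda>m. if Poly_Mapping.keys m \<subseteq> V then monomial m else 0)"

lemma keys_add_nat: "Poly_Mapping.keys (m + m') = Poly_Mapping.keys m \<union> Poly_Mapping.keys (m' :: nat \<Rightarrow>\<^sub>0 nat)"
  by (auto simp: in_keys_iff lookup_add)

lemma restrict_single:
  "restrict_vars V (Poly_Mapping.single m c) = (if Poly_Mapping.keys m \<subseteq> V then Poly_Mapping.single m c else 0)"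
  by (simp add: restrict_vars_def linear_ext_single Const_mult_single)

lemma restrict_add: "restrict_vars V (p + q) = restrict_vars V p + restrict_vars V q"
  by (simp add: restrict_vars_def linear_ext_add)

lemma restrict_diff: "restrict_vars V (p - q) = restrict_vars V p - restrict_vars V q"
  by (simp add: restrict_vars_def linear_ext_diff)

lemma restrict_zero [simp]: "restrict_vars V 0 = 0"
  by (simp add: restrict_vars_def)

lemma restrict_sum: "restrict_vars V (\<Sum>a\<in>A. p a) = (\<Sum>a\<in>A. restrict_vars V (p a))"
  by (simp add: restrict_vars_def linear_ext_sum)

lemma restrict_mult: "restrict_vars V (p * q) = restrict_vars V p * restrict_vars V q"
proof (induction p rule: mpoly_induct)
  case (2 m c)
  show ?case
    by (induction q rule: mpoly_induct)
      (auto simp: distrib_left restrict_add restrict_single mult_single keys_add_nat)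
qed (simp add: distrib_right restrict_add)

lemma restrict_Const [simp]: "restrict_vars V (Const c) = Const c"
  by (simp add: restrict_single)

lemma restrict_one [simp]: "restrict_vars V 1 = 1"
  using restrict_Const[of V 1] by simp

lemma restrict_restrict [simp]: "restrict_vars V (restrict_vars V p) = restrict_vars V p"
  by (induction p rule: mpoly_induct) (simp_all add: restrict_add restrict_single)

lemma restrict_restrict_subset: "V \<subseteq> W \<Longrightarrow> restrict_vars W (restrict_vars V p) = restrict_vars V p"
  by (induction p rule: mpoly_induct) (auto simp add: restrict_add restrict_single)


lemma lookup_restrict:
  "Poly_Mapping.lookup (restrict_vars V p) m = (if Poly_Mapping.keys m \<subseteq> V then Poly_Mapping.lookup p m else 0)"
  by (induction p rule: mpoly_induct) (auto simp add: restrict_add lookup_add restrict_single lookup_single when_def)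

lemma restrict_id_iff: "restrict_vars V p = p \<longleftrightarrow> (\<forall>m\<in>Poly_Mapping.keys p. Poly_Mapping.keys m \<subseteq> V)"
  by (auto simp: poly_mapping_eq_iff fun_eq_iff lookup_restrict in_keys_iff split: if_splits)

lemma restrict_mat_vec: "restrict_vars V (mat_vec B D v i) = mat_vec B (\<lambda>i j. restrict_vars V (D i j)) (\<lambda>j. restrict_vars V (v j)) i"
  by (simp add: mat_vec_def restrict_sum restrict_mult)

text \<open>
  The constant coefficient is the restriction to the empty set of variables, hence multiplicative.
\<close>

lemma const_coeff_eq: "Const (const_coeff p) = restrict_vars {} p"
  by (rule poly_mapping_eqI) (auto simp: lookup_restrict const_coeff_def lookup_single when_def)

lemma const_coeff_add: "const_coeff (p + q) = const_coeff p + const_coeff q"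
  by (simp add: const_coeff_def lookup_add)

lemma const_coeff_diff: "const_coeff (p - q) = const_coeff p - const_coeff q"
  by (simp add: const_coeff_def lookup_minus)

lemma const_coeff_zero [simp]: "const_coeff 0 = 0"
  by (simp add: const_coeff_def)

lemma const_coeff_Const [simp]: "const_coeff (Const c) = c"
  by (simp add: const_coeff_def)

lemma const_coeff_one [simp]: "const_coeff 1 = 1"
  by (simp add: const_coeff_def)

lemma const_coeff_mult: "const_coeff (p * q) = const_coeff p * const_coeff q"
  using restrict_mult[of "{}" p q] unfolding const_coeff_eq[symmetric] Const_mult[symmetric] by (metis const_coeff_Const)

lemma const_coeff_sum: "const_coeff (\<Sum>a\<in>A. p a) = (\<Sum>a\<in>A. const_coeff (p a))"
  by (simp add: const_coeff_def lookup_sum)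

lemma const_coeff_restrict [simp]: "const_coeff (restrict_vars V p) = const_coeff p"
  by (simp add: const_coeff_def lookup_restrict)

lemma const_coeff_mat_vec:
  "const_coeff (mat_vec B D v i) = mat_vec B (\<lambda>i j. const_coeff (D i j)) (\<lambda>j. const_coeff (v j)) i"
  by (simp add: mat_vec_def const_coeff_sum const_coeff_mult)

text \<open>
  The ideal of all variables of the ambient ring, whose quotient is \<open>k\<close>.
\<close>

definition maximal :: "'k::field mpoly set" where
  "maximal = {p. const_coeff p = 0}"

lemma subspace_maximal: "self.subspace maximal"
  by (simp add: self.subspace_def maximal_def const_coeff_add const_coeff_mult)

text \<open>
  \<open>ideal_in V I\<close>: \<open>I\<close> is an ideal of the polynomial ring \<open>k[V]\<close>.  Instead of the quotient \<open>k[V]/I\<close>,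
  all computations use the quotient of the ambient ring by \<open>lift_ideal V I\<close>, the preimage of \<open>I\<close> under
  \<open>restrict_vars V\<close>; the two quotients are isomorphic.
\<close>

definition ideal_in :: "nat set \<Rightarrow> 'k::field mpoly set \<Rightarrow> bool" where
  "ideal_in V I \<longleftrightarrow> 0 \<in> I \<and> (\<forall>p\<in>I. restrict_vars V p = p) \<and> (\<forall>p\<in>I. \<forall>q\<in>I. p + q \<in> I) \<and>
    (\<forall>p. \<forall>q\<in>I. restrict_vars V p * q \<in> I)"

definition lift_ideal :: "nat set \<Rightarrow> 'k::field mpoly set \<Rightarrow> 'k mpoly set" where
  "lift_ideal V I = {p. restrict_vars V p \<in> I}"

lemma ideal_in_mult: "ideal_in V I \<Longrightarrow> restrict_vars V p = p \<Longrightarrow> q \<in> I \<Longrightarrow> p * q \<in> I"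
  unfolding ideal_in_def by metis

lemma subspace_lift_ideal: "ideal_in V I \<Longrightarrow> self.subspace (lift_ideal V I)"
  by (auto simp: ideal_in_def lift_ideal_def self.subspace_def restrict_add restrict_mult)

lemma ideal_in_le_lift: "ideal_in V I \<Longrightarrow> I \<subseteq> lift_ideal V I"
  by (auto simp: ideal_in_def lift_ideal_def)


section \<open>Base change along disjoint variables\<close>

definition monom_part :: "nat set \<Rightarrow> (nat \<Rightarrow>\<^sub>0 nat) \<Rightarrow> nat \<Rightarrow>\<^sub>0 nat" where
  "monom_part V m = (\<Sum>i\<in>Poly_Mapping.keys m \<inter> V. Poly_Mapping.single i (Poly_Mapping.lookup m i))"

lemma lookup_monom_part: "Poly_Mapping.lookup (monom_part V m) i = (if i \<in> V then Poly_Mapping.lookup m i else 0)"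
proof -
  have "Poly_Mapping.lookup (monom_part V m) i =
      (\<Sum>j\<in>Poly_Mapping.keys m \<inter> V. if j = i then Poly_Mapping.lookup m i else 0)"
    unfolding monom_part_def lookup_sum by (intro sum.cong) (auto simp: lookup_single when_def)
  then show ?thesis by (auto simp: in_keys_iff)
qed

lemma monom_part_add: "monom_part V (m + m') = monom_part V m + monom_part V m'"
  by (rule poly_mapping_eqI) (simp add: lookup_monom_part lookup_add)

lemma monom_part_decomposition: "monom_part V m + monom_part (- V) m = m"
  by (rule poly_mapping_eqI) (simp add: lookup_monom_part lookup_add)

lemma keys_monom_part: "Poly_Mapping.keys (monom_part V m) = Poly_Mapping.keys m \<inter> V"
  by (auto simp: in_keys_iff lookup_monom_part split: if_splits)

lemma monom_part_id: "Poly_Mapping.keys m \<subseteq> V \<Longrightarrow> monom_part V m = m"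
  by (rule poly_mapping_eqI) (auto simp add: lookup_monom_part in_keys_iff)

lemma monom_part_zero: "Poly_Mapping.keys m \<subseteq> - V \<Longrightarrow> monom_part V m = 0"
  by (rule poly_mapping_eqI) (auto simp add: lookup_monom_part in_keys_iff)

text \<open>The \<open>k[V]\<close>-linear extension of a \<open>k\<close>-linear functional on the polynomials without variables in \<open>V\<close>.\<close>

definition coefficient :: "nat set \<Rightarrow> ('k mpoly \<Rightarrow> 'k) \<Rightarrow> 'k::field mpoly \<Rightarrow> 'k mpoly" where
  "coefficient V \<phi> = linear_ext (\<lambda>m. Const (\<phi> (monomial (monom_part (- V) m))) * monomial (monom_part V m))"

lemma coefficient_single:
  "coefficient V \<phi> (Poly_Mapping.single m c) =
    Const (c * \<phi> (monomial (monom_part (- V) m))) * monomial (monom_part V m)"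
  by (simp add: coefficient_def linear_ext_single Const_mult mult.assoc)

lemma coefficient_zero [simp]: "coefficient V \<phi> 0 = 0"
  by (simp add: coefficient_def)

lemma coefficient_add: "coefficient V \<phi> (p + q) = coefficient V \<phi> p + coefficient V \<phi> q"
  by (simp add: coefficient_def linear_ext_add)

lemma coefficient_sum: "coefficient V \<phi> (\<Sum>a\<in>A. p a) = (\<Sum>a\<in>A. coefficient V \<phi> (p a))"
  by (simp add: coefficient_def linear_ext_sum)

lemma restrict_coefficient: "restrict_vars V (coefficient V \<phi> p) = coefficient V \<phi> p"
  by (induction p rule: mpoly_induct)
    (simp_all add: coefficient_add restrict_add coefficient_single restrict_mult restrict_single keys_monom_part)

text \<open>
  Linearity over \<open>k[V]\<close> is what makes coordinates of solutions of a linear system over \<open>k[V]\<close> solutions again.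
\<close>

lemma coefficient_mult:
  assumes "restrict_vars V p = p"
  shows "coefficient V \<phi> (p * q) = p * coefficient V \<phi> q"
proof -
  have "coefficient V \<phi> (restrict_vars V p * q) = restrict_vars V p * coefficient V \<phi> q"
  proof (induction p rule: mpoly_induct)
    case (2 m c)
    show ?case
    proof (induction q rule: mpoly_induct)
      case (2 m' c')
      show ?case
        by (simp add: restrict_single mult_single coefficient_single monom_part_add monom_part_id
            monom_part_zero mult_ac add_ac)
    qed (simp add: distrib_left coefficient_add)
  qed (simp add: distrib_right restrict_add coefficient_add)
  then show ?thesis using assms by simp
qed

lemma coefficient_complement:
  assumes \<phi>: "Vector_Spaces.linear (\<lambda>c p. Const c * p) (*) \<phi>" and "restrict_vars (- V) p = p"
  shows "coefficient V \<phi> p = Const (\<phi> p)"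
proof -
  interpret \<phi>: Vector_Spaces.linear "\<lambda>c p. Const c * p" "(*)" \<phi> by fact
  have "coefficient V \<phi> (restrict_vars (- V) p) = Const (\<phi> (restrict_vars (- V) p))"
  proof (induction p rule: mpoly_induct)
    case (2 m c)
    have "\<phi> (Poly_Mapping.single m c) = c * \<phi> (monomial m)"
      using \<phi>.scale[of c "monomial m"] by (simp add: Const_mult_single)
    then show ?case
      by (auto simp: restrict_single coefficient_single monom_part_id monom_part_zero \<phi>.zero mult_single)
  qed (simp add: restrict_add coefficient_add \<phi>.add Const_add)
  then show ?thesis using assms(2) by simp
qed


text \<open>
  The ideal of the ambient ring whose quotient is \<open>k[V1]/I1 \<otimes> k[V2]/I2\<close>: the variables outside both sets are
  set to zero as well.
\<close>

definition join_ideals :: "nat set \<Rightarrow> nat set \<Rightarrow> 'k::field mpoly set \<Rightarrow> 'k mpoly set \<Rightarrow> 'k mpoly set" where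
  "join_ideals V1 V2 I1 I2 = self.span (I1 \<union> I2 \<union> mvar ` (- (V1 \<union> V2)))"

lemma subspace_join: "self.subspace (join_ideals V1 V2 I1 I2)"
  by (simp add: join_ideals_def)

lemma join_commute: "join_ideals V1 V2 I1 I2 = join_ideals V2 V1 I2 I1"
  by (simp add: join_ideals_def Un_ac)

lemma join_left: "p \<in> I1 \<Longrightarrow> p \<in> join_ideals V1 V2 I1 I2"
  by (simp add: join_ideals_def self.span_base)

lemma join_right: "p \<in> I2 \<Longrightarrow> p \<in> join_ideals V1 V2 I1 I2"
  by (simp add: join_ideals_def self.span_base)

lemma join_mono: "I1 \<subseteq> A1 \<Longrightarrow> join_ideals V1 V2 I1 I2 \<subseteq> join_ideals V1 V2 A1 I2"
  unfolding join_ideals_def by (intro self.span_mono) blast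

lemma monomial_mem:
  assumes J: "self.subspace J" and "mvar i \<in> J" "i \<in> Poly_Mapping.keys m"
  shows "monomial m \<in> J"
proof -
  have "m = (m - Poly_Mapping.single i 1) + Poly_Mapping.single i 1"
    using assms(3) by (intro poly_mapping_eqI) (auto simp: lookup_add lookup_minus lookup_single when_def in_keys_iff)
  then have "monomial m = monomial (m - Poly_Mapping.single i 1) * mvar i"
    by (simp add: mvar_def mult_single)
  then show ?thesis using self.subspace_scale[OF J assms(2)] by metis
qed

text \<open>
  A \<open>k\<close>-basis of a complement of the ideal, with its coordinate functionals \<open>\<phi> b\<close>, which vanish on the
  ideal.  Every polynomial has only finitely many nonzero coordinates, and the expansion holds for each
  larger finite set of basis elements, so that one set serves for several polynomials.
\<close>

lemma complement_basis:
  fixes I :: "'k::field mpoly set"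
  assumes I: "ideal_in V I"
  obtains Bs :: "'k mpoly set" and \<phi> :: "'k mpoly \<Rightarrow> 'k mpoly \<Rightarrow> 'k" where
    "\<And>b. b \<in> Bs \<Longrightarrow> Vector_Spaces.linear (\<lambda>c p. Const c * p) (*) (\<phi> b)"
    "\<And>b p. b \<in> Bs \<Longrightarrow> p \<in> lift_ideal V I \<Longrightarrow> \<phi> b p = 0"
    "\<And>p. \<exists>A. finite A \<and> A \<subseteq> Bs \<and> (\<forall>A'. finite A' \<longrightarrow> A \<subseteq> A' \<longrightarrow> A' \<subseteq> Bs \<longrightarrow>
      p - (\<Sum>b\<in>A'. Const (\<phi> b p) * b) \<in> lift_ideal V I)"
proof -
  have W: "poly.subspace (lift_ideal V I)"
    using subspace_lift_ideal[OF I] by (simp add: poly.subspace_def self.subspace_def)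
  obtain B0 where B0: "B0 \<subseteq> lift_ideal V I" "poly.independent B0" "lift_ideal V I \<subseteq> poly.span B0"
    using poly.maximal_independent_subset[of "lift_ideal V I"] by blast
  have span0: "poly.span B0 = lift_ideal V I" using B0 W by (metis poly.span_subspace)
  obtain B where B: "B0 \<subseteq> B" "poly.independent B" "UNIV \<subseteq> poly.span B"
    using poly.maximal_independent_subset_extend[OF subset_UNIV B0(2)] by (metis subset_UNIV)
  have spanB: "poly.span B = UNIV" using B(3) by blast
  let ?r = "poly.representation B"
  show ?thesis
  proof (rule that[of "B - B0" "\<lambda>b p. ?r p b"])
    show "Vector_Spaces.linear (\<lambda>c p. Const c * p) (*) (\<lambda>p. ?r p b)" if "b \<in> B - B0" for b
      by (rule poly.linear_representation[OF B(2) spanB])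
    show "?r p b = 0" if "b \<in> B - B0" "p \<in> lift_ideal V I" for b p
    proof -
      have "?r p = poly.representation B0 p"
        by (rule poly.representation_extend[OF B(2) _ B(1)]) (use that span0 in auto)
      then show ?thesis using that poly.representation_ne_zero[of B0 p b] by auto
    qed
    fix p
    define A where "A = {b \<in> B - B0. ?r p b \<noteq> 0}"
    have fin: "finite {b. ?r p b \<noteq> 0}" by (rule poly.finite_representation)
    have "p - (\<Sum>b\<in>A'. Const (?r p b) * b) \<in> lift_ideal V I"
      if "finite A'" "A \<subseteq> A'" "A' \<subseteq> B - B0" for A'
    proof -
      have A'A: "(\<Sum>b\<in>A'. Const (?r p b) * b) = (\<Sum>b\<in>A. Const (?r p b) * b)"
        by (rule sum.mono_neutral_right) (use that in \<open>auto simp: A_def\<close>)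
      have "p = (\<Sum>b | ?r p b \<noteq> 0. Const (?r p b) * b)"
        by (rule poly.sum_nonzero_representation_eq[symmetric]) (use B(2) spanB in auto)
      also have "\<dots> = (\<Sum>b\<in>{b. ?r p b \<noteq> 0} - A. Const (?r p b) * b) + (\<Sum>b\<in>A. Const (?r p b) * b)"
        by (rule sum.subset_diff[OF _ fin]) (auto simp: A_def)
      finally have "p - (\<Sum>b\<in>A'. Const (?r p b) * b) = (\<Sum>b\<in>{b. ?r p b \<noteq> 0} - A. Const (?r p b) * b)"
        unfolding diff_eq_eq A'A .
      moreover have "(\<Sum>b\<in>{b. ?r p b \<noteq> 0} - A. Const (?r p b) * b) \<in> lift_ideal V I"
        using poly.representation_ne_zero[of B p] B0(1)
        by (intro poly.subspace_sum[OF W] poly.subspace_scale[OF W]) (auto simp: A_def)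
      ultimately show ?thesis by (simp only:)
    qed
    moreover have "finite A" "A \<subseteq> B - B0" using fin by (auto simp: A_def)
    ultimately show "\<exists>A. finite A \<and> A \<subseteq> B - B0 \<and> (\<forall>A'. finite A' \<longrightarrow> A \<subseteq> A' \<longrightarrow> A' \<subseteq> B - B0 \<longrightarrow>
      p - (\<Sum>b\<in>A'. Const (?r p b) * b) \<in> lift_ideal V I)"
      by blast
  qed
qed

text \<open>
  \<open>k[V1]/I1 \<otimes> k[V2]/I2\<close> is free over \<open>k[V1]/I1\<close>, with the basis \<open>Bs\<close> of \<open>k[V2]/I2\<close> over \<open>k\<close>.  The coordinates
  with respect to it are the \<open>k[V1]\<close>-linear extensions of the functionals \<open>\<phi> b\<close>.
\<close>

locale disjoint_base_change =
  fixes V1 V2 :: "nat set" and I2 :: "'k::field mpoly set"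
    and Bs :: "'k mpoly set" and \<phi> :: "'k mpoly \<Rightarrow> 'k mpoly \<Rightarrow> 'k"
  assumes disj: "V1 \<inter> V2 = {}" and I2: "ideal_in V2 I2"
    and lin: "\<And>b. b \<in> Bs \<Longrightarrow> Vector_Spaces.linear (\<lambda>c p. Const c * p) (*) (\<phi> b)"
    and vanish: "\<And>b p. b \<in> Bs \<Longrightarrow> p \<in> lift_ideal V2 I2 \<Longrightarrow> \<phi> b p = 0"
    and expand: "\<And>p. \<exists>A. finite A \<and> A \<subseteq> Bs \<and> (\<forall>A'. finite A' \<longrightarrow> A \<subseteq> A' \<longrightarrow> A' \<subseteq> Bs \<longrightarrow>
      p - (\<Sum>b\<in>A'. Const (\<phi> b p) * b) \<in> lift_ideal V2 I2)"
begin

abbreviation "coord b \<equiv> coefficient V1 (\<phi> b)"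

text \<open>
  By linearity it suffices to look at multiples of generators of the joined ideal by monomials without
  variables in \<open>V1\<close>.  For generators from \<open>I1\<close> the coordinate is a multiple of the generator; all others
  lie in the ideal on which \<open>\<phi> b\<close> vanishes.
\<close>

lemma coord_join:
  assumes I1: "ideal_in V1 I1" and b: "b \<in> Bs" and p: "p \<in> join_ideals V1 V2 I1 I2"
  shows "coord b p \<in> I1"
  using p unfolding join_ideals_def
proof (induction rule: self.span_induct_alt)
  case base
  show ?case using I1 by (simp add: ideal_in_def)
next
  case (step c x y)
  interpret \<phi>: Vector_Spaces.linear "\<lambda>c p. Const c * p" "(*)" "\<phi> b" by (rule lin[OF b])
  have add: "p \<in> I1 \<Longrightarrow> q \<in> I1 \<Longrightarrow> p + q \<in> I1" for p q using I1 by (simp add: ideal_in_def)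
  have zero: "0 \<in> I1" using I1 by (simp add: ideal_in_def)
  have "coord b (c * x) \<in> I1"
  proof (induction c rule: mpoly_induct)
    case (1 p q)
    then show ?case by (simp add: distrib_right coefficient_add add)
  next
    case (2 m c)
    let ?m1 = "monom_part V1 m" and ?m2 = "monom_part (- V1) m"
    have split: "Poly_Mapping.single m c * x = (Const c * monomial ?m1) * (monomial ?m2 * x)"
      by (simp add: mult_single monom_part_decomposition flip: mult.assoc)
    have m1: "restrict_vars V1 (Const c * monomial ?m1) = Const c * monomial ?m1"
      by (simp add: mult_single restrict_single keys_monom_part)
    have m2: "restrict_vars (- V1) (monomial ?m2) = monomial ?m2"
      by (simp add: restrict_single keys_monom_part)
    have "coord b (monomial ?m2 * x) \<in> I1"
      using step(1)
    proof (elim UnE)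
      assume x: "x \<in> I1"
      then have "restrict_vars V1 x = x" using I1 by (simp add: ideal_in_def)
      then have "coord b (monomial ?m2 * x) = x * Const (\<phi> b (monomial ?m2))"
        using coefficient_mult[of V1 x "\<phi> b" "monomial ?m2"]
        by (simp add: mult.commute coefficient_complement[OF lin[OF b] m2])
      then show ?thesis using ideal_in_mult[OF I1 restrict_Const x] by (simp add: mult.commute)
    next
      assume x: "x \<in> I2"
      have "restrict_vars V2 x = x" using I2 x by (simp add: ideal_in_def)
      then have x1: "restrict_vars (- V1) x = x"
        using restrict_restrict_subset[of V2 "- V1" x] disj by (metis disjoint_eq_subset_Compl inf_commute)
      have "restrict_vars (- V1) (monomial ?m2 * x) = monomial ?m2 * x" by (simp only: restrict_mult m2 x1)
      moreover have "monomial ?m2 * x \<in> lift_ideal V2 I2"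
        using self.subspace_scale[OF subspace_lift_ideal[OF I2]] ideal_in_le_lift[OF I2] x by blast
      ultimately show ?thesis using coefficient_complement[OF lin[OF b]] vanish[OF b] zero by simp
    next
      assume "x \<in> mvar ` (- (V1 \<union> V2))"
      then obtain i where i: "x = mvar i" "i \<notin> V1" "i \<notin> V2" by blast
      have x1: "restrict_vars (- V1) x = x" using i by (simp add: mvar_def restrict_single)
      have "restrict_vars (- V1) (monomial ?m2 * x) = monomial ?m2 * x" by (simp only: restrict_mult m2 x1)
      moreover have "x \<in> lift_ideal V2 I2"
        using i I2 by (simp add: mvar_def lift_ideal_def restrict_single ideal_in_def)
      then have "monomial ?m2 * x \<in> lift_ideal V2 I2"
        by (rule self.subspace_scale[OF subspace_lift_ideal[OF I2]])
      ultimately show ?thesis using coefficient_complement[OF lin[OF b]] vanish[OF b] zero by simp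
    qed
    then show ?case
      unfolding split coefficient_mult[OF m1] by (rule ideal_in_mult[OF I1 m1])
  qed
  then show ?case using step(2) by (simp add: coefficient_add add)
qed

lemma coord_expand:
  "\<exists>A. finite A \<and> A \<subseteq> Bs \<and> (\<forall>A'. finite A' \<longrightarrow> A \<subseteq> A' \<longrightarrow> A' \<subseteq> Bs \<longrightarrow>
    p - (\<Sum>b\<in>A'. coord b p * restrict_vars V2 b) \<in> join_ideals V1 V2 I1 I2)"
proof (induction p rule: mpoly_induct)
  case (1 p q)
  then obtain A A2 where "finite A" "A \<subseteq> Bs" "finite A2" "A2 \<subseteq> Bs"
    and *: "\<And>A'. finite A' \<Longrightarrow> A \<subseteq> A' \<Longrightarrow> A' \<subseteq> Bs \<Longrightarrow>
        p - (\<Sum>b\<in>A'. coord b p * restrict_vars V2 b) \<in> join_ideals V1 V2 I1 I2"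
      "\<And>A'. finite A' \<Longrightarrow> A2 \<subseteq> A' \<Longrightarrow> A' \<subseteq> Bs \<Longrightarrow>
        q - (\<Sum>b\<in>A'. coord b q * restrict_vars V2 b) \<in> join_ideals V1 V2 I1 I2"
    by blast
  moreover have "p + q - (\<Sum>b\<in>A'. coord b (p + q) * restrict_vars V2 b) \<in> join_ideals V1 V2 I1 I2"
    if "finite A'" "A \<union> A2 \<subseteq> A'" "A' \<subseteq> Bs" for A'
    using self.subspace_add[OF subspace_join *(1)[of A'] *(2)[of A']] that
    by (simp add: coefficient_add distrib_right sum.distrib algebra_simps)
  ultimately show ?case by (intro exI[of _ "A \<union> A2"]) auto
next
  case (2 m c)
  let ?J = "join_ideals V1 V2 I1 I2"
  let ?m1 = "monom_part V1 m" and ?m2 = "monom_part (- V1) m"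
  obtain A where *: "finite A \<and> A \<subseteq> Bs \<and> (\<forall>A'. finite A' \<longrightarrow> A \<subseteq> A' \<longrightarrow> A' \<subseteq> Bs \<longrightarrow>
      monomial ?m2 - (\<Sum>b\<in>A'. Const (\<phi> b (monomial ?m2)) * b) \<in> lift_ideal V2 I2)"
    using expand[of "monomial ?m2"] by (rule exE)
  from * have A: "finite A" "A \<subseteq> Bs" by simp_all
  from * have w: "monomial ?m2 - (\<Sum>b\<in>A'. Const (\<phi> b (monomial ?m2)) * b) \<in> lift_ideal V2 I2"
    if "finite A'" "A \<subseteq> A'" "A' \<subseteq> Bs" for A'
    using that by simp
  have tail: "monomial ?m2 - restrict_vars V2 (monomial ?m2) \<in> ?J"
  proof (cases "Poly_Mapping.keys ?m2 \<subseteq> V2")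
    case True
    then show ?thesis using self.subspace_0[OF subspace_join] by (simp add: restrict_single)
  next
    case False
    then obtain i where i: "i \<in> Poly_Mapping.keys ?m2" "i \<notin> V2" by blast
    then have "i \<notin> V1" by (simp add: keys_monom_part)
    then have "mvar i \<in> ?J" using i(2) by (auto simp: join_ideals_def intro!: self.span_base)
    from monomial_mem[OF subspace_join this i(1)] show ?thesis using False by (simp add: restrict_single)
  qed
  have "Poly_Mapping.single m c - (\<Sum>b\<in>A'. coord b (Poly_Mapping.single m c) * restrict_vars V2 b) \<in> ?J"
    if A': "finite A'" "A \<subseteq> A'" "A' \<subseteq> Bs" for A'
  proof -
    let ?w = "monomial ?m2 - (\<Sum>b\<in>A'. Const (\<phi> b (monomial ?m2)) * b)"
    have "restrict_vars V2 ?w \<in> ?J" using w[OF A'] by (intro join_right) (simp add: lift_ideal_def)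
    then have "(Const c * monomial ?m1) * ((monomial ?m2 - restrict_vars V2 (monomial ?m2)) + restrict_vars V2 ?w) \<in> ?J"
      by (intro self.subspace_scale[OF subspace_join] self.subspace_add[OF subspace_join] tail)
    moreover have "(monomial ?m2 - restrict_vars V2 (monomial ?m2)) + restrict_vars V2 ?w =
        monomial ?m2 - (\<Sum>b\<in>A'. Const (\<phi> b (monomial ?m2)) * restrict_vars V2 b)"
      by (simp add: restrict_diff restrict_sum restrict_mult)
    moreover have "(Const c * monomial ?m1) * monomial ?m2 = Poly_Mapping.single m c"
      by (simp add: mult_single monom_part_decomposition)
    moreover have "(Const c * monomial ?m1) * (\<Sum>b\<in>A'. Const (\<phi> b (monomial ?m2)) * restrict_vars V2 b) =
        (\<Sum>b\<in>A'. coord b (Poly_Mapping.single m c) * restrict_vars V2 b)"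
      unfolding sum_distrib_left coefficient_single Const_mult
      by (intro sum.cong refl) (simp only: mult_ac)
    ultimately show ?thesis by (simp only: right_diff_distrib)
  qed
  then show ?case using A by blast
qed

text \<open>
  Base change along a free extension preserves exactness: the coordinates of a vector are
  \<open>k[V1]\<close>-linear in it, so they can be lifted over \<open>k[V1]\<close> one at a time.
\<close>

lemma exact_base_change:
  fixes M :: "'x \<Rightarrow> 'y \<Rightarrow> 'k mpoly" and N :: "'y \<Rightarrow> 'z \<Rightarrow> 'k mpoly"
  assumes I1: "ideal_in V1 I1" and A1: "ideal_in V1 A1" and IA: "I1 \<subseteq> A1"
    and Y: "finite Y" and Z: "finite Z"
    and M: "\<And>x y. restrict_vars V1 (M x y) = M x y" and N: "\<And>y z. restrict_vars V1 (N y z) = N y z"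
    and ex: "\<And>v. (\<forall>x\<in>Q. mat_vec Y M v x \<in> lift_ideal V1 A1) \<longleftrightarrow>
      (\<exists>w. \<forall>y\<in>Y. v y - mat_vec Z N w y \<in> lift_ideal V1 I1)"
  shows "(\<forall>x\<in>Q. mat_vec Y M v x \<in> join_ideals V1 V2 A1 I2) \<longleftrightarrow>
    (\<exists>w. \<forall>y\<in>Y. v y - mat_vec Z N w y \<in> join_ideals V1 V2 I1 I2)"
proof
  let ?J = "join_ideals V1 V2 I1 I2"
  assume v: "\<forall>x\<in>Q. mat_vec Y M v x \<in> join_ideals V1 V2 A1 I2"
  have "\<forall>y. \<exists>A. finite A \<and> A \<subseteq> Bs \<and> (\<forall>A'. finite A' \<longrightarrow> A \<subseteq> A' \<longrightarrow> A' \<subseteq> Bs \<longrightarrow>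
      v y - (\<Sum>b\<in>A'. coord b (v y) * restrict_vars V2 b) \<in> ?J)"
    by (intro allI coord_expand)
  from choice[OF this] obtain A where *: "\<forall>y. finite (A y) \<and> A y \<subseteq> Bs \<and>
      (\<forall>A'. finite A' \<longrightarrow> A y \<subseteq> A' \<longrightarrow> A' \<subseteq> Bs \<longrightarrow>
        v y - (\<Sum>b\<in>A'. coord b (v y) * restrict_vars V2 b) \<in> ?J)"
    by (rule exE)
  from * have A: "finite (A y)" "A y \<subseteq> Bs" for y by simp_all
  from * have exp: "v y - (\<Sum>b\<in>A'. coord b (v y) * restrict_vars V2 b) \<in> ?J"
    if "finite A'" "A y \<subseteq> A'" "A' \<subseteq> Bs" for y A'
    using that by simp
  \<comment> \<open>One finite set of basis elements for all components of the vector.\<close>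
  define A' where "A' = (\<Union>y\<in>Y. A y)"
  have A': "finite A'" "A' \<subseteq> Bs" using A Y by (auto simp: A'_def)
  have "\<exists>w. \<forall>y\<in>Y. coord b (v y) - mat_vec Z N w y \<in> I1" if b: "b \<in> A'" for b
  proof -
    have "mat_vec Y M (\<lambda>y. coord b (v y)) x = coord b (mat_vec Y M v x)" for x
      unfolding mat_vec_def coefficient_sum by (simp add: coefficient_mult M)
    moreover have "coord b (mat_vec Y M v x) \<in> A1" if "x \<in> Q" for x
      by (rule coord_join[OF A1]) (use v b A'(2) that in auto)
    ultimately have "\<forall>x\<in>Q. mat_vec Y M (\<lambda>y. coord b (v y)) x \<in> lift_ideal V1 A1"
      using ideal_in_le_lift[OF A1] by auto
    then obtain w where w: "\<And>y. y \<in> Y \<Longrightarrow> coord b (v y) - mat_vec Z N w y \<in> lift_ideal V1 I1"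
      using ex[of "\<lambda>y. coord b (v y)"] by auto
    have "coord b (v y) - mat_vec Z N (\<lambda>z. restrict_vars V1 (w z)) y \<in> I1" if "y \<in> Y" for y
      using w[OF that] by (simp add: lift_ideal_def restrict_diff restrict_mat_vec restrict_coefficient N)
    then show ?thesis by blast
  qed
  then obtain w where w: "\<And>b y. b \<in> A' \<Longrightarrow> y \<in> Y \<Longrightarrow> coord b (v y) - mat_vec Z N (w b) y \<in> I1"
    by metis
  have "v y - mat_vec Z N (\<lambda>z. \<Sum>b\<in>A'. restrict_vars V2 b * w b z) y \<in> ?J" if y: "y \<in> Y" for y
  proof -
    have "v y - (\<Sum>b\<in>A'. coord b (v y) * restrict_vars V2 b) \<in> ?J"
      by (rule exp[OF A'(1) _ A'(2)]) (use y in \<open>auto simp: A'_def\<close>)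
    moreover have "(\<Sum>b\<in>A'. restrict_vars V2 b * (coord b (v y) - mat_vec Z N (w b) y)) \<in> ?J"
      by (intro self.subspace_sum[OF subspace_join] self.subspace_scale[OF subspace_join] join_left w y)
    ultimately have "(v y - (\<Sum>b\<in>A'. coord b (v y) * restrict_vars V2 b)) +
        (\<Sum>b\<in>A'. restrict_vars V2 b * (coord b (v y) - mat_vec Z N (w b) y)) \<in> ?J"
      by (rule self.subspace_add[OF subspace_join])
    then show ?thesis
      unfolding mat_vec_sum by (simp add: right_diff_distrib sum_subtractf mult.commute)
  qed
  then show "\<exists>w. \<forall>y\<in>Y. v y - mat_vec Z N w y \<in> ?J" by blast
next
  let ?J = "join_ideals V1 V2 A1 I2"
  assume "\<exists>w. \<forall>y\<in>Y. v y - mat_vec Z N w y \<in> join_ideals V1 V2 I1 I2"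
  then obtain w where w: "\<And>y. y \<in> Y \<Longrightarrow> v y - mat_vec Z N w y \<in> ?J"
    using join_mono[OF IA] by blast
  show "\<forall>x\<in>Q. mat_vec Y M v x \<in> ?J"
  proof
    fix x assume x: "x \<in> Q"
    have col: "mat_vec Y M (\<lambda>y. N y z) x \<in> A1" if z: "z \<in> Z" for z
    proof -
      have "N y z - mat_vec Z N (\<lambda>z'. if z' = z then 1 else 0) y \<in> lift_ideal V1 I1" for y
      proof -
        have "mat_vec Z N (\<lambda>z'. if z' = z then 1 else 0) y = (\<Sum>z'\<in>Z. if z' = z then N y z else 0)"
          unfolding mat_vec_def by (intro sum.cong) auto
        then show ?thesis using Z z self.subspace_0[OF subspace_lift_ideal[OF I1]] by simp
      qed
      then have "mat_vec Y M (\<lambda>y. N y z) x \<in> lift_ideal V1 A1" using ex x by blast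
      then show ?thesis by (simp add: lift_ideal_def restrict_mat_vec M N)
    qed
    have "mat_vec Y M (mat_vec Z N w) x = (\<Sum>z\<in>Z. w z * mat_vec Y M (\<lambda>y. N y z) x)"
      unfolding mat_vec_sum[symmetric] by (simp add: mat_vec_def[of Z] mult.commute)
    also have "\<dots> \<in> ?J"
      by (intro self.subspace_sum[OF subspace_join] self.subspace_scale[OF subspace_join] join_left col)
    finally show "mat_vec Y M v x \<in> ?J"
      using mat_vec_mem_cong[OF subspace_join, of Y v "mat_vec Z N w" V1 V2 A1 I2 M x] w by blast
  qed
qed

end

theorem resolution_base_change:
  fixes B :: "nat \<Rightarrow> 'i set" and I1 A1 I2 :: "'k::field mpoly set"
  assumes disj: "V1 \<inter> V2 = {}" and I1: "ideal_in V1 I1" and A1: "ideal_in V1 A1" and I2: "ideal_in V2 I2"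
    and res: "resolution_mod (lift_ideal V1 I1) (lift_ideal V1 A1) B D e"
    and D: "\<And>n i j. restrict_vars V1 (D n i j) = D n i j" and e: "\<And>i. restrict_vars V1 (e i) = e i"
  shows "resolution_mod (join_ideals V1 V2 I1 I2) (join_ideals V1 V2 A1 I2) B D e"
proof -
  obtain Bs :: "'k mpoly set" and \<phi> where B\<phi>:
    "\<And>b. b \<in> Bs \<Longrightarrow> Vector_Spaces.linear (\<lambda>c p. Const c * p) (*) (\<phi> b)"
    "\<And>b p. b \<in> Bs \<Longrightarrow> p \<in> lift_ideal V2 I2 \<Longrightarrow> \<phi> b p = 0"
    "\<And>p. \<exists>A. finite A \<and> A \<subseteq> Bs \<and> (\<forall>A'. finite A' \<longrightarrow> A \<subseteq> A' \<longrightarrow> A' \<subseteq> Bs \<longrightarrow>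
      p - (\<Sum>b\<in>A'. Const (\<phi> b p) * b) \<in> lift_ideal V2 I2)"
    by (rule complement_basis[OF I2], rule that)
  interpret disjoint_base_change V1 V2 I2 Bs \<phi>
    by (rule disjoint_base_change.intro[OF disj I2 B\<phi>])
  have IA: "I1 \<subseteq> A1"
  proof
    fix p assume p: "p \<in> I1"
    then have "p \<in> lift_ideal V1 A1"
      using ideal_in_le_lift[OF I1] resolution_ideal_le[OF subspace_lift_ideal[OF I1] subspace_lift_ideal[OF A1] res] by blast
    moreover have "restrict_vars V1 p = p" using I1 p by (simp add: ideal_in_def)
    ultimately show "p \<in> A1" by (simp add: lift_ideal_def)
  qed
  have fin: "finite (B n)" for n using res by (simp add: resolution_mod_def)
  show ?thesis
    unfolding resolution_mod_def
  proof (intro conjI allI fin)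
    obtain v where "(\<Sum>i\<in>B 0. e i * v i) - 1 \<in> lift_ideal V1 A1" using res by (auto simp: resolution_mod_def)
    then have "(\<Sum>i\<in>B 0. e i * restrict_vars V1 (v i)) - 1 \<in> A1"
      by (simp add: lift_ideal_def restrict_diff restrict_sum restrict_mult e)
    then show "\<exists>v. (\<Sum>i\<in>B 0. e i * v i) - 1 \<in> join_ideals V1 V2 A1 I2"
      by (intro exI[of _ "\<lambda>i. restrict_vars V1 (v i)"] join_left)
  next
    fix v
    have "(\<forall>x\<in>UNIV :: unit set. mat_vec (B 0) (\<lambda>_. e) v x \<in> join_ideals V1 V2 A1 I2) \<longleftrightarrow>
        (\<exists>w. \<forall>y\<in>B 0. v y - mat_vec (B (Suc 0)) (D 0) w y \<in> join_ideals V1 V2 I1 I2)"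
      by (rule exact_base_change[OF I1 A1 IA fin fin e D])
        (use res in \<open>simp add: resolution_mod_def boundary_mod_def mat_vec_def[of "B 0"]\<close>)
    then show "(\<Sum>i\<in>B 0. e i * v i) \<in> join_ideals V1 V2 A1 I2 \<longleftrightarrow>
        boundary_mod (join_ideals V1 V2 I1 I2) B D 0 v"
      by (simp add: boundary_mod_def mat_vec_def[of "B 0"])
  next
    fix n v
    have "(\<forall>x\<in>B n. mat_vec (B (Suc n)) (D n) v x \<in> join_ideals V1 V2 I1 I2) \<longleftrightarrow>
        (\<exists>w. \<forall>y\<in>B (Suc n). v y - mat_vec (B (Suc (Suc n))) (D (Suc n)) w y \<in> join_ideals V1 V2 I1 I2)"
      by (rule exact_base_change[OF I1 I1 subset_refl fin fin D D])
        (use res in \<open>simp add: resolution_mod_def boundary_mod_def cycle_mod_def\<close>)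
    then show "cycle_mod (join_ideals V1 V2 I1 I2) B D (Suc n) v \<longleftrightarrow>
        boundary_mod (join_ideals V1 V2 I1 I2) B D (Suc n) v"
      by (simp add: boundary_mod_def cycle_mod_def)
  qed
qed

text \<open>
  Base change along the second factor makes \<open>B\<close> a resolution of \<open>k[V1]/A1 \<otimes> k[V2]/A2\<close> over
  \<open>k[V1]/I1 \<otimes> k[V2]/A2\<close>, and base change along the first factor makes \<open>C\<close> a resolution of the latter ring
  over \<open>k[V1]/I1 \<otimes> k[V2]/I2\<close>.  These are the hypotheses of \<open>resolution_tot\<close>.
\<close>

theorem resolution_tensor:
  fixes B :: "nat \<Rightarrow> 'i set" and C :: "nat \<Rightarrow> 'j set" and I1 A1 I2 A2 :: "'k::field mpoly set"
  assumes disj: "V1 \<inter> V2 = {}"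
    and I1: "ideal_in V1 I1" and A1: "ideal_in V1 A1" and I2: "ideal_in V2 I2" and A2: "ideal_in V2 A2"
    and res1: "resolution_mod (lift_ideal V1 I1) (lift_ideal V1 A1) B D e"
    and D: "\<And>n i j. restrict_vars V1 (D n i j) = D n i j" and e: "\<And>i. restrict_vars V1 (e i) = e i"
    and res2: "resolution_mod (lift_ideal V2 I2) (lift_ideal V2 A2) C E e'"
    and E: "\<And>n i j. restrict_vars V2 (E n i j) = E n i j" and e': "\<And>i. restrict_vars V2 (e' i) = e' i"
  shows "resolution_mod (join_ideals V1 V2 I1 I2) (join_ideals V1 V2 A1 A2)
    (tot_index B C) (tot_mat D E) (\<lambda>(p, i, j). e i * e' j)"
proof (rule resolution_tot[OF subspace_join subspace_join subspace_join])
  show "complex_mod (join_ideals V1 V2 I1 I2) B D"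
    by (rule complex_of_resolution[OF subspace_join resolution_base_change[OF disj I1 A1 I2 res1 D e]])
  show "resolution_mod (join_ideals V1 V2 I1 A2) (join_ideals V1 V2 A1 A2) B D e"
    by (rule resolution_base_change[OF disj I1 A1 A2 res1 D e])
  show "resolution_mod (join_ideals V1 V2 I1 I2) (join_ideals V1 V2 I1 A2) C E e'"
    using resolution_base_change[OF _ I2 A2 I1 res2 E e'] disj by (simp add: join_commute[of V1] Int_commute)
qed


section \<open>Hilbert's basis theorem and existence of resolutions\<close>

lemma nat_seq_nondecreasing_subseq:
  fixes s :: "nat \<Rightarrow> nat"
  shows "\<exists>r :: nat \<Rightarrow> nat. strict_mono r \<and> (\<forall>i j. i \<le> j \<longrightarrow> s (r i) \<le> s (r j))"
proof -
  obtain f where f: "strict_mono f" "monoseq (\<lambda>n. s (f n))"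
    using seq_monosub[of s] by (elim exE conjE)
  show ?thesis
  proof (cases "\<forall>i j. i \<le> j \<longrightarrow> s (f i) \<le> s (f j)")
    case True
    with f(1) show ?thesis by (intro exI[of _ f] conjI)
  next
    case False
    then have dec: "s (f j) \<le> s (f i)" if "i \<le> j" for i j
      using f(2) False that unfolding monoseq_def by blast
    obtain N where N: "\<And>n. s (f N) \<le> s (f n)"
      using ex_has_least_nat[of "\<lambda>_. True" undefined "\<lambda>n. s (f n)"] by auto
    have "s (f (N + i)) = s (f N)" for i
      using dec[of N "N + i"] N[of "N + i"] by simp
    moreover have "strict_mono (\<lambda>i. f (N + i))"
      using f(1) by (simp add: strict_mono_def)
    ultimately show ?thesis by (intro exI[of _ "\<lambda>i. f (N + i)"]) simp
  qed
qed

definition monom_dvd :: "(nat \<Rightarrow>\<^sub>0 nat) \<Rightarrow> (nat \<Rightarrow>\<^sub>0 nat) \<Rightarrow> bool" where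
  "monom_dvd m m' \<longleftrightarrow> (\<forall>v. Poly_Mapping.lookup m v \<le> Poly_Mapping.lookup m' v)"

lemma monom_dvd_add: "monom_dvd m m' \<Longrightarrow> m' = m + (m' - m)"
  by (rule poly_mapping_eqI) (simp add: monom_dvd_def lookup_add lookup_minus)

lemma monom_dvd_le: "monom_dvd m m' \<Longrightarrow> m \<le> m'"
proof -
  assume dvd: "monom_dvd m m'"
  define d where "d = m' - m"
  have "0 \<le> d"
  proof (cases "d = 0")
    case False
    define k where "k = Min (Poly_Mapping.keys d)"
    have "Poly_Mapping.keys d \<noteq> {}" using False by simp
    then have k: "k \<in> Poly_Mapping.keys d" "\<And>k'. k' < k \<Longrightarrow> k' \<notin> Poly_Mapping.keys d"
      unfolding k_def by (auto dest: Min_le[OF finite_keys] simp: leD)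
    have "less_fun (Poly_Mapping.lookup 0) (Poly_Mapping.lookup d)"
      unfolding less_fun_def using k by (intro exI[of _ k]) (auto simp: in_keys_iff)
    then show ?thesis by (simp add: less_eq_poly_mapping.rep_eq)
  qed simp
  then have "m + 0 \<le> m + d" by (rule add_left_mono)
  then show ?thesis using monom_dvd_add[OF dvd] by (simp add: d_def)
qed

text \<open>
  Dickson's lemma: pass to a subsequence along which the exponent of one variable after the other is
  nondecreasing.
\<close>

lemma dickson:
  fixes f :: "nat \<Rightarrow> nat \<Rightarrow>\<^sub>0 nat"
  assumes "finite V" and f: "\<And>n. Poly_Mapping.keys (f n) \<subseteq> V"
  shows "\<exists>i j. i < j \<and> monom_dvd (f i) (f j)"
proof -
  have "\<exists>r :: nat \<Rightarrow> nat. strict_mono r \<and> (\<forall>v\<in>V. \<forall>i j. i \<le> j \<longrightarrow>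
      Poly_Mapping.lookup (f (r i)) v \<le> Poly_Mapping.lookup (f (r j)) v)"
    using assms(1)
  proof (induction V rule: finite_induct)
    case empty
    show ?case by (rule exI[of _ id]) (simp add: strict_mono_def)
  next
    case (insert x V)
    then obtain r :: "nat \<Rightarrow> nat" where r: "strict_mono r" "\<forall>v\<in>V. \<forall>i j. i \<le> j \<longrightarrow>
      Poly_Mapping.lookup (f (r i)) v \<le> Poly_Mapping.lookup (f (r j)) v" by (elim exE conjE)
    obtain r' :: "nat \<Rightarrow> nat" where r': "strict_mono r'" "\<forall>i j. i \<le> j \<longrightarrow>
      Poly_Mapping.lookup (f (r (r' i))) x \<le> Poly_Mapping.lookup (f (r (r' j))) x"
      using nat_seq_nondecreasing_subseq[of "\<lambda>n. Poly_Mapping.lookup (f (r n)) x"] by (elim exE conjE)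
    show ?case
      by (rule exI[of _ "r \<circ> r'"])
        (use r r' strict_mono_o[OF r(1) r'(1)] in \<open>auto simp: strict_mono_less_eq o_def\<close>)
  qed
  then obtain r :: "nat \<Rightarrow> nat" where r: "strict_mono r" and r_le: "\<forall>v\<in>V. \<forall>i j. i \<le> j \<longrightarrow>
      Poly_Mapping.lookup (f (r i)) v \<le> Poly_Mapping.lookup (f (r j)) v" by (elim exE conjE)
  have "monom_dvd (f (r 0)) (f (r 1))"
    unfolding monom_dvd_def
  proof
    fix v
    show "Poly_Mapping.lookup (f (r 0)) v \<le> Poly_Mapping.lookup (f (r 1)) v"
    proof (cases "v \<in> V")
      case False
      then have "v \<notin> Poly_Mapping.keys (f (r 0))" using f by blast
      then show ?thesis by (simp add: in_keys_iff)
    qed (use r_le in simp)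
  qed
  moreover have "r 0 < r 1" using r by (simp add: strict_mono_def)
  ultimately show ?thesis by blast
qed

text \<open>
  A strictly descending sequence of monomials contradicts Dickson's lemma, because the order of
  \<open>nat \<Rightarrow>\<^sub>0 nat\<close> refines divisibility.
\<close>

lemma wf_monom_less:
  assumes "finite V"
  shows "wf {(m, m'). m < m' \<and> Poly_Mapping.keys m \<subseteq> V \<and> Poly_Mapping.keys (m' :: nat \<Rightarrow>\<^sub>0 nat) \<subseteq> V}"
  unfolding wf_iff_no_infinite_down_chain
proof
  assume "\<exists>f. \<forall>i. (f (Suc i), f i) \<in> {(m, m'). m < m' \<and> Poly_Mapping.keys m \<subseteq> V \<and> Poly_Mapping.keys (m' :: nat \<Rightarrow>\<^sub>0 nat) \<subseteq> V}"
  then obtain f :: "nat \<Rightarrow> nat \<Rightarrow>\<^sub>0 nat" where f: "\<And>i. f (Suc i) < f i" "\<And>i. Poly_Mapping.keys (f i) \<subseteq> V" by auto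
  obtain i j where ij: "i < j" "monom_dvd (f i) (f j)" using dickson[OF assms f(2)] by blast
  have "f j < f i" using ij(1) by (induction rule: less_Suc_induct) (auto intro: f(1) less_trans)
  then show False using monom_dvd_le[OF ij(2)] by simp
qed

lemma mdeg_strict:
  assumes "monom_dvd m m'" "m \<noteq> m'"
  shows "mdeg m < mdeg m'"
proof -
  have keys: "Poly_Mapping.keys m \<subseteq> Poly_Mapping.keys m'"
    using assms(1) by (metis in_keys_iff le_zero_eq monom_dvd_def subsetI)
  obtain v where v: "Poly_Mapping.lookup m v \<noteq> Poly_Mapping.lookup m' v"
    using assms(2) poly_mapping_eqI[of m m'] by blast
  then have v': "Poly_Mapping.lookup m v < Poly_Mapping.lookup m' v"
    using assms(1) by (simp add: monom_dvd_def le_neq_implies_less)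
  have "mdeg m = (\<Sum>i\<in>Poly_Mapping.keys m'. Poly_Mapping.lookup m i)"
    unfolding mdeg_def by (rule sum.mono_neutral_left) (use keys in \<open>auto simp: in_keys_iff\<close>)
  also have "\<dots> < mdeg m'"
    unfolding mdeg_def
    by (rule sum_strict_mono_ex1) (use assms(1) v' in \<open>auto simp: monom_dvd_def in_keys_iff\<close>)
  finally show ?thesis .
qed

text \<open>
  The monomials that are minimal for divisibility form an antichain, which is finite by Dickson's lemma.
\<close>

lemma finite_divisor_basis:
  assumes V: "finite V" and L: "\<And>m. m \<in> L \<Longrightarrow> Poly_Mapping.keys m \<subseteq> V"
  shows "\<exists>F\<subseteq>L. finite F \<and> (\<forall>m\<in>L. \<exists>m'\<in>F. monom_dvd m' m)"
proof -
  define F where "F = {m \<in> L. \<forall>m'\<in>L. monom_dvd m' m \<longrightarrow> m' = m}"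
  have "finite F"
  proof (rule ccontr)
    assume "infinite F"
    then obtain f :: "nat \<Rightarrow> nat \<Rightarrow>\<^sub>0 nat" where f: "inj f" "range f \<subseteq> F"
      using infinite_countable_subset by blast
    have "\<And>n. Poly_Mapping.keys (f n) \<subseteq> V" using f(2) L by (auto simp: F_def)
    from dickson[OF V this] obtain i j where "i < j" "monom_dvd (f i) (f j)" by blast
    moreover have "f j \<in> F" "f i \<in> L" using f(2) by (auto simp: F_def)
    ultimately have "f i = f j" by (auto simp: F_def)
    with f(1) \<open>i < j\<close> show False by (auto dest: injD)
  qed
  moreover have "\<exists>m'\<in>F. monom_dvd m' m" if "m \<in> L" for m
    using that
  proof (induction m rule: measure_induct_rule[of mdeg])
    case (less m)
    show ?case
    proof (cases "m \<in> F")
      case True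
      then show ?thesis by (auto simp: monom_dvd_def)
    next
      case False
      then obtain m' where m': "m' \<in> L" "monom_dvd m' m" "m' \<noteq> m" using less.prems by (auto simp: F_def)
      from less.IH[OF mdeg_strict[OF m'(2,3)] m'(1)] m'(2) show ?thesis
        by (auto simp: monom_dvd_def intro: order_trans)
    qed
  qed
  ultimately show ?thesis by (intro exI[of _ F]) (auto simp: F_def)
qed

lemma lookup_single_mult: "Poly_Mapping.lookup (Poly_Mapping.single d c * p) (d + m) = c * Poly_Mapping.lookup (p :: 'k::field mpoly) m"
  by (induction p rule: mpoly_induct)
    (simp_all add: distrib_left lookup_add mult_single lookup_single when_def)

text \<open>
  Division with remainder: elements of \<open>I\<close> whose leading monomials divide all leading monomials of \<open>I\<close>
  generate, since subtracting a multiple of one of them lowers the leading monomial.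
\<close>

theorem hilbert_basis:
  fixes I :: "'k::field mpoly set"
  assumes V: "finite V" and I: "ideal_in V I"
  shows "\<exists>G\<subseteq>I. finite G \<and> I \<subseteq> self.span G"
proof -
  define lm where "lm p = Max (Poly_Mapping.keys p)" for p :: "'k mpoly"
  have lm: "lm p \<in> Poly_Mapping.keys p" if "p \<noteq> 0" for p
    unfolding lm_def using that by (intro Max_in) auto
  have lm_max: "m \<le> lm p" if "m \<in> Poly_Mapping.keys p" for m p
    unfolding lm_def using that by simp
  have keys: "Poly_Mapping.keys m \<subseteq> V" if "p \<in> I" "m \<in> Poly_Mapping.keys p" for p m
    using I that by (auto simp: ideal_in_def restrict_id_iff)
  obtain F where F: "F \<subseteq> lm ` (I - {0})" "finite F" "\<And>m. m \<in> lm ` (I - {0}) \<Longrightarrow> \<exists>m'\<in>F. monom_dvd m' m"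
  proof -
    have "Poly_Mapping.keys m \<subseteq> V" if "m \<in> lm ` (I - {0})" for m
      using that lm keys by auto
    then have "\<exists>F\<subseteq>lm ` (I - {0}). finite F \<and> (\<forall>m\<in>lm ` (I - {0}). \<exists>m'\<in>F. monom_dvd m' m)"
      by (intro finite_divisor_basis[OF V]) auto
    then show ?thesis by (elim exE conjE) (rule that, auto)
  qed
  have "\<forall>m\<in>F. \<exists>p. p \<in> I \<and> p \<noteq> 0 \<and> lm p = m" using F(1) by auto
  then obtain g where g: "\<And>m. m \<in> F \<Longrightarrow> g m \<in> I \<and> g m \<noteq> 0 \<and> lm (g m) = m" by metis
  have "p \<in> self.span (g ` F)" if "p \<in> I" "p \<noteq> 0" "lm p = m" for p m
    using that
  proof (induction m arbitrary: p rule: wf_induct_rule[OF wf_monom_less[OF V]])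
    case (1 m)
    obtain m' where m': "m' \<in> F" "monom_dvd m' m" using F(3) 1 by blast
    define d where "d = m - m'"
    have md: "m = d + m'" using monom_dvd_add[OF m'(2)] by (simp add: d_def add.commute)
    have gm: "g m' \<in> I" "g m' \<noteq> 0" "lm (g m') = m'" using g[OF m'(1)] by auto
    define c where "c = Poly_Mapping.lookup p m / Poly_Mapping.lookup (g m') m'"
    define q where "q = p - Poly_Mapping.single d c * g m'"
    have lc: "Poly_Mapping.lookup (g m') m' \<noteq> 0" using lm[OF gm(2)] gm(3) by (simp add: in_keys_iff)
    have pm: "Poly_Mapping.keys m \<subseteq> V" using keys[OF 1(2)] lm[OF 1(3)] 1(4) by simp
    have d: "Poly_Mapping.keys d \<subseteq> V" using pm by (simp add: md keys_add_nat)
    then have "Poly_Mapping.single d c * g m' \<in> I"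
      by (intro ideal_in_mult[OF I _ gm(1)]) (simp add: restrict_single)
    moreover have "restrict_vars V (- 1) * (Poly_Mapping.single d c * g m') \<in> I"
      using I calculation by (simp add: ideal_in_def del: restrict_one)
    moreover have "restrict_vars V (- 1 :: 'k mpoly) = - 1"
      using restrict_diff[of V 0 "1 :: 'k mpoly"] by simp
    ultimately have q: "q \<in> I" using I 1(2) unfolding q_def ideal_in_def
      by (metis (no_types, lifting) add_uminus_conv_diff mult_minus1)
    have lt: "k < m" if "k \<in> Poly_Mapping.keys q" for k
    proof -
      have "Poly_Mapping.lookup q m = 0"
        using lc unfolding q_def lookup_minus by (subst (2) md) (simp add: lookup_single_mult c_def)
      then have "k \<noteq> m" using that by (auto simp: in_keys_iff)
      moreover have "k \<le> m"
      proof (cases "k \<in> Poly_Mapping.keys p")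
        case True
        then show ?thesis using lm_max 1(4) by blast
      next
        case False
        then have "k \<in> Poly_Mapping.keys (Poly_Mapping.single d c * g m')"
          using that by (auto simp: q_def in_keys_iff lookup_minus)
        then obtain b where "k = d + b" "b \<in> Poly_Mapping.keys (g m')"
          using Poly_Mapping.keys_mult[of "Poly_Mapping.single d c" "g m'"] by (auto split: if_splits)
        then show ?thesis using lm_max[of b "g m'"] gm(3) md by (simp add: add_left_mono)
      qed
      ultimately show ?thesis by simp
    qed
    have "q \<in> self.span (g ` F)"
    proof (cases "q = 0")
      case True
      then show ?thesis by (simp add: self.span_zero)
    next
      case False
      have "(lm q, m) \<in> {(m, m'). m < m' \<and> Poly_Mapping.keys m \<subseteq> V \<and> Poly_Mapping.keys m' \<subseteq> V}"
        using lt[OF lm[OF False]] keys[OF q lm[OF False]] pm by simp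
      then show ?thesis using 1(1) q False by blast
    qed
    moreover have "Poly_Mapping.single d c * g m' \<in> self.span (g ` F)"
      using m'(1) by (intro self.span_scale self.span_base) simp
    ultimately have "q + Poly_Mapping.single d c * g m' \<in> self.span (g ` F)" by (rule self.span_add)
    then show ?case by (simp add: q_def)
  qed
  then have "I \<subseteq> self.span (g ` F)" using self.span_zero by blast
  moreover have "g ` F \<subseteq> I" using g by blast
  ultimately show ?thesis using F(2) by blast
qed


text \<open>Vectors over a ring, with submodules as subspaces.\<close>

interpretation vec: Modules.module "\<lambda>(c::'a::comm_ring_1) (v::'i \<Rightarrow> 'a) i. c * v i"
  by unfold_locales (auto simp: fun_eq_iff algebra_simps)

declare vec.scale_scale [simp del]

lemma ideal_in_zero: "ideal_in V {0}"
  by (simp add: ideal_in_def)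

text \<open>The ideal of the variables outside \<open>V\<close>, as the kernel of \<open>restrict_vars V\<close>.\<close>

abbreviation outside :: "nat set \<Rightarrow> 'k::field mpoly set" where
  "outside V \<equiv> lift_ideal V {0}"

lemma subspace_outside: "self.subspace (outside V)"
  by (rule subspace_lift_ideal[OF ideal_in_zero])


text \<open>
  Submodules of \<open>k[V]\<^sup>A\<close> are finitely generated, by induction on \<open>A\<close>: lift generators of the ideal of
  \<open>i\<close>-th coordinates, and add generators of the vectors whose \<open>i\<close>-th coordinate vanishes.
\<close>

lemma noetherian_vectors:
  fixes M :: "('i \<Rightarrow> 'k::field mpoly) set"
  assumes V: "finite V" and A: "finite A" and M: "vec.subspace M"
  shows "\<exists>G\<subseteq>M. finite G \<and> (\<forall>v\<in>M. \<exists>w\<in>vec.span G. \<forall>i\<in>A. v i - w i \<in> outside V)"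
  using A M
proof (induction A arbitrary: M rule: finite_induct)
  case empty
  show ?case by (intro exI[of _ "{}"]) simp
next
  case (insert i A)
  note M = insert.prems
  let ?O = "outside V :: 'k mpoly set"
  define M' where "M' = {v \<in> M. v i \<in> ?O}"
  have M': "vec.subspace M'"
    using M self.subspace_0[OF subspace_outside] self.subspace_add[OF subspace_outside]
      self.subspace_scale[OF subspace_outside]
    by (auto simp: M'_def vec.subspace_def)
  from insert.IH[OF M'] obtain G' where G': "G' \<subseteq> M'" "finite G'"
    "\<And>v. v \<in> M' \<Longrightarrow> \<exists>w\<in>vec.span G'. \<forall>j\<in>A. v j - w j \<in> ?O" by auto
  define I where "I = (\<lambda>v. restrict_vars V (v i)) ` M"
  have I: "ideal_in V I"
    unfolding ideal_in_def
  proof (intro conjI ballI allI)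
    show "0 \<in> I"
      unfolding I_def by (rule image_eqI[of _ _ 0]) (use vec.subspace_0[OF M] in auto)
    show "restrict_vars V p = p" if "p \<in> I" for p using that by (auto simp: I_def)
    show "p + q \<in> I" if pq: "p \<in> I" "q \<in> I" for p q
    proof -
      obtain v w where vw: "v \<in> M" "p = restrict_vars V (v i)" "w \<in> M" "q = restrict_vars V (w i)"
        using pq by (auto simp: I_def)
      show ?thesis
        unfolding I_def by (rule image_eqI[of _ _ "v + w"]) (use vw vec.subspace_add[OF M] in \<open>auto simp: restrict_add\<close>)
    qed
    show "restrict_vars V p * q \<in> I" if q: "q \<in> I" for p q
    proof -
      obtain v where v: "v \<in> M" "q = restrict_vars V (v i)" using q by (auto simp: I_def)
      show ?thesis
        unfolding I_def by (rule image_eqI[of _ _ "\<lambda>j. p * v j"]) (use v vec.subspace_scale[OF M] in \<open>auto simp: restrict_mult\<close>)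
    qed
  qed
  obtain H where H: "H \<subseteq> I" "finite H" "I \<subseteq> self.span H" using hilbert_basis[OF V I] by blast
  have "\<forall>h\<in>H. \<exists>u\<in>M. h = restrict_vars V (u i)" using H(1) by (auto simp: I_def)
  then obtain u where u: "\<And>h. h \<in> H \<Longrightarrow> u h \<in> M \<and> h = restrict_vars V (u h i)" by metis
  let ?G = "G' \<union> u ` H"
  have "\<exists>w\<in>vec.span ?G. \<forall>j\<in>insert i A. v j - w j \<in> ?O" if v: "v \<in> M" for v
  proof -
    have "restrict_vars V (v i) \<in> self.span H" using v H(3) by (auto simp: I_def)
    then obtain c where c: "restrict_vars V (v i) = (\<Sum>h\<in>H. c h * h)"
      using H(2) by (auto simp: self.span_finite)
    define w where "w = (\<Sum>h\<in>H. (\<lambda>j. c h * u h j))"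
    have w: "w \<in> vec.span (u ` H)"
      unfolding w_def by (intro vec.span_sum vec.span_scale vec.span_base) simp
    have wM: "w \<in> M"
      unfolding w_def using u by (intro vec.subspace_sum[OF M] vec.subspace_scale[OF M]) auto
    have "restrict_vars V (w i) = (\<Sum>h\<in>H. restrict_vars V (c h) * restrict_vars V (u h i))"
      by (simp add: w_def fn_sum_apply restrict_sum restrict_mult)
    also have "\<dots> = (\<Sum>h\<in>H. restrict_vars V (c h) * restrict_vars V h)"
      using u by (intro sum.cong refl) (metis restrict_restrict)
    also have "\<dots> = restrict_vars V (restrict_vars V (v i))"
      unfolding c by (simp add: restrict_sum restrict_mult)
    finally have vw: "v - w \<in> M'"
      using vec.subspace_diff[OF M v wM] by (simp add: M'_def lift_ideal_def restrict_diff)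
    then obtain w' where w': "w' \<in> vec.span G'" "\<And>j. j \<in> A \<Longrightarrow> (v - w) j - w' j \<in> ?O" using G'(3) by blast
    have "w' \<in> M'" using w'(1) vec.span_minimal[OF G'(1) M'] by blast
    then have "(v - w) j - w' j \<in> ?O" if "j \<in> insert i A" for j
      using that w'(2) vw self.subspace_diff[OF subspace_outside] by (auto simp: M'_def)
    moreover have "w + w' \<in> vec.span ?G"
      using w w'(1) vec.span_mono[of "u ` H" ?G] vec.span_mono[of G' ?G] by (intro vec.span_add) auto
    ultimately show ?thesis by (intro bexI[of _ "w + w'"]) (simp_all add: diff_diff_eq)
  qed
  moreover have "?G \<subseteq> M" using G'(1) u by (auto simp: M'_def)
  moreover have "finite ?G" using G'(2) H(2) by simp
  ultimately show ?case by (intro exI[of _ ?G] conjI ballI)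
qed

text \<open>
  The solutions of a linear system over the quotient by \<open>A\<close> form a submodule, so they are the image of a
  matrix with finitely many columns; the columns are indexed by a subset of a given infinite type.
\<close>

lemma finite_syzygies:
  fixes M :: "'x \<Rightarrow> 'y \<Rightarrow> 'k::field mpoly"
  assumes inf: "infinite (UNIV :: 'z set)" and V: "finite V" and Y: "finite Y"
    and J: "self.subspace J" and A: "self.subspace A" and JA: "J \<subseteq> A" and OJ: "outside V \<subseteq> J"
  shows "\<exists>(Z :: 'z set) N. finite Z \<and> (\<forall>v. (\<forall>x\<in>Q. mat_vec Y M v x \<in> A) \<longleftrightarrow>
    (\<exists>w. \<forall>y\<in>Y. v y - mat_vec Z N w y \<in> J))"
proof -
  define L where "L = {v. \<forall>x\<in>Q. mat_vec Y M v x \<in> A}"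
  have L: "vec.subspace L"
    using self.subspace_0[OF A] self.subspace_add[OF A] self.subspace_scale[OF A]
    by (auto simp: L_def vec.subspace_def mat_vec_mult plus_fun_def mat_vec_add zero_fun_def) (simp add: mat_vec_def)
  obtain G where G: "G \<subseteq> L" "finite G" "\<And>v. v \<in> L \<Longrightarrow> \<exists>w\<in>vec.span G. \<forall>y\<in>Y. v y - w y \<in> outside V"
    using noetherian_vectors[OF V Y L] by blast
  obtain Z :: "'z set" where Z: "finite Z" "card Z = card G"
    using infinite_arbitrarily_large[OF inf] by blast
  then obtain \<beta> where \<beta>: "bij_betw \<beta> Z G" using finite_same_card_bij G(2) by blast
  have N: "mat_vec Z (\<lambda>y z. \<beta> z y) w = (\<Sum>z\<in>Z. (\<lambda>y. w z * \<beta> z y))" for w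
    by (rule ext) (simp add: mat_vec_def fn_sum_apply mult.commute)
  have "(\<forall>x\<in>Q. mat_vec Y M v x \<in> A) \<longleftrightarrow> (\<exists>w. \<forall>y\<in>Y. v y - mat_vec Z (\<lambda>y z. \<beta> z y) w y \<in> J)" for v
  proof
    assume "\<forall>x\<in>Q. mat_vec Y M v x \<in> A"
    then have "v \<in> L" by (simp add: L_def)
    then obtain w where w: "w \<in> vec.span G" "\<And>y. y \<in> Y \<Longrightarrow> v y - w y \<in> outside V" using G(3) by blast
    obtain c where "w = (\<Sum>g\<in>G. (\<lambda>y. c g * g y))"
      using w(1) G(2) by (auto simp: vec.span_finite)
    also have "\<dots> = (\<Sum>z\<in>Z. (\<lambda>y. c (\<beta> z) * \<beta> z y))"
      by (rule sum.reindex_bij_betw[OF \<beta>, symmetric])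
    finally have "w = mat_vec Z (\<lambda>y z. \<beta> z y) (\<lambda>z. c (\<beta> z))" by (simp add: N)
    then show "\<exists>w. \<forall>y\<in>Y. v y - mat_vec Z (\<lambda>y z. \<beta> z y) w y \<in> J" using w(2) OJ by blast
  next
    assume "\<exists>w. \<forall>y\<in>Y. v y - mat_vec Z (\<lambda>y z. \<beta> z y) w y \<in> J"
    then obtain w where w: "\<And>y. y \<in> Y \<Longrightarrow> v y - mat_vec Z (\<lambda>y z. \<beta> z y) w y \<in> A" using JA by blast
    have "mat_vec Z (\<lambda>y z. \<beta> z y) w \<in> L"
      unfolding N using \<beta> G(1) by (intro vec.subspace_sum[OF L] vec.subspace_scale[OF L]) (auto simp: bij_betw_def)
    then show "\<forall>x\<in>Q. mat_vec Y M v x \<in> A"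
      using mat_vec_mem_cong[OF A, of Y v "mat_vec Z (\<lambda>y z. \<beta> z y) w" M] w by (auto simp: L_def)
  qed
  then show ?thesis using Z(1) by blast
qed

text \<open>
  A partial resolution of positive length can be continued by matrices of syzygies.  Given ranks and
  matrices are kept, which is how an explicit beginning enters a resolution.
\<close>

theorem resolution_extend:
  fixes B' :: "nat \<Rightarrow> 'i set" and D' :: "nat \<Rightarrow> 'i \<Rightarrow> 'i \<Rightarrow> 'k::field mpoly"
  assumes inf: "infinite (UNIV :: 'i set)" and V: "finite V"
    and J: "self.subspace J" and OJ: "outside V \<subseteq> J"
    and fin: "\<And>n. n \<le> Suc k \<Longrightarrow> finite (B' n)"
    and surj: "\<exists>v. (\<Sum>i\<in>B' 0. e i * v i) - 1 \<in> A"
    and aug: "\<And>v. (\<Sum>i\<in>B' 0. e i * v i) \<in> A \<longleftrightarrow> boundary_mod J B' D' 0 v"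
    and ex: "\<And>n v. n < k \<Longrightarrow> cycle_mod J B' D' (Suc n) v \<longleftrightarrow> boundary_mod J B' D' (Suc n) v"
  shows "\<exists>B D. resolution_mod J A B D e \<and> (\<forall>n\<le>Suc k. B n = B' n) \<and> (\<forall>n\<le>k. D n = D' n)"
proof -
  define P where "P n s \<longleftrightarrow> (case s of (X0, X1, M) \<Rightarrow> finite X0 \<and> finite X1 \<and>
    (n \<le> k \<longrightarrow> X0 = B' n \<and> X1 = B' (Suc n) \<and> M = D' n))" for n and s :: "'i set \<times> 'i set \<times> ('i \<Rightarrow> 'i \<Rightarrow> 'k mpoly)"
  define R where "R s s' \<longleftrightarrow> (case s of (X0, X1, M) \<Rightarrow> case s' of (Y0, Y1, N) \<Rightarrow> Y0 = X1 \<and>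
    (\<forall>v. (\<forall>x\<in>X0. mat_vec X1 M v x \<in> J) \<longleftrightarrow> (\<exists>w. \<forall>y\<in>X1. v y - mat_vec Y1 N w y \<in> J)))"
    for s s' :: "'i set \<times> 'i set \<times> ('i \<Rightarrow> 'i \<Rightarrow> 'k mpoly)"
  \<comment> \<open>A state consists of two consecutive index sets and the matrix between them.\<close>
  have "\<exists>f. \<forall>n. P n (f n) \<and> R (f n) (f (Suc n))"
  proof (rule dependent_nat_choice)
    show "\<exists>s. P 0 s"
      by (rule exI[of _ "(B' 0, B' 1, D' 0)"]) (use fin[of 0] fin[of 1] in \<open>auto simp: P_def\<close>)
    fix s n assume "P n s"
    then obtain X0 X1 M where s: "s = (X0, X1, M)" "finite X0" "finite X1"
      "n \<le> k \<Longrightarrow> X0 = B' n \<and> X1 = B' (Suc n) \<and> M = D' n" by (auto simp: P_def)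
    show "\<exists>s'. P (Suc n) s' \<and> R s s'"
    proof (cases "Suc n \<le> k")
      case True
      then have "R s (B' (Suc n), B' (Suc (Suc n)), D' (Suc n))"
        using s(4) ex[of n] by (simp add: R_def s(1) cycle_mod_def boundary_mod_def)
      then show ?thesis
        using True fin[of "Suc n"] fin[of "Suc (Suc n)"]
        by (intro exI[of _ "(B' (Suc n), B' (Suc (Suc n)), D' (Suc n))"]) (simp add: P_def)
    next
      case False
      obtain Z :: "'i set" and N where "finite Z" "\<And>v. (\<forall>x\<in>X0. mat_vec X1 M v x \<in> J) \<longleftrightarrow>
          (\<exists>w. \<forall>y\<in>X1. v y - mat_vec Z N w y \<in> J)"
        using finite_syzygies[OF inf V s(3) J J subset_refl OJ, of X0 M] by blast
      then show ?thesis
        using False s(3) by (intro exI[of _ "(X1, Z, N)"]) (simp add: P_def R_def s(1))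
    qed
  qed
  then obtain f where f: "\<And>n. P n (f n)" "\<And>n. R (f n) (f (Suc n))" by blast
  define B where "B n = fst (f n)" for n
  define D where "D n = snd (snd (f n))" for n
  have f_eq: "f n = (B n, B (Suc n), D n)" for n
    using f(2)[of n] by (auto simp: B_def D_def R_def split: prod.splits)
  have B: "finite (B n)" for n using f(1)[of n] by (simp add: f_eq P_def)
  have eq: "B n = B' n" "B (Suc n) = B' (Suc n)" "D n = D' n" if "n \<le> k" for n
    using f(1)[of n] that by (simp_all add: f_eq P_def)
  have "resolution_mod J A B D e"
    unfolding resolution_mod_def
  proof (intro conjI allI B)
    show "\<exists>v. (\<Sum>i\<in>B 0. e i * v i) - 1 \<in> A" using surj eq(1)[of 0] by simp
    show "(\<Sum>i\<in>B 0. e i * v i) \<in> A \<longleftrightarrow> boundary_mod J B D 0 v" for v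
      using aug[of v] eq[of 0] by (simp add: boundary_mod_def)
    show "cycle_mod J B D (Suc n) v \<longleftrightarrow> boundary_mod J B D (Suc n) v" for n v
      using f(2)[of n] by (simp add: f_eq R_def cycle_mod_def boundary_mod_def)
  qed
  moreover have "B n = B' n" if "n \<le> Suc k" for n using eq[of n] eq[of "n - 1"] that by (cases n) auto
  ultimately show ?thesis using eq(3) by blast
qed

theorem resolution_exists:
  fixes J A :: "'k::field mpoly set"
  assumes V: "finite V" and J: "self.subspace J" and A: "self.subspace A"
    and OJ: "outside V \<subseteq> J" and JA: "J \<subseteq> A"
  shows "\<exists>B (D :: nat \<Rightarrow> nat \<Rightarrow> nat \<Rightarrow> 'k mpoly). resolution_mod J A B D (\<lambda>_. 1) \<and> B 0 = {0}"
proof -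
  have "\<exists>(Z :: nat set) N. finite Z \<and> (\<forall>v. (\<forall>x\<in>UNIV :: unit set. mat_vec {0 :: nat} (\<lambda>_ _. 1) v x \<in> A) \<longleftrightarrow>
      (\<exists>w. \<forall>y\<in>{0}. v y - mat_vec Z N w y \<in> J))"
    by (rule finite_syzygies[OF infinite_UNIV_nat V _ J A JA OJ]) simp
  then obtain Z :: "nat set" and N where Z: "finite Z"
    "\<forall>v. (\<forall>x\<in>UNIV :: unit set. mat_vec {0 :: nat} (\<lambda>_ _. 1) v x \<in> A) \<longleftrightarrow>
      (\<exists>w. \<forall>y\<in>{0}. v y - mat_vec Z N w y \<in> J)"
    by (elim exE conjE)
  define B' where "B' n = (if n = 0 then {0} else Z)" for n :: nat
  have "\<exists>B D. resolution_mod J A B D (\<lambda>_. 1) \<and> (\<forall>n\<le>Suc 0. B n = B' n) \<and> (\<forall>n\<le>0. D n = N)"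
  proof (rule resolution_extend[OF infinite_UNIV_nat V J OJ])
    show "finite (B' n)" for n using Z(1) by (simp add: B'_def)
    show "\<exists>v. (\<Sum>i\<in>B' 0. 1 * v i) - 1 \<in> A"
      by (rule exI[of _ "\<lambda>_. 1"]) (simp add: B'_def self.subspace_0[OF A])
    show "(\<Sum>i\<in>B' 0. 1 * v i) \<in> A \<longleftrightarrow> boundary_mod J B' (\<lambda>_. N) 0 v" for v
      using Z(2)[rule_format, of v] by (simp add: boundary_mod_def B'_def mat_vec_def)
  qed simp
  then obtain B D where "resolution_mod J A B D (\<lambda>_. 1)" "B 0 = B' 0" by auto
  then show ?thesis by (auto simp: B'_def)
qed

lemma mat_vec_cong_mod:
  assumes J: "self.subspace J" and "\<And>j. j \<in> B \<Longrightarrow> D i j - D' i j \<in> J"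
  shows "mat_vec B D v i \<in> J \<longleftrightarrow> mat_vec B D' v i \<in> J"
    and "x - mat_vec B D v i \<in> J \<longleftrightarrow> x - mat_vec B D' v i \<in> J"
proof -
  have "(\<Sum>j\<in>B. v j * (D i j - D' i j)) \<in> J"
    by (intro self.subspace_sum[OF J] self.subspace_scale[OF J] assms(2))
  then have d: "mat_vec B D v i - mat_vec B D' v i \<in> J"
    by (simp add: mat_vec_def right_diff_distrib sum_subtractf mult.commute)
  show "mat_vec B D v i \<in> J \<longleftrightarrow> mat_vec B D' v i \<in> J"
    using self.subspace_diff[OF J _ d, of "mat_vec B D v i"] self.subspace_add[OF J _ d, of "mat_vec B D' v i"] by auto
  show "x - mat_vec B D v i \<in> J \<longleftrightarrow> x - mat_vec B D' v i \<in> J"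
    using self.subspace_add[OF J _ d, of "x - mat_vec B D v i"] self.subspace_diff[OF J _ d, of "x - mat_vec B D' v i"] by auto
qed

text \<open>
  Only the residues of the entries matter, so a resolution over \<open>k[V]/I\<close> can be chosen with entries in \<open>k[V]\<close>.
\<close>

lemma resolution_cong_mod:
  assumes J: "self.subspace J" and A: "self.subspace A" and res: "resolution_mod J A B D e"
    and D: "\<And>n i j. D n i j - D' n i j \<in> J" and e: "\<And>i. e i - e' i \<in> A"
  shows "resolution_mod J A B D' e'"
proof -
  have m1: "mat_vec C (D' n) v i \<in> J \<longleftrightarrow> mat_vec C (D n) v i \<in> J" for C n v i
    using mat_vec_cong_mod(1)[OF J, of C "D n" i "D' n" v] D by blast
  have m2: "x - mat_vec C (D' n) v i \<in> J \<longleftrightarrow> x - mat_vec C (D n) v i \<in> J" for C n v i x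
    using mat_vec_cong_mod(2)[OF J, of C "D n" i "D' n" x v] D by blast
  have cyc: "cycle_mod J B D' n v \<longleftrightarrow> cycle_mod J B D n v" for n v
    unfolding cycle_mod_def m1 ..
  have bd: "boundary_mod J B D' n v \<longleftrightarrow> boundary_mod J B D n v" for n v
    unfolding boundary_mod_def m2 ..
  have e1: "(\<Sum>i\<in>B 0. e' i * v i) \<in> A \<longleftrightarrow> (\<Sum>i\<in>B 0. e i * v i) \<in> A" for v
    using mat_vec_cong_mod(1)[OF A, of "B 0" "\<lambda>_. e" "()" "\<lambda>_. e'" v] e by (simp add: mat_vec_def)
  have "1 - (\<Sum>i\<in>B 0. e' i * v i) \<in> A \<longleftrightarrow> 1 - (\<Sum>i\<in>B 0. e i * v i) \<in> A" for v
    using mat_vec_cong_mod(2)[OF A, of "B 0" "\<lambda>_. e" "()" "\<lambda>_. e'" 1 v] e by (simp add: mat_vec_def)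
  then have e2: "(\<Sum>i\<in>B 0. e' i * v i) - 1 \<in> A \<longleftrightarrow> (\<Sum>i\<in>B 0. e i * v i) - 1 \<in> A" for v
    using self.subspace_neg[OF A] by (metis minus_diff_eq)
  show ?thesis using res unfolding resolution_mod_def cyc bd e1 e2 .
qed

lemma resolution_restrict:
  assumes I: "ideal_in V I" and A: "ideal_in V A"
    and res: "resolution_mod (lift_ideal V I) (lift_ideal V A) B D e"
  shows "resolution_mod (lift_ideal V I) (lift_ideal V A) B (\<lambda>n i j. restrict_vars V (D n i j)) (\<lambda>i. restrict_vars V (e i))"
  by (rule resolution_cong_mod[OF subspace_lift_ideal[OF I] subspace_lift_ideal[OF A] res])
    (use I A in \<open>auto simp: lift_ideal_def restrict_diff ideal_in_def\<close>)


section \<open>Tor over presented rings\<close>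

lemma cycle_maximal_iff:
  "cycle_mod maximal B D n x \<longleftrightarrow> cycle_mod {0} B (\<lambda>n i j. const_coeff (D n i j)) n (\<lambda>i. const_coeff (x i))"
  by (simp add: cycle_mod_def maximal_def const_coeff_mat_vec)

lemma boundary_maximal_iff:
  "boundary_mod maximal B D n x \<longleftrightarrow> boundary_mod {0} B (\<lambda>n i j. const_coeff (D n i j)) n (\<lambda>i. const_coeff (x i))"
proof
  assume "boundary_mod maximal B D n x"
  then obtain w where "\<And>i. i \<in> B n \<Longrightarrow> const_coeff (x i - mat_vec (B (Suc n)) (D n) w i) = 0"
    by (auto simp: boundary_mod_def maximal_def)
  then show "boundary_mod {0} B (\<lambda>n i j. const_coeff (D n i j)) n (\<lambda>i. const_coeff (x i))"
    unfolding boundary_mod_def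
    by (intro exI[of _ "\<lambda>j. const_coeff (w j)"]) (simp add: const_coeff_diff const_coeff_mat_vec)
next
  assume "boundary_mod {0} B (\<lambda>n i j. const_coeff (D n i j)) n (\<lambda>i. const_coeff (x i))"
  then obtain w where "\<And>i. i \<in> B n \<Longrightarrow>
      const_coeff (x i) - mat_vec (B (Suc n)) (\<lambda>i j. const_coeff (D n i j)) w i = 0"
    by (auto simp: boundary_mod_def)
  then show "boundary_mod maximal B D n x"
    unfolding boundary_mod_def maximal_def
    by (intro exI[of _ "\<lambda>j. Const (w j)"]) (simp add: const_coeff_diff const_coeff_mat_vec)
qed

text \<open>
  A vector modulo \<open>maximal\<close> is determined by its constant coefficients, so homology with coefficients in
  \<open>k = S/maximal\<close> is that of a complex of vector spaces.
\<close>

lemma homology_basis_const_coeff: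
  assumes "homology_basis Const (cycle_mod maximal B D n) (boundary_mod maximal B D n) K v"
  shows "homology_basis id (cycle_mod {0} B (\<lambda>n i j. const_coeff (D n i j)) n)
    (boundary_mod {0} B (\<lambda>n i j. const_coeff (D n i j)) n) K (\<lambda>a i. const_coeff (v a i))"
  unfolding homology_basis_def
proof (intro conjI ballI allI impI)
  show "finite K" using assms by (simp add: homology_basis_def)
  show "cycle_mod {0} B (\<lambda>n i j. const_coeff (D n i j)) n (\<lambda>i. const_coeff (v a i))" if "a \<in> K" for a
    using assms that by (simp add: homology_basis_def cycle_maximal_iff)
next
  fix z assume "cycle_mod {0} B (\<lambda>n i j. const_coeff (D n i j)) n z"
  then have "cycle_mod maximal B D n (\<lambda>i. Const (z i))" by (simp add: cycle_maximal_iff)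
  then obtain c where "boundary_mod maximal B D n (\<lambda>i. Const (z i) - (\<Sum>a\<in>K. Const (c a) * v a i))"
    using assms unfolding homology_basis_def by blast
  then show "\<exists>c. boundary_mod {0} B (\<lambda>n i j. const_coeff (D n i j)) n
      (\<lambda>i. z i - (\<Sum>a\<in>K. id (c a) * const_coeff (v a i)))"
    by (intro exI[of _ c]) (simp add: boundary_maximal_iff const_coeff_diff const_coeff_sum const_coeff_mult)
next
  fix c a assume "boundary_mod {0} B (\<lambda>n i j. const_coeff (D n i j)) n (\<lambda>i. \<Sum>a\<in>K. id (c a) * const_coeff (v a i))"
  then have "boundary_mod maximal B D n (\<lambda>i. \<Sum>a\<in>K. Const (c a) * v a i)"
    by (simp add: boundary_maximal_iff const_coeff_sum const_coeff_mult)
  moreover assume "a \<in> K"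
  ultimately show "c a = 0" using assms unfolding homology_basis_def by blast
qed

lemma homology_basis_Const:
  assumes "homology_basis id (cycle_mod {0} B (\<lambda>n i j. const_coeff (D n i j)) n)
    (boundary_mod {0} B (\<lambda>n i j. const_coeff (D n i j)) n) K v"
  shows "homology_basis Const (cycle_mod maximal B D n) (boundary_mod maximal B D n) K (\<lambda>a i. Const (v a i))"
  using assms unfolding homology_basis_def cycle_maximal_iff boundary_maximal_iff
  by (auto simp: const_coeff_diff const_coeff_sum const_coeff_mult)

lemma resolution_reindex:
  fixes J A :: "'a::comm_ring_1 set" and B :: "nat \<Rightarrow> 'i set" and C :: "nat \<Rightarrow> 'j set"
  assumes res: "resolution_mod J A B D e" and \<beta>: "\<And>n. bij_betw (\<beta> n) (C n) (B n)"
  shows "resolution_mod J A C (\<lambda>n i j. D n (\<beta> n i) (\<beta> (Suc n) j)) (\<lambda>i. e (\<beta> 0 i))"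
proof -
  let ?D = "\<lambda>n i j. D n (\<beta> n i) (\<beta> (Suc n) j)"
  have mv: "mat_vec (C (Suc n)) (?D n) (\<lambda>j. w (\<beta> (Suc n) j)) i = mat_vec (B (Suc n)) (D n) w (\<beta> n i)" for n w i
    unfolding mat_vec_def by (rule sum.reindex_bij_betw[OF \<beta>])
  have pull: "\<exists>x'. \<forall>i\<in>C n. x i = x' (\<beta> n i)" for n and x :: "'j \<Rightarrow> 'a"
    using \<beta>[of n] by (intro exI[of _ "\<lambda>i. x (inv_into (C n) (\<beta> n) i)"]) (auto simp: bij_betw_def)
  have ball: "(\<forall>i\<in>C n. P (\<beta> n i)) \<longleftrightarrow> (\<forall>i\<in>B n. P i)" for n P
    unfolding bij_betw_imp_surj_on[OF \<beta>, symmetric] by simp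
  have cyc: "cycle_mod J C ?D n (\<lambda>i. x (\<beta> n i)) \<longleftrightarrow> cycle_mod J B D n x" for n x
    by (cases n) (simp_all add: cycle_mod_def mv ball[of _ "\<lambda>i. mat_vec _ _ x i \<in> J"])
  have bd: "boundary_mod J C ?D n (\<lambda>i. x (\<beta> n i)) \<longleftrightarrow> boundary_mod J B D n x" for n x
  proof
    assume "boundary_mod J C ?D n (\<lambda>i. x (\<beta> n i))"
    then obtain w where w: "\<And>i. i \<in> C n \<Longrightarrow> x (\<beta> n i) - mat_vec (C (Suc n)) (?D n) w i \<in> J"
      by (auto simp: boundary_mod_def)
    obtain w' where w': "\<forall>j\<in>C (Suc n). w j = w' (\<beta> (Suc n) j)" using pull[of "Suc n" w] by (rule exE)
    have "mat_vec (C (Suc n)) (?D n) w i = mat_vec (B (Suc n)) (D n) w' (\<beta> n i)" for i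
      unfolding mv[symmetric] by (rule mat_vec_cong) (use w' in auto)
    then have "\<forall>i\<in>C n. x (\<beta> n i) - mat_vec (B (Suc n)) (D n) w' (\<beta> n i) \<in> J" using w by simp
    then show "boundary_mod J B D n x"
      unfolding ball[of n "\<lambda>i. x i - mat_vec (B (Suc n)) (D n) w' i \<in> J"] by (auto simp: boundary_mod_def)
  next
    assume "boundary_mod J B D n x"
    then obtain w where "\<forall>i\<in>B n. x i - mat_vec (B (Suc n)) (D n) w i \<in> J" by (auto simp: boundary_mod_def)
    then show "boundary_mod J C ?D n (\<lambda>i. x (\<beta> n i))"
      unfolding boundary_mod_def by (intro exI[of _ "\<lambda>j. w (\<beta> (Suc n) j)"]) (simp add: mv ball[of n "\<lambda>i. x i - mat_vec (B (Suc n)) (D n) w i \<in> J"])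
  qed
  have esum: "(\<Sum>i\<in>C 0. e (\<beta> 0 i) * x (\<beta> 0 i)) = (\<Sum>i\<in>B 0. e i * x i)" for x
    by (rule sum.reindex_bij_betw[OF \<beta>])
  show ?thesis
    unfolding resolution_mod_def
  proof (intro conjI allI)
    show "finite (C n)" for n
      using bij_betw_finite[OF \<beta>] res by (simp add: resolution_mod_def)
    obtain v where "(\<Sum>i\<in>B 0. e i * v i) - 1 \<in> A" using res by (auto simp: resolution_mod_def)
    then show "\<exists>v. (\<Sum>i\<in>C 0. e (\<beta> 0 i) * v i) - 1 \<in> A"
      by (intro exI[of _ "\<lambda>i. v (\<beta> 0 i)"]) (simp add: esum)
  next
    fix v :: "'j \<Rightarrow> 'a"
    obtain v' where v': "\<forall>i\<in>C 0. v i = v' (\<beta> 0 i)" using pull[of 0 v] by (rule exE)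
    have "(\<Sum>i\<in>C 0. e (\<beta> 0 i) * v i) = (\<Sum>i\<in>B 0. e i * v' i)"
      unfolding esum[symmetric] by (rule sum.cong) (use v' in auto)
    moreover have "boundary_mod J C ?D 0 v \<longleftrightarrow> boundary_mod J C ?D 0 (\<lambda>i. v' (\<beta> 0 i))"
      using v' by (simp add: boundary_mod_def)
    ultimately show "(\<Sum>i\<in>C 0. e (\<beta> 0 i) * v i) \<in> A \<longleftrightarrow> boundary_mod J C ?D 0 v"
      using res bd[of 0 v'] by (simp add: resolution_mod_def)
  next
    fix n and v :: "'j \<Rightarrow> 'a"
    obtain v' where v': "\<forall>i\<in>C (Suc n). v i = v' (\<beta> (Suc n) i)" using pull[of "Suc n" v] by (rule exE)
    have "boundary_mod J C ?D (Suc n) v \<longleftrightarrow> boundary_mod J C ?D (Suc n) (\<lambda>i. v' (\<beta> (Suc n) i))"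
      using v' by (simp add: boundary_mod_def)
    moreover have "cycle_mod J C ?D (Suc n) v \<longleftrightarrow> cycle_mod J C ?D (Suc n) (\<lambda>i. v' (\<beta> (Suc n) i))"
      using cycle_mod_cong[of J C ?D "Suc n" v "\<lambda>i. v' (\<beta> (Suc n) i)"]
        cycle_mod_cong[of J C ?D "Suc n" "\<lambda>i. v' (\<beta> (Suc n) i)" v] v' by auto
    ultimately show "cycle_mod J C ?D (Suc n) v \<longleftrightarrow> boundary_mod J C ?D (Suc n) v"
      using res bd[of "Suc n" v'] cyc[of "Suc n" v'] by (simp add: resolution_mod_def)
  qed
qed

lemma resolution_reindex_nat:
  assumes "resolution_mod J A B D e"
  shows "\<exists>b D' e'. resolution_mod J A (\<lambda>n. {..<b n :: nat}) D' e' \<and> (\<forall>n. b n = card (B n))"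
proof -
  have "\<exists>\<beta>. bij_betw \<beta> {..<card (B n)} (B n)" for n
    using ex_bij_betw_nat_finite[of "B n"] assms by (auto simp: resolution_mod_def atLeast0LessThan)
  then obtain \<beta> where "\<And>n. bij_betw (\<beta> n) {..<card (B n)} (B n)" by metis
  from resolution_reindex[OF assms this] show ?thesis
    by (intro exI[of _ "\<lambda>n. card (B n)"]) auto
qed

text \<open>
  \<open>N\<close> is the quotient of a commutative ring by \<open>K\<close>, via \<open>\<nu>\<close>, and \<open>R\<close> acts through the surjection \<open>\<pi>\<close>.
\<close>

locale presented_module =
  fixes R :: "('b, 'm) ring_scheme" and N :: "('b, 'c) module"
    and \<pi> :: "'a::comm_ring_1 \<Rightarrow> 'b" and \<nu> :: "'a \<Rightarrow> 'c" and K :: "'a set"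
  assumes mod: "module R N"
    and carrier_R: "carrier R = range \<pi>" and carrier_N: "carrier N = range \<nu>"
    and \<nu>_add: "\<nu> (p + q) = \<nu> p \<oplus>\<^bsub>N\<^esub> \<nu> q" and \<nu>_zero: "\<nu> 0 = \<zero>\<^bsub>N\<^esub>"
    and act: "\<pi> r \<odot>\<^bsub>N\<^esub> \<nu> p = \<nu> (r * p)"
    and \<nu>_eq: "\<nu> p = \<nu> q \<longleftrightarrow> p - q \<in> K"
begin

definition vector :: "nat \<Rightarrow> (nat \<Rightarrow> 'a) \<Rightarrow> nat \<Rightarrow> 'c" where
  "vector n x = (\<lambda>j. if j < n then \<nu> (x j) else \<zero>\<^bsub>N\<^esub>)"

lemma finsum_\<nu>:
  assumes "finite A"
  shows "(\<Oplus>\<^bsub>N\<^esub>j\<in>A. \<nu> (f j)) = \<nu> (\<Sum>j\<in>A. f j)"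
proof -
  interpret module R N by (rule mod)
  show ?thesis
    using assms by (induction A rule: finite_induct) (simp_all add: \<nu>_zero \<nu>_add carrier_N)
qed

lemma power_module_eq: "power_module N n = range (vector n)"
proof (intro equalityI subsetI)
  fix v assume v: "v \<in> power_module N n"
  then have "\<forall>j<n. \<exists>x. v j = \<nu> x" by (auto simp: power_module_def carrier_N)
  then obtain x where "\<And>j. j < n \<Longrightarrow> v j = \<nu> (x j)" by metis
  then have "v = vector n x" using v by (auto simp: vector_def power_module_def)
  then show "v \<in> range (vector n)" by blast
qed (auto simp: vector_def power_module_def carrier_N)

lemma mat_apply_vector:
  assumes "\<And>i j. i < p \<Longrightarrow> j < q \<Longrightarrow> D i j = \<pi> (D' i j)"
  shows "mat_apply N p q D (vector q x) = vector p (mat_vec {..<q} D' x)"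
proof
  fix i
  interpret module R N by (rule mod)
  show "mat_apply N p q D (vector q x) i = vector p (mat_vec {..<q} D' x) i"
  proof (cases "i < p")
    case True
    have "(\<Oplus>\<^bsub>N\<^esub>j\<in>{..<q}. D i j \<odot>\<^bsub>N\<^esub> vector q x j) = (\<Oplus>\<^bsub>N\<^esub>j\<in>{..<q}. \<nu> (D' i j * x j))"
      by (intro M.finsum_cong') (auto simp: assms True vector_def act carrier_N)
    then show ?thesis using True by (simp add: mat_apply_def vector_def finsum_\<nu> mat_vec_def)
  qed (simp add: mat_apply_def vector_def)
qed

lemma vector_eq_iff: "vector n x = vector n y \<longleftrightarrow> (\<forall>j\<in>{..<n}. x j - y j \<in> K)"
  by (auto simp: vector_def fun_eq_iff \<nu>_eq)

lemma vector_zero_iff: "vector n x = (\<lambda>_. \<zero>\<^bsub>N\<^esub>) \<longleftrightarrow> (\<forall>j\<in>{..<n}. x j \<in> K)"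
  using \<nu>_eq[of _ 0] by (auto simp: vector_def fun_eq_iff \<nu>_zero)

lemma tor_cycles_eq:
  assumes D: "\<And>n i j. i < b n \<Longrightarrow> j < b (Suc n) \<Longrightarrow> D n i j = \<pi> (D' n i j)"
  shows "tor_cycles N b D n = vector (b n) ` {x. cycle_mod K (\<lambda>n. {..<b n}) D' n x}"
proof (cases n)
  case (Suc m)
  have "{v \<in> power_module N (b n). mat_apply N (b m) (b n) (D m) v = (\<lambda>_. \<zero>\<^bsub>N\<^esub>)} =
      vector (b n) ` {x. mat_apply N (b m) (b n) (D m) (vector (b n) x) = (\<lambda>_. \<zero>\<^bsub>N\<^esub>)}"
    by (auto simp: power_module_eq)
  also have "\<dots> = vector (b n) ` {x. cycle_mod K (\<lambda>n. {..<b n}) D' n x}"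
    using Suc by (simp add: mat_apply_vector[of "b m" "b (Suc m)" "D m" "D' m", OF D] vector_zero_iff cycle_mod_def)
  finally show ?thesis using Suc by (simp add: tor_cycles_def)
qed (simp add: tor_cycles_def power_module_eq cycle_mod_def)

lemma tor_boundaries_eq:
  assumes D: "\<And>n i j. i < b n \<Longrightarrow> j < b (Suc n) \<Longrightarrow> D n i j = \<pi> (D' n i j)"
  shows "tor_boundaries N b D n = vector (b n) ` {x. boundary_mod K (\<lambda>n. {..<b n}) D' n x}"
proof -
  have "tor_boundaries N b D n = range (\<lambda>w. vector (b n) (mat_vec {..<b (Suc n)} (D' n) w))"
    unfolding tor_boundaries_def power_module_eq image_image
    by (simp add: mat_apply_vector[of "b n" "b (Suc n)" "D n" "D' n", OF D])
  also have "\<dots> = vector (b n) ` {x. boundary_mod K (\<lambda>n. {..<b n}) D' n x}"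
  proof (intro equalityI subsetI)
    fix v assume "v \<in> vector (b n) ` {x. boundary_mod K (\<lambda>n. {..<b n}) D' n x}"
    then obtain x w where "v = vector (b n) x" "\<forall>i\<in>{..<b n}. x i - mat_vec {..<b (Suc n)} (D' n) w i \<in> K"
      by (auto simp: boundary_mod_def)
    then have "v = vector (b n) (mat_vec {..<b (Suc n)} (D' n) w)"
      using vector_eq_iff by blast
    then show "v \<in> range (\<lambda>w. vector (b n) (mat_vec {..<b (Suc n)} (D' n) w))" by blast
  next
    fix v assume "v \<in> range (\<lambda>w. vector (b n) (mat_vec {..<b (Suc n)} (D' n) w))"
    then obtain w where w: "v = vector (b n) (mat_vec {..<b (Suc n)} (D' n) w)" by blast
    have "0 \<in> K" using \<nu>_eq[of 0 0] by simp
    then have "boundary_mod K (\<lambda>n. {..<b n}) D' n (mat_vec {..<b (Suc n)} (D' n) w)"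
      unfolding boundary_mod_def by (intro exI[of _ w]) simp
    then show "v \<in> vector (b n) ` {x. boundary_mod K (\<lambda>n. {..<b n}) D' n x}" using w by blast
  qed
  finally show ?thesis .
qed

end

lemma Collect_range_eq_iff:
  assumes "S \<subseteq> range f"
  shows "{v \<in> range f. Q v} = S \<longleftrightarrow> (\<forall>x. Q (f x) \<longleftrightarrow> f x \<in> S)"
proof
  assume eq: "{v \<in> range f. Q v} = S"
  show "\<forall>x. Q (f x) \<longleftrightarrow> f x \<in> S" unfolding eq[symmetric] by simp
next
  assume "\<forall>x. Q (f x) \<longleftrightarrow> f x \<in> S"
  then show "{v \<in> range f. Q v} = S" using assms by auto
qed

text \<open>
  The dictionary between resolutions over a ring with a carrier and resolutions over a quotient of the
  ambient ring: images of maps become congruences.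
\<close>

lemma free_resolution_iff:
  assumes RR: "presented_module R (module_along id R) \<pi> \<pi> J" and RM: "presented_module R M \<pi> \<mu> A"
    and A: "self.subspace A"
    and D: "\<And>n i j. i < b n \<Longrightarrow> j < b (Suc n) \<Longrightarrow> D n i j = \<pi> (D' n i j)"
    and e: "\<And>j. j < b 0 \<Longrightarrow> e j = \<mu> (e' j)"
  shows "free_resolution R M b D e \<longleftrightarrow> resolution_mod J A (\<lambda>n. {..<b n}) D' e'"
proof -
  interpret F: presented_module R "module_along id R" \<pi> \<pi> J by (rule RR)
  interpret M: presented_module R M \<pi> \<mu> A by (rule RM)
  interpret MM: module R M by (rule M.mod)
  let ?B = "\<lambda>n. {..<b n}"
  let ?d = "\<lambda>n. mat_apply (module_along id R) (b n) (b (Suc n)) (D n)"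
  let ?P = "\<lambda>n. power_module (module_along id R) (b n)"
  have d: "?d n (F.vector (b (Suc n)) x) = F.vector (b n) (mat_vec (?B (Suc n)) (D' n) x)" for n x
    by (rule F.mat_apply_vector[OF D])
  have zero: "\<zero>\<^bsub>module_along id R\<^esub> = \<zero>\<^bsub>R\<^esub>" by (simp add: module_along_def)
  have eps: "(\<Oplus>\<^bsub>M\<^esub>j\<in>{..<b 0}. F.vector (b 0) x j \<odot>\<^bsub>M\<^esub> e j) = \<mu> (\<Sum>j\<in>?B 0. e' j * x j)" for x
  proof -
    have "(\<Oplus>\<^bsub>M\<^esub>j\<in>{..<b 0}. F.vector (b 0) x j \<odot>\<^bsub>M\<^esub> e j) = (\<Oplus>\<^bsub>M\<^esub>j\<in>{..<b 0}. \<mu> (e' j * x j))"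
      by (intro MM.M.finsum_cong') (auto simp: F.vector_def e M.act M.carrier_N mult.commute)
    then show ?thesis by (simp add: M.finsum_\<nu>)
  qed
  have mem_image: "F.vector (b n) x \<in> ?d n ` ?P (Suc n) \<longleftrightarrow> boundary_mod J ?B D' n x" for n x
    unfolding F.power_module_eq image_image d boundary_mod_def F.vector_eq_iff[symmetric] by auto
  have 1: "(\<lambda>v. \<Oplus>\<^bsub>M\<^esub>j\<in>{..<b 0}. v j \<odot>\<^bsub>M\<^esub> e j) ` ?P 0 = carrier M \<longleftrightarrow>
      (\<exists>v. (\<Sum>j\<in>?B 0. e' j * v j) - 1 \<in> A)"
  proof
    assume "(\<lambda>v. \<Oplus>\<^bsub>M\<^esub>j\<in>{..<b 0}. v j \<odot>\<^bsub>M\<^esub> e j) ` ?P 0 = carrier M"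
    then have "\<mu> 1 \<in> (\<lambda>v. \<Oplus>\<^bsub>M\<^esub>j\<in>{..<b 0}. v j \<odot>\<^bsub>M\<^esub> e j) ` range (F.vector (b 0))"
      by (simp add: M.carrier_N F.power_module_eq)
    then obtain x where "\<mu> 1 = \<mu> (\<Sum>j\<in>?B 0. e' j * x j)" by (auto simp: eps)
    then show "\<exists>v. (\<Sum>j\<in>?B 0. e' j * v j) - 1 \<in> A" using M.\<nu>_eq by metis
  next
    assume "\<exists>v. (\<Sum>j\<in>?B 0. e' j * v j) - 1 \<in> A"
    then obtain v where v: "(\<Sum>j\<in>?B 0. e' j * v j) - 1 \<in> A" by blast
    have "\<mu> s = (\<Oplus>\<^bsub>M\<^esub>j\<in>{..<b 0}. F.vector (b 0) (\<lambda>j. s * v j) j \<odot>\<^bsub>M\<^esub> e j)" for s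
    proof -
      have "s * ((\<Sum>j\<in>?B 0. e' j * v j) - 1) \<in> A" by (rule self.subspace_scale[OF A v])
      then have "(\<Sum>j\<in>?B 0. e' j * (s * v j)) - s \<in> A"
        by (simp add: right_diff_distrib sum_distrib_left mult.left_commute)
      then show ?thesis unfolding eps using M.\<nu>_eq by metis
    qed
    then have "carrier M \<subseteq> (\<lambda>v. \<Oplus>\<^bsub>M\<^esub>j\<in>{..<b 0}. v j \<odot>\<^bsub>M\<^esub> e j) ` ?P 0"
      unfolding M.carrier_N F.power_module_eq by auto
    moreover have "(\<lambda>v. \<Oplus>\<^bsub>M\<^esub>j\<in>{..<b 0}. v j \<odot>\<^bsub>M\<^esub> e j) ` ?P 0 \<subseteq> carrier M"
      unfolding M.carrier_N F.power_module_eq by (auto simp: eps)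
    ultimately show "(\<lambda>v. \<Oplus>\<^bsub>M\<^esub>j\<in>{..<b 0}. v j \<odot>\<^bsub>M\<^esub> e j) ` ?P 0 = carrier M" by blast
  qed
  have sets: "{v \<in> ?P n. Q v} = ?d n ` ?P (Suc n) \<longleftrightarrow> (\<forall>x. Q (F.vector (b n) x) \<longleftrightarrow> boundary_mod J ?B D' n x)" for n Q
  proof -
    have sub: "?d n ` ?P (Suc n) \<subseteq> range (F.vector (b n))" by (auto simp: F.power_module_eq d)
    have "{v \<in> ?P n. Q v} = ?d n ` ?P (Suc n) \<longleftrightarrow>
        (\<forall>x. Q (F.vector (b n) x) \<longleftrightarrow> F.vector (b n) x \<in> ?d n ` ?P (Suc n))"
      unfolding F.power_module_eq[of "b n"] by (rule Collect_range_eq_iff[OF sub])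
    then show ?thesis by (simp only: mem_image)
  qed
  have 2: "{v \<in> ?P 0. (\<Oplus>\<^bsub>M\<^esub>j\<in>{..<b 0}. v j \<odot>\<^bsub>M\<^esub> e j) = \<zero>\<^bsub>M\<^esub>} = ?d 0 ` ?P (Suc 0) \<longleftrightarrow>
      (\<forall>v. (\<Sum>j\<in>?B 0. e' j * v j) \<in> A \<longleftrightarrow> boundary_mod J ?B D' 0 v)"
    unfolding sets eps M.\<nu>_zero[symmetric] M.\<nu>_eq by simp
  have 3: "{v \<in> ?P (Suc n). ?d n v = (\<lambda>_. \<zero>\<^bsub>R\<^esub>)} = ?d (Suc n) ` ?P (Suc (Suc n)) \<longleftrightarrow>
      (\<forall>v. cycle_mod J ?B D' (Suc n) v \<longleftrightarrow> boundary_mod J ?B D' (Suc n) v)" for n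
    unfolding sets d zero[symmetric] F.vector_zero_iff by (simp add: cycle_mod_def)
  have 4: "\<forall>n. \<forall>r<b n. \<forall>c<b (Suc n). D n r c \<in> carrier R" "\<forall>j<b 0. e j \<in> carrier M"
    using D e by (auto simp: F.carrier_R M.carrier_N)
  show ?thesis
    unfolding free_resolution_def Let_def resolution_mod_def 1 2 One_nat_def 3
    using 4 by blast
qed


text \<open>
  Cycles and boundaries with coefficients in \<open>k\<close> are subspaces of \<open>k\<^sup>n\<close>, \<open>n\<close> being the rank \<open>b n\<close>, and the basis
  cycles represent a basis of their quotient.
\<close>

lemma tor_dim_of_basis:
  fixes N :: "('b, 'k::field) module" and D' :: "nat \<Rightarrow> nat \<Rightarrow> nat \<Rightarrow> 'k mpoly"
  assumes N: "presented_module R N \<pi> const_coeff maximal"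
    and D: "\<And>n i j. i < b n \<Longrightarrow> j < b (Suc n) \<Longrightarrow> D n i j = \<pi> (D' n i j)"
    and cx: "\<And>x. boundary_mod maximal (\<lambda>n. {..<b n}) D' n x \<Longrightarrow> cycle_mod maximal (\<lambda>n. {..<b n}) D' n x"
    and basis: "homology_basis Const (cycle_mod maximal (\<lambda>n. {..<b n}) D' n)
      (boundary_mod maximal (\<lambda>n. {..<b n}) D' n) K v"
  shows "coord.dim (tor_cycles N b D n) - coord.dim (tor_boundaries N b D n) = card K"
proof -
  interpret N: presented_module R N \<pi> const_coeff maximal by (rule N)
  let ?B = "\<lambda>n. {..<b n}"
  let ?Z = "tor_cycles N b D n" and ?W = "tor_boundaries N b D n"
  have Z: "?Z = N.vector (b n) ` {x. cycle_mod maximal ?B D' n x}"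
    and W: "?W = N.vector (b n) ` {x. boundary_mod maximal ?B D' n x}"
    using N.tor_cycles_eq[of b D D' n] N.tor_boundaries_eq[of b D D' n] D by blast+
  have vec: "N.vector m x = (\<lambda>j. if j < m then const_coeff (x j) else 0)" for m x
    using N.\<nu>_zero by (auto simp: N.vector_def fun_eq_iff)
  have vec_comb: "N.vector m (\<lambda>j. Const s0 * z j + (\<Sum>a\<in>L. Const (s a) * x a j)) =
      (\<lambda>j. s0 * N.vector m z j + (\<Sum>a\<in>L. s a * N.vector m (x a) j))" for m s0 z s x and L :: "'l set"
    by (auto simp: vec fun_eq_iff const_coeff_add const_coeff_mult const_coeff_sum)
  have sub: "coord.subspace (N.vector (b n) ` {x. P x})"
    if P: "\<And>s0 z. \<And>L :: unit set. \<And>s x. P z \<Longrightarrow> (\<And>a. a \<in> L \<Longrightarrow> P (x a)) \<Longrightarrow> P (\<lambda>i. Const s0 * z i + (\<Sum>a\<in>L. Const (s a) * x a i))"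
      and P0: "P (\<lambda>_. 0)" for P
    unfolding coord.subspace_def
  proof (intro conjI ballI allI)
    show "0 \<in> N.vector (b n) ` {x. P x}"
      by (rule image_eqI[of _ _ "\<lambda>_. 0"]) (use P0 in \<open>auto simp: vec\<close>)
  next
    fix y1 y2 assume "y1 \<in> N.vector (b n) ` {x. P x}" "y2 \<in> N.vector (b n) ` {x. P x}"
    then obtain x1 x2 where x: "y1 = N.vector (b n) x1" "P x1" "y2 = N.vector (b n) x2" "P x2" by blast
    have "P (\<lambda>i. Const 1 * x1 i + (\<Sum>a\<in>{()}. Const 1 * x2 i))" by (rule P) (use x in auto)
    then show "y1 + y2 \<in> N.vector (b n) ` {x. P x}"
      by (intro image_eqI[of _ _ "\<lambda>i. Const 1 * x1 i + (\<Sum>a\<in>{()}. Const 1 * x2 i)"])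
        (auto simp: x vec fun_eq_iff const_coeff_add)
  next
    fix c y assume "y \<in> N.vector (b n) ` {x. P x}"
    then obtain x where x: "y = N.vector (b n) x" "P x" by blast
    have "P (\<lambda>i. Const c * x i + (\<Sum>a\<in>({} :: unit set). Const 0 * 0))" by (rule P) (use x in auto)
    then show "(\<lambda>i. c * y i) \<in> N.vector (b n) ` {x. P x}"
      by (intro image_eqI[of _ _ "\<lambda>i. Const c * x i + (\<Sum>a\<in>({} :: unit set). Const 0 * 0)"])
        (auto simp: x vec fun_eq_iff const_coeff_mult)
  qed
  have b0: "boundary_mod maximal ?B D' n (\<lambda>_. 0)"
    unfolding boundary_mod_def
    by (rule exI[of _ "\<lambda>_. 0"]) (simp add: mat_vec_def self.subspace_0[OF subspace_maximal])
  have subZ: "coord.subspace ?Z"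
    unfolding Z by (rule sub[OF cycle_mod_comb[OF subspace_maximal] cx[OF b0]])
  have subW: "coord.subspace ?W"
    unfolding W by (rule sub[OF boundary_mod_comb[OF subspace_maximal] b0])
  have "coord.dim ?Z = coord.dim ?W + card K"
  proof (rule coord.dim_quotient[where v = "\<lambda>a. N.vector (b n) (v a)" and T = "unit_vec ` {..<b n}"])
    show "?W \<subseteq> coord.span (unit_vec ` {..<b n})"
      unfolding W by (auto simp: vec intro!: supported_in_span_unit_vec split: if_splits)
    show "finite K" using basis by (simp add: homology_basis_def)
    show "?W \<subseteq> ?Z" unfolding Z W using cx by blast
    show "N.vector (b n) (v a) \<in> ?Z" if "a \<in> K" for a
      using basis that unfolding Z by (simp add: homology_basis_def)
  next
    fix z assume "z \<in> ?Z"
    then obtain x where x: "z = N.vector (b n) x" "cycle_mod maximal ?B D' n x" by (auto simp: Z)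
    then obtain c where c: "boundary_mod maximal ?B D' n (\<lambda>i. x i - (\<Sum>a\<in>K. Const (c a) * v a i))"
      using basis unfolding homology_basis_def by blast
    have "z - (\<Sum>a\<in>K. (\<lambda>i. c a * N.vector (b n) (v a) i)) =
        N.vector (b n) (\<lambda>i. x i - (\<Sum>a\<in>K. Const (c a) * v a i))"
      by (auto simp: x vec fun_eq_iff fn_sum_apply const_coeff_diff const_coeff_sum const_coeff_mult)
    then show "\<exists>c. z - (\<Sum>a\<in>K. (\<lambda>i. c a * N.vector (b n) (v a) i)) \<in> ?W"
      using c unfolding W by blast
  next
    fix c assume "(\<Sum>a\<in>K. (\<lambda>i. c a * N.vector (b n) (v a) i)) \<in> ?W"
    then obtain x where x: "boundary_mod maximal ?B D' n x"
      "(\<Sum>a\<in>K. (\<lambda>i. c a * N.vector (b n) (v a) i)) = N.vector (b n) x" by (auto simp: W)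
    have "boundary_mod maximal ?B D' n (\<lambda>i. \<Sum>a\<in>K. Const (c a) * v a i)"
    proof (rule boundary_mod_cong[OF subspace_maximal x(1)])
      fix i assume "i \<in> {..<b n}"
      then show "x i - (\<Sum>a\<in>K. Const (c a) * v a i) \<in> maximal"
        using fun_cong[OF x(2), of i]
        by (simp add: maximal_def vec fn_sum_apply const_coeff_diff const_coeff_sum const_coeff_mult)
    qed
    then show "\<forall>a\<in>K. c a = 0" using basis unfolding homology_basis_def by blast
  qed (simp_all add: subZ subW)
  then show ?thesis by simp
qed

lemma boundary_maximal_cycle:
  assumes J: "self.subspace J" and "J \<subseteq> maximal" and cx: "complex_mod J B D"
    and "boundary_mod maximal B D n x"
  shows "cycle_mod maximal B D n x"
  unfolding cycle_mod_def
proof (intro allI impI ballI)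
  fix p i assume n: "Suc p = n" and i: "i \<in> B p"
  obtain w where w: "\<And>i. i \<in> B n \<Longrightarrow> x i - mat_vec (B (Suc n)) (D n) w i \<in> maximal"
    using assms(4) by (auto simp: boundary_mod_def)
  have "mat_vec (B (Suc p)) (D p) (mat_vec (B (Suc n)) (D n) w) i \<in> maximal"
    using cx i n assms(2) by (auto simp: complex_mod_def)
  then show "mat_vec (B (Suc p)) (D p) x i \<in> maximal"
    using mat_vec_mem_cong[OF subspace_maximal, of "B (Suc p)" x "mat_vec (B (Suc n)) (D n) w" "D p" i] w n by simp
qed

text \<open>
  The dimension of Tor can be computed from any resolution: compare the given resolution and the
  chosen one with a resolution of the residue field.
\<close>

theorem tor_dim_eq:
  fixes N :: "('b, 'k::field) module" and J A :: "'k mpoly set"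
  assumes RR: "presented_module R (module_along id R) \<pi> \<pi> J"
    and RM: "presented_module R M \<pi> \<mu> A"
    and RN: "presented_module R N \<pi> const_coeff maximal"
    and V: "finite V" and J: "self.subspace J" and A: "self.subspace A"
    and OJ: "outside V \<subseteq> J" and JA: "J \<subseteq> A" and Jm: "J \<subseteq> maximal"
    and res: "resolution_mod J A B D e"
    and basis: "homology_basis Const (cycle_mod maximal B D n) (boundary_mod maximal B D n) K v"
  shows "tor_dim R M N n = card K"
proof -
  interpret M: presented_module R M \<pi> \<mu> A by (rule RM)
  interpret F: presented_module R "module_along id R" \<pi> \<pi> J by (rule RR)
  obtain b0 D0 e0 where "resolution_mod J A (\<lambda>n. {..<b0 n :: nat}) D0 e0"
  proof -
    obtain B1 and D1 :: "nat \<Rightarrow> nat \<Rightarrow> nat \<Rightarrow> 'k mpoly" where "resolution_mod J A B1 D1 (\<lambda>_. 1) \<and> B1 0 = {0}"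
      using resolution_exists[OF V J A OJ JA] by (elim exE)
    then have "resolution_mod J A B1 D1 (\<lambda>_. 1)" ..
    from resolution_reindex_nat[OF this] show ?thesis by (elim exE conjE) (rule that)
  qed
  then have "free_resolution R M b0 (\<lambda>n i j. \<pi> (D0 n i j)) (\<lambda>j. \<mu> (e0 j))"
    by (subst free_resolution_iff[OF RR RM A]) auto
  then have "\<exists>s. case s of (b, D, e) \<Rightarrow> free_resolution R M b D e"
    by (intro exI[of _ "(b0, \<lambda>n i j. \<pi> (D0 n i j), \<lambda>j. \<mu> (e0 j))"]) simp
  from someI_ex[OF this] obtain b D1 e1 where
    s: "(SOME (b, D, e). free_resolution R M b D e) = (b, D1, e1)" and free: "free_resolution R M b D1 e1"
    by (auto split: prod.splits)
  note fr = free[unfolded free_resolution_def Let_def F.carrier_R M.carrier_N]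
  from conjunct1[OF fr] conjunct1[OF conjunct2[OF fr]] have "\<forall>n i j. \<exists>p. i < b n \<longrightarrow> j < b (Suc n) \<longrightarrow> D1 n i j = \<pi> p"
    and "\<forall>j. \<exists>p. j < b 0 \<longrightarrow> e1 j = \<mu> p" unfolding image_iff by auto
  then obtain D' e' where D': "\<And>n i j. i < b n \<Longrightarrow> j < b (Suc n) \<Longrightarrow> D1 n i j = \<pi> (D' n i j)"
    and e': "\<And>j. j < b 0 \<Longrightarrow> e1 j = \<mu> (e' j)"
    by metis
  have res': "resolution_mod J A (\<lambda>n. {..<b n}) D' e'"
    using free free_resolution_iff[OF RR RM A, of b D1 D' e1 e'] D' e' by blast
  \<comment> \<open>Carry the basis to a resolution of the residue field and from there to the chosen resolution.\<close>
  obtain C E where G: "resolution_mod J maximal C (E :: nat \<Rightarrow> nat \<Rightarrow> nat \<Rightarrow> 'k mpoly) (\<lambda>_. 1)"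
    using resolution_exists[OF V J subspace_maximal OJ Jm] by (elim exE conjE)
  obtain w where "homology_basis Const (cycle_mod A C E n) (boundary_mod A C E n) K w"
    using balance_tor[OF J A subspace_maximal res G basis] by blast
  then obtain v' where basis': "homology_basis Const (cycle_mod maximal (\<lambda>n. {..<b n}) D' n)
      (boundary_mod maximal (\<lambda>n. {..<b n}) D' n) K v'"
    using balance_tor[OF J subspace_maximal A G res'] by blast
  have "coord.dim (tor_cycles N b D1 n) - coord.dim (tor_boundaries N b D1 n) = card K"
    by (rule tor_dim_of_basis[OF RN D' boundary_maximal_cycle[OF J Jm complex_of_resolution[OF J res']] basis'])
  then show ?thesis by (simp add: tor_dim_def s)
qed

section \<open>Betti numbers of quotients of polynomial rings\<close>

lemma carrier_mpoly_ring: "p \<in> carrier (mpoly_ring V) \<longleftrightarrow> restrict_vars V p = p"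
  by (simp add: mpoly_ring_def restrict_id_iff)

lemma carrier_mpoly_ring_range: "carrier (mpoly_ring V) = range (restrict_vars V)"
  by (auto simp: carrier_mpoly_ring image_iff) (metis)

lemma ring_mpoly_ring: "ring (mpoly_ring V :: 'k::field mpoly ring)"
  using mpoly_ring_cring[of V] by (rule cring.axioms(1))

lemma mpoly_ring_simps [simp]:
  "\<zero>\<^bsub>mpoly_ring V\<^esub> = 0" "\<one>\<^bsub>mpoly_ring V\<^esub> = 1"
  "p \<oplus>\<^bsub>mpoly_ring V\<^esub> q = p + q" "p \<otimes>\<^bsub>mpoly_ring V\<^esub> q = p * q"
  by (simp_all add: mpoly_ring_def)

lemma uminus_mpoly_ring:
  assumes "p \<in> carrier (mpoly_ring V)"
  shows "\<ominus>\<^bsub>mpoly_ring V\<^esub> p = - p"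
proof -
  interpret ring "mpoly_ring V" by (rule ring_mpoly_ring)
  have "- p \<in> carrier (mpoly_ring V)"
    using assms restrict_diff[of V 0 p] by (simp add: carrier_mpoly_ring)
  then show ?thesis using assms by (intro minus_equality) auto
qed

lemma ideal_in_iff: "ideal I (mpoly_ring V) \<longleftrightarrow> ideal_in V (I :: 'k::field mpoly set)"
proof
  assume "ideal I (mpoly_ring V)"
  then interpret ideal I "mpoly_ring V" .
  show "ideal_in V I"
    unfolding ideal_in_def
  proof (intro conjI ballI allI)
    show "0 \<in> I" using additive_subgroup.zero_closed[OF is_additive_subgroup] by simp
    show "restrict_vars V p = p" if "p \<in> I" for p using that a_subset by (auto simp: carrier_mpoly_ring)
    show "p + q \<in> I" if "p \<in> I" "q \<in> I" for p q using additive_subgroup.a_closed[OF is_additive_subgroup that] by simp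
    show "restrict_vars V p * q \<in> I" if "q \<in> I" for p q
      using I_l_closed[OF that, of "restrict_vars V p"] by (simp add: carrier_mpoly_ring)
  qed
next
  assume I: "ideal_in V I"
  have car: "I \<subseteq> carrier (mpoly_ring V)" using I by (auto simp: ideal_in_def carrier_mpoly_ring)
  have neg: "- p \<in> I" if "p \<in> I" for p
    using ideal_in_mult[OF I restrict_Const[of V "- 1"] that] by (simp add: single_uminus)
  have "subgroup I (add_monoid (mpoly_ring V))"
  proof
    show "inv\<^bsub>add_monoid (mpoly_ring V)\<^esub> p \<in> I" if "p \<in> I" for p
      using uminus_mpoly_ring[of p V] neg[OF that] car that by (auto simp: a_inv_def)
  qed (use I car in \<open>auto simp: ideal_in_def\<close>)
  moreover have "p * q \<in> I" "q * p \<in> I" if "q \<in> I" "restrict_vars V p = p" for p q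
    using ideal_in_mult[OF I that(2,1)] by (simp_all add: mult.commute)
  ultimately show "ideal I (mpoly_ring V)"
    by (intro idealI[OF ring_mpoly_ring]) (auto simp: carrier_mpoly_ring)
qed

lemma union_carrier:
  assumes I1: "ideal_in V1 I1" and I2: "ideal_in V2 I2"
  shows "I1 \<union> I2 \<subseteq> carrier (mpoly_ring (V1 \<union> V2))"
proof
  fix p assume "p \<in> I1 \<union> I2"
  then have "restrict_vars V1 p = p \<or> restrict_vars V2 p = p" using I1 I2 by (auto simp: ideal_in_def)
  then show "p \<in> carrier (mpoly_ring (V1 \<union> V2))"
    using restrict_restrict_subset[of V1 "V1 \<union> V2" p] restrict_restrict_subset[of V2 "V1 \<union> V2" p]
    by (auto simp: carrier_mpoly_ring)
qed

text \<open>
  The ideal generated by \<open>I1\<close> and \<open>I2\<close> in \<open>k[V1 \<union> V2]\<close> defines the tensor product of the two quotients.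
\<close>

lemma genideal_join:
  fixes I1 I2 :: "'k::field mpoly set"
  assumes I1: "ideal_in V1 I1" and I2: "ideal_in V2 I2"
  shows "lift_ideal (V1 \<union> V2) (genideal (mpoly_ring (V1 \<union> V2)) (I1 \<union> I2)) = join_ideals V1 V2 I1 I2"
proof -
  let ?V = "V1 \<union> V2"
  let ?G = "genideal (mpoly_ring ?V) (I1 \<union> I2)" and ?J = "join_ideals V1 V2 I1 I2"
  interpret ring "mpoly_ring ?V :: 'k mpoly ring" by (rule ring_mpoly_ring)
  note car = union_carrier[OF I1 I2]
  have G: "ideal_in ?V ?G" using genideal_ideal[OF car] by (simp add: ideal_in_iff)
  have "I1 \<union> I2 \<subseteq> lift_ideal ?V ?G" using genideal_self[OF car] ideal_in_le_lift[OF G] by blast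
  moreover have "mvar ` (- ?V) \<subseteq> lift_ideal ?V ?G"
    using G by (auto simp: lift_ideal_def mvar_def restrict_single ideal_in_def)
  ultimately have "?J \<subseteq> lift_ideal ?V ?G"
    unfolding join_ideals_def by (intro self.span_minimal subspace_lift_ideal[OF G]) blast
  moreover have "lift_ideal ?V ?G \<subseteq> ?J"
  proof
    fix p assume p: "p \<in> lift_ideal ?V ?G"
    have "ideal_in ?V {q \<in> ?J. restrict_vars ?V q = q}"
      using self.subspace_0[OF subspace_join] self.subspace_add[OF subspace_join] self.subspace_scale[OF subspace_join]
      by (auto simp: ideal_in_def restrict_add restrict_mult)
    moreover have "I1 \<union> I2 \<subseteq> {q \<in> ?J. restrict_vars ?V q = q}"
      using car join_left[of _ I1] join_right[of _ I2] by (auto simp: carrier_mpoly_ring)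
    ultimately have "?G \<subseteq> {q \<in> ?J. restrict_vars ?V q = q}"
      by (intro genideal_minimal) (simp add: ideal_in_iff)
    then have 1: "restrict_vars ?V p \<in> ?J" using p by (auto simp: lift_ideal_def)
    have "p - restrict_vars ?V p \<in> ?J"
    proof (induction p rule: mpoly_induct)
      case (1 p q)
      have "p + q - restrict_vars ?V (p + q) = (p - restrict_vars ?V p) + (q - restrict_vars ?V q)"
        by (simp add: restrict_add)
      then show ?case using self.subspace_add[OF subspace_join 1] by (simp only:)
    next
      case (2 m c)
      show ?case
      proof (cases "Poly_Mapping.keys m \<subseteq> ?V")
        case True
        then show ?thesis by (simp add: restrict_single self.subspace_0[OF subspace_join])
      next
        case False
        then obtain i where i: "i \<in> Poly_Mapping.keys m" "i \<notin> ?V" by blast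
        then have "mvar i \<in> ?J" unfolding join_ideals_def by (intro self.span_base) blast
        from self.subspace_scale[OF subspace_join monomial_mem[OF subspace_join this i(1)], of "Const c"]
        show ?thesis using False by (simp add: restrict_single Const_mult_single)
      qed
    qed
    from self.subspace_add[OF subspace_join this 1] show "p \<in> ?J" by simp
  qed
  ultimately show ?thesis by blast
qed


lemma ring_of_type_simps [simp]:
  "carrier (ring_of_type_algebra :: 'k::field ring) = UNIV"
  "\<zero>\<^bsub>ring_of_type_algebra :: 'k ring\<^esub> = 0" "\<one>\<^bsub>ring_of_type_algebra :: 'k ring\<^esub> = 1"
  "x \<oplus>\<^bsub>ring_of_type_algebra :: 'k ring\<^esub> y = x + y" "x \<otimes>\<^bsub>ring_of_type_algebra :: 'k ring\<^esub> y = x * y"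
  by (simp_all add: ring_of_type_algebra_def)

lemma module_along_simps [simp]:
  "carrier (module_along \<phi> S) = carrier S" "\<zero>\<^bsub>module_along \<phi> S\<^esub> = \<zero>\<^bsub>S\<^esub>"
  "x \<oplus>\<^bsub>module_along \<phi> S\<^esub> y = x \<oplus>\<^bsub>S\<^esub> y" "r \<odot>\<^bsub>module_along \<phi> S\<^esub> x = \<phi> r \<otimes>\<^bsub>S\<^esub> x"
  by (simp_all add: module_along_def)

text \<open>
  The projection of the ambient ring onto the quotient ring, with variables outside \<open>V\<close> sent to zero.
\<close>

definition coset :: "nat set \<Rightarrow> 'k::field mpoly set \<Rightarrow> 'k mpoly \<Rightarrow> 'k mpoly set" where
  "coset V I p = I +>\<^bsub>mpoly_ring V\<^esub> restrict_vars V p"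

lemma presented_mpoly_ring:
  "presented_module (mpoly_ring V) (module_along id (mpoly_ring V)) (restrict_vars V) (restrict_vars V)
    (outside V :: 'k::field mpoly set)"
proof (rule presented_module.intro)
  show "module (mpoly_ring V) (module_along id (mpoly_ring V :: 'k mpoly ring))"
    by (rule module_along_module[OF mpoly_ring_cring ring_mpoly_ring id_ring_hom])
qed (auto simp: carrier_mpoly_ring_range restrict_add restrict_mult lift_ideal_def restrict_diff)

lemma range_const_coeff: "range const_coeff = (UNIV :: 'k::field set)"
  by (rule surjI[of const_coeff Const]) simp

lemma presented_residue_field:
  "presented_module (mpoly_ring V) residue_field (restrict_vars V) const_coeff (maximal :: 'k::field mpoly set)"
  unfolding residue_field_def
proof (rule presented_module.intro)
  show "module (mpoly_ring V) (module_along const_coeff (ring_of_type_algebra :: 'k ring))"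
    by (rule module_along_module[OF mpoly_ring_cring ring_from_type_algebra])
      (auto intro!: ring_hom_memI simp: const_coeff_mult const_coeff_add)
  show "carrier (module_along const_coeff (ring_of_type_algebra :: 'k ring)) = range const_coeff"
    by (simp add: range_const_coeff)
qed (auto simp: carrier_mpoly_ring_range const_coeff_add const_coeff_mult maximal_def const_coeff_diff)

context
  fixes V :: "nat set" and I :: "'k::field mpoly set"
  assumes I: "ideal I (mpoly_ring V)"
begin

interpretation ideal I "mpoly_ring V" by (rule I)

lemma coset_hom:
  "coset V I (p + q) = coset V I p \<oplus>\<^bsub>mpoly_ring V Quot I\<^esub> coset V I q"
  "coset V I (p * q) = coset V I p \<otimes>\<^bsub>mpoly_ring V Quot I\<^esub> coset V I q"
  "coset V I 0 = \<zero>\<^bsub>mpoly_ring V Quot I\<^esub>"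
proof -
  have car: "restrict_vars V p \<in> carrier (mpoly_ring V)" for p :: "'k mpoly"
    by (simp add: carrier_mpoly_ring)
  show "coset V I (p + q) = coset V I p \<oplus>\<^bsub>mpoly_ring V Quot I\<^esub> coset V I q"
    using ring_hom_add[OF rcos_ring_hom car car, of p q] by (simp add: coset_def restrict_add)
  show "coset V I (p * q) = coset V I p \<otimes>\<^bsub>mpoly_ring V Quot I\<^esub> coset V I q"
    using ring_hom_mult[OF rcos_ring_hom car car, of p q] by (simp add: coset_def restrict_mult)
  show "coset V I 0 = \<zero>\<^bsub>mpoly_ring V Quot I\<^esub>"
    using ring_hom_zero[OF rcos_ring_hom ring_mpoly_ring quotient_is_ring] by (simp add: coset_def)
qed

lemma coset_eq_iff: "coset V I p = coset V I q \<longleftrightarrow> p - q \<in> lift_ideal V I"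
proof -
  have car: "restrict_vars V p \<in> carrier (mpoly_ring V)" for p :: "'k mpoly"
    by (simp add: carrier_mpoly_ring)
  have "restrict_vars V p \<ominus>\<^bsub>mpoly_ring V\<^esub> restrict_vars V q = restrict_vars V (p - q)"
    by (simp add: a_minus_def uminus_mpoly_ring[OF car] restrict_diff)
  then show ?thesis
    using quotient_eq_iff_same_a_r_cos[OF I car car, of p q] by (simp add: coset_def lift_ideal_def)
qed

lemma carrier_quotient: "carrier (mpoly_ring V Quot I) = range (coset V I)"
  by (auto simp: FactRing_def A_RCOSETS_def' coset_def carrier_mpoly_ring_range)

lemma presented_quotient_ring:
  "presented_module (mpoly_ring V Quot I) (module_along id (mpoly_ring V Quot I)) (coset V I) (coset V I) (lift_ideal V I)"
proof (rule presented_module.intro)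
  show "module (mpoly_ring V Quot I) (module_along id (mpoly_ring V Quot I))"
    by (rule module_along_module[OF quotient_is_cring[OF mpoly_ring_cring] quotient_is_ring id_ring_hom])
qed (auto simp: carrier_quotient coset_hom coset_eq_iff)

lemma presented_quot_module:
  "presented_module (mpoly_ring V) (quot_module V I) (restrict_vars V) (coset V I) (lift_ideal V I)"
  unfolding quot_module_def
proof (rule presented_module.intro)
  show "module (mpoly_ring V) (module_along ((+>\<^bsub>mpoly_ring V\<^esub>) I) (mpoly_ring V Quot I))"
    by (rule module_along_module[OF mpoly_ring_cring quotient_is_ring rcos_ring_hom])
  show "restrict_vars V r \<odot>\<^bsub>module_along ((+>\<^bsub>mpoly_ring V\<^esub>) I) (mpoly_ring V Quot I)\<^esub> coset V I p = coset V I (r * p)" for r p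
    by (simp add: coset_hom(2)) (simp add: coset_def)
qed (auto simp: carrier_mpoly_ring_range carrier_quotient coset_hom coset_eq_iff)

lemma presented_residue_field_quot:
  assumes Im: "I \<subseteq> maximal"
  shows "presented_module (mpoly_ring V Quot I) residue_field_quot (coset V I) const_coeff maximal"
  unfolding residue_field_quot_def
proof (rule presented_module.intro)
  have elem: "the_elem (const_coeff ` coset V I p) = const_coeff p" for p
  proof -
    have "const_coeff ` coset V I p = {const_coeff p}"
    proof -
      have "const_coeff q = const_coeff p" if "q \<in> coset V I p" for q
        using that Im by (auto simp: coset_def a_r_coset_def' const_coeff_add maximal_def)
      moreover have "coset V I p \<noteq> {}"
        using additive_subgroup.zero_closed[OF is_additive_subgroup] by (auto simp: coset_def a_r_coset_def')
      ultimately show ?thesis by auto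
    qed
    then show ?thesis by simp
  qed
  let ?f = "\<lambda>a. the_elem (const_coeff ` a)"
  have one: "\<one>\<^bsub>mpoly_ring V Quot I\<^esub> = coset V I 1"
    by (simp add: FactRing_def coset_def)
  show "module (mpoly_ring V Quot I) (module_along ?f (ring_of_type_algebra :: 'k ring))"
    by (rule module_along_module[OF quotient_is_cring[OF mpoly_ring_cring] ring_from_type_algebra])
      (auto intro!: ring_hom_memI simp: carrier_quotient one elem const_coeff_mult const_coeff_add
        simp flip: coset_hom)
  show "carrier (module_along ?f (ring_of_type_algebra :: 'k ring)) = range const_coeff"
    by (simp add: range_const_coeff)
  show "coset V I r \<odot>\<^bsub>module_along ?f (ring_of_type_algebra :: 'k ring)\<^esub> const_coeff p = const_coeff (r * p)" for r p
    by (simp add: elem const_coeff_mult)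
qed (auto simp: carrier_quotient const_coeff_add maximal_def const_coeff_diff)

lemma ideal_in_I: "ideal_in V I" using I by (simp add: ideal_in_iff)

lemma outside_le_lift: "outside V \<subseteq> lift_ideal V I"
  using ideal_in_I by (auto simp: lift_ideal_def ideal_in_def)

lemma lift_le_maximal:
  assumes "I \<subseteq> maximal"
  shows "lift_ideal V I \<subseteq> maximal"
proof
  fix p assume "p \<in> lift_ideal V I"
  then have "restrict_vars V p \<in> maximal" using assms by (auto simp: lift_ideal_def)
  then show "p \<in> maximal" by (simp add: maximal_def)
qed

text \<open>
  Resolutions here are over the quotient ring, which is the ambient ring modulo \<open>lift_ideal V I\<close>; in
  \<open>betti_dim_eq\<close> they are over the polynomial ring.
\<close>

lemma residue_betti_eq:
  assumes V: "finite V" and Im: "I \<subseteq> maximal"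
    and res: "resolution_mod (lift_ideal V I) maximal B D e"
    and basis: "homology_basis Const (cycle_mod maximal B D n) (boundary_mod maximal B D n) K v"
  shows "residue_betti V I n = card K"
  unfolding residue_betti_def
  by (rule tor_dim_eq[OF presented_quotient_ring presented_residue_field_quot[OF Im] presented_residue_field_quot[OF Im]
        V subspace_lift_ideal[OF ideal_in_I] subspace_maximal outside_le_lift lift_le_maximal[OF Im] lift_le_maximal[OF Im] res basis])

lemma betti_dim_eq:
  assumes V: "finite V"
    and res: "resolution_mod (outside V) (lift_ideal V I) B D e"
    and basis: "homology_basis Const (cycle_mod maximal B D n) (boundary_mod maximal B D n) K v"
  shows "betti_dim V I n = card K"
  unfolding betti_dim_def
proof (rule tor_dim_eq[OF presented_mpoly_ring presented_quot_module presented_residue_field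
        V subspace_outside subspace_lift_ideal[OF ideal_in_I] subset_refl outside_le_lift _ res basis])
  show "outside V \<subseteq> (maximal :: 'k mpoly set)"
  proof
    fix p :: "'k mpoly" assume "p \<in> outside V"
    then have "const_coeff (restrict_vars V p) = 0" by (simp add: lift_ideal_def)
    then show "p \<in> maximal" by (simp add: maximal_def)
  qed
qed

end


section \<open>Betti numbers of tensor products\<close>

text \<open>
  The maximal ideal of \<open>k[V]\<close>, as polynomials without constant term instead of by generators.
\<close>

definition max_in :: "nat set \<Rightarrow> 'k::field mpoly set" where
  "max_in V = {p. restrict_vars V p = p \<and> const_coeff p = 0}"

lemma ideal_in_max_in: "ideal_in V (max_in V)"
  by (auto simp: ideal_in_def max_in_def restrict_add restrict_mult const_coeff_add const_coeff_mult)

lemma lift_max_in: "lift_ideal V (max_in V) = maximal"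
  by (auto simp: lift_ideal_def max_in_def maximal_def)

lemma mvar_maximal: "mvar i \<in> maximal"
proof -
  have "Poly_Mapping.lookup (Poly_Mapping.single i (1 :: nat)) i \<noteq> Poly_Mapping.lookup 0 i" by simp
  then have "Poly_Mapping.single i (1 :: nat) \<noteq> 0" by metis
  then show ?thesis by (simp add: maximal_def mvar_def const_coeff_def lookup_single when_def)
qed

lemma maximal_subset_of_mvars:
  assumes J: "self.subspace J" and mvar: "\<And>i. mvar i \<in> J"
  shows "maximal \<subseteq> (J :: 'k::field mpoly set)"
proof
  fix p :: "'k mpoly" assume p: "p \<in> maximal"
  have "p - Const (const_coeff p) \<in> J"
  proof (induction p rule: mpoly_induct)
    case (1 p q)
    have "p + q - Const (const_coeff (p + q)) = (p - Const (const_coeff p)) + (q - Const (const_coeff q))"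
      by (simp add: const_coeff_add Const_add)
    then show ?case using self.subspace_add[OF J 1] by (simp only:)
  next
    case (2 m c)
    show ?case
    proof (cases "m = 0")
      case True
      then show ?thesis by (simp add: self.subspace_0[OF J])
    next
      case False
      then obtain i where i: "i \<in> Poly_Mapping.keys m"
        using poly_mapping_eqI[of m 0] by (auto simp: in_keys_iff)
      from self.subspace_scale[OF J monomial_mem[OF J mvar i], of "Const c"] False
      show ?thesis by (simp add: Const_mult_single const_coeff_def lookup_single when_def)
    qed
  qed
  then show "p \<in> J" using p by (simp add: maximal_def)
qed

lemma join_max_in: "join_ideals V1 V2 (max_in V1) (max_in V2) = (maximal :: 'k::field mpoly set)"
proof
  show "join_ideals V1 V2 (max_in V1) (max_in V2) \<subseteq> (maximal :: 'k mpoly set)"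
    unfolding join_ideals_def
  proof (rule self.span_minimal[OF _ subspace_maximal])
    show "max_in V1 \<union> max_in V2 \<union> mvar ` (- (V1 \<union> V2)) \<subseteq> (maximal :: 'k mpoly set)"
      using mvar_maximal by (auto simp: max_in_def maximal_def)
  qed
  show "maximal \<subseteq> (join_ideals V1 V2 (max_in V1) (max_in V2) :: 'k mpoly set)"
  proof (rule maximal_subset_of_mvars[OF subspace_join])
    fix i
    have "const_coeff (mvar i :: 'k mpoly) = 0" using mvar_maximal by (auto simp: maximal_def)
    then have "(mvar i :: 'k mpoly) \<in> max_in V1 \<union> max_in V2 \<union> mvar ` (- (V1 \<union> V2))"
      by (auto simp: max_in_def mvar_def restrict_single)
    then show "mvar i \<in> join_ideals V1 V2 (max_in V1) (max_in V2 :: 'k mpoly set)"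
      unfolding join_ideals_def by (rule self.span_base)
  qed
qed

lemma join_zero: "join_ideals V1 V2 {0} {0} = (outside (V1 \<union> V2) :: 'k::field mpoly set)"
proof -
  have "genideal (mpoly_ring (V1 \<union> V2)) {0} = ({0} :: 'k mpoly set)"
    using ring.genideal_zero[OF ring_mpoly_ring[where 'k = 'k], of "V1 \<union> V2"] by simp
  then show ?thesis
    using genideal_join[OF ideal_in_zero[where 'a = 'k] ideal_in_zero, of V1 V2] by simp
qed

lemma complex_const_coeff:
  assumes "complex_mod J B D" "J \<subseteq> maximal"
  shows "complex_mod {0} B (\<lambda>n i j. const_coeff (D n i j))"
  unfolding complex_mod_def
proof (intro conjI allI ballI)
  show "finite (B p)" for p using assms by (simp add: complex_mod_def)
  fix p w i assume "i \<in> B p"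
  then have "mat_vec (B (Suc p)) (D p) (mat_vec (B (Suc (Suc p))) (D (Suc p)) (\<lambda>j. Const (w j))) i \<in> J"
    using assms(1) by (auto simp: complex_mod_def)
  then have "const_coeff (mat_vec (B (Suc p)) (D p) (mat_vec (B (Suc (Suc p))) (D (Suc p)) (\<lambda>j. Const (w j))) i) = 0"
    using assms(2) by (auto simp: maximal_def)
  then show "mat_vec (B (Suc p)) (\<lambda>i j. const_coeff (D p i j))
      (mat_vec (B (Suc (Suc p))) (\<lambda>i j. const_coeff (D (Suc p) i j)) w) i \<in> {0}"
    by (simp add: const_coeff_mat_vec)
qed

lemma const_coeff_sign: "const_coeff ((-1) ^ p * q) = (-1) ^ p * const_coeff q"
proof (induction p)
  case (Suc p)
  have "const_coeff (- ((-1) ^ p * q)) = - const_coeff ((-1) ^ p * q)"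
    using const_coeff_diff[of 0 "(-1) ^ p * q"] by simp
  then show ?case using Suc by simp
qed simp

lemma const_coeff_tot_mat:
  "(\<lambda>n x y. const_coeff (tot_mat D E n x y)) =
    tot_mat (\<lambda>n i j. const_coeff (D n i j)) (\<lambda>n i j. const_coeff (E n i j))"
  by (auto simp: fun_eq_iff tot_mat_def const_coeff_add const_coeff_sign split: prod.splits)

lemma homology_basis_mod_exists:
  fixes D :: "nat \<Rightarrow> 'i \<Rightarrow> 'i \<Rightarrow> 'k::field mpoly"
  assumes "complex_mod J B D" "J \<subseteq> maximal"
  obtains K :: "nat \<Rightarrow> ('i \<Rightarrow> 'k) set" and v where
    "\<And>n. homology_basis Const (cycle_mod maximal B D n) (boundary_mod maximal B D n) (K n) (v n)"
proof -
  have "\<forall>n. \<exists>Kv :: ('i \<Rightarrow> 'k) set \<times> _.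
      homology_basis Const (cycle_mod maximal B D n) (boundary_mod maximal B D n) (fst Kv) (snd Kv)"
  proof
    fix n
    obtain K :: "('i \<Rightarrow> 'k) set" and v where "homology_basis id (cycle_mod {0} B (\<lambda>n i j. const_coeff (D n i j)) n)
        (boundary_mod {0} B (\<lambda>n i j. const_coeff (D n i j)) n) K v"
      using homology_basis_exists[OF complex_const_coeff[OF assms], of n] by (elim exE)
    from homology_basis_Const[OF this]
    show "\<exists>Kv :: ('i \<Rightarrow> 'k) set \<times> _.
        homology_basis Const (cycle_mod maximal B D n) (boundary_mod maximal B D n) (fst Kv) (snd Kv)"
      by (intro exI[of _ "(K, \<lambda>a i. Const (v a i))"]) simp
  qed
  from choice[OF this] obtain Kv :: "nat \<Rightarrow> ('i \<Rightarrow> 'k) set \<times> _" where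
    "\<forall>n. homology_basis Const (cycle_mod maximal B D n) (boundary_mod maximal B D n) (fst (Kv n)) (snd (Kv n))"
    by (elim exE)
  then show ?thesis by (intro that[of "\<lambda>n. fst (Kv n)" "\<lambda>n. snd (Kv n)"]) simp
qed

text \<open>
  Kuenneth formula with coefficients in the residue field, where complexes become complexes of vector
  spaces.
\<close>

lemma homology_basis_tot:
  fixes B :: "nat \<Rightarrow> 'i set" and C :: "nat \<Rightarrow> 'j set"
  assumes cx1: "complex_mod J1 B D" "J1 \<subseteq> maximal" and cx2: "complex_mod J2 C E" "J2 \<subseteq> maximal"
    and v: "\<And>p. homology_basis Const (cycle_mod maximal B D p) (boundary_mod maximal B D p) (K p) (v p)"
    and w: "\<And>q. homology_basis Const (cycle_mod maximal C E q) (boundary_mod maximal C E q) (L q) (w q)"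
  shows "\<exists>u. homology_basis Const (cycle_mod maximal (tot_index B C) (tot_mat D E) n)
    (boundary_mod maximal (tot_index B C) (tot_mat D E) n) (tot_index K L n) u"
proof -
  let ?D = "\<lambda>n i j. const_coeff (D n i j)" and ?E = "\<lambda>n i j. const_coeff (E n i j)"
  obtain S where S: "split_complex B ?D S" using split_complex_exists[OF complex_const_coeff[OF cx1]] .
  obtain S' where S': "split_complex C ?E S'" using split_complex_exists[OF complex_const_coeff[OF cx2]] .
  interpret split_pair B ?D S C ?E S' by (rule split_pair.intro[OF S S'])
  show ?thesis
    using homology_basis_Const[of "tot_index B C" "tot_mat D E" n, unfolded const_coeff_tot_mat,
        OF product_basis[OF homology_basis_const_coeff[OF v] homology_basis_const_coeff[OF w]]]
    by blast
qed

lemma resolution_restricted_exists: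
  fixes I A :: "'k::field mpoly set"
  assumes V: "finite V" and I: "ideal_in V I" and A: "ideal_in V A" and IA: "lift_ideal V I \<subseteq> lift_ideal V A"
  obtains B and D :: "nat \<Rightarrow> nat \<Rightarrow> nat \<Rightarrow> 'k mpoly" and e where
    "resolution_mod (lift_ideal V I) (lift_ideal V A) B D e"
    "\<And>n i j. restrict_vars V (D n i j) = D n i j" "\<And>i. restrict_vars V (e i) = e i"
proof -
  have "outside V \<subseteq> lift_ideal V I" using I by (auto simp: lift_ideal_def ideal_in_def)
  then obtain B and D :: "nat \<Rightarrow> nat \<Rightarrow> nat \<Rightarrow> 'k mpoly" where
    res: "resolution_mod (lift_ideal V I) (lift_ideal V A) B D (\<lambda>_. 1)"
    using resolution_exists[OF V subspace_lift_ideal[OF I] subspace_lift_ideal[OF A] _ IA] by blast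
  from resolution_restrict[OF I A res] show ?thesis by (rule that) auto
qed

text \<open>
  Resolutions of the residue field over the two quotient rings are tensored: by \<open>resolution_tensor\<close> the
  result is a resolution of the residue field of the tensor product, since the maximal ideals of both
  factors together generate the maximal ideal.
\<close>

theorem residue_betti_tensor:
  fixes I1 I2 :: "'k::field mpoly set"
  assumes fin: "finite V1" "finite V2" and disj: "V1 \<inter> V2 = {}"
    and I1: "ideal I1 (mpoly_ring V1)" "I1 \<subseteq> maximal" and I2: "ideal I2 (mpoly_ring V2)" "I2 \<subseteq> maximal"
  shows "residue_betti (V1 \<union> V2) (genideal (mpoly_ring (V1 \<union> V2)) (I1 \<union> I2)) n =
    (\<Sum>p\<le>n. residue_betti V1 I1 p * residue_betti V2 I2 (n - p))"
proof -
  note i1 = ideal_in_I[OF I1(1)] and i2 = ideal_in_I[OF I2(1)]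
  note m1 = lift_le_maximal[OF I1] and m2 = lift_le_maximal[OF I2]
  obtain B and D :: "nat \<Rightarrow> nat \<Rightarrow> nat \<Rightarrow> 'k mpoly" and e where
    res1: "resolution_mod (lift_ideal V1 I1) (lift_ideal V1 (max_in V1)) B D e"
    and D: "\<And>n i j. restrict_vars V1 (D n i j) = D n i j" and e: "\<And>i. restrict_vars V1 (e i) = e i"
    by (rule resolution_restricted_exists[OF fin(1) i1 ideal_in_max_in[of V1]]) (use m1 in \<open>simp add: lift_max_in\<close>, rule that)
  obtain C and E :: "nat \<Rightarrow> nat \<Rightarrow> nat \<Rightarrow> 'k mpoly" and e' where
    res2: "resolution_mod (lift_ideal V2 I2) (lift_ideal V2 (max_in V2)) C E e'"
    and E: "\<And>n i j. restrict_vars V2 (E n i j) = E n i j" and e': "\<And>i. restrict_vars V2 (e' i) = e' i"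
    by (rule resolution_restricted_exists[OF fin(2) i2 ideal_in_max_in[of V2]]) (use m2 in \<open>simp add: lift_max_in\<close>, rule that)
  let ?G = "genideal (mpoly_ring (V1 \<union> V2)) (I1 \<union> I2)"
  have G: "lift_ideal (V1 \<union> V2) ?G = join_ideals V1 V2 I1 I2" by (rule genideal_join[OF i1 i2])
  note cx1 = complex_of_resolution[OF subspace_lift_ideal[OF i1] res1] m1
  note cx2 = complex_of_resolution[OF subspace_lift_ideal[OF i2] res2] m2
  obtain K :: "nat \<Rightarrow> (nat \<Rightarrow> 'k) set" and v where
    v: "\<And>n. homology_basis Const (cycle_mod maximal B D n) (boundary_mod maximal B D n) (K n) (v n)"
    by (rule homology_basis_mod_exists[OF cx1], rule that)
  obtain L :: "nat \<Rightarrow> (nat \<Rightarrow> 'k) set" and w where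
    w: "\<And>n. homology_basis Const (cycle_mod maximal C E n) (boundary_mod maximal C E n) (L n) (w n)"
    by (rule homology_basis_mod_exists[OF cx2], rule that)
  obtain u where u: "homology_basis Const (cycle_mod maximal (tot_index B C) (tot_mat D E) n)
    (boundary_mod maximal (tot_index B C) (tot_mat D E) n) (tot_index K L n) u"
    using homology_basis_tot[OF cx1 cx2 v w] by blast
  have idG: "ideal ?G (mpoly_ring (V1 \<union> V2))" by (rule ring.genideal_ideal[OF ring_mpoly_ring union_carrier[OF i1 i2]])
  have Gm: "?G \<subseteq> maximal"
  proof -
    have "?G \<subseteq> lift_ideal (V1 \<union> V2) ?G" by (rule ideal_in_le_lift[OF ideal_in_I[OF idG]])
    also have "\<dots> \<subseteq> maximal"
      unfolding G join_ideals_def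
      by (rule self.span_minimal[OF _ subspace_maximal]) (use I1(2) I2(2) mvar_maximal in auto)
    finally show ?thesis .
  qed
  have "resolution_mod (lift_ideal (V1 \<union> V2) ?G) maximal (tot_index B C) (tot_mat D E) (\<lambda>(p, i, j). e i * e' j)"
    using resolution_tensor[OF disj i1 ideal_in_max_in i2 ideal_in_max_in res1 D e res2 E e'] by (simp add: G join_max_in)
  then have "residue_betti (V1 \<union> V2) ?G n = card (tot_index K L n)"
    using fin by (intro residue_betti_eq[OF idG _ Gm _ u]) simp_all
  also have "\<dots> = (\<Sum>p\<le>n. card (K p) * card (L (n - p)))"
    by (rule card_tot_index) (use v w in \<open>auto simp: homology_basis_def\<close>)
  also have "\<dots> = (\<Sum>p\<le>n. residue_betti V1 I1 p * residue_betti V2 I2 (n - p))"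
    using residue_betti_eq[OF I1(1) fin(1) I1(2) res1[unfolded lift_max_in] v]
      residue_betti_eq[OF I2(1) fin(2) I2(2) res2[unfolded lift_max_in] w] by simp
  finally show ?thesis .
qed

lemma outside_le_maximal: "outside V \<subseteq> (maximal :: 'k::field mpoly set)"
proof
  fix p :: "'k mpoly" assume "p \<in> outside V"
  then have "const_coeff (restrict_vars V p) = 0" by (simp add: lift_ideal_def)
  then show "p \<in> maximal" by (simp add: maximal_def)
qed

text \<open>
  The same with resolutions of the quotient rings over the polynomial rings.
\<close>

theorem betti_dim_tensor:
  fixes I1 I2 :: "'k::field mpoly set"
  assumes fin: "finite V1" "finite V2" and disj: "V1 \<inter> V2 = {}"
    and I1: "ideal I1 (mpoly_ring V1)" and I2: "ideal I2 (mpoly_ring V2)"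
  shows "betti_dim (V1 \<union> V2) (genideal (mpoly_ring (V1 \<union> V2)) (I1 \<union> I2)) n =
    (\<Sum>p\<le>n. betti_dim V1 I1 p * betti_dim V2 I2 (n - p))"
proof -
  note i1 = ideal_in_I[OF I1] and i2 = ideal_in_I[OF I2]
  obtain B and D :: "nat \<Rightarrow> nat \<Rightarrow> nat \<Rightarrow> 'k mpoly" and e where
    res1: "resolution_mod (outside V1) (lift_ideal V1 I1) B D e"
    and D: "\<And>n i j. restrict_vars V1 (D n i j) = D n i j" and e: "\<And>i. restrict_vars V1 (e i) = e i"
    by (rule resolution_restricted_exists[OF fin(1) ideal_in_zero i1 outside_le_lift[OF I1]], rule that)
  obtain C and E :: "nat \<Rightarrow> nat \<Rightarrow> nat \<Rightarrow> 'k mpoly" and e' where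
    res2: "resolution_mod (outside V2) (lift_ideal V2 I2) C E e'"
    and E: "\<And>n i j. restrict_vars V2 (E n i j) = E n i j" and e': "\<And>i. restrict_vars V2 (e' i) = e' i"
    by (rule resolution_restricted_exists[OF fin(2) ideal_in_zero i2 outside_le_lift[OF I2]], rule that)
  let ?G = "genideal (mpoly_ring (V1 \<union> V2)) (I1 \<union> I2)"
  have G: "lift_ideal (V1 \<union> V2) ?G = join_ideals V1 V2 I1 I2" by (rule genideal_join[OF i1 i2])
  note cx1 = complex_of_resolution[OF subspace_outside res1] outside_le_maximal
  note cx2 = complex_of_resolution[OF subspace_outside res2] outside_le_maximal
  obtain K :: "nat \<Rightarrow> (nat \<Rightarrow> 'k) set" and v where
    v: "\<And>n. homology_basis Const (cycle_mod maximal B D n) (boundary_mod maximal B D n) (K n) (v n)"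
    by (rule homology_basis_mod_exists[OF cx1], rule that)
  obtain L :: "nat \<Rightarrow> (nat \<Rightarrow> 'k) set" and w where
    w: "\<And>n. homology_basis Const (cycle_mod maximal C E n) (boundary_mod maximal C E n) (L n) (w n)"
    by (rule homology_basis_mod_exists[OF cx2], rule that)
  obtain u where u: "homology_basis Const (cycle_mod maximal (tot_index B C) (tot_mat D E) n)
    (boundary_mod maximal (tot_index B C) (tot_mat D E) n) (tot_index K L n) u"
    using homology_basis_tot[OF cx1 cx2 v w] by blast
  have idG: "ideal ?G (mpoly_ring (V1 \<union> V2))" by (rule ring.genideal_ideal[OF ring_mpoly_ring union_carrier[OF i1 i2]])
  have "resolution_mod (outside (V1 \<union> V2)) (lift_ideal (V1 \<union> V2) ?G) (tot_index B C) (tot_mat D E) (\<lambda>(p, i, j). e i * e' j)"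
    using resolution_tensor[OF disj ideal_in_zero i1 ideal_in_zero i2 res1 D e res2 E e'] by (simp add: G join_zero)
  then have "betti_dim (V1 \<union> V2) ?G n = card (tot_index K L n)"
    using fin by (intro betti_dim_eq[OF idG _ _ u]) simp_all
  also have "\<dots> = (\<Sum>p\<le>n. card (K p) * card (L (n - p)))"
    by (rule card_tot_index) (use v w in \<open>auto simp: homology_basis_def\<close>)
  also have "\<dots> = (\<Sum>p\<le>n. betti_dim V1 I1 p * betti_dim V2 I2 (n - p))"
    using betti_dim_eq[OF I1 fin(1) res1 v] betti_dim_eq[OF I2 fin(2) res2 w] by simp
  finally show ?thesis .
qed


section \<open>The Koszul resolution\<close>

lemma restrict_uminus: "restrict_vars V (- p) = - restrict_vars V p"
  using restrict_diff[of V 0 p] by simp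

lemma mvar_quotient: "\<exists>w. p - Const (const_coeff p) - mvar x * w \<in> (outside {x} :: 'k::field mpoly set)"
proof (induction p rule: mpoly_induct)
  case (1 p q)
  then obtain w w' where "p - Const (const_coeff p) - mvar x * w \<in> outside {x}"
    "q - Const (const_coeff q) - mvar x * w' \<in> outside {x}" by blast
  from self.subspace_add[OF subspace_outside this]
  have "p + q - Const (const_coeff (p + q)) - mvar x * (w + w') \<in> outside {x}"
    by (simp add: const_coeff_add Const_add algebra_simps)
  then show ?case by blast
next
  case (2 m c)
  show ?case
  proof (cases "x \<in> Poly_Mapping.keys m")
    case True
    have m: "Poly_Mapping.single x 1 + (m - Poly_Mapping.single x 1) = m"
      using True by (intro poly_mapping_eqI) (auto simp: lookup_add lookup_minus lookup_single when_def in_keys_iff)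
    then have "Poly_Mapping.single m c = mvar x * Poly_Mapping.single (m - Poly_Mapping.single x 1) c"
      by (simp add: mvar_def mult_single)
    moreover have "m \<noteq> 0" using True by auto
    then have "const_coeff (Poly_Mapping.single m c) = 0" by (simp add: const_coeff_def lookup_single when_def)
    ultimately show ?thesis
      using self.subspace_0[OF subspace_outside]
      by (intro exI[of _ "Poly_Mapping.single (m - Poly_Mapping.single x 1) c"]) simp
  next
    case False
    show ?thesis
    proof (cases "m = 0")
      case True
      then show ?thesis using self.subspace_0[OF subspace_outside] by (intro exI[of _ 0]) simp
    next
      case m: False
      then obtain i where "i \<in> Poly_Mapping.keys m" using poly_mapping_eqI[of m 0] by (auto simp: in_keys_iff)
      then have "\<not> Poly_Mapping.keys m \<subseteq> {x}" using False by blast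
      then show ?thesis using m
        by (intro exI[of _ 0]) (simp add: lift_ideal_def restrict_diff restrict_single const_coeff_def lookup_single when_def)
    qed
  qed
qed

text \<open>
  Multiplication by the variable on \<open>k[x]\<close> is injective with cokernel \<open>k\<close>.
\<close>

lemma koszul_one_variable:
  "resolution_mod (outside {x}) maximal (\<lambda>n. if n \<le> 1 then {0 :: nat} else {})
    (\<lambda>n _ _. if n = 0 then (mvar x :: 'k::field mpoly) else 0) (\<lambda>_. 1)"
  unfolding resolution_mod_def
proof (intro conjI allI)
  let ?B = "\<lambda>n :: nat. if n \<le> 1 then {0 :: nat} else {}"
  let ?D = "\<lambda>(n::nat) (_::nat) (_::nat). if n = 0 then (mvar x :: 'k mpoly) else 0"
  show "finite (?B n)" for n by simp
  show "\<exists>v. (\<Sum>i\<in>?B 0. 1 * v i) - 1 \<in> (maximal :: 'k mpoly set)"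
    by (rule exI[of _ "\<lambda>_. 1"]) (simp add: self.subspace_0[OF subspace_maximal])
  show "(\<Sum>i\<in>?B 0. 1 * v i) \<in> maximal \<longleftrightarrow> boundary_mod (outside {x}) ?B ?D 0 v" for v
  proof
    assume "(\<Sum>i\<in>?B 0. 1 * v i) \<in> maximal"
    then have v: "const_coeff (v 0) = 0" by (simp add: maximal_def)
    obtain w where "v 0 - Const (const_coeff (v 0)) - mvar x * w \<in> outside {x}" using mvar_quotient by blast
    then show "boundary_mod (outside {x}) ?B ?D 0 v"
      unfolding boundary_mod_def by (intro exI[of _ "\<lambda>_. w"]) (simp add: mat_vec_def v)
  next
    assume "boundary_mod (outside {x}) ?B ?D 0 v"
    then obtain w where "v 0 - mvar x * w 0 \<in> outside {x}" by (auto simp: boundary_mod_def mat_vec_def)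
    then have "v 0 - mvar x * w 0 \<in> maximal" using outside_le_maximal by blast
    then show "(\<Sum>i\<in>?B 0. 1 * v i) \<in> maximal"
      using mvar_maximal[where 'a = 'k, of x] by (simp add: maximal_def const_coeff_diff const_coeff_mult)
  qed
  show "cycle_mod (outside {x}) ?B ?D (Suc n) v \<longleftrightarrow> boundary_mod (outside {x}) ?B ?D (Suc n) v" for n v
  proof (cases n)
    case 0
    have "mvar x \<noteq> (0 :: 'k mpoly)"
    proof
      assume "mvar x = (0 :: 'k mpoly)"
      then have "Poly_Mapping.lookup (mvar x :: 'k mpoly) (Poly_Mapping.single x 1) = 0" by simp
      then show False by (simp add: mvar_def)
    qed
    moreover have "restrict_vars {x} (mvar x) = (mvar x :: 'k mpoly)" by (simp add: mvar_def restrict_single)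
    ultimately have "mvar x * v 0 \<in> outside {x} \<longleftrightarrow> v 0 \<in> outside {x}"
      by (simp add: lift_ideal_def restrict_mult)
    then show ?thesis using 0 by (simp add: cycle_mod_def boundary_mod_def mat_vec_def)
  next
    case (Suc k)
    then show ?thesis
      using self.subspace_0[OF subspace_outside] by (auto simp: cycle_mod_def boundary_mod_def mat_vec_def)
  qed
qed

text \<open>
  The tensor product of the complexes of single variables, added one at a time; the ranks follow from
  the recursion of binomial coefficients.  The entries lie in the maximal ideal, so the resolution is
  minimal.
\<close>

theorem koszul_resolution:
  assumes "finite V"
  shows "\<exists>D :: nat \<Rightarrow> nat \<Rightarrow> nat \<Rightarrow> 'k::field mpoly.
    resolution_mod (outside V) maximal (\<lambda>n. {..<card V choose n}) D (\<lambda>_. 1) \<and>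
    (\<forall>n i j. D n i j \<in> maximal \<and> restrict_vars V (D n i j) = D n i j)"
  using assms
proof (induction V rule: finite_induct)
  case empty
  have out: "outside {} = (maximal :: 'k mpoly set)"
  proof -
    have "p \<in> outside {} \<longleftrightarrow> const_coeff p = 0" for p :: "'k mpoly"
    proof -
      have "Const (const_coeff p) = 0 \<longleftrightarrow> const_coeff p = 0" by (metis const_coeff_Const single_zero)
      then show ?thesis by (simp add: lift_ideal_def flip: const_coeff_eq)
    qed
    then show ?thesis by (auto simp: maximal_def)
  qed
  have "resolution_mod (outside {}) maximal (\<lambda>n. {..<card ({} :: nat set) choose n}) (\<lambda>_ _ _. 0 :: 'k mpoly) (\<lambda>_. 1)"
    unfolding resolution_mod_def
  proof (intro conjI allI)
    show "\<exists>v. (\<Sum>i\<in>{..<card ({} :: nat set) choose 0}. 1 * v i) - 1 \<in> (maximal :: 'k mpoly set)"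
      by (rule exI[of _ "\<lambda>_. 1"]) (simp add: self.subspace_0[OF subspace_maximal])
  qed (auto simp: out cycle_mod_def boundary_mod_def mat_vec_def self.subspace_0[OF subspace_maximal])
  then show ?case using self.subspace_0[OF subspace_maximal] by (intro exI[of _ "\<lambda>_ _ _. 0"]) simp
next
  case (insert x V)
  then obtain E :: "nat \<Rightarrow> nat \<Rightarrow> nat \<Rightarrow> 'k mpoly" where
    E: "resolution_mod (outside V) maximal (\<lambda>n. {..<card V choose n}) E (\<lambda>_. 1)"
    "\<And>n i j. E n i j \<in> maximal" "\<And>n i j. restrict_vars V (E n i j) = E n i j" by blast
  let ?B = "\<lambda>n :: nat. if n \<le> 1 then {0 :: nat} else {}"
  let ?D = "\<lambda>(n::nat) (_::nat) (_::nat). if n = 0 then (mvar x :: 'k mpoly) else 0"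
  let ?C = "\<lambda>n. {..<card V choose n}"
  have D: "restrict_vars {x} (?D n i j) = ?D n i j" for n i j by (simp add: mvar_def restrict_single)
  have "{x} \<inter> V = {}" using insert by simp
  from resolution_tensor[OF this ideal_in_zero ideal_in_max_in ideal_in_zero ideal_in_max_in,
      unfolded lift_max_in, OF koszul_one_variable D _ E(1) E(3)]
  have res: "resolution_mod (outside (insert x V)) maximal (tot_index ?B ?C) (tot_mat ?D E) (\<lambda>_. 1)"
    by (simp add: join_zero join_max_in case_prod_unfold)
  have card: "card (tot_index ?B ?C n) = card (insert x V) choose n" for n
  proof -
    have "card (tot_index ?B ?C n) = (\<Sum>p\<le>n. card (?B p) * card (?C (n - p)))"
      by (rule card_tot_index) auto
    also have "\<dots> = (\<Sum>p\<in>{..n} \<inter> {0, 1}. card V choose (n - p))"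
      by (rule sum.mono_neutral_cong_right) auto
    also have "\<dots> = card (insert x V) choose n"
      using insert by (cases n) (auto simp: Int_insert_right)
    finally show ?thesis .
  qed
  have "\<exists>\<beta>. bij_betw \<beta> {..<card (insert x V) choose n} (tot_index ?B ?C n)" for n
  proof -
    have "finite (tot_index ?B ?C n)" by (rule finite_tot_index) auto
    from ex_bij_betw_nat_finite[OF this] show ?thesis unfolding card atLeast0LessThan .
  qed
  then obtain \<beta> where \<beta>: "\<And>n. bij_betw (\<beta> n) {..<card (insert x V) choose n} (tot_index ?B ?C n)" by metis
  have sign: "(-1) ^ p = (1 :: 'k mpoly) \<or> (-1) ^ p = (- 1 :: 'k mpoly)" for p by (cases "even p") auto
  have tot_max: "tot_mat ?D E n a b \<in> maximal" for n a b
    using E(2) mvar_maximal self.subspace_0[OF subspace_maximal]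
    by (auto simp: tot_mat_def split: prod.splits
        intro!: self.subspace_add[OF subspace_maximal] self.subspace_scale[OF subspace_maximal])
  have E': "restrict_vars (insert x V) (E n i j) = E n i j" for n i j
    using restrict_restrict_subset[of V "insert x V" "E n i j"] E(3) by auto
  have tot_restrict: "restrict_vars (insert x V) (tot_mat ?D E n a b) = tot_mat ?D E n a b" for n a b
    using sign[of "fst a"]
    by (auto simp: tot_mat_def restrict_add restrict_mult restrict_uminus E' mvar_def restrict_single split: prod.splits)
  from resolution_reindex[OF res \<beta>] show ?case
    using tot_max tot_restrict
    by (intro exI[of _ "\<lambda>n i j. tot_mat ?D E n (\<beta> n i) (\<beta> (Suc n) j)"]) simp
qed

text \<open>Over the residue field the differentials vanish, so every unit vector represents a basis class.\<close>

lemma minimal_homology_basis: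
  fixes D :: "nat \<Rightarrow> 'i \<Rightarrow> 'i \<Rightarrow> 'k::field mpoly"
  assumes fin: "finite (B n)" and D: "\<And>n i j. D n i j \<in> maximal"
  shows "homology_basis Const (cycle_mod maximal B D n) (boundary_mod maximal B D n) (B n) (\<lambda>k i. Const (unit_vec k i))"
proof -
  have mv: "mat_vec Q (D n) v i \<in> maximal" for Q n v i
    unfolding mat_vec_def using D
    by (intro self.subspace_sum[OF subspace_maximal]) (simp add: mult.commute[of "D _ _ _"] self.subspace_scale[OF subspace_maximal])
  have bd: "boundary_mod maximal B D n x \<longleftrightarrow> (\<forall>i\<in>B n. const_coeff (x i) = 0)" for x
    using mv by (auto simp: boundary_mod_def maximal_def const_coeff_diff)
  have sum: "const_coeff (\<Sum>a\<in>B n. Const (c a) * Const (unit_vec a i)) = c i" if "i \<in> B n" for c i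
    using sum_mult_unit_vec[OF fin, of c i] that by (simp add: const_coeff_sum const_coeff_mult)
  show ?thesis
    unfolding homology_basis_def bd
  proof (intro conjI fin ballI allI impI)
    show "cycle_mod maximal B D n (\<lambda>i. Const (unit_vec k i))" for k using mv by (simp add: cycle_mod_def)
    show "\<exists>c. \<forall>i\<in>B n. const_coeff (z i - (\<Sum>a\<in>B n. Const (c a) * Const (unit_vec a i))) = 0" for z
      by (intro exI[of _ "\<lambda>a. const_coeff (z a)"]) (simp add: const_coeff_diff sum)
    fix c a assume c: "\<forall>i\<in>B n. const_coeff (\<Sum>a\<in>B n. Const (c a) * Const (unit_vec a i)) = 0" and a: "a \<in> B n"
    show "c a = 0" using bspec[OF c a] unfolding sum[OF a] .
  qed
qed

lemma residue_betti_zero_ideal: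
  assumes V: "finite V"
  shows "residue_betti V ({0} :: 'k::field mpoly set) n = card V choose n"
proof -
  obtain D :: "nat \<Rightarrow> nat \<Rightarrow> nat \<Rightarrow> 'k mpoly" where
    D: "resolution_mod (outside V) maximal (\<lambda>n. {..<card V choose n}) D (\<lambda>_. 1)"
    and D': "\<forall>n i j. D n i j \<in> maximal \<and> restrict_vars V (D n i j) = D n i j"
    using koszul_resolution[OF V] by (elim exE conjE)
  have I: "ideal {0 :: 'k mpoly} (mpoly_ring V)" by (simp add: ideal_in_iff ideal_in_zero)
  have "residue_betti V ({0} :: 'k mpoly set) n = card {..<card V choose n}"
    by (rule residue_betti_eq[OF I V _ D minimal_homology_basis])
      (simp_all add: self.subspace_0[OF subspace_maximal] D')
  then show ?thesis by simp
qed

lemma betti_dim_zero_ideal: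
  assumes V: "finite V"
  shows "betti_dim V ({0} :: 'k::field mpoly set) n = (if n = 0 then 1 else 0)"
proof -
  let ?B = "\<lambda>n :: nat. if n = 0 then {0 :: nat} else {}"
  have I: "ideal {0 :: 'k mpoly} (mpoly_ring V)" by (simp add: ideal_in_iff ideal_in_zero)
  have "resolution_mod (outside V) (lift_ideal V {0}) ?B (\<lambda>_ _ _. 0 :: 'k mpoly) (\<lambda>_. 1)"
    unfolding resolution_mod_def
  proof (intro conjI allI)
    show "\<exists>v. (\<Sum>i\<in>?B 0. 1 * v i) - 1 \<in> (outside V :: 'k mpoly set)"
      by (rule exI[of _ "\<lambda>_. 1"]) (simp add: self.subspace_0[OF subspace_outside])
  qed (auto simp: cycle_mod_def boundary_mod_def mat_vec_def self.subspace_0[OF subspace_outside])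
  from betti_dim_eq[OF I V this minimal_homology_basis]
  have "betti_dim V ({0} :: 'k mpoly set) n = card (?B n)"
    by (simp add: self.subspace_0[OF subspace_maximal])
  then show ?thesis by simp
qed


section \<open>Serre's inequality in degrees at most three\<close>

lemma homology_basis_reindex:
  assumes "homology_basis \<iota> Z W K v" and \<beta>: "bij_betw \<beta> L K"
  shows "homology_basis \<iota> Z W L (\<lambda>a. v (\<beta> a))"
proof -
  have sum: "(\<Sum>a\<in>L. \<iota> (c (\<beta> a)) * v (\<beta> a) i) = (\<Sum>a\<in>K. \<iota> (c a) * v a i)" for c i
    by (rule sum.reindex_bij_betw[OF \<beta>])
  show ?thesis
    unfolding homology_basis_def
  proof (intro conjI ballI allI impI)
    show "finite L" using assms bij_betw_finite[OF \<beta>] by (simp add: homology_basis_def)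
    show "Z (v (\<beta> a))" if "a \<in> L" for a
      using assms that by (auto simp: homology_basis_def bij_betw_def)
    fix z assume "Z z"
    then obtain c where "W (\<lambda>i. z i - (\<Sum>a\<in>K. \<iota> (c a) * v a i))"
      using assms(1) unfolding homology_basis_def by blast
    then show "\<exists>c. W (\<lambda>i. z i - (\<Sum>a\<in>L. \<iota> (c a) * v (\<beta> a) i))"
      by (intro exI[of _ "\<lambda>a. c (\<beta> a)"]) (simp add: sum)
  next
    fix c a assume W: "W (\<lambda>i. \<Sum>a\<in>L. \<iota> (c a) * v (\<beta> a) i)" and a: "a \<in> L"
    define c' where "c' b = c (inv_into L \<beta> b)" for b
    have c': "c' (\<beta> b) = c b" if "b \<in> L" for b
      using that \<beta> by (simp add: c'_def bij_betw_def)
    have "(\<lambda>i. \<Sum>a\<in>L. \<iota> (c a) * v (\<beta> a) i) = (\<lambda>i. \<Sum>a\<in>K. \<iota> (c' a) * v a i)"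
      unfolding sum[symmetric] by (intro ext sum.cong refl) (simp add: c')
    then have "\<forall>b\<in>K. c' b = 0" using W assms(1) unfolding homology_basis_def by simp
    then show "c a = 0" using c'[OF a] a \<beta> by (auto simp: bij_betw_def)
  qed
qed

text \<open>
  The Koszul complex \<open>C\<close>, \<open>E\<close> of the polynomial ring \<open>S/N\<close>, read over the quotient ring \<open>S/J\<close>; the entries \<open>g j\<close>
  of its first matrix generate the maximal ideal modulo \<open>N\<close>.
\<close>

locale koszul_homology =
  fixes N J :: "'k::field mpoly set" and C :: "nat \<Rightarrow> nat set" and E :: "nat \<Rightarrow> nat \<Rightarrow> nat \<Rightarrow> 'k mpoly"
  assumes N: "self.subspace N" and J: "self.subspace J" and NJ: "N \<subseteq> J" and Jm: "J \<subseteq> maximal"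
    and koszul: "resolution_mod N maximal C E (\<lambda>_. 1)" and C0: "C 0 = {0}"
begin

abbreviation "g j \<equiv> E 0 0 j"
abbreviation "d n \<equiv> mat_vec (C (Suc n)) (E n)"

lemma fin: "finite (C n)" using koszul by (simp add: resolution_mod_def)

lemma dd: "i \<in> C n \<Longrightarrow> d n (d (Suc n) w) i \<in> J"
  using complex_of_resolution[OF N koszul] NJ by (auto simp: complex_mod_def)

lemma maximal_iff: "p \<in> maximal \<longleftrightarrow> (\<exists>w. p - d 0 w 0 \<in> N)"
proof -
  have "\<forall>v. (\<Sum>i\<in>C 0. 1 * v i) \<in> maximal \<longleftrightarrow> boundary_mod N C E 0 v"
    using koszul unfolding resolution_mod_def by (elim conjE)
  from spec[OF this, of "\<lambda>_. p"] show ?thesis by (simp add: C0 boundary_mod_def)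
qed

lemma mat_vec_unit:
  assumes "finite Q" "j \<in> Q"
  shows "mat_vec Q M (\<lambda>l. if l = j then 1 else 0) i = M i j"
proof -
  have "mat_vec Q M (\<lambda>l. if l = j then 1 else 0) i = (\<Sum>l\<in>Q. if l = j then M i j else 0)"
    unfolding mat_vec_def by (intro sum.cong) auto
  then show ?thesis using assms by simp
qed

text \<open>
  The maximal ideal annihilates Koszul homology in degree one.  Multiplying the relations
  \<open>g i e\<^sub>k - g k e\<^sub>i\<close>, which are boundaries \<open>d w\<^sub>k\<close>, by the coefficients \<open>x k\<close> and adding up gives
  \<open>g i x - (\<Sum>k. g k x k) e\<^sub>i\<close>, and the sum in parentheses vanishes because \<open>x\<close> is a cycle.
\<close>

lemma maximal_kills:
  assumes x: "cycle_mod J C E 1 x" and i: "i \<in> C 1"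
  shows "boundary_mod J C E 1 (\<lambda>j. g i * x j)"
proof -
  define s where "s k j = g i * (if j = k then 1 else 0) - g k * (if j = i then 1 else 0)" for k j
  have "\<exists>w. \<forall>j\<in>C 1. s k j - d 1 w j \<in> N" if k: "k \<in> C 1" for k
  proof -
    have "d 0 (s k) 0 = g i * g k - g k * g i"
      unfolding s_def mat_vec_diff mat_vec_mult using i k by (simp add: mat_vec_unit[OF fin])
    then have "cycle_mod N C E (Suc 0) (s k)"
      using self.subspace_0[OF N] by (simp add: cycle_mod_def C0 mult.commute)
    then have "boundary_mod N C E (Suc 0) (s k)" using koszul unfolding resolution_mod_def by blast
    then show ?thesis by (simp add: boundary_mod_def)
  qed
  then obtain w where w: "\<And>k j. k \<in> C 1 \<Longrightarrow> j \<in> C 1 \<Longrightarrow> s k j - d 1 (w k) j \<in> N" by metis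
  have "g i * x j - d 1 (\<lambda>l. \<Sum>k\<in>C 1. x k * w k l) j \<in> J" if j: "j \<in> C 1" for j
  proof -
    have "(\<Sum>k\<in>C 1. x k * (s k j - d 1 (w k) j)) \<in> J"
      using w j NJ by (intro self.subspace_sum[OF J] self.subspace_scale[OF J]) auto
    moreover have "(if j = i then 1 else 0) * d 0 x 0 \<in> J"
      using x by (intro self.subspace_scale[OF J]) (simp add: cycle_mod_def C0)
    ultimately have "(\<Sum>k\<in>C 1. x k * (s k j - d 1 (w k) j)) + (if j = i then 1 else 0) * d 0 x 0 \<in> J"
      by (rule self.subspace_add[OF J])
    moreover have "(\<Sum>k\<in>C 1. x k * s k j) = g i * x j - (if j = i then 1 else 0) * d 0 x 0"
    proof -
      have "(\<Sum>k\<in>C 1. x k * s k j) =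
          (\<Sum>k\<in>C 1. if j = k then g i * x j else 0) - (\<Sum>k\<in>C 1. (if j = i then 1 else 0) * (g k * x k))"
        unfolding sum_subtractf[symmetric] by (intro sum.cong refl) (auto simp: s_def algebra_simps)
      then show ?thesis using j fin by (simp add: mat_vec_def sum_distrib_left)
    qed
    ultimately show ?thesis
      unfolding mat_vec_sum by (simp add: right_diff_distrib sum_subtractf)
  qed
  then show ?thesis unfolding boundary_mod_def by (intro exI[of _ "\<lambda>l. \<Sum>k\<in>C 1. x k * w k l"]) simp
qed

end

text \<open>
  Bases \<open>z\<close> and \<open>w\<close> of the Koszul homology in degrees one and two, and witnesses \<open>U\<close> that \<open>g i z\<^sub>a\<close> is a boundary.
\<close>

locale koszul_basis = koszul_homology N J C E
  for N J :: "'k::field mpoly set" and C :: "nat \<Rightarrow> nat set" and E :: "nat \<Rightarrow> nat \<Rightarrow> nat \<Rightarrow> 'k mpoly" +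
  fixes K1 K2 :: "nat set" and z w :: "nat \<Rightarrow> nat \<Rightarrow> 'k mpoly" and U :: "nat \<Rightarrow> nat \<Rightarrow> nat \<Rightarrow> 'k mpoly"
  assumes z: "homology_basis Const (cycle_mod J C E 1) (boundary_mod J C E 1) K1 z"
    and w: "homology_basis Const (cycle_mod J C E 2) (boundary_mod J C E 2) K2 w"
    and U: "\<And>i a j. i \<in> C 1 \<Longrightarrow> a \<in> K1 \<Longrightarrow> j \<in> C 1 \<Longrightarrow> g i * z a j - d 1 (U i a) j \<in> J"
begin

lemma finK: "finite K1" "finite K2" using z w by (auto simp: homology_basis_def)

lemma z_cycle: "a \<in> K1 \<Longrightarrow> d 0 (z a) 0 \<in> J"
  using z by (simp add: homology_basis_def cycle_mod_def C0)

lemma w_cycle: "a \<in> K2 \<Longrightarrow> j \<in> C 1 \<Longrightarrow> d 1 (w a) j \<in> J"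
  using w by (simp add: homology_basis_def cycle_mod_def)

text \<open>
  With a free module that maps to the basis cycles \<open>z\<close> added in degree two, the complex becomes exact in
  degree one.
\<close>

lemma exact_degree_one:
  "d 0 v 0 \<in> J \<longleftrightarrow> (\<exists>y0 y1. \<forall>j\<in>C 1. v j - (d 1 y0 j + (\<Sum>a\<in>K1. z a j * y1 a)) \<in> J)"
proof
  assume "d 0 v 0 \<in> J"
  then have "cycle_mod J C E 1 v" by (simp add: cycle_mod_def C0)
  then obtain c where "boundary_mod J C E 1 (\<lambda>j. v j - (\<Sum>a\<in>K1. Const (c a) * z a j))"
    using z unfolding homology_basis_def by blast
  then obtain y where "\<And>j. j \<in> C 1 \<Longrightarrow> v j - (\<Sum>a\<in>K1. Const (c a) * z a j) - d 1 y j \<in> J"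
    by (auto simp: boundary_mod_def)
  then show "\<exists>y0 y1. \<forall>j\<in>C 1. v j - (d 1 y0 j + (\<Sum>a\<in>K1. z a j * y1 a)) \<in> J"
    by (intro exI[of _ y] exI[of _ "\<lambda>a. Const (c a)"]) (simp add: algebra_simps)
next
  assume "\<exists>y0 y1. \<forall>j\<in>C 1. v j - (d 1 y0 j + (\<Sum>a\<in>K1. z a j * y1 a)) \<in> J"
  then obtain y0 y1 where y: "\<And>j. j \<in> C 1 \<Longrightarrow> v j - (d 1 y0 j + (\<Sum>a\<in>K1. y1 a * z a j)) \<in> J"
    by (auto simp: mult.commute)
  have "d 0 (\<lambda>j. d 1 y0 j + (\<Sum>a\<in>K1. y1 a * z a j)) 0 \<in> J"
    unfolding mat_vec_add mat_vec_sum using dd[of 0 0 y0] z_cycle C0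
    by (intro self.subspace_add[OF J] self.subspace_sum[OF J] self.subspace_scale[OF J]) auto
  then show "d 0 v 0 \<in> J"
    using mat_vec_mem_cong[OF J, of "C (Suc 0)" v "\<lambda>j. d 1 y0 j + (\<Sum>a\<in>K1. y1 a * z a j)" "E 0" 0] y by simp
qed

lemma mat_vec_sum2:
  "mat_vec Q M (\<lambda>l. \<Sum>a\<in>K. \<Sum>i\<in>L. h a i * u i a l) j = (\<Sum>a\<in>K. \<Sum>i\<in>L. h a i * mat_vec Q M (u i a) j)"
  using mat_vec_sum[of Q M "\<lambda>_. 1" "\<lambda>a l. \<Sum>i\<in>L. h a i * u i a l" K j] by (simp add: mat_vec_sum)

text \<open>
  A pair \<open>(u, \<alpha>)\<close> is a cycle in degree two when \<open>d u + \<Sum>a. \<alpha> a z\<^sub>a = 0\<close>.  Since the maximal ideal annihilates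
  the classes of \<open>z\<^sub>a\<close> and these are independent over \<open>k\<close>, all \<open>\<alpha> a\<close> lie in the maximal ideal.  Subtracting
  the relations \<open>g i z\<^sub>a = d U\<^sub>i\<^sub>a\<close> leaves a Koszul cycle in degree two, which is a combination of \<open>w\<close> and a
  boundary.  Hence the cycles are generated by Koszul boundaries, the \<open>w\<^sub>a\<close> and the relations.
\<close>

lemma exact_degree_two:
  "(\<forall>j\<in>C 1. d 1 u j + (\<Sum>a\<in>K1. z a j * \<alpha> a) \<in> J) \<longleftrightarrow>
    (\<exists>y0 y1 y2. (\<forall>l\<in>C 2. u l - (d 2 y0 l + (\<Sum>a\<in>K2. w a l * y1 a) - (\<Sum>a\<in>K1. \<Sum>i\<in>C 1. y2 a i * U i a l)) \<in> J) \<and>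
      (\<forall>a\<in>K1. \<alpha> a - (\<Sum>i\<in>C 1. g i * y2 a i) \<in> J))"
  (is "?lhs \<longleftrightarrow> ?rhs")
proof
  assume H: ?lhs
  have "\<forall>a. \<exists>h. \<alpha> a - Const (const_coeff (\<alpha> a)) - d 0 h 0 \<in> N"
    unfolding maximal_iff[symmetric] by (simp add: maximal_def const_coeff_diff)
  then obtain h where "\<And>a. \<alpha> a - Const (const_coeff (\<alpha> a)) - d 0 (h a) 0 \<in> N" by metis
  then have h: "\<alpha> a - Const (const_coeff (\<alpha> a)) - d 0 (h a) 0 \<in> J" for a using NJ by blast
  \<comment> \<open>Replace \<open>\<alpha> a\<close> by its constant coefficient, at the cost of a multiple of \<open>U\<close>.\<close>
  let ?u = "\<lambda>l. u l + (\<Sum>a\<in>K1. \<Sum>i\<in>C 1. h a i * U i a l)"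
  have du: "d 1 ?u j + (\<Sum>a\<in>K1. Const (const_coeff (\<alpha> a)) * z a j) \<in> J" if j: "j \<in> C 1" for j
  proof -
    have 1: "(\<Sum>a\<in>K1. z a j * (\<alpha> a - Const (const_coeff (\<alpha> a)) - d 0 (h a) 0)) \<in> J"
      by (intro self.subspace_sum[OF J] self.subspace_scale[OF J] h)
    have 2: "(\<Sum>a\<in>K1. \<Sum>i\<in>C 1. h a i * (g i * z a j - d 1 (U i a) j)) \<in> J"
      by (intro self.subspace_sum[OF J] self.subspace_scale[OF J] U j)
    have "(d 1 u j + (\<Sum>a\<in>K1. z a j * \<alpha> a)) -
        (\<Sum>a\<in>K1. z a j * (\<alpha> a - Const (const_coeff (\<alpha> a)) - d 0 (h a) 0)) -
        (\<Sum>a\<in>K1. \<Sum>i\<in>C 1. h a i * (g i * z a j - d 1 (U i a) j)) \<in> J"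
      using H j by (intro self.subspace_diff[OF J] 1 2) blast
    moreover have "(\<Sum>a\<in>K1. \<Sum>i\<in>C 1. h a i * (g i * z a j)) = (\<Sum>a\<in>K1. z a j * d 0 (h a) 0)"
      by (intro sum.cong refl) (simp add: mat_vec_def[of "C (Suc 0)"] sum_distrib_left mult_ac)
    ultimately show ?thesis
      unfolding mat_vec_add mat_vec_sum2
      by (simp add: right_diff_distrib sum_subtractf sum.distrib algebra_simps)
  qed
  have "boundary_mod J C E 1 (\<lambda>j. \<Sum>a\<in>K1. Const (const_coeff (\<alpha> a)) * z a j)"
    unfolding boundary_mod_def
  proof (intro exI ballI)
    fix j assume "j \<in> C 1"
    then show "(\<Sum>a\<in>K1. Const (const_coeff (\<alpha> a)) * z a j) - mat_vec (C (Suc 1)) (E 1) (\<lambda>l. (- 1) * ?u l) j \<in> J"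
      unfolding mat_vec_mult using du by (simp add: add.commute)
  qed
  moreover have "\<forall>c. boundary_mod J C E 1 (\<lambda>j. \<Sum>a\<in>K1. Const (c a) * z a j) \<longrightarrow> (\<forall>a\<in>K1. c a = 0)"
    using z unfolding homology_basis_def by (elim conjE)
  ultimately have "\<forall>a\<in>K1. const_coeff (\<alpha> a) = 0" by (elim allE[of _ "\<lambda>a. const_coeff (\<alpha> a)"] impE)
  then have 0: "const_coeff (\<alpha> a) = 0" if "a \<in> K1" for a using that by blast
  then have "(\<Sum>a\<in>K1. Const (const_coeff (\<alpha> a)) * z a j) = 0" for j by simp
  then have "cycle_mod J C E 2 ?u" using du by (simp add: cycle_mod_def numeral_2_eq_2)
  then obtain c where "boundary_mod J C E 2 (\<lambda>l. ?u l - (\<Sum>a\<in>K2. Const (c a) * w a l))"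
    using w unfolding homology_basis_def by blast
  then obtain y0 where y0: "\<And>l. l \<in> C 2 \<Longrightarrow> ?u l - (\<Sum>a\<in>K2. Const (c a) * w a l) - d 2 y0 l \<in> J"
    by (auto simp: boundary_mod_def)
  show ?rhs
  proof (rule exI[of _ y0], rule exI[of _ "\<lambda>a. Const (c a)"], rule exI[of _ h], intro conjI ballI)
    fix l assume "l \<in> C 2"
    from y0[OF this] show "u l - (d 2 y0 l + (\<Sum>a\<in>K2. w a l * Const (c a)) - (\<Sum>a\<in>K1. \<Sum>i\<in>C 1. h a i * U i a l)) \<in> J"
      by (simp add: algebra_simps)
  next
    fix a assume "a \<in> K1"
    then show "\<alpha> a - (\<Sum>i\<in>C 1. g i * h a i) \<in> J" using h[of a] 0 by (simp add: mat_vec_def)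
  qed
next
  assume ?rhs
  then obtain y0 y1 y2 where
    y': "\<And>l. l \<in> C 2 \<Longrightarrow> u l - (d 2 y0 l + (\<Sum>a\<in>K2. w a l * y1 a) - (\<Sum>a\<in>K1. \<Sum>i\<in>C 1. y2 a i * U i a l)) \<in> J"
    and y2: "\<And>a. a \<in> K1 \<Longrightarrow> \<alpha> a - (\<Sum>i\<in>C 1. g i * y2 a i) \<in> J"
    by (elim exE conjE) (rule that, erule (1) bspec, erule (1) bspec)
  have y: "u l - (d 2 y0 l + (\<Sum>a\<in>K2. y1 a * w a l) - (\<Sum>a\<in>K1. \<Sum>i\<in>C 1. y2 a i * U i a l)) \<in> J"
    if "l \<in> C 2" for l
    using y'[OF that] by (simp add: mult.commute[of "y1 _"])
  let ?r = "\<lambda>l. d 2 y0 l + (\<Sum>a\<in>K2. y1 a * w a l) - (\<Sum>a\<in>K1. \<Sum>i\<in>C 1. y2 a i * U i a l)"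
  show ?lhs
  proof
    fix j assume j: "j \<in> C 1"
    have "d 1 (\<lambda>l. u l - ?r l) j \<in> J"
      by (rule mat_vec_mem[OF J]) (use y in \<open>auto simp: numeral_2_eq_2\<close>)
    moreover have "d 1 (d 2 y0) j \<in> J" using dd[of j 1 y0] j by (simp add: numeral_2_eq_2)
    ultimately have "d 1 (\<lambda>l. u l - ?r l) j + d 1 (d 2 y0) j + (\<Sum>a\<in>K2. y1 a * d 1 (w a) j) +
        (\<Sum>a\<in>K1. \<Sum>i\<in>C 1. y2 a i * (g i * z a j - d 1 (U i a) j)) +
        (\<Sum>a\<in>K1. z a j * (\<alpha> a - (\<Sum>i\<in>C 1. g i * y2 a i))) \<in> J"
      using w_cycle U y2 j
      by (intro self.subspace_add[OF J] self.subspace_sum[OF J] self.subspace_scale[OF J]) auto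
    moreover have "(\<Sum>a\<in>K1. \<Sum>i\<in>C 1. y2 a i * (g i * z a j)) = (\<Sum>a\<in>K1. z a j * (\<Sum>i\<in>C 1. g i * y2 a i))"
      by (intro sum.cong refl) (simp add: sum_distrib_left mult_ac)
    ultimately show "d 1 u j + (\<Sum>a\<in>K1. z a j * \<alpha> a) \<in> J"
      unfolding mat_vec_diff mat_vec_add mat_vec_sum mat_vec_sum2
      by (simp add: right_diff_distrib sum_subtractf sum.distrib algebra_simps)
  qed
qed

text \<open>
  Ranks and matrices of the beginning of a resolution of \<open>k\<close>.  The first entry of an index is a tag: \<open>0\<close> for
  the Koszul complex, \<open>1\<close> for the generators that kill \<open>z\<close> (degree two) and \<open>w\<close> (degree three), and \<open>2\<close> for the
  relations \<open>U\<close> in degree three.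
\<close>

definition serre_index :: "nat \<Rightarrow> (nat \<times> nat \<times> nat) set" where
  "serre_index n = (\<lambda>j. (0, j, 0)) ` C n \<union>
    (if n = 2 then (\<lambda>a. (1, a, 0)) ` K1
     else if n = 3 then (\<lambda>a. (1, a, 0)) ` K2 \<union> Pair 2 ` (K1 \<times> C 1) else {})"

definition serre_mat :: "nat \<Rightarrow> nat \<times> nat \<times> nat \<Rightarrow> nat \<times> nat \<times> nat \<Rightarrow> 'k mpoly" where
  "serre_mat n = (\<lambda>(t, j, _) (t', j', i').
    if t = 0 then
      if t' = 0 then E n j j'
      else if n = 1 then z j' j
      else if t' = 1 then w j' j
      else - U i' j' j
    else if t' = 2 \<and> j' = j then g i' else 0)"

lemma finite_serre_index: "finite (serre_index n)"
  by (simp add: serre_index_def fin finK)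

lemma card_serre_index:
  "card (serre_index 0) = card (C 0)" "card (serre_index 1) = card (C 1)"
  "card (serre_index 2) = card (C 2) + card K1"
  "card (serre_index 3) = card (C 3) + (card K2 + card K1 * card (C 1))"
proof -
  have inj: "inj_on (\<lambda>j. (t, j, 0)) S" for t :: nat and S :: "nat set" by (auto intro: inj_onI)
  have inj2: "inj_on (Pair (2 :: nat)) S" for S :: "(nat \<times> nat) set" by (auto intro: inj_onI)
  show "card (serre_index 0) = card (C 0)" "card (serre_index 1) = card (C 1)"
    by (simp_all add: serre_index_def card_image inj)
  have "card ((\<lambda>j. (0 :: nat, j, 0 :: nat)) ` C 2 \<union> (\<lambda>a. (1, a, 0)) ` K1) = card (C 2) + card K1"
    using fin finK by (subst card_Un_disjoint) (auto simp: card_image inj)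
  then show "card (serre_index 2) = card (C 2) + card K1" by (simp add: serre_index_def)
  have "card ((\<lambda>a. (1 :: nat, a, 0 :: nat)) ` K2 \<union> Pair 2 ` (K1 \<times> C 1)) = card K2 + card K1 * card (C 1)"
    using fin finK by (subst card_Un_disjoint) (auto simp: card_image inj inj2 card_cartesian_product)
  then show "card (serre_index 3) = card (C 3) + (card K2 + card K1 * card (C 1))"
    unfolding serre_index_def using fin finK
    by (subst card_Un_disjoint) (auto simp: card_image inj)
qed

lemma mat_vec_serre:
  "mat_vec (serre_index 1) (serre_mat 0) v (0, j, k) = d 0 (\<lambda>l. v (0, l, 0)) j"
  "mat_vec (serre_index 2) (serre_mat 1) v (0, j, k) =
    d 1 (\<lambda>l. v (0, l, 0)) j + (\<Sum>a\<in>K1. z a j * v (1, a, 0))"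
  "mat_vec (serre_index 3) (serre_mat 2) v (0, j, k) =
    d 2 (\<lambda>l. v (0, l, 0)) j + (\<Sum>a\<in>K2. w a j * v (1, a, 0)) - (\<Sum>a\<in>K1. \<Sum>i\<in>C 1. v (2, a, i) * U i a j)"
  "a \<in> K1 \<Longrightarrow> mat_vec (serre_index 3) (serre_mat 2) v (1, a, k) = (\<Sum>i\<in>C 1. g i * v (2, a, i))"
proof -
  have inj: "inj_on (\<lambda>j. (t, j, 0)) S" for t :: nat and S :: "nat set" by (auto intro: inj_onI)
  have inj2: "inj_on (Pair (2 :: nat)) S" for S :: "(nat \<times> nat) set" by (auto intro: inj_onI)
  have s1: "(\<Sum>x\<in>serre_index 1. f x) = (\<Sum>l\<in>C 1. f (0, l, 0))" for f :: "_ \<Rightarrow> 'k mpoly"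
    by (simp add: serre_index_def sum.reindex[OF inj])
  have s2: "(\<Sum>x\<in>serre_index 2. f x) = (\<Sum>l\<in>C 2. f (0, l, 0)) + (\<Sum>a\<in>K1. f (1, a, 0))" for f :: "_ \<Rightarrow> 'k mpoly"
  proof -
    have "serre_index 2 = (\<lambda>j. (0, j, 0)) ` C 2 \<union> (\<lambda>a. (1, a, 0)) ` K1" by (simp add: serre_index_def)
    then have "(\<Sum>x\<in>serre_index 2. f x) = (\<Sum>x\<in>(\<lambda>j. (0, j, 0)) ` C 2. f x) + (\<Sum>x\<in>(\<lambda>a. (1, a, 0)) ` K1. f x)"
      using fin finK by (simp only:) (intro sum.union_disjoint, auto)
    then show ?thesis by (simp add: sum.reindex[OF inj])
  qed
  have s3: "(\<Sum>x\<in>serre_index 3. f x) = (\<Sum>l\<in>C 3. f (0, l, 0)) + ((\<Sum>a\<in>K2. f (1, a, 0)) + (\<Sum>a\<in>K1. \<Sum>i\<in>C 1. f (2, a, i)))"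
    for f :: "_ \<Rightarrow> 'k mpoly"
  proof -
    have "serre_index 3 = (\<lambda>j. (0, j, 0)) ` C 3 \<union> ((\<lambda>a. (1, a, 0)) ` K2 \<union> Pair 2 ` (K1 \<times> C 1))"
      by (simp add: serre_index_def)
    then have "(\<Sum>x\<in>serre_index 3. f x) = (\<Sum>x\<in>(\<lambda>j. (0, j, 0)) ` C 3. f x) +
        (\<Sum>x\<in>(\<lambda>a. (1, a, 0)) ` K2 \<union> Pair 2 ` (K1 \<times> C 1). f x)"
      using fin finK by (simp only:) (intro sum.union_disjoint, auto)
    also have "(\<Sum>x\<in>(\<lambda>a. (1, a, 0)) ` K2 \<union> Pair 2 ` (K1 \<times> C 1). f x) =
        (\<Sum>x\<in>(\<lambda>a. (1, a, 0)) ` K2. f x) + (\<Sum>x\<in>Pair 2 ` (K1 \<times> C 1). f x)"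
      using fin finK by (intro sum.union_disjoint) auto
    finally show ?thesis
      by (simp add: sum.reindex[OF inj] sum.reindex[OF inj2] sum.cartesian_product case_prod_unfold)
  qed
  show "mat_vec (serre_index 1) (serre_mat 0) v (0, j, k) = d 0 (\<lambda>l. v (0, l, 0)) j"
    unfolding mat_vec_def s1 by (simp add: serre_mat_def)
  show "mat_vec (serre_index 2) (serre_mat 1) v (0, j, k) =
      d 1 (\<lambda>l. v (0, l, 0)) j + (\<Sum>a\<in>K1. z a j * v (1, a, 0))"
    unfolding mat_vec_def s2 by (simp add: serre_mat_def numeral_2_eq_2)
  show "mat_vec (serre_index 3) (serre_mat 2) v (0, j, k) =
      d 2 (\<lambda>l. v (0, l, 0)) j + (\<Sum>a\<in>K2. w a j * v (1, a, 0)) - (\<Sum>a\<in>K1. \<Sum>i\<in>C 1. v (2, a, i) * U i a j)"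
    unfolding mat_vec_def s3 by (simp add: serre_mat_def sum_negf mult.commute[of "v _"])
  show "mat_vec (serre_index 3) (serre_mat 2) v (1, a, k) = (\<Sum>i\<in>C 1. g i * v (2, a, i))" if a: "a \<in> K1"
  proof -
    have "mat_vec (serre_index 3) (serre_mat 2) v (1, a, k) =
        (\<Sum>a'\<in>K1. \<Sum>i\<in>C 1. (if a' = a then g i else 0) * v (2, a', i))"
      unfolding mat_vec_def s3 by (simp add: serre_mat_def)
    also have "\<dots> = (\<Sum>a'\<in>K1. if a' = a then \<Sum>i\<in>C 1. g i * v (2, a, i) else 0)"
      by (intro sum.cong refl) auto
    finally show ?thesis using a finK by simp
  qed
qed

end


text \<open>
  Koszul homology of \<open>A = T/I\<close> computes \<open>Tor\<^sup>T(k, A)\<close>, and the Betti numbers are the dimensions of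
  \<open>Tor\<^sup>T(A, k)\<close>; balancing identifies the two.
\<close>

lemma koszul_homology_basis:
  fixes I :: "'k::field mpoly set" and C :: "nat \<Rightarrow> nat set"
  assumes V: "finite V" and I: "ideal I (mpoly_ring V)" and Im: "I \<subseteq> maximal"
    and koszul: "resolution_mod (outside V) maximal C E (\<lambda>_. 1)"
  shows "\<exists>z. homology_basis Const (cycle_mod (lift_ideal V I) C E n) (boundary_mod (lift_ideal V I) C E n)
    {..<betti_dim V I n} z"
proof -
  have "\<exists>B (D :: nat \<Rightarrow> nat \<Rightarrow> nat \<Rightarrow> 'k mpoly).
      resolution_mod (outside V) (lift_ideal V I) B D (\<lambda>_. 1) \<and> B 0 = {0}"
    by (rule resolution_exists[OF V subspace_outside subspace_lift_ideal[OF ideal_in_I[OF I]] subset_refl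
          outside_le_lift[OF I]])
  then obtain B and D :: "nat \<Rightarrow> nat \<Rightarrow> nat \<Rightarrow> 'k mpoly" where
    res: "resolution_mod (outside V) (lift_ideal V I) B D (\<lambda>_. 1)" by (elim exE conjE)
  have cx: "complex_mod (outside V) B D" by (rule complex_of_resolution[OF subspace_outside res])
  obtain K :: "nat \<Rightarrow> (nat \<Rightarrow> 'k) set" and v where
    basis: "\<And>n. homology_basis Const (cycle_mod maximal B D n) (boundary_mod maximal B D n) (K n) (v n)"
    by (rule homology_basis_mod_exists[OF cx outside_le_maximal], rule that)
  have "\<exists>z. homology_basis Const (cycle_mod (lift_ideal V I) C E n) (boundary_mod (lift_ideal V I) C E n) (K n) z"
    by (rule balance_tor[OF subspace_outside subspace_lift_ideal[OF ideal_in_I[OF I]] subspace_maximal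
          res koszul basis])
  then obtain z where z: "homology_basis Const (cycle_mod (lift_ideal V I) C E n)
      (boundary_mod (lift_ideal V I) C E n) (K n) z" by (elim exE)
  have "finite (K n)" using basis[of n] by (simp add: homology_basis_def)
  from ex_bij_betw_nat_finite[OF this] obtain \<beta> where "bij_betw \<beta> {0..<card (K n)} (K n)" by (elim exE)
  then have \<beta>: "bij_betw \<beta> {..<betti_dim V I n} (K n)"
    by (simp add: betti_dim_eq[OF I V res basis] atLeast0LessThan)
  show ?thesis using homology_basis_reindex[OF z \<beta>] by (rule exI[of _ "\<lambda>a. z (\<beta> a)"])
qed

text \<open>
  The ranks of any resolution of \<open>k\<close> over \<open>A\<close> bound the dimensions of \<open>Tor\<^sup>A(k, k)\<close>.  Here the resolution
  continues the complex with ranks \<open>serre_index\<close>, which is exact up to degree two.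
\<close>

theorem serre_bound:
  fixes I :: "'k::field mpoly set"
  assumes V: "finite V" and I: "ideal I (mpoly_ring V)" and Im: "I \<subseteq> maximal"
  shows "residue_betti V I 0 \<le> 1" "residue_betti V I 1 \<le> card V"
    "residue_betti V I 2 \<le> (card V choose 2) + betti_dim V I 1"
    "residue_betti V I 3 \<le> (card V choose 3) + (betti_dim V I 2 + betti_dim V I 1 * card V)"
proof -
  define C where "C n = {..<card V choose n}" for n
  define b1 b2 where "b1 = betti_dim V I 1" and "b2 = betti_dim V I 2"
  define J where "J = lift_ideal V I"
  have "\<exists>E :: nat \<Rightarrow> nat \<Rightarrow> nat \<Rightarrow> 'k mpoly. resolution_mod (outside V) maximal C E (\<lambda>_. 1)"
    using koszul_resolution[OF V] unfolding C_def by blast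
  then obtain E :: "nat \<Rightarrow> nat \<Rightarrow> nat \<Rightarrow> 'k mpoly" where
    koszul: "resolution_mod (outside V) maximal C E (\<lambda>_. 1)" by (elim exE)
  have J: "self.subspace J" unfolding J_def by (rule subspace_lift_ideal[OF ideal_in_I[OF I]])
  have NJ: "outside V \<subseteq> J" unfolding J_def by (rule outside_le_lift[OF I])
  have Jm: "J \<subseteq> maximal" unfolding J_def by (rule lift_le_maximal[OF I Im])
  have C0: "C 0 = {0}" by (auto simp: C_def)
  interpret K: koszul_homology "outside V" J C E
    using J NJ Jm koszul C0 subspace_outside by unfold_locales
  obtain z where z: "homology_basis Const (cycle_mod J C E 1) (boundary_mod J C E 1) {..<b1} z"
    unfolding J_def b1_def b2_def by (rule exE[OF koszul_homology_basis[OF V I Im koszul]])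
  obtain w where w: "homology_basis Const (cycle_mod J C E 2) (boundary_mod J C E 2) {..<b2} w"
    unfolding J_def b1_def b2_def by (rule exE[OF koszul_homology_basis[OF V I Im koszul]])
  have "\<forall>i a. \<exists>u. i \<in> C 1 \<longrightarrow> a \<in> {..<b1} \<longrightarrow>
      (\<forall>j\<in>C 1. E 0 0 i * z a j - mat_vec (C (Suc 1)) (E 1) u j \<in> J)"
  proof (intro allI)
    fix i a
    show "\<exists>u. i \<in> C 1 \<longrightarrow> a \<in> {..<b1} \<longrightarrow>
        (\<forall>j\<in>C 1. E 0 0 i * z a j - mat_vec (C (Suc 1)) (E 1) u j \<in> J)"
    proof (cases "i \<in> C 1 \<and> a \<in> {..<b1}")
      case True
      then have "cycle_mod J C E 1 (z a)" using z by (simp add: homology_basis_def)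
      from K.maximal_kills[OF this] True show ?thesis by (simp add: boundary_mod_def)
    qed simp
  qed
  then obtain U where U: "\<And>i a j. i \<in> C 1 \<Longrightarrow> a \<in> {..<b1} \<Longrightarrow> j \<in> C 1 \<Longrightarrow>
      E 0 0 i * z a j - mat_vec (C (Suc 1)) (E 1) (U i a) j \<in> J" by metis
  interpret S: koszul_basis "outside V" J C E "{..<b1}" "{..<b2}" z w U
    using z w U by unfold_locales
  let ?S = S.serre_index and ?M = S.serre_mat
  have S0: "?S 0 = {(0, 0, 0)}" by (simp add: S.serre_index_def C0)
  have S1: "?S 1 = (\<lambda>j. (0, j, 0)) ` C 1" by (simp add: S.serre_index_def)
  have S2: "?S 2 = (\<lambda>j. (0, j, 0)) ` C 2 \<union> (\<lambda>a. (1, a, 0)) ` {..<b1}"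
    by (simp add: S.serre_index_def)
  have aug: "(\<Sum>i\<in>?S 0. 1 * v i) \<in> maximal \<longleftrightarrow> boundary_mod J ?S ?M 0 v" for v :: "nat \<times> nat \<times> nat \<Rightarrow> 'k mpoly"
  proof
    assume "(\<Sum>i\<in>?S 0. 1 * v i) \<in> maximal"
    then obtain w where "v (0, 0, 0) - mat_vec (C (Suc 0)) (E 0) w 0 \<in> outside V"
      using K.maximal_iff by (auto simp: S0)
    then show "boundary_mod J ?S ?M 0 v"
      unfolding boundary_mod_def S0 using NJ S.mat_vec_serre(1)[of "\<lambda>(t, l, _). w l"]
      by (intro exI[of _ "\<lambda>(t, l, _). w l"]) auto
  next
    assume "boundary_mod J ?S ?M 0 v"
    then obtain w where "v (0, 0, 0) - mat_vec (?S (Suc 0)) (?M 0) w (0, 0, 0) \<in> J"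
      by (auto simp: boundary_mod_def S0)
    then have "v (0, 0, 0) - mat_vec (C (Suc 0)) (E 0) (\<lambda>l. w (0, l, 0)) 0 \<in> maximal"
      using S.mat_vec_serre(1)[of w] Jm by auto
    moreover have "mat_vec (C (Suc 0)) (E 0) (\<lambda>l. w (0, l, 0)) 0 \<in> maximal"
      unfolding K.maximal_iff using self.subspace_0[OF subspace_outside]
      by (intro exI[of _ "\<lambda>l. w (0, l, 0)"]) simp
    ultimately have "v (0, 0, 0) - mat_vec (C (Suc 0)) (E 0) (\<lambda>l. w (0, l, 0)) 0 +
        mat_vec (C (Suc 0)) (E 0) (\<lambda>l. w (0, l, 0)) 0 \<in> maximal"
      by (rule self.subspace_add[OF subspace_maximal])
    then show "(\<Sum>i\<in>?S 0. 1 * v i) \<in> maximal" by (simp add: S0)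
  qed
  have deg1: "cycle_mod J ?S ?M 1 v \<longleftrightarrow> boundary_mod J ?S ?M 1 v" for v
  proof -
    have "cycle_mod J ?S ?M 1 v \<longleftrightarrow> mat_vec (C (Suc 0)) (E 0) (\<lambda>l. v (0, l, 0)) 0 \<in> J"
      using S.mat_vec_serre(1)[of v 0 0] by (simp add: cycle_mod_def S0)
    moreover have "boundary_mod J ?S ?M 1 v \<longleftrightarrow> (\<exists>y :: nat \<times> nat \<times> nat \<Rightarrow> 'k mpoly. \<forall>j\<in>C 1. v (0, j, 0) -
        (mat_vec (C (Suc 1)) (E 1) (\<lambda>l. y (0, l, 0)) j + (\<Sum>a<b1. z a j * y (1, a, 0))) \<in> J)"
      unfolding boundary_mod_def S1 using S.mat_vec_serre(2) by (simp add: numeral_2_eq_2)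
    moreover have "\<dots> \<longleftrightarrow> (\<exists>y0 y1. \<forall>j\<in>C 1. v (0, j, 0) -
        (mat_vec (C (Suc 1)) (E 1) y0 j + (\<Sum>a<b1. z a j * y1 a)) \<in> J)" (is "?l \<longleftrightarrow> ?r")
    proof
      assume ?r
      then obtain y0 y1 where "\<forall>j\<in>C 1. v (0, j, 0) -
        (mat_vec (C (Suc 1)) (E 1) y0 j + (\<Sum>a<b1. z a j * y1 a)) \<in> J" by (elim exE)
      then show ?l by (intro exI[of _ "\<lambda>(t, p, q). if t = 0 then y0 p else y1 p"]) simp
    qed (elim exE, rule exI, rule exI)
    ultimately show ?thesis using S.exact_degree_one by simp
  qed
  have deg2: "cycle_mod J ?S ?M 2 v \<longleftrightarrow> boundary_mod J ?S ?M 2 v" for v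
  proof -
    have "cycle_mod J ?S ?M 2 v \<longleftrightarrow> (\<forall>j\<in>C 1. mat_vec (C (Suc 1)) (E 1) (\<lambda>l. v (0, l, 0)) j +
        (\<Sum>a<b1. z a j * v (1, a, 0)) \<in> J)"
      using S.mat_vec_serre(2)[of v] S1 by (simp add: cycle_mod_def numeral_2_eq_2)
    moreover have "boundary_mod J ?S ?M 2 v \<longleftrightarrow> (\<exists>y :: nat \<times> nat \<times> nat \<Rightarrow> 'k mpoly. (\<forall>l\<in>C 2. v (0, l, 0) - (mat_vec (C (Suc 2)) (E 2) (\<lambda>l. y (0, l, 0)) l +
        (\<Sum>a<b2. w a l * y (1, a, 0)) - (\<Sum>a<b1. \<Sum>i\<in>C 1. y (2, a, i) * U i a l)) \<in> J) \<and>
        (\<forall>a\<in>{..<b1}. v (1, a, 0) - (\<Sum>i\<in>C 1. E 0 0 i * y (2, a, i)) \<in> J))"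
    proof -
      have 3: "Suc 2 = 3" by simp
      have "boundary_mod J ?S ?M 2 v \<longleftrightarrow> (\<exists>y. (\<forall>l\<in>C 2. v (0, l, 0) - mat_vec (?S 3) (?M 2) y (0, l, 0) \<in> J) \<and>
          (\<forall>a\<in>{..<b1}. v (1, a, 0) - mat_vec (?S 3) (?M 2) y (1, a, 0) \<in> J))"
        unfolding boundary_mod_def S2 ball_Un ball_simps 3 by simp
      then show ?thesis
        unfolding S.mat_vec_serre(3) using S.mat_vec_serre(4) by simp
    qed
    moreover have "\<dots> \<longleftrightarrow> (\<exists>y0 y1 y2. (\<forall>l\<in>C 2. v (0, l, 0) - (mat_vec (C (Suc 2)) (E 2) y0 l +
        (\<Sum>a<b2. w a l * y1 a) - (\<Sum>a<b1. \<Sum>i\<in>C 1. y2 a i * U i a l)) \<in> J) \<and>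
        (\<forall>a\<in>{..<b1}. v (1, a, 0) - (\<Sum>i\<in>C 1. E 0 0 i * y2 a i) \<in> J))" (is "?l \<longleftrightarrow> ?r")
    proof
      assume ?r
      then obtain y0 y1 y2 where "(\<forall>l\<in>C 2. v (0, l, 0) - (mat_vec (C (Suc 2)) (E 2) y0 l +
        (\<Sum>a<b2. w a l * y1 a) - (\<Sum>a<b1. \<Sum>i\<in>C 1. y2 a i * U i a l)) \<in> J) \<and>
        (\<forall>a\<in>{..<b1}. v (1, a, 0) - (\<Sum>i\<in>C 1. E 0 0 i * y2 a i) \<in> J)" by (elim exE)
      then show ?l
        by (intro exI[of _ "\<lambda>(t, p, q). if t = 0 then y0 p else if t = 1 then y1 p else y2 p q"]) simp
    next
      assume ?l
      then obtain y :: "nat \<times> nat \<times> nat \<Rightarrow> 'k mpoly" where y: "(\<forall>l\<in>C 2. v (0, l, 0) - (mat_vec (C (Suc 2)) (E 2) (\<lambda>l. y (0, l, 0)) l +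
        (\<Sum>a<b2. w a l * y (1, a, 0)) - (\<Sum>a<b1. \<Sum>i\<in>C 1. y (2, a, i) * U i a l)) \<in> J) \<and>
        (\<forall>a\<in>{..<b1}. v (1, a, 0) - (\<Sum>i\<in>C 1. E 0 0 i * y (2, a, i)) \<in> J)" by (elim exE)
      show ?r
        by (rule exI[of _ "\<lambda>l. y (0, l, 0)"], rule exI[of _ "\<lambda>a. y (1, a, 0)"],
            rule exI[of _ "\<lambda>a i. y (2, a, i)"], rule y)
    qed
    ultimately show ?thesis using S.exact_degree_two by simp
  qed
  have "\<exists>B D. resolution_mod J maximal B D (\<lambda>_. 1) \<and> (\<forall>n\<le>Suc 2. B n = ?S n) \<and> (\<forall>n\<le>2. D n = ?M n)"
  proof (rule resolution_extend[OF _ V J NJ])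
    show "infinite (UNIV :: (nat \<times> nat \<times> nat) set)" by (simp add: finite_prod)
    show "finite (?S n)" for n by (rule S.finite_serre_index)
    show "\<exists>v. (\<Sum>i\<in>?S 0. 1 * v i) - 1 \<in> maximal"
      using self.subspace_0[OF subspace_maximal] by (intro exI[of _ "\<lambda>_. 1"]) (simp add: S0)
    show "(\<Sum>i\<in>?S 0. 1 * v i) \<in> maximal \<longleftrightarrow> boundary_mod J ?S ?M 0 v" for v by (rule aug)
    fix n :: nat and v assume "n < 2"
    then consider "Suc n = 1" | "Suc n = 2" by linarith
    then show "cycle_mod J ?S ?M (Suc n) v \<longleftrightarrow> boundary_mod J ?S ?M (Suc n) v"
      by cases (simp_all only: deg1 deg2)
  qed
  then obtain B D where res: "resolution_mod J maximal B D (\<lambda>_. 1)" and B: "\<And>n. n \<le> Suc 2 \<Longrightarrow> B n = ?S n"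
    by (elim exE conjE) (rule that, assumption, simp)
  have cx: "complex_mod J B D" by (rule complex_of_resolution[OF J res])
  obtain L :: "nat \<Rightarrow> ((nat \<times> nat \<times> nat) \<Rightarrow> 'k) set" and v where
    basis: "\<And>n. homology_basis Const (cycle_mod maximal B D n) (boundary_mod maximal B D n) (L n) (v n)"
    by (rule homology_basis_mod_exists[OF cx Jm], rule that)
  have "residue_betti V I n \<le> card (?S n)" if "n \<le> 3" for n
  proof -
    have "residue_betti V I n = card (L n)"
      using res unfolding J_def by (rule residue_betti_eq[OF I V Im _ basis])
    also have "\<dots> \<le> card (B n)"
      by (rule card_homology_basis_le[OF _ homology_basis_const_coeff[OF basis]])
        (use cx in \<open>simp add: complex_mod_def\<close>)
    finally show ?thesis using B[of n] that by simp
  qed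
  from this[of 0] this[of 1] this[of 2] this[of 3]
  show "residue_betti V I 0 \<le> 1" "residue_betti V I 1 \<le> card V"
    "residue_betti V I 2 \<le> (card V choose 2) + betti_dim V I 1"
    "residue_betti V I 3 \<le> (card V choose 3) + (betti_dim V I 2 + betti_dim V I 1 * card V)"
    unfolding S.card_serre_index by (simp_all add: C_def b1_def b2_def)
qed


section \<open>The lowest Betti numbers of an ideal\<close>

lemma max_ideal_le_maximal: "max_ideal V \<subseteq> (maximal :: 'k::field mpoly set)"
proof -
  have car: "mvar ` V \<subseteq> carrier (mpoly_ring V :: 'k mpoly ring)"
    by (auto simp: mpoly_ring_def mvar_def)
  have "ideal (max_in V) (mpoly_ring V :: 'k mpoly ring)" by (simp add: ideal_in_iff ideal_in_max_in)
  moreover have "mvar ` V \<subseteq> (max_in V :: 'k mpoly set)"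
    using mvar_maximal by (auto simp: max_in_def maximal_def mvar_def restrict_single)
  ultimately have "max_ideal V \<subseteq> (max_in V :: 'k mpoly set)"
    unfolding max_ideal_def by (rule ring.genideal_minimal[OF cring.axioms(1)[OF mpoly_ring_cring]])
  then show ?thesis by (auto simp: max_in_def maximal_def)
qed

lemma square_le_maximal:
  "ideal_prod (mpoly_ring V) (max_ideal V) (max_ideal V) \<subseteq> (maximal :: 'k::field mpoly set)"
proof
  fix p :: "'k mpoly" assume "p \<in> ideal_prod (mpoly_ring V) (max_ideal V) (max_ideal V)"
  then show "p \<in> maximal"
  proof induction
    case (prod i j)
    then have "i \<in> maximal" using max_ideal_le_maximal by blast
    then show ?case by (simp add: maximal_def mpoly_ring_def const_coeff_mult)
  next
    case (sum p q)
    then show ?case by (simp add: maximal_def mpoly_ring_def const_coeff_add)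
  qed
qed

text \<open>
  \<open>A \<otimes>\<^sub>T k = k\<close>: a resolution of the cyclic module \<open>A\<close> starts with \<open>T\<close>, and the next matrix has entries in \<open>I\<close>.
\<close>

lemma betti_dim_0:
  fixes I :: "'k::field mpoly set"
  assumes V: "finite V" and I: "ideal I (mpoly_ring V)" and Im: "I \<subseteq> maximal"
  shows "betti_dim V I 0 = 1"
proof -
  have "\<exists>B (D :: nat \<Rightarrow> nat \<Rightarrow> nat \<Rightarrow> 'k mpoly).
      resolution_mod (outside V) (lift_ideal V I) B D (\<lambda>_. 1) \<and> B 0 = {0}"
    by (rule resolution_exists[OF V subspace_outside subspace_lift_ideal[OF ideal_in_I[OF I]] subset_refl
          outside_le_lift[OF I]])
  then obtain B and D :: "nat \<Rightarrow> nat \<Rightarrow> nat \<Rightarrow> 'k mpoly" where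
    res: "resolution_mod (outside V) (lift_ideal V I) B D (\<lambda>_. 1)" and B0: "B 0 = {0}" by (elim exE conjE)
  have fin: "finite (B (Suc 0))" using res by (simp add: resolution_mod_def)
  have aug: "\<forall>v. (\<Sum>i\<in>B 0. 1 * v i) \<in> lift_ideal V I \<longleftrightarrow> boundary_mod (outside V) B D 0 v"
    using res unfolding resolution_mod_def by (elim conjE)
  have D: "D 0 0 j \<in> maximal" if j: "j \<in> B (Suc 0)" for j
  proof -
    have "mat_vec (B (Suc 0)) (D 0) (\<lambda>l. if l = j then 1 else 0) 0 = (\<Sum>l\<in>B (Suc 0). if l = j then D 0 0 j else 0)"
      unfolding mat_vec_def by (intro sum.cong) auto
    then have "boundary_mod (outside V) B D 0 (\<lambda>_. D 0 0 j)"
      using fin j self.subspace_0[OF subspace_outside]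
      by (simp add: boundary_mod_def B0) (intro exI[of _ "\<lambda>l. if l = j then 1 else 0"], simp)
    then have "D 0 0 j \<in> lift_ideal V I" using spec[OF aug, of "\<lambda>_. D 0 0 j"] by (simp add: B0)
    then show ?thesis using lift_le_maximal[OF I Im] by blast
  qed
  have bd: "boundary_mod maximal B D 0 v \<longleftrightarrow> v 0 \<in> maximal" for v
  proof -
    have "mat_vec (B (Suc 0)) (D 0) w 0 \<in> maximal" for w
      unfolding mat_vec_def
      by (intro self.subspace_sum[OF subspace_maximal]) (simp add: D mult.commute self.subspace_scale[OF subspace_maximal])
    then have "v 0 - mat_vec (B (Suc 0)) (D 0) w 0 \<in> maximal \<longleftrightarrow> v 0 \<in> maximal" for w
      by (simp add: maximal_def const_coeff_diff)
    then show ?thesis by (simp add: boundary_mod_def B0)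
  qed
  have "homology_basis Const (cycle_mod maximal B D 0) (boundary_mod maximal B D 0) {()} (\<lambda>_ _. 1)"
    unfolding homology_basis_def bd
    by (auto simp: cycle_mod_def maximal_def const_coeff_diff const_coeff_mult intro: exI[of _ "\<lambda>_. const_coeff _"])
  from betti_dim_eq[OF I V res this] show ?thesis by simp
qed

text \<open>
  If the first Koszul homology of \<open>A\<close> vanished, every \<open>f\<close> in \<open>I\<close> would be a combination of elements of the
  maximal ideal with coefficients in \<open>I\<close>, as in Nakayama's lemma.  Then a monomial of least degree in an
  element of \<open>I\<close> would be divisible by a smaller monomial of another element.
\<close>

lemma betti_dim_1_pos:
  fixes I :: "'k::field mpoly set"
  assumes V: "finite V" and I: "ideal I (mpoly_ring V)" and Im: "I \<subseteq> maximal" and nz: "I \<noteq> {0}"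
  shows "betti_dim V I 1 \<noteq> 0"
proof
  assume b: "betti_dim V I 1 = 0"
  define C where "C n = {..<card V choose n}" for n
  define J where "J = lift_ideal V I"
  have "\<exists>E :: nat \<Rightarrow> nat \<Rightarrow> nat \<Rightarrow> 'k mpoly. resolution_mod (outside V) maximal C E (\<lambda>_. 1) \<and>
      (\<forall>n i j. E n i j \<in> maximal \<and> restrict_vars V (E n i j) = E n i j)"
    using koszul_resolution[OF V] unfolding C_def by simp
  then obtain E :: "nat \<Rightarrow> nat \<Rightarrow> nat \<Rightarrow> 'k mpoly" where
    koszul: "resolution_mod (outside V) maximal C E (\<lambda>_. 1)"
    and E: "\<And>n i j. E n i j \<in> maximal" "\<And>n i j. restrict_vars V (E n i j) = E n i j"
    by (elim exE conjE) (rule that, assumption, simp_all)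
  have J: "self.subspace J" unfolding J_def by (rule subspace_lift_ideal[OF ideal_in_I[OF I]])
  have NJ: "outside V \<subseteq> J" unfolding J_def by (rule outside_le_lift[OF I])
  have Jm: "J \<subseteq> maximal" unfolding J_def by (rule lift_le_maximal[OF I Im])
  have C0: "C 0 = {0}" by (auto simp: C_def)
  interpret K: koszul_homology "outside V" J C E
    using J NJ Jm koszul C0 subspace_outside by unfold_locales
  obtain z :: "nat \<Rightarrow> nat \<Rightarrow> 'k mpoly" where
    "homology_basis Const (cycle_mod J C E 1) (boundary_mod J C E 1) {..<betti_dim V I 1} z"
    unfolding J_def by (rule exE[OF koszul_homology_basis[OF V I Im koszul]])
  then have exact: "boundary_mod J C E 1 x" if "cycle_mod J C E 1 x" for x
    using that unfolding homology_basis_def b by simp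
  have decomp: "\<exists>h. (\<forall>j\<in>C 1. h j \<in> I) \<and> f = (\<Sum>j\<in>C 1. E 0 0 j * h j)" if f: "f \<in> I" for f
  proof -
    have rf: "restrict_vars V f = f" using f ideal_in_I[OF I] by (simp add: ideal_in_def)
    obtain w where w: "f - K.d 0 w 0 \<in> outside V" using K.maximal_iff f Im by blast
    have "f \<in> J" using f rf by (simp add: J_def lift_ideal_def)
    moreover have "f - K.d 0 w 0 \<in> J" using w NJ by blast
    ultimately have "f - (f - K.d 0 w 0) \<in> J" by (rule self.subspace_diff[OF J])
    then have "cycle_mod J C E 1 w" by (simp add: cycle_mod_def C0)
    then have "boundary_mod J C E 1 w" by (rule exact)
    then obtain y where y: "\<And>j. j \<in> C 1 \<Longrightarrow> w j - K.d 1 y j \<in> J" by (auto simp: boundary_mod_def)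
    define h where "h j = restrict_vars V (w j - K.d 1 y j)" for j
    \<comment> \<open>Over the polynomial ring the composite vanishes, so \<open>w\<close> may be replaced by \<open>w - d y\<close>.\<close>
    have "K.d 0 (K.d 1 y) 0 \<in> outside V"
      using complex_of_resolution[OF subspace_outside koszul] by (simp add: complex_mod_def C0)
    with w have "(f - K.d 0 w 0) + K.d 0 (K.d 1 y) 0 \<in> outside V"
      by (rule self.subspace_add[OF subspace_outside])
    then have "restrict_vars V (f - K.d 0 (\<lambda>j. w j - K.d 1 y j) 0) = 0"
      unfolding mat_vec_diff by (simp add: lift_ideal_def algebra_simps)
    then have "f = (\<Sum>j\<in>C 1. E 0 0 j * h j)"
      by (simp add: restrict_diff restrict_sum restrict_mult rf E h_def mat_vec_def)
    moreover have "\<forall>j\<in>C 1. h j \<in> I" using y by (simp add: h_def J_def lift_ideal_def)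
    ultimately show ?thesis by blast
  qed
  have no_monomial: "f \<in> I \<Longrightarrow> m \<in> Poly_Mapping.keys f \<Longrightarrow> False" for f m
  proof (induction "mdeg m" arbitrary: f m rule: less_induct)
    case less
    obtain h where h: "\<And>j. j \<in> C 1 \<Longrightarrow> h j \<in> I" and f: "f = (\<Sum>j\<in>C 1. E 0 0 j * h j)"
      using decomp[OF less.prems(1)] by blast
    obtain j where j: "j \<in> C 1" and "m \<in> Poly_Mapping.keys (E 0 0 j * h j)"
      using less.prems(2) Poly_Mapping.keys_sum[of "\<lambda>j. E 0 0 j * h j" "C 1"] unfolding f by blast
    then obtain a b where m: "m = a + b" and a: "a \<in> Poly_Mapping.keys (E 0 0 j)" and b: "b \<in> Poly_Mapping.keys (h j)"
      using Poly_Mapping.keys_mult[of "E 0 0 j" "h j"] by blast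
    have "a \<noteq> 0" using a E(1)[of 0 0 j] by (auto simp: maximal_def const_coeff_def in_keys_iff)
    then have "mdeg b < mdeg m"
      by (intro mdeg_strict) (auto simp: m monom_dvd_def lookup_add)
    then show False using less.hyps h[OF j] b by blast
  qed
  have "I \<subseteq> {0}"
  proof
    fix f assume f: "f \<in> I"
    then have "Poly_Mapping.keys f = {}" using no_monomial by blast
    then show "f \<in> {0}" by simp
  qed
  moreover have "0 \<in> I" using ideal_in_I[OF I] by (simp add: ideal_in_def)
  ultimately show False using nz by blast
qed


section \<open>The Golod property of a tensor product\<close>

definition residue_series :: "nat set \<Rightarrow> 'k::field mpoly set \<Rightarrow> rat fps" where
  "residue_series V I = Abs_fps (\<lambda>i. of_nat (residue_betti V I i))"

definition serre_denominator :: "nat set \<Rightarrow> 'k::field mpoly set \<Rightarrow> rat fps" where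
  "serre_denominator V I = 1 - Abs_fps (\<lambda>j. if j \<ge> 2 then of_nat (betti_dim V I (j - 1)) else 0)"

text \<open>
  The denominator has constant coefficient \<open>1\<close>, so it is a unit.
\<close>

lemma golod_iff:
  "golod V I \<longleftrightarrow> residue_series V I * serre_denominator V I = (1 + fps_X) ^ card V"
proof -
  have u: "fps_nth (serre_denominator V I) 0 \<noteq> 0" by (simp add: serre_denominator_def)
  have "golod V I \<longleftrightarrow> residue_series V I = (1 + fps_X) ^ card V * inverse (serre_denominator V I)"
    using u by (simp add: golod_def residue_series_def serre_denominator_def fps_divide_unit)
  also have "\<dots> \<longleftrightarrow> residue_series V I * serre_denominator V I = (1 + fps_X) ^ card V"
  proof
    assume "residue_series V I = (1 + fps_X) ^ card V * inverse (serre_denominator V I)"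
    then show "residue_series V I * serre_denominator V I = (1 + fps_X) ^ card V"
      using inverse_mult_eq_1[OF u] by (simp add: mult.assoc)
  next
    assume "residue_series V I * serre_denominator V I = (1 + fps_X) ^ card V"
    then show "residue_series V I = (1 + fps_X) ^ card V * inverse (serre_denominator V I)"
      using inverse_mult_eq_1[OF u] by (metis mult.assoc mult.commute mult.left_neutral)
  qed
  finally show ?thesis .
qed

lemma nth_binomial_power: "fps_nth ((1 + fps_X) ^ n :: rat fps) k = of_nat (n choose k)"
proof (induction n arbitrary: k)
  case 0
  then show ?case by (cases k) auto
next
  case (Suc n)
  have "fps_nth ((1 + fps_X) ^ Suc n :: rat fps) k =
      fps_nth ((1 + fps_X) ^ n) k + (if k = 0 then 0 else fps_nth ((1 + fps_X) ^ n) (k - 1))"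
    by (simp add: distrib_right)
  then show ?case using Suc.IH by (cases k) auto
qed

text \<open>
  The coefficient of \<open>z\<^sup>3\<close> in the identity \<open>P (1 - \<Sum>i. b\<^sub>i z\<^sup>i\<^sup>+\<^sup>1) = (1 + z)\<^sup>N\<close>; the coefficients of \<open>1\<close> and \<open>z\<close> give
  \<open>P\<^sub>0 = 1\<close> and \<open>P\<^sub>1 = N\<close>.
\<close>

lemma golod_degree_three:
  assumes "golod V I"
  shows "residue_betti V I 3 = (card V choose 3) + card V * betti_dim V I 1 + betti_dim V I 2"
proof -
  have eq: "fps_nth (residue_series V I * serre_denominator V I) k = of_nat (card V choose k)" for k
    using assms by (simp add: golod_iff nth_binomial_power)
  have s: "{0..1 :: nat} = {0, 1}" "{0..3 :: nat} = {0, 1, 2, 3}" by auto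
  have 0: "residue_betti V I 0 = 1"
    using eq[of 0] by (simp add: fps_mult_nth residue_series_def serre_denominator_def)
  have 1: "residue_betti V I 1 = card V"
    using eq[of 1] 0 by (simp add: fps_mult_nth s residue_series_def serre_denominator_def)
  have "(of_nat (residue_betti V I 3) :: rat) - of_nat (card V) * of_nat (betti_dim V I 1) - of_nat (betti_dim V I 2)
      = of_nat (card V choose 3)"
    using eq[of 3] 0 1
    by (simp add: fps_mult_nth s residue_series_def serre_denominator_def numeral_eq_Suc)
  then have "(of_nat (residue_betti V I 3) :: rat) =
      of_nat ((card V choose 3) + card V * betti_dim V I 1 + betti_dim V I 2)"
    by simp
  then show ?thesis by (simp only: of_nat_eq_iff)
qed

text \<open>
  For the second factor \<open>P = (1 + z)\<^sup>m\<close> and \<open>B = 1\<close> by the Koszul resolution, so the Golod identity is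
  multiplied by \<open>(1 + z)\<^sup>m\<close>, which can be cancelled.
\<close>

lemma golod_extend_variables:
  fixes I :: "'k::field mpoly set"
  assumes fin: "finite V1" "finite V2" and disj: "V1 \<inter> V2 = {}"
    and I: "ideal I (mpoly_ring V1)" and Im: "I \<subseteq> maximal"
  shows "golod (V1 \<union> V2) (genideal (mpoly_ring (V1 \<union> V2)) (I \<union> {0})) \<longleftrightarrow> golod V1 I"
proof -
  let ?V = "V1 \<union> V2" and ?I = "genideal (mpoly_ring (V1 \<union> V2)) (I \<union> {0})"
  have 0: "ideal ({0} :: 'k mpoly set) (mpoly_ring V2)" "{0} \<subseteq> (maximal :: 'k mpoly set)"
    by (auto simp: ideal_in_iff ideal_in_zero maximal_def)
  have "betti_dim ?V ?I n = betti_dim V1 I n" for n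
  proof -
    have "betti_dim ?V ?I n = (\<Sum>p\<le>n. if p = n then betti_dim V1 I n else 0)"
      unfolding betti_dim_tensor[OF fin disj I 0(1)]
      by (intro sum.cong) (auto simp: betti_dim_zero_ideal[OF fin(2)])
    then show ?thesis by simp
  qed
  then have den: "serre_denominator ?V ?I = serre_denominator V1 I"
    by (simp add: serre_denominator_def cong: if_cong)
  have res: "residue_series ?V ?I = residue_series V1 I * (1 + fps_X) ^ card V2"
  proof (rule fps_ext)
    fix k
    have "residue_betti ?V ?I k = (\<Sum>p\<le>k. residue_betti V1 I p * (card V2 choose (k - p)))"
      unfolding residue_betti_tensor[OF fin disj I Im 0] by (simp add: residue_betti_zero_ideal[OF fin(2)])
    then show "fps_nth (residue_series ?V ?I) k = fps_nth (residue_series V1 I * (1 + fps_X) ^ card V2) k"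
      unfolding residue_series_def fps_mult_nth nth_binomial_power fps_nth_Abs_fps by (simp add: atLeast0AtMost)
  qed
  have "fps_nth ((1 + fps_X) ^ card V2 :: rat fps) 0 \<noteq> 0" by (simp add: nth_binomial_power)
  then have nz: "(1 + fps_X) ^ card V2 \<noteq> (0 :: rat fps)" by (metis fps_zero_nth)
  have "golod ?V ?I \<longleftrightarrow> (1 + fps_X) ^ card V2 * (residue_series V1 I * serre_denominator V1 I) =
      (1 + fps_X) ^ card V2 * (1 + fps_X) ^ card V1"
    unfolding golod_iff den res card_Un_disjoint[OF fin disj] power_add by (simp add: mult_ac)
  also have "\<dots> \<longleftrightarrow> golod V1 I" unfolding golod_iff using nz by simp
  finally show ?thesis .
qed

text \<open>
  Both sides are compared in degree three: the product of the two bounds of Serre falls short of the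
  value that the Golod identity prescribes by the product \<open>s 1 * t 1\<close> of the numbers of generators.
\<close>

lemma tensor_not_golod:
  fixes I1 I2 :: "'k::field mpoly set"
  assumes fin: "finite V1" "finite V2" and disj: "V1 \<inter> V2 = {}"
    and I1: "ideal I1 (mpoly_ring V1)" "I1 \<subseteq> maximal" "I1 \<noteq> {0}"
    and I2: "ideal I2 (mpoly_ring V2)" "I2 \<subseteq> maximal" "I2 \<noteq> {0}"
  shows "\<not> golod (V1 \<union> V2) (genideal (mpoly_ring (V1 \<union> V2)) (I1 \<union> I2))"
proof
  let ?V = "V1 \<union> V2" and ?I = "genideal (mpoly_ring (V1 \<union> V2)) (I1 \<union> I2)"
  assume golod: "golod ?V ?I"
  define a b where "a p = residue_betti V1 I1 p" and "b p = residue_betti V2 I2 p" for p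
  define s t where "s p = betti_dim V1 I1 p" and "t p = betti_dim V2 I2 p" for p
  define n m where "n = card V1" and "m = card V2"
  have sets: "{..1 :: nat} = {0, 1}" "{..2 :: nat} = {0, 1, 2}" "{..3 :: nat} = {0, 1, 2, 3}" by auto
  have st0: "s 0 = 1" "t 0 = 1"
    using betti_dim_0[OF fin(1) I1(1,2)] betti_dim_0[OF fin(2) I2(1,2)] by (simp_all add: s_def t_def)
  have "betti_dim ?V ?I 1 = s 1 + t 1"
    unfolding betti_dim_tensor[OF fin disj I1(1) I2(1)] by (simp add: sets s_def[symmetric] t_def[symmetric] st0)
  moreover have "betti_dim ?V ?I 2 = s 2 + s 1 * t 1 + t 2"
    unfolding betti_dim_tensor[OF fin disj I1(1) I2(1)] by (simp add: sets s_def[symmetric] t_def[symmetric] st0)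
  moreover have "residue_betti ?V ?I 3 = a 0 * b 3 + a 1 * b 2 + a 2 * b 1 + a 3 * b 0"
    unfolding residue_betti_tensor[OF fin disj I1(1,2) I2(1,2)]
    by (simp add: sets a_def[symmetric] b_def[symmetric])
  moreover have "card ?V = n + m" unfolding n_def m_def by (rule card_Un_disjoint[OF fin disj])
  ultimately have eq: "a 0 * b 3 + a 1 * b 2 + a 2 * b 1 + a 3 * b 0 =
      ((n + m) choose 3) + (n + m) * (s 1 + t 1) + (s 2 + s 1 * t 1 + t 2)"
    using golod_degree_three[OF golod] by simp
  have a: "a 0 \<le> 1" "a 1 \<le> n" "a 2 \<le> (n choose 2) + s 1" "a 3 \<le> (n choose 3) + (s 2 + s 1 * n)"
    using serre_bound[OF fin(1) I1(1,2)] by (simp_all add: a_def s_def n_def)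
  have b: "b 0 \<le> 1" "b 1 \<le> m" "b 2 \<le> (m choose 2) + t 1" "b 3 \<le> (m choose 3) + (t 2 + t 1 * m)"
    using serre_bound[OF fin(2) I2(1,2)] by (simp_all add: b_def t_def m_def)
  have vandermonde3: "(n + m) choose 3 = (m choose 3) + n * (m choose 2) + (n choose 2) * m + (n choose 3)"
    using vandermonde[of n m 3] by (simp add: sets)
  have "a 0 * b 3 + a 1 * b 2 + a 2 * b 1 + a 3 * b 0 \<le>
      1 * ((m choose 3) + (t 2 + t 1 * m)) + n * ((m choose 2) + t 1) + ((n choose 2) + s 1) * m +
      ((n choose 3) + (s 2 + s 1 * n)) * 1"
    by (intro add_mono mult_le_mono a b)
  also have "\<dots> = ((n + m) choose 3) + (n + m) * (s 1 + t 1) + (s 2 + t 2)"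
    unfolding vandermonde3 by (simp add: algebra_simps)
  finally have "s 1 * t 1 = 0" unfolding eq by simp
  moreover have "s 1 \<noteq> 0" "t 1 \<noteq> 0"
    using betti_dim_1_pos[OF fin(1) I1] betti_dim_1_pos[OF fin(2) I2] by (simp_all add: s_def t_def)
  ultimately show False by simp
qed

theorem proposition3p1:
  fixes n m :: nat
    and I1 I2 :: "'k::field mpoly set"
  assumes "infinite (UNIV :: 'k set)"
    and "ideal I1 (mpoly_ring {..<n})"
    and "homogeneous_ideal {..<n} I1"
    and "I1 \<subseteq> ideal_prod (mpoly_ring {..<n}) (max_ideal {..<n}) (max_ideal {..<n})"
    and "ideal I2 (mpoly_ring {n..<n + m})"
    and "homogeneous_ideal {n..<n + m} I2"
    and "I2 \<subseteq> ideal_prod (mpoly_ring {n..<n + m}) (max_ideal {n..<n + m}) (max_ideal {n..<n + m})"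
    and "I1 \<noteq> {0}"
  shows "golod {..<n + m} (genideal (mpoly_ring {..<n + m}) (I1 \<union> I2)) \<longleftrightarrow>
         golod {..<n} I1 \<and> I2 = {0}"
proof -
  have disj: "{..<n} \<inter> {n..<n + m} = {}" and union: "{..<n} \<union> {n..<n + m} = {..<n + m}" by auto
  have I1: "I1 \<subseteq> maximal" using assms(4) square_le_maximal by (rule subset_trans)
  have I2: "I2 \<subseteq> maximal" using assms(7) square_le_maximal by (rule subset_trans)
  show ?thesis
  proof (cases "I2 = {0}")
    case True
    then show ?thesis
      using golod_extend_variables[OF finite_lessThan finite_atLeastLessThan disj assms(2) I1] by (simp add: union)
  next
    case False
    then show ?thesis
      using tensor_not_golod[OF finite_lessThan finite_atLeastLessThan disj assms(2) I1 assms(8) assms(5) I2]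
      by (simp add: union)
  qed
qed

end
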